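(* Let $\mathbb{F}$ be an algebraically closed field of characteristic $0$. (a) Let $(A,\{\cdot,\cdot\})$ be a unital simple linearly compact generalized Poisson superalgebra over $\mathbb{F}$. Then the Jordan superalgebra $J(A)$ is isomorphic to one of the superalgebras $JP(m,n)=J(P(m,n))$. (b) Any unital simple linearly compact generalized Poisson superalgebra over $\mathbb{F}$ is gauge equivalent to one of the generalized Poisson superalgebras $P(m,n)$ (that is, it is isomorphic to $P(m,n)^{\varphi}$ for some $m,n\ge 0$ and some even invertible element $\varphi\in\mathcal{O}(m,n)$). (c) Any unital simple linearly compact Poisson superalgebra over $\mathbb{F}$ is isomorphic to a Poisson superalgebra $P(m,n)$ with $m$ even.
   Context: Superalgebras are $\mathbb{Z}/2\mathbb{Z}$-graded; $p(a)$ is the parity of $a$. A topological vector space is linearly compact if it is a topological direct product of finite-dimensional discrete vector spaces; a linearly compact superalgebra is a topological superalgebra (all operations continuous) whose underlying space is linearly compact. A **generalized Poisson superalgebra** is a superalgebra $A$ with two operations, a commutative associative superalgebra product $(a,b)\mapsto ab$ and a Lie superalgebra bracket $(a,b)\mapsto\{a,b\}$, satisfying $$\{a,bc\}=\{a,b\}c+(-1)^{p(a)p(b)}b\{a,c\}+D(a)bc$$ for some even derivation $D$ of $A$ with respect to the product and the bracket. If $D=0$, $A$ is a Poisson superalgebra. $A$ is simple if it contains no non-trivial ideals with respect to both operations and the bracket is non-trivial. If $A$ is unital with unit $e$ then $D(a)=\{e,a\}$. **Gauge equivalence.** If $A$ is a unital generalized Poisson superalgebra with bracket $\{\cdot,\cdot\}$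 and $\varphi\in A$ is an even invertible element, then $\{f,g\}^{\varphi}=\varphi^{-1}\{\varphi f,\varphi g\}$ is another generalized Poisson bracket on the superalgebra $A$, with derivation $D^{\varphi}(a)=D(\varphi)a+\{\varphi,a\}$. The resulting generalized Poisson superalgebra is denoted $A^{\varphi}$; $A$ and $A^{\varphi}$ are called gauge equivalent. **The algebras $P(m,n)$.** $\mathcal{O}(m,n)=\Lambda(n)[[x_1,\dots,x_m]]$, where $\Lambda(n)$ is the Grassmann algebra in odd $\xi_1,\dots,\xi_n$ and the $x_i$ are even, with the formal power series topology. $P(m,n)$ is $\mathcal{O}(m,n)$ with the following bracket. If $m=2k$, with even indeterminates $p_1,\dots,p_k,q_1,\dots,q_k$ (here $D=0$): $$\{f,g\}=\sum_{i=1}^k\Big(\frac{\partial f}{\partial p_i}\frac{\partial g}{\partial q_i}-\frac{\partial f}{\partial q_i}\frac{\partial g}{\partial p_i}\Big)+(-1)^{p(f)}\Big(\sum_{i=1}^{n-2}\frac{\partial f}{\partial\xi_i}\frac{\partial g}{\partial\xi_i}+\frac{\partial f}{\partial\xi_{n-1}}\frac{\partial g}{\partial\xi_n}+\frac{\partial f}{\partial\xi_n}\frac{\partial g}{\partial\xi_{n-1}}\Big)$$ (for $n=1$ the last parenthesis is $\frac{\partial f}{\partial\xi_1}\frac{\partial g}{\partial\xi_1}$, for $n=0$ it is absent). If $m=2k+1$, with even indeterminates $t,p_i,q_i$ (here $D=2\frac{\partial}{\partial t}$): the bracket is $\{f,g\}_K=(2-\mathcal{E})f\,\frac{\partial g}{\partial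 t}-\frac{\partial f}{\partial t}\,(2-\mathcal{E})g+\{f,g\}$, where $\mathcal{E}=\sum_i(p_i\frac{\partial}{\partial p_i}+q_i\frac{\partial}{\partial q_i})+\sum_i\xi_i\frac{\partial}{\partial\xi_i}$ and $\{f,g\}$ is given by the formula above. **The double $J(A)$.** For a generalized Poisson superalgebra $A$ put $\{f,g\}_D=\{f,g\}-\frac12(fD(g)-D(f)g)$. Then $J(A)=A\oplus\eta A$, with $\eta$ odd, is the Jordan superalgebra with product ($a,b\in A$) $a\circ b=ab$, $\eta a\circ b=\eta(ab)$, $a\circ\eta b=(-1)^{p(a)}\eta(ab)$, $\eta a\circ\eta b=(-1)^{p(a)}\{a,b\}_D$. *)

theory Defs
  imports
    "HOL-Analysis.Analysis"
    "HOL-Library.Function_Algebras"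
    "HOL-Library.Poly_Mapping"
    "HOL-Computational_Algebra.Computational_Algebra"
begin

section \<open>Superspaces and superalgebras\<close>

text \<open>
  The underlying space is the subspace \<open>evens A + odds A\<close> of an ambient vector space of type
  \<open>'v\<close> (possibly the whole type). All laws are relativised to it, and operations and maps may
  take arbitrary values outside it.
\<close>

record ('k, 'v) superspace =
  scl :: "'k \<Rightarrow> 'v \<Rightarrow> 'v"
  evens :: "'v set"
  odds :: "'v set"
  topo :: "'v topology"

record ('k, 'v) superalg = "('k, 'v) superspace" +
  mul :: "'v \<Rightarrow> 'v \<Rightarrow> 'v"

record ('k, 'v) gp_superalg = "('k, 'v) superalg" +
  brk :: "'v \<Rightarrow> 'v \<Rightarrow> 'v"

definition space_of :: "('k, 'v::ab_group_add, 'z) superspace_scheme \<Rightarrow> 'v set" where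
  "space_of A = {x + y |x y. x \<in> evens A \<and> y \<in> odds A}"

text \<open>Parities are natural numbers read modulo 2; \<open>0\<close> is homogeneous of both parities.\<close>

definition homog :: "('k, 'v, 'z) superspace_scheme \<Rightarrow> nat \<Rightarrow> 'v set" where
  "homog A p = (if even p then evens A else odds A)"

definition is_superspace :: "('k::field, 'v::ab_group_add, 'z) superspace_scheme \<Rightarrow> bool" where
  "is_superspace A \<longleftrightarrow> vector_space (scl A) \<and>
     module.subspace (scl A) (evens A) \<and> module.subspace (scl A) (odds A) \<and>
     evens A \<inter> odds A = {0}"

definition linear_on_space ::
    "('k, 'v::ab_group_add, 'z) superspace_scheme \<Rightarrow> ('k \<Rightarrow> 'w::ab_group_add \<Rightarrow> 'w) \<Rightarrow>
     ('v \<Rightarrow> 'w) \<Rightarrow> bool" where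
  "linear_on_space A s h \<longleftrightarrow>
     (\<forall>a\<in>space_of A. \<forall>b\<in>space_of A. h (a + b) = h a + h b) \<and>
     (\<forall>c. \<forall>a\<in>space_of A. h (scl A c a) = s c (h a))"

definition graded_bilinear ::
    "('k, 'v::ab_group_add, 'z) superspace_scheme \<Rightarrow> ('v \<Rightarrow> 'v \<Rightarrow> 'v) \<Rightarrow> bool" where
  "graded_bilinear A f \<longleftrightarrow>
     (\<forall>a\<in>space_of A. linear_on_space A (scl A) (f a)) \<and>
     (\<forall>b\<in>space_of A. linear_on_space A (scl A) (\<lambda>a. f a b)) \<and>
     (\<forall>p q. \<forall>a\<in>homog A p. \<forall>b\<in>homog A q. f a b \<in> homog A (p + q))"

definition is_superalgebra :: "('k::field, 'v::ab_group_add, 'z) superalg_scheme \<Rightarrow> bool" where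
  "is_superalgebra A \<longleftrightarrow> is_superspace A \<and> graded_bilinear A (mul A)"

definition is_unit_element :: "('k, 'v::ab_group_add, 'z) superalg_scheme \<Rightarrow> 'v \<Rightarrow> bool" where
  "is_unit_element A e \<longleftrightarrow>
     e \<in> space_of A \<and> (\<forall>a\<in>space_of A. mul A e a = a \<and> mul A a e = a)"

definition unital :: "('k, 'v::ab_group_add, 'z) superalg_scheme \<Rightarrow> bool" where
  "unital A \<longleftrightarrow> (\<exists>e. is_unit_element A e)"

definition is_inverse ::
    "('k, 'v::ab_group_add, 'z) superalg_scheme \<Rightarrow> 'v \<Rightarrow> 'v \<Rightarrow> bool" where
  "is_inverse A a b \<longleftrightarrow> b \<in> space_of A \<and>
     is_unit_element A (mul A a b) \<and> is_unit_element A (mul A b a)"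

definition invertible_element :: "('k, 'v::ab_group_add, 'z) superalg_scheme \<Rightarrow> 'v \<Rightarrow> bool" where
  "invertible_element A a \<longleftrightarrow> a \<in> space_of A \<and> (\<exists>b. is_inverse A a b)"

definition inverse_of :: "('k, 'v::ab_group_add, 'z) superalg_scheme \<Rightarrow> 'v \<Rightarrow> 'v" where
  "inverse_of A a = (THE b. is_inverse A a b)"

section \<open>Generalized Poisson superalgebras\<close>

definition comm_assoc_superalgebra ::
    "('k::field, 'v::ab_group_add, 'z) superalg_scheme \<Rightarrow> bool" where
  "comm_assoc_superalgebra A \<longleftrightarrow> is_superalgebra A \<and>
     (\<forall>p q. \<forall>a\<in>homog A p. \<forall>b\<in>homog A q.
        mul A a b = scl A ((-1) ^ (p * q)) (mul A b a)) \<and>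
     (\<forall>a\<in>space_of A. \<forall>b\<in>space_of A. \<forall>c\<in>space_of A.
        mul A (mul A a b) c = mul A a (mul A b c))"

definition lie_super_bracket ::
    "('k::field, 'v::ab_group_add, 'z) superspace_scheme \<Rightarrow> ('v \<Rightarrow> 'v \<Rightarrow> 'v) \<Rightarrow> bool" where
  "lie_super_bracket A br \<longleftrightarrow> is_superspace A \<and> graded_bilinear A br \<and>
     (\<forall>p q. \<forall>a\<in>homog A p. \<forall>b\<in>homog A q.
        br a b = - scl A ((-1) ^ (p * q)) (br b a)) \<and>
     (\<forall>p q. \<forall>a\<in>homog A p. \<forall>b\<in>homog A q. \<forall>c\<in>space_of A.
        br a (br b c) = br (br a b) c + scl A ((-1) ^ (p * q)) (br b (br a c)))"

definition even_derivation ::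
    "('k, 'v::ab_group_add, 'z) gp_superalg_scheme \<Rightarrow> ('v \<Rightarrow> 'v) \<Rightarrow> bool" where
  "even_derivation A D \<longleftrightarrow> linear_on_space A (scl A) D \<and>
     (\<forall>p. \<forall>a\<in>homog A p. D a \<in> homog A p) \<and>
     (\<forall>a\<in>space_of A. \<forall>b\<in>space_of A. D (mul A a b) = mul A (D a) b + mul A a (D b)) \<and>
     (\<forall>a\<in>space_of A. \<forall>b\<in>space_of A. D (brk A a b) = brk A (D a) b + brk A a (D b))"

definition generalized_poisson ::
    "('k::field, 'v::ab_group_add, 'z) gp_superalg_scheme \<Rightarrow> ('v \<Rightarrow> 'v) \<Rightarrow> bool" where
  "generalized_poisson A D \<longleftrightarrow> comm_assoc_superalgebra A \<and> lie_super_bracket A (brk A) \<and>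
     even_derivation A D \<and>
     (\<forall>p q. \<forall>a\<in>homog A p. \<forall>b\<in>homog A q. \<forall>c\<in>space_of A.
        brk A a (mul A b c) =
          mul A (brk A a b) c + scl A ((-1) ^ (p * q)) (mul A b (brk A a c))
          + mul A (mul A (D a) b) c)"

definition poisson_superalgebra ::
    "('k::field, 'v::ab_group_add, 'z) gp_superalg_scheme \<Rightarrow> bool" where
  "poisson_superalgebra A \<longleftrightarrow> generalized_poisson A (\<lambda>_. 0)"

text \<open>
  As usual for superalgebras, ideals are graded. (For unital \<open>A\<close> this restriction is immaterial
  for simplicity: a proper non-zero ideal \<open>I\<close> without graded ones around would give
  \<open>A = I \<oplus> \<sigma> I\<close>, \<open>\<sigma>\<close> the parity automorphism, hence an idempotent with even part \<open>1/2\<close> and odd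
  part of square zero.)
\<close>

definition gp_ideal :: "('k::field, 'v::ab_group_add, 'z) gp_superalg_scheme \<Rightarrow> 'v set \<Rightarrow> bool" where
  "gp_ideal A I \<longleftrightarrow> module.subspace (scl A) I \<and>
     I = {x + y |x y. x \<in> I \<inter> evens A \<and> y \<in> I \<inter> odds A} \<and>
     (\<forall>a\<in>space_of A. \<forall>x\<in>I.
        mul A a x \<in> I \<and> mul A x a \<in> I \<and> brk A a x \<in> I \<and> brk A x a \<in> I)"

definition gp_simple :: "('k::field, 'v::ab_group_add, 'z) gp_superalg_scheme \<Rightarrow> bool" where
  "gp_simple A \<longleftrightarrow> (\<forall>I. gp_ideal A I \<longrightarrow> I = {0} \<or> I = space_of A) \<and>
     (\<exists>a\<in>space_of A. \<exists>b\<in>space_of A. brk A a b \<noteq> 0)"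

section \<open>Linear compactness\<close>

text \<open>The ground field carries the discrete topology.\<close>

definition topological_superspace ::
    "('k::field, 'v::ab_group_add, 'z) superspace_scheme \<Rightarrow> bool" where
  "topological_superspace A \<longleftrightarrow> topspace (topo A) = space_of A \<and>
     continuous_map (prod_topology (topo A) (topo A)) (topo A) (\<lambda>(a, b). a + b) \<and>
     continuous_map (prod_topology (discrete_topology UNIV) (topo A)) (topo A)
       (\<lambda>(c, a). scl A c a)"

text \<open>
  \<open>A\<close> is linearly homeomorphic to a product, over \<open>I\<close>, of finite-dimensional discrete spaces \<open>W i\<close>.
  Taking the indices and the factors inside \<open>'v\<close> is no restriction: zero factors can be dropped,
  every other factor embeds into the product, and the index of a non-zero factor can be replaced
  by the image of one of its non-zero vectors.
\<close>

definition linearly_compact_space ::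
    "('k::field, 'v::ab_group_add, 'z) superspace_scheme \<Rightarrow> bool" where
  "linearly_compact_space A \<longleftrightarrow>
     (\<exists>(I :: 'v set) (W :: 'v \<Rightarrow> 'v set) (h :: 'v \<Rightarrow> 'v \<Rightarrow> 'v).
        (\<forall>i\<in>I. \<exists>B. finite B \<and> W i = module.span (scl A) B) \<and>
        homeomorphic_map (topo A) (product_topology (\<lambda>i. discrete_topology (W i)) I) h \<and>
        (\<forall>i\<in>I. linear_on_space A (scl A) (\<lambda>v. h v i)))"

definition linearly_compact_gp ::
    "('k::field, 'v::ab_group_add, 'z) gp_superalg_scheme \<Rightarrow> bool" where
  "linearly_compact_gp A \<longleftrightarrow> topological_superspace A \<and> linearly_compact_space A \<and>
     continuous_map (prod_topology (topo A) (topo A)) (topo A) (\<lambda>(a, b). mul A a b) \<and>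
     continuous_map (prod_topology (topo A) (topo A)) (topo A) (\<lambda>(a, b). brk A a b)"

section \<open>Isomorphisms\<close>

definition superalgebra_iso ::
    "('k, 'v::ab_group_add, 'y) superalg_scheme \<Rightarrow> ('k, 'w::ab_group_add, 'z) superalg_scheme \<Rightarrow>
     ('v \<Rightarrow> 'w) \<Rightarrow> bool" where
  "superalgebra_iso A B h \<longleftrightarrow> bij_betw h (space_of A) (space_of B) \<and>
     linear_on_space A (scl B) h \<and>
     h ` evens A \<subseteq> evens B \<and> h ` odds A \<subseteq> odds B \<and>
     (\<forall>a\<in>space_of A. \<forall>b\<in>space_of A. h (mul A a b) = mul B (h a) (h b)) \<and>
     homeomorphic_map (topo A) (topo B) h"

definition superalgebra_isomorphic ::
    "('k, 'v::ab_group_add, 'y) superalg_scheme \<Rightarrow> ('k, 'w::ab_group_add, 'z) superalg_scheme \<Rightarrow>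
     bool" where
  "superalgebra_isomorphic A B \<longleftrightarrow> (\<exists>h. superalgebra_iso A B h)"

definition gp_isomorphic ::
    "('k, 'v::ab_group_add, 'y) gp_superalg_scheme \<Rightarrow>
     ('k, 'w::ab_group_add, 'z) gp_superalg_scheme \<Rightarrow> bool" where
  "gp_isomorphic A B \<longleftrightarrow> (\<exists>h. superalgebra_iso A B h \<and>
     (\<forall>a\<in>space_of A. \<forall>b\<in>space_of A. h (brk A a b) = brk B (h a) (h b)))"

section \<open>Gauge transformation and the double\<close>

definition gauge_transform ::
    "('k, 'v::ab_group_add, 'z) gp_superalg_scheme \<Rightarrow> 'v \<Rightarrow>
     ('k, 'v, 'z) gp_superalg_scheme" where
  "gauge_transform A \<phi> = A\<lparr>brk := (\<lambda>f g. mul A (inverse_of A \<phi>) (brk A (mul A \<phi> f) (mul A \<phi> g)))\<rparr>"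

text \<open>\<open>a \<mapsto> (-1)\<^bsup>p(a)\<^esup> a\<close>, extended linearly.\<close>

definition parity_aut :: "('k, 'v::ab_group_add, 'z) superspace_scheme \<Rightarrow> 'v \<Rightarrow> 'v" where
  "parity_aut A a = (THE b. \<exists>x\<in>evens A. \<exists>y\<in>odds A. a = x + y \<and> b = x - y)"

definition bracket_D ::
    "('k::field, 'v::ab_group_add, 'z) gp_superalg_scheme \<Rightarrow> ('v \<Rightarrow> 'v) \<Rightarrow> 'v \<Rightarrow> 'v \<Rightarrow> 'v" where
  "bracket_D A D f g = brk A f g - scl A (1 / 2) (mul A f (D g) - mul A (D f) g)"

text \<open>The pair \<open>(a, b)\<close> stands for \<open>a + \<eta> b\<close>.\<close>

definition jordan_double ::
    "('k::field, 'v::ab_group_add, 'z) gp_superalg_scheme \<Rightarrow> ('v \<Rightarrow> 'v) \<Rightarrow>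
     ('k, 'v \<times> 'v) superalg" where
  "jordan_double A D =
     \<lparr>scl = (\<lambda>c (a, b). (scl A c a, scl A c b)),
      evens = evens A \<times> odds A,
      odds = odds A \<times> evens A,
      topo = prod_topology (topo A) (topo A),
      mul = (\<lambda>(a, b) (c, d).
        (mul A a c + bracket_D A D (parity_aut A b) d,
         mul A b c + mul A (parity_aut A a) d))\<rparr>"

section \<open>The superalgebras \<open>P(m,n)\<close>\<close>

text \<open>
  A series \<open>f\<close> is the family of its coefficients: \<open>f \<alpha> S\<close> is the coefficient of
  \<open>x\<^sup>\<alpha> \<xi>\<^sub>S\<close>, where \<open>\<xi>\<^sub>S\<close> is the product of the \<open>\<xi>\<^sub>i\<close>, \<open>i \<in> S\<close>, in increasing
  order of \<open>i\<close>. Indeterminates are numbered from \<open>0\<close>.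
\<close>

type_synonym 'k grassmann = "nat set \<Rightarrow> 'k"
type_synonym 'k series = "(nat \<Rightarrow>\<^sub>0 nat) \<Rightarrow> 'k grassmann"

definition Lam :: "nat \<Rightarrow> 'k::zero grassmann set" where
  "Lam n = {u. \<forall>S. u S \<noteq> 0 \<longrightarrow> S \<subseteq> {..<n}}"

definition wedge :: "'k::field grassmann \<Rightarrow> 'k grassmann \<Rightarrow> 'k grassmann" where
  "wedge u v = (\<lambda>U. \<Sum>S\<in>Pow U.
     (-1) ^ card {(i, j). i \<in> S \<and> j \<in> U - S \<and> j < i} * u S * v (U - S))"

definition Ser :: "nat \<Rightarrow> nat \<Rightarrow> 'k::field series set" where
  "Ser m n = {f. (\<forall>\<alpha>. f \<alpha> \<in> Lam n) \<and> (\<forall>\<alpha>. \<not> Poly_Mapping.keys \<alpha> \<subseteq> {..<m} \<longrightarrow> f \<alpha> = 0)}"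

definition ser_scale :: "'k::field \<Rightarrow> 'k series \<Rightarrow> 'k series" where
  "ser_scale c f = (\<lambda>\<alpha> S. c * f \<alpha> S)"

definition ser_mult :: "'k::field series \<Rightarrow> 'k series \<Rightarrow> 'k series" where
  "ser_mult f g = (\<lambda>\<gamma>. \<Sum>(\<alpha>, \<beta>)\<in>{(\<alpha>, \<beta>). \<alpha> + \<beta> = \<gamma>}. wedge (f \<alpha>) (g \<beta>))"

definition ser_x :: "nat \<Rightarrow> 'k::field series" where
  "ser_x i = (\<lambda>\<alpha> S. if \<alpha> = Poly_Mapping.single i 1 \<and> S = {} then 1 else 0)"

definition ser_xi :: "nat \<Rightarrow> 'k::field series" where
  "ser_xi i = (\<lambda>\<alpha> S. if \<alpha> = 0 \<and> S = {i} then 1 else 0)"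

definition d_x :: "nat \<Rightarrow> 'k::field series \<Rightarrow> 'k series" where
  "d_x i f = (\<lambda>\<alpha> S. of_nat (Poly_Mapping.lookup \<alpha> i + 1) * f (\<alpha> + Poly_Mapping.single i 1) S)"

text \<open>Left derivative: \<open>\<xi>\<^sub>i\<close> is first moved to the front.\<close>

definition d_xi :: "nat \<Rightarrow> 'k::field series \<Rightarrow> 'k series" where
  "d_xi i f = (\<lambda>\<alpha> S. if i \<in> S then 0 else (-1) ^ card {j\<in>S. j < i} * f \<alpha> (insert i S))"

text \<open>\<open>f \<mapsto> (-1)\<^bsup>p(f)\<^esup> f\<close>, extended linearly.\<close>

definition ser_sign :: "'k::field series \<Rightarrow> 'k series" where
  "ser_sign f = (\<lambda>\<alpha> S. (-1) ^ card S * f \<alpha> S)"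

text \<open>
  With \<open>k = m div 2\<close>, the indeterminates are \<open>p\<^sub>i = x\<^sub>i\<close> and \<open>q\<^sub>i = x\<^sub>k\<^sub>+\<^sub>i\<close> for \<open>i < k\<close>, and
  \<open>t = x\<^sub>2\<^sub>k\<close> for odd \<open>m\<close>.
\<close>

definition bracket_even_part :: "nat \<Rightarrow> 'k::field series \<Rightarrow> 'k series \<Rightarrow> 'k series" where
  "bracket_even_part k f g = (\<Sum>i<k.
     ser_mult (d_x i f) (d_x (k + i) g) - ser_mult (d_x (k + i) f) (d_x i g))"

definition bracket_odd_part :: "nat \<Rightarrow> 'k::field series \<Rightarrow> 'k series \<Rightarrow> 'k series" where
  "bracket_odd_part n f g =
     (if n = 0 then 0
      else if n = 1 then ser_mult (d_xi 0 f) (d_xi 0 g)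
      else (\<Sum>i<n - 2. ser_mult (d_xi i f) (d_xi i g))
        + ser_mult (d_xi (n - 2) f) (d_xi (n - 1) g)
        + ser_mult (d_xi (n - 1) f) (d_xi (n - 2) g))"

definition bracket_H :: "nat \<Rightarrow> nat \<Rightarrow> 'k::field series \<Rightarrow> 'k series \<Rightarrow> 'k series" where
  "bracket_H k n f g = bracket_even_part k f g + bracket_odd_part n (ser_sign f) g"

definition euler :: "nat \<Rightarrow> nat \<Rightarrow> 'k::field series \<Rightarrow> 'k series" where
  "euler k n f =
     (\<Sum>i<k. ser_mult (ser_x i) (d_x i f) + ser_mult (ser_x (k + i)) (d_x (k + i) f))
     + (\<Sum>i<n. ser_mult (ser_xi i) (d_xi i f))"

definition bracket_K :: "nat \<Rightarrow> nat \<Rightarrow> 'k::field series \<Rightarrow> 'k series \<Rightarrow> 'k series" where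
  "bracket_K k n f g =
     ser_mult (ser_scale 2 f - euler k n f) (d_x (2 * k) g)
     - ser_mult (d_x (2 * k) f) (ser_scale 2 g - euler k n g)
     + bracket_H k n f g"

text \<open>
  The formal power series topology is that of coefficientwise convergence, each coefficient
  lying in the discrete space \<open>\<Lambda>(n)\<close>.
\<close>

definition P_alg :: "nat \<Rightarrow> nat \<Rightarrow> ('k::field, 'k series) gp_superalg" where
  "P_alg m n =
     \<lparr>scl = ser_scale,
      evens = {f \<in> Ser m n. \<forall>\<alpha> S. f \<alpha> S \<noteq> 0 \<longrightarrow> even (card S)},
      odds = {f \<in> Ser m n. \<forall>\<alpha> S. f \<alpha> S \<noteq> 0 \<longrightarrow> odd (card S)},
      topo = subtopology (product_topology (\<lambda>_. discrete_topology UNIV) UNIV) (Ser m n),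
      mul = ser_mult,
      brk = (if even m then bracket_H (m div 2) n else bracket_K (m div 2) n)\<rparr>"

definition P_deriv :: "nat \<Rightarrow> 'k::field series \<Rightarrow> 'k series" where
  "P_deriv m f = (if even m then 0 else ser_scale 2 (d_x (m - 1) f))"

end

theory Submission imports Defs
begin

text \<open>The proof constructs coordinates in which a suitably gauged bracket takes one of the two normal forms.
Write \<open>e\<close> for the unit, \<open>D = {e, \<cdot>}\<close>, and
\<open>X\<^sub>f = {f, \<cdot>} + D(f)\<cdot>\<close> for \<open>f \<in> A\<close>; the Leibniz rule says that \<open>X\<^sub>f\<close> is a derivation of the product.

The local structure. Linear compactness gives a continuous functional whose translates under
multiplication span a space of minimal dimension, and over an algebraically closed field this produces
a continuous character \<open>\<epsilon>\<close> (\<open>ex_character\<close>). Let \<open>m\<close> be its kernel. The derivations \<open>X\<^sub>f\<close> send \<open>m\<^sup>k\<^sup>+\<^sup>1\<close> to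
\<open>m\<^sup>k\<close>, so the closure of \<open>0\<close> in the \<open>m\<close>-adic topology is an ideal for both operations, hence \<open>0\<close> by
simplicity. By duality every continuous functional vanishes on some power \<open>m\<^sup>k\<close> (\<open>Dual_nilpotent\<close>).
Therefore power series in elements of \<open>m\<close> converge, even elements outside \<open>m\<close> have inverses and square
roots, and a derivation \<open>M\<close> with \<open>M x = 1\<close> can be integrated along \<open>x\<close> (\<open>integration\<close>).

The choice of a gauge. If \<open>\<epsilon> \<circ> X\<^sub>\<psi> = 0\<close> for some even \<open>\<psi>\<close> outside \<open>m\<close>, then the derivation of \<open>A\<^sup>\<psi>\<close> vanishes at the
origin, and in that situation there is an even \<open>\<phi>\<close> with \<open>\<epsilon>(\<phi>) = 1\<close> and \<open>X\<^sub>\<phi> = 0\<close> (\<open>casimir\<close>); a second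
gauge transformation, by \<open>\<phi>\<close>, makes the derivation zero. In the remaining case no such \<open>\<psi>\<close> exists, and
\<open>A\<close> itself has a contact normal form.

Canonical coordinates, in the style of Darboux. If \<open>D \<noteq> 0\<close>, take an even \<open>t\<close> with \<open>D t = 2\<close>. Then split off pairs \<open>{p, q} = 1\<close>
and odd elements \<open>{\<xi>, \<xi>} = -1\<close> from the centralizer of what has been found; \<open>t\<close> is corrected at each
step so that \<open>{t, \<cdot>}\<close> acts on the new elements by \<open>-1\<close>. The process ends, because the value at the origin of
the bracket has finite rank (\<open>rank_bound\<close>), and at the end the centralizer consists of the scalars
(\<open>center_trivial\<close>). The derivations dual to the coordinates then commute and determine everything: the
Taylor expansion along them is an isomorphism with \<open>\<O>(m,n)\<close>, and the bracket, being a first order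
operator in each argument, is given by its values on the coordinates (\<open>bracket_formula\<close>).

Consequences. Up to isomorphism, \<open>P(m,n)\<close> is thus \<open>A\<close> with a bracket gauged by some \<open>\<phi>\<close>, so \<open>A\<close> is
\<open>P(m,n)\<close> gauged by the image of \<open>\<phi>\<inverse>\<close>. If \<open>D = 0\<close>, then no gauge is needed and \<open>m\<close> is even. For the doubles
one writes \<open>\<phi> = \<psi>\<^sup>2\<close>: the bracket \<open>{\<cdot>,\<cdot>}\<^sub>D\<close> of the gauged algebra is
\<open>{\<psi> f, \<psi> g}\<^sub>D\<close> (\<open>jordan_gauge\<close>), so \<open>a + \<eta> b \<mapsto> a + \<eta> \<psi>\<inverse> b\<close> identifies the two doubles.\<close>

section \<open>Linear functionals\<close>

interpretation fs: vector_space "\<lambda>c (f :: 'v => 'k::field) x. c * f x"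
 by standard (auto simp: fun_eq_iff algebra_simps)

lemma (in vector_space) ex_functional:
 assumes "subspace S" "v \<notin> S"
 obtains \<psi> :: "'b => 'a" where
  "\<And>x y. \<psi> (x + y) = \<psi> x + \<psi> y" "\<And>c x. \<psi> (scale c x) = c * \<psi> x"
  "\<And>x. x \<in> S ==> \<psi> x = 0" "\<psi> v = 1"
proof -
 interpret k: vector_space "(*) :: 'a => 'a => 'a"
  by standard (auto simp: algebra_simps)
 interpret p: vector_space_pair scale "(*) :: 'a => 'a => 'a" ..
 obtain B where B: "B \<subseteq> S" "independent B" "S \<subseteq> span B"
  using maximal_independent_subset[of S] by blast
 have S: "span B = S"
  using B assms(1) by (metis span_minimal subset_antisym)
 have vB: "v \<notin> span B" using S assms(2) by simp
 hence "independent (insert v B)" using B(2) by (simp add: independent_insertI)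
 from p.linear_independent_extend[OF this, of "\<lambda>x. if x = v then 1 else 0"]
 obtain g where g: "Vector_Spaces.linear scale (*) g" "\<forall>x\<in>insert v B. g x = (if x = v then 1 else 0)" by blast
 interpret g: Vector_Spaces.linear scale "(*)" g by fact
 have "g x = 0" if "x \<in> S" for x
 proof -
  have "x \<in> span B" using that S by simp
  moreover have "\<And>b. b \<in> B ==> g b = 0" using g(2) vB span_base by auto
  ultimately show ?thesis using g.eq_0_on_span by blast
 qed
 with g(2) that[of g] show thesis by (simp add: g.add g.scale)
qed

lemma (in vector_space) functional_in_span:
 fixes \<phi> :: "'b => 'a"
 assumes "finite \<Phi>"
  and "\<And>f. f \<in> \<Phi> ==> (\<forall>x y. f (x + y) = f x + f y) \<and> (\<forall>c x. f (scale c x) = c * f x)"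
  and "\<And>x y. \<phi> (x + y) = \<phi> x + \<phi> y" "\<And>c x. \<phi> (scale c x) = c * \<phi> x"
  and "\<And>x. (\<And>f. f \<in> \<Phi> ==> f x = 0) ==> \<phi> x = 0"
 shows "\<exists>c. \<forall>x. \<phi> x = (\<Sum>f\<in>\<Phi>. c f * f x)"
 using assms
proof (induction \<Phi> arbitrary: \<phi> rule: finite_induct)
 case empty
 then show ?case by simp
next
 case (insert g \<Phi>)
 have lin: "\<And>x y. g (x + y) = g x + g y" "\<And>c x. g (scale c x) = c * g x"
  using insert.prems(1) by auto
 show ?case
 proof (cases "\<exists>x0. (\<forall>f\<in>\<Phi>. f x0 = 0) \<and> \<phi> x0 \<noteq> 0")
  case False
  have "\<exists>c. \<forall>x. \<phi> x = (\<Sum>f\<in>\<Phi>. c f * f x)"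
  proof (rule insert.IH)
   show "\<And>f. f \<in> \<Phi> ==> (\<forall>x y. f (x + y) = f x + f y) \<and> (\<forall>c x. f (scale c x) = c * f x)"
    using insert.prems(1) by simp
   show "\<phi> (x + y) = \<phi> x + \<phi> y" for x y by (rule insert.prems(2))
   show "\<phi> (scale c x) = c * \<phi> x" for c x by (rule insert.prems(3))
   show "\<phi> x = 0" if "\<And>f. f \<in> \<Phi> ==> f x = 0" for x using False that by metis
  qed
  then obtain c where c: "\<And>x. \<phi> x = (\<Sum>f\<in>\<Phi>. c f * f x)" by metis
  have "\<phi> x = (\<Sum>f\<in>insert g \<Phi>. (c(g := 0)) f * f x)" for x
  proof -
   have "(\<Sum>f\<in>\<Phi>. (c(g := 0)) f * f x) = (\<Sum>f\<in>\<Phi>. c f * f x)"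
    by (rule sum.cong) (use insert.hyps in auto)
   thus ?thesis using insert.hyps c by simp
  qed
  thus ?thesis by blast
 next
  case True
  then obtain x0 where x0: "\<And>f. f \<in> \<Phi> ==> f x0 = 0" "\<phi> x0 \<noteq> 0" by blast
  have g0: "g x0 \<noteq> 0"
   using x0 insert.prems(4)[of x0] by auto
  define r where "r = \<phi> x0 / g x0"
  have "\<exists>c. \<forall>x. (\<lambda>x. \<phi> x - r * g x) x = (\<Sum>f\<in>\<Phi>. c f * f x)"
  proof (rule insert.IH)
   show "\<And>f. f \<in> \<Phi> ==> (\<forall>x y. f (x + y) = f x + f y) \<and> (\<forall>c x. f (scale c x) = c * f x)"
    using insert.prems(1) by auto
   show "\<phi> (x + y) - r * g (x + y) = \<phi> x - r * g x + (\<phi> y - r * g y)" for x y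
    by (simp add: insert.prems(2) lin algebra_simps)
   show "\<phi> (scale c x) - r * g (scale c x) = c * (\<phi> x - r * g x)" for c x
    by (simp add: insert.prems(3) lin algebra_simps)
   show "\<phi> x - r * g x = 0" if z: "\<And>f. f \<in> \<Phi> ==> f x = 0" for x
   proof -
    define y where "y = x + scale (- (g x / g x0)) x0"
    have "f y = 0" if "f \<in> insert g \<Phi>" for f
    proof -
     have "f y = f x + (- (g x / g x0)) * f x0"
      using insert.prems(1)[OF that] unfolding y_def by metis
     moreover have "f x = 0 \<and> f x0 = 0" if "f \<noteq> g"
      using that \<open>f \<in> insert g \<Phi>\<close> z x0(1) by blast
     ultimately show ?thesis using g0 by (cases "f = g") simp_all
    qed
    hence "\<phi> y = 0" by (rule insert.prems(4))
    hence "\<phi> x - (g x / g x0) * \<phi> x0 = 0"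
     unfolding y_def insert.prems(2,3) by simp
    thus ?thesis unfolding r_def by (simp add: mult.commute)
   qed
  qed
  then obtain c where c: "\<And>x. \<phi> x - r * g x = (\<Sum>f\<in>\<Phi>. c f * f x)" by blast
  have "\<phi> x = (\<Sum>f\<in>insert g \<Phi>. (c(g := r)) f * f x)" for x
  proof -
   have "(\<Sum>f\<in>\<Phi>. (c(g := r)) f * f x) = (\<Sum>f\<in>\<Phi>. c f * f x)"
    by (rule sum.cong) (use insert.hyps in auto)
   thus ?thesis using insert.hyps c[of x] by (simp add: algebra_simps)
  qed
  thus ?thesis by blast
 qed
qed

text \<open>Elimination of one equation at a time. The unknowns are indexed by \<open>I\<close>; an equation is given by its row of
coefficients.\<close>

lemma underdetermined_system_bound:
 fixes \<Phi> :: "('i => 'k::field) set"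
 assumes "finite \<Phi>" "finite I" "card \<Phi> \<le> n" "n < card I"
 shows "\<exists>c. (\<exists>i\<in>I. c i \<noteq> 0) \<and> (\<forall>\<phi>\<in>\<Phi>. (\<Sum>i\<in>I. c i * \<phi> i) = 0)"
 using assms
proof (induction n arbitrary: \<Phi> I)
 case 0
 hence "\<Phi> = {}" "I \<noteq> {}" by auto
 thus ?case by (intro exI[of _ "\<lambda>_. 1"]) auto
next
 case (Suc n)
 show ?case
 proof (cases "\<forall>\<phi>\<in>\<Phi>. \<forall>i\<in>I. \<phi> i = 0")
  case True
  moreover have "I \<noteq> {}" using Suc.prems by auto
  ultimately show ?thesis by (intro exI[of _ "\<lambda>_. 1"]) auto
 next
  case False
  then obtain \<phi> j where j: "\<phi> \<in> \<Phi>" "j \<in> I" "\<phi> j \<noteq> 0" by blast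
  define \<Phi>' where "\<Phi>' = \<Phi> - {\<phi>}"
  define T where "T \<theta> = (\<lambda>i. \<theta> i - \<theta> j * \<phi> i / \<phi> j)" for \<theta> :: "'i => 'k"
  have cI: "card (I - {j}) = card I - 1" using j Suc.prems by simp
  have cP: "card \<Phi>' = card \<Phi> - 1" using j Suc.prems by (simp add: \<Phi>'_def)
  have f: "finite \<Phi>'" using Suc.prems by (simp add: \<Phi>'_def)
  have "card (T ` \<Phi>') \<le> n" using card_image_le[OF f, of T] cP Suc.prems by simp
  hence "\<exists>c. (\<exists>i\<in>I-{j}. c i \<noteq> 0) \<and> (\<forall>\<theta>\<in>T ` \<Phi>'. (\<Sum>i\<in>I-{j}. c i * \<theta> i) = 0)"
   by (intro Suc.IH) (use f Suc.prems cI in auto)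
  then obtain c where c: "\<exists>i\<in>I-{j}. c i \<noteq> 0"
    "\<And>\<theta>. \<theta> \<in> \<Phi>' ==> (\<Sum>i\<in>I-{j}. c i * T \<theta> i) = 0" by blast
  define c' where "c' = c(j := - (\<Sum>i\<in>I-{j}. c i * \<phi> i) / \<phi> j)"
  have s: "(\<Sum>i\<in>I. c' i * \<theta> i) = - (\<Sum>i\<in>I-{j}. c i * \<phi> i) / \<phi> j * \<theta> j + (\<Sum>i\<in>I-{j}. c i * \<theta> i)" for \<theta>
  proof -
   have "(\<Sum>i\<in>I. c' i * \<theta> i) = c' j * \<theta> j + (\<Sum>i\<in>I-{j}. c' i * \<theta> i)"
    using j Suc.prems by (simp add: sum.remove)
   also have "(\<Sum>i\<in>I-{j}. c' i * \<theta> i) = (\<Sum>i\<in>I-{j}. c i * \<theta> i)"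
    by (rule sum.cong) (auto simp: c'_def)
   finally show ?thesis by (simp add: c'_def)
  qed
  have "(\<Sum>i\<in>I. c' i * \<phi> i) = 0" unfolding s using j by simp
  moreover have "(\<Sum>i\<in>I. c' i * \<theta> i) = 0" if "\<theta> \<in> \<Phi>'" for \<theta>
  proof -
   have "(\<Sum>i\<in>I-{j}. c i * T \<theta> i) = (\<Sum>i\<in>I-{j}. c i * \<theta> i) - (\<Sum>i\<in>I-{j}. c i * \<phi> i) / \<phi> j * \<theta> j"
    unfolding T_def by (simp add: sum_subtractf right_diff_distrib sum_distrib_left sum_divide_distrib mult_ac)
   thus ?thesis using c(2)[OF that] unfolding s by simp
  qed
  moreover have "\<exists>i\<in>I. c' i \<noteq> 0" using c(1) by (auto simp: c'_def)
  ultimately show ?thesis by (intro exI[of _ c']) (auto simp: \<Phi>'_def)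
 qed
qed

lemma underdetermined_system:
 fixes \<Phi> :: "('i => 'k::field) set"
 assumes "finite \<Phi>" "finite I" "card \<Phi> < card I"
 shows "\<exists>c. (\<exists>i\<in>I. c i \<noteq> 0) \<and> (\<forall>\<phi>\<in>\<Phi>. (\<Sum>i\<in>I. c i * \<phi> i) = 0)"
 using underdetermined_system_bound[of \<Phi> I "card \<Phi>"] assms by simp

section \<open>Linearly compact commutative superalgebras, algebraically\<close>

text \<open>The operations are extended to the whole ambient type through the projections \<open>P0\<close> and \<open>P1\<close> to the even and
the odd part, so that the laws hold without membership conditions and \<open>P0 x + P1 x = x\<close> describes the
carrier. The topology enters only through the space \<open>Dual\<close> of continuous functionals: by \<open>Dual_refl\<close> the
carrier is the full algebraic dual of \<open>Dual\<close>, which is linear compactness, and \<open>prd_fin\<close> is what joint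
continuity of the product at the origin means for functionals.\<close>

locale calg = vector_space scale
 for scale :: "'k::{alg_closed_field,field_char_0} => 'v::ab_group_add => 'v" (infixr "\<cdot>" 75) +
 fixes P0 P1 :: "'v => 'v" and prd :: "'v => 'v => 'v" (infixl "\<odot>" 70)
  and e :: 'v and Dual :: "('v => 'k) set"
 assumes P0_add: "P0 (x + y) = P0 x + P0 y" and P0_scale: "P0 (c \<cdot> x) = c \<cdot> P0 x"
  and P1_add: "P1 (x + y) = P1 x + P1 y" and P1_scale: "P1 (c \<cdot> x) = c \<cdot> P1 x"
  and P00 [simp]: "P0 (P0 x) = P0 x" and P11 [simp]: "P1 (P1 x) = P1 x"
  and P01 [simp]: "P0 (P1 x) = 0" and P10 [simp]: "P1 (P0 x) = 0"
  and prd_addl: "(x + y) \<odot> z = x \<odot> z + y \<odot> z"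
  and prd_addr: "x \<odot> (y + z) = x \<odot> y + x \<odot> z"
  and prd_scalel: "(c \<cdot> x) \<odot> y = c \<cdot> (x \<odot> y)"
  and prd_scaler: "x \<odot> (c \<cdot> y) = c \<cdot> (x \<odot> y)"
  and prd_pil: "(P0 x + P1 x) \<odot> y = x \<odot> y"
  and prd_pir: "x \<odot> (P0 y + P1 y) = x \<odot> y"
  and prd_00: "P0 x \<odot> P0 y = P0 (P0 x \<odot> P0 y)"
  and prd_01: "P0 x \<odot> P1 y = P1 (P0 x \<odot> P1 y)"
  and prd_11: "P1 x \<odot> P1 y = P0 (P1 x \<odot> P1 y)"
  and comm_0: "P0 x \<odot> y = y \<odot> P0 x"
  and comm_11: "P1 x \<odot> P1 y = - (P1 y \<odot> P1 x)"
  and assoc: "(x \<odot> y) \<odot> z = x \<odot> (y \<odot> z)"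
  and e_even: "P0 e = e" and unitl: "e \<odot> x = P0 x + P1 x" and e_nz: "e \<noteq> 0"
  and Dual_add: "h \<in> Dual ==> h (x + y) = h x + h y"
  and Dual_scale: "h \<in> Dual ==> h (c \<cdot> x) = c * h x"
  and Dual_pi: "h \<in> Dual ==> h (P0 x + P1 x) = h x"
  and Dual_plus: "h \<in> Dual ==> g \<in> Dual ==> (\<lambda>x. h x + g x) \<in> Dual"
  and Dual_times: "h \<in> Dual ==> (\<lambda>x. c * h x) \<in> Dual"
  and Dual_prdl: "h \<in> Dual ==> (\<lambda>x. h (a \<odot> x)) \<in> Dual"
  and Dual_prdr: "h \<in> Dual ==> (\<lambda>x. h (x \<odot> a)) \<in> Dual"
  and Dual_sep: "P0 x + P1 x = x ==> (\<And>h. h \<in> Dual ==> h x = 0) ==> x = 0"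
  and Dual_refl: "(\<And>h g. h \<in> Dual ==> g \<in> Dual ==> F (\<lambda>x. h x + g x) = F h + F g) ==>
    (\<And>c h. h \<in> Dual ==> F (\<lambda>x. c * h x) = c * F h) ==>
    \<exists>a. P0 a + P1 a = a \<and> (\<forall>h\<in>Dual. F h = h a)"
  and prd_fin: "h \<in> Dual ==> \<exists>\<Phi>. finite \<Phi> \<and> \<Phi> \<subseteq> Dual \<and>
    (\<forall>x y. (\<forall>f\<in>\<Phi>. f x = 0) \<longrightarrow> h (x \<odot> y) = 0 \<and> h (y \<odot> x) = 0)"
begin

definition pi where "pi x = P0 x + P1 x"
definition sg where "sg x = P0 x - P1 x"
text \<open>The sign rule: \<open>x \<odot> y = tw p y \<odot> x\<close> for \<open>x\<close> of parity \<open>p\<close>. With a parity automorphism in place of powers of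
\<open>-1\<close>, only one of the two arguments has to be homogeneous.\<close>

definition tw :: "nat => 'v => 'v" where "tw p x = (if even p then x else sg x)"
definition V where "V = {x. pi x = x}"
definition H :: "nat => 'v set" where "H p = {x. (if even p then P0 x else P1 x) = x}"

lemma lin_simps:
 "P0 0 = 0" "P1 0 = 0" "P0 (- x) = - P0 x" "P1 (- x) = - P1 x"
 "P0 (x - y) = P0 x - P0 y" "P1 (x - y) = P1 x - P1 y"
proof -
 show 0: "P0 0 = 0" "P1 0 = 0" using P0_scale[of 0 0] P1_scale[of 0 0] by simp_all
 show "P0 (- x) = - P0 x" "P1 (- x) = - P1 x" for x
  using P0_scale[of "-1" x] P1_scale[of "-1" x] by simp_all
 then show "P0 (x - y) = P0 x - P0 y" "P1 (x - y) = P1 x - P1 y"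
  using P0_add[of x "-y"] P1_add[of x "-y"] by simp_all
qed

lemmas Plin = lin_simps P0_add P1_add P0_scale P1_scale

lemma prd_0 [simp]: "0 \<odot> x = 0" "x \<odot> 0 = 0"
 using prd_scalel[of 0 0 x] prd_scaler[of x 0 0] by simp_all

lemma prd_minus: "(- x) \<odot> y = - (x \<odot> y)" "x \<odot> (- y) = - (x \<odot> y)"
 using prd_scalel[of "-1" x y] prd_scaler[of x "-1" y] by simp_all

lemma prd_diff: "(x - y) \<odot> z = x \<odot> z - y \<odot> z" "x \<odot> (y - z) = x \<odot> y - x \<odot> z"
 using prd_addl[of x "-y" z] prd_addr[of x y "-z"] by (simp_all add: prd_minus)

lemmas prd_lin = prd_addl prd_addr prd_minus prd_diff prd_scalel prd_scaler

lemma prd_sum: "(\<Sum>i\<in>A. f i) \<odot> y = (\<Sum>i\<in>A. f i \<odot> y)" "y \<odot> (\<Sum>i\<in>A. f i) = (\<Sum>i\<in>A. y \<odot> f i)"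
 by (induction A rule: infinite_finite_induct) (auto simp: prd_lin)

lemma pi_simps [simp]: "pi (pi x) = pi x" "P0 (pi x) = P0 x" "P1 (pi x) = P1 x"
 "pi (P0 x) = P0 x" "pi (P1 x) = P1 x" "pi (sg x) = sg x" "sg (pi x) = sg x" "sg (sg x) = pi x"
 "sg (P0 x) = P0 x" "sg (P1 x) = - P1 x" "P0 (sg x) = P0 x" "P1 (sg x) = - P1 x"
 by (simp_all add: pi_def sg_def Plin)

lemma pi_lin: "pi (x + y) = pi x + pi y" "pi (c \<cdot> x) = c \<cdot> pi x" "pi (x - y) = pi x - pi y" "pi 0 = 0" "pi (- x) = - pi x"
 by (simp_all add: pi_def Plin algebra_simps)

lemma sg_lin: "sg (x + y) = sg x + sg y" "sg (c \<cdot> x) = c \<cdot> sg x" "sg (x - y) = sg x - sg y" "sg 0 = 0" "sg (- x) = - sg x"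
 by (simp_all add: sg_def Plin algebra_simps)

lemma tw_lin: "tw p (x + y) = tw p x + tw p y" "tw p (c \<cdot> x) = c \<cdot> tw p x" "tw p (x - y) = tw p x - tw p y" "tw p 0 = 0" "tw p (- x) = - tw p x"
 by (simp_all add: tw_def sg_lin)

lemma V_in [simp, intro]: "0 \<in> V" "x \<in> V ==> y \<in> V ==> x + y \<in> V" "x \<in> V ==> y \<in> V ==> x - y \<in> V"
 "x \<in> V ==> c \<cdot> x \<in> V" "x \<in> V ==> - x \<in> V" "P0 x \<in> V" "P1 x \<in> V" "pi x \<in> V" "sg x \<in> V"
 by (simp_all add: V_def pi_lin)

lemma V_sum: "(\<And>i. i \<in> A ==> f i \<in> V) ==> (\<Sum>i\<in>A. f i) \<in> V"
 by (induction A rule: infinite_finite_induct) auto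

lemma H_in: "0 \<in> H p" "x \<in> H p ==> y \<in> H p ==> x + y \<in> H p" "x \<in> H p ==> y \<in> H p ==> x - y \<in> H p"
 "x \<in> H p ==> c \<cdot> x \<in> H p" "x \<in> H p ==> - x \<in> H p"
 by (simp_all add: H_def Plin split: if_splits)

lemma H_cong: "even p = even q ==> H p = H q" by (simp add: H_def)
lemma tw_cong: "even p = even q ==> tw p = tw q" by (simp add: tw_def fun_eq_iff)

lemma P_in_H [simp]: "P0 x \<in> H 0" "P1 x \<in> H (Suc 0)" "P1 x \<in> H 1"
 by (simp_all add: H_def)

lemma H_V: "x \<in> H p ==> x \<in> V"
 by (auto simp: H_def V_def pi_def split: if_splits) (metis P10 add.right_neutral, metis P01 add.left_neutral)

lemma V_decomp: "x \<in> V ==> x = P0 x + P1 x" by (simp add: V_def pi_def)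

lemma prd_V [simp]: "x \<odot> y \<in> V"
proof -
 have "x \<odot> y = P0 x \<odot> P0 y + P0 x \<odot> P1 y + P1 x \<odot> P0 y + P1 x \<odot> P1 y"
  by (metis prd_pil prd_pir prd_addl prd_addr add.assoc)
 also have "P1 x \<odot> P0 y = P0 y \<odot> P1 x" by (metis comm_0)
 also have "P0 x \<odot> P0 y + P0 x \<odot> P1 y + P0 y \<odot> P1 x + P1 x \<odot> P1 y \<in> V"
  using prd_00 prd_01 prd_11 V_in(2,6,7) by metis
 finally show ?thesis .
qed

lemma prd_pi [simp]: "pi x \<odot> y = x \<odot> y" "x \<odot> pi y = x \<odot> y"
 by (simp_all add: pi_def prd_pil prd_pir)

lemma unit [simp]: "e \<odot> x = pi x" "x \<odot> e = pi x"
proof -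
 show a: "e \<odot> x = pi x" for x by (simp add: unitl pi_def)
 show "x \<odot> e = pi x" using a[of x] comm_0[of e x] by (simp add: e_even)
qed

lemma pi_V: "x \<in> V ==> pi x = x" by (simp add: V_def)

lemma e_H [simp]: "e \<in> H 0" "e \<in> V" "P0 e = e" "P1 e = 0" "sg e = e" "tw p e = e"
proof -
 show "e \<in> H 0" by (simp add: H_def e_even)
 thus "e \<in> V" by (rule H_V)
 show "P0 e = e" by (rule e_even)
 show 1: "P1 e = 0" using P10[of e] e_even by simp
 show "sg e = e" using 1 by (simp add: sg_def e_even)
 thus "tw p e = e" by (simp add: tw_def)
qed

lemma prd_H: "x \<in> H p ==> y \<in> H q ==> x \<odot> y \<in> H (p + q)"
 unfolding H_def by (auto split: if_splits) (metis prd_00 prd_01 prd_11 comm_0)+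

lemma H_comps: "x \<in> H p ==> even p ==> P0 x = x \<and> P1 x = 0"
 "x \<in> H p ==> odd p ==> P0 x = 0 \<and> P1 x = x"
 by (auto simp: H_def split: if_splits) (metis P10, metis P01)

lemma sg_H: "x \<in> H p ==> sg x = (if even p then x else - x)"
 using H_comps[of x p] by (auto simp: sg_def)

lemma comm_tw: "x \<in> H p ==> x \<odot> y = tw p y \<odot> x"
proof (cases "even p")
 case True
 assume "x \<in> H p"
 thus ?thesis using True comm_0[of x y] by (simp add: H_def tw_def)
next
 case False
 assume x: "x \<in> H p"
 hence x1: "P1 x = x" using False by (simp add: H_def)
 have "x \<odot> y = x \<odot> P0 y + x \<odot> P1 y" by (metis prd_pir prd_addr)
 also have "x \<odot> P0 y = P0 y \<odot> x" by (metis comm_0)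
 also have "x \<odot> P1 y = - (P1 y \<odot> x)" using comm_11[of x y] x1 by simp
 finally show ?thesis using False by (simp add: tw_def sg_def prd_lin)
qed

lemma comm_e: "x \<in> H 0 ==> x \<odot> y = y \<odot> x" using comm_tw[of x 0 y] by (simp add: tw_def)

lemma sg_prd: "sg (x \<odot> y) = sg x \<odot> sg y"
proof -
 have "x \<odot> y = P0 x \<odot> P0 y + P0 x \<odot> P1 y + P0 y \<odot> P1 x + P1 x \<odot> P1 y"
  by (metis prd_pil prd_pir prd_addl prd_addr add.assoc comm_0)
 moreover have "sg (P0 x \<odot> P0 y) = P0 x \<odot> P0 y" "sg (P0 x \<odot> P1 y) = - (P0 x \<odot> P1 y)"
   "sg (P0 y \<odot> P1 x) = - (P0 y \<odot> P1 x)" "sg (P1 x \<odot> P1 y) = P1 x \<odot> P1 y"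
  by (metis prd_00 pi_simps(9), metis prd_01 pi_simps(10), metis prd_01 pi_simps(10), metis prd_11 pi_simps(9))
 moreover have "sg x \<odot> sg y = P0 x \<odot> P0 y - P0 x \<odot> P1 y - P0 y \<odot> P1 x + P1 x \<odot> P1 y"
  unfolding sg_def using comm_0[of y "P1 x"] by (simp add: prd_lin algebra_simps)
 ultimately show ?thesis by (simp add: sg_lin)
qed

lemma tw_prd: "tw p (x \<odot> y) = tw p x \<odot> tw p y" by (simp add: tw_def sg_prd)

lemma tw_H: "x \<in> H q ==> tw p x \<in> H q"
 using sg_H[of x q] H_in(5)[of x q] by (auto simp: tw_def)

lemma tw_HH: "x \<in> H q ==> tw p x = (if even p \<or> even q then x else - x)"
 by (auto simp: tw_def sg_H)

lemma tw_V [simp]: "x \<in> V ==> tw p x \<in> V" by (simp add: tw_def)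

lemma prd_tw_l: "tw p (tw p x) \<odot> y = x \<odot> y" by (simp add: tw_def)

lemma odd_square: "x \<in> H p ==> odd p ==> x \<odot> x = 0"
proof -
 assume x: "x \<in> H p" "odd p"
 have "x \<odot> x = - (x \<odot> x)" using comm_tw[OF x(1), of x] x by (simp add: tw_def sg_H prd_lin)
 hence "(2::'k) \<cdot> (x \<odot> x) = 0" by (metis add.right_inverse one_add_one scale_left_distrib scale_one)
 thus ?thesis by simp
qed

lemma two_zero: "x + x = 0 ==> x = (0::'v)"
proof -
 assume "x + x = 0"
 hence "(2::'k) \<cdot> x = 0" by (metis one_add_one scale_left_distrib scale_one)
 thus ?thesis by simp
qed

subsection \<open>Functionals and convergent sums\<close>

lemma Dual_zero [simp]: "h \<in> Dual ==> h 0 = 0" using Dual_scale[of h 0 0] by simp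
lemma Dual_minus: "h \<in> Dual ==> h (- x) = - h x" using Dual_scale[of h "-1" x] by simp
lemma Dual_diff: "h \<in> Dual ==> h (x - y) = h x - h y" using Dual_add[of h x "-y"] by (simp add: Dual_minus)
lemma Dual_sum: "h \<in> Dual ==> h (\<Sum>i\<in>A. f i) = (\<Sum>i\<in>A. h (f i))"
 by (induction A rule: infinite_finite_induct) (auto simp: Dual_add)
lemmas Dual_lin = Dual_add Dual_scale Dual_minus Dual_diff Dual_sum

lemma Dual_pi' [simp]: "h \<in> Dual ==> h (pi x) = h x" by (simp add: pi_def Dual_pi)

lemma Dual_eqI: "x \<in> V ==> y \<in> V ==> (\<And>h. h \<in> Dual ==> h x = h y) ==> x = y"
 using Dual_sep[of "x - y"] by (simp add: V_def pi_lin Dual_diff flip: pi_def)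

lemma Dual_0: "(\<lambda>x. 0) \<in> Dual"
proof -
 obtain h where "h \<in> Dual" using Dual_sep[of e] e_nz e_H(2) by (auto simp: V_def pi_def)
 from Dual_times[OF this, of 0] show ?thesis by simp
qed

definition cop :: "('v => 'v) => bool" where
 "cop L \<longleftrightarrow> (\<forall>x. L x \<in> V) \<and> (\<forall>h\<in>Dual. (\<lambda>x. h (L x)) \<in> Dual)"

lemma cop_V: "cop L ==> L x \<in> V" and cop_Dual: "cop L ==> h \<in> Dual ==> (\<lambda>x. h (L x)) \<in> Dual"
 by (simp_all add: cop_def)

lemma cop_add: "cop L ==> L (x + y) = L x + L y"
 by (rule Dual_eqI) (auto simp: Dual_add cop_V Dual_add[OF cop_Dual])

lemma cop_scale: "cop L ==> L (c \<cdot> x) = c \<cdot> L x"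
 by (rule Dual_eqI) (auto simp: Dual_scale cop_V Dual_scale[OF cop_Dual])

lemma cop_zero: "cop L ==> L 0 = 0" using cop_scale[of L 0 0] by simp
lemma cop_minus: "cop L ==> L (- x) = - L x" using cop_scale[of L "-1" x] by simp
lemma cop_diff: "cop L ==> L (x - y) = L x - L y" using cop_add[of L x "-y"] by (simp add: cop_minus)
lemma cop_sum: "cop L ==> L (\<Sum>i\<in>A. f i) = (\<Sum>i\<in>A. L (f i))"
 by (induction A rule: infinite_finite_induct) (auto simp: cop_add cop_zero)
lemma cop_pi: "cop L ==> L (pi x) = L x"
proof (rule Dual_eqI)
 fix h assume "cop L" "h \<in> Dual"
 from Dual_pi'[OF cop_Dual[OF this]] show "h (L (pi x)) = h (L x)" .
qed (auto simp: cop_V)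
lemmas cop_lin = cop_add cop_scale cop_zero cop_minus cop_diff cop_sum

lemma cop_prdl: "cop (\<lambda>x. a \<odot> x)" and cop_prdr: "cop (\<lambda>x. x \<odot> a)"
 by (auto simp: cop_def Dual_prdl Dual_prdr)
lemma cop_comp: "cop L ==> cop M ==> cop (\<lambda>x. L (M x))"
 by (auto simp: cop_def)
lemma cop_plus: "cop L ==> cop M ==> cop (\<lambda>x. L x + M x)"
 by (auto simp: cop_def Dual_add Dual_plus)
lemma cop_smult: "cop L ==> cop (\<lambda>x. c \<cdot> L x)"
 by (auto simp: cop_def Dual_scale Dual_times)
lemma cop_uminus: "cop L ==> cop (\<lambda>x. - L x)"
 using cop_smult[of L "-1"] by simp
lemma cop_minus': "cop L ==> cop M ==> cop (\<lambda>x. L x - M x)"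
 using cop_plus[of L "\<lambda>x. - M x"] cop_uminus[of M] by simp
lemma cop_pi_op: "cop pi" by (auto simp: cop_def)
lemma cop_mult: "cop L ==> cop (\<lambda>x. a \<odot> L x)" "cop L ==> cop (\<lambda>x. L x \<odot> a)"
 using cop_comp[OF cop_prdl, of L a] cop_comp[OF cop_prdr, of L a] by auto
text \<open>Convergence to \<open>0\<close> of the terms in the weak topology, which in a linearly compact space suffices for the
convergence of the series.\<close>

definition summ :: "(nat => 'v) => bool" where
 "summ a \<longleftrightarrow> (\<forall>h\<in>Dual. \<exists>N. \<forall>k\<ge>N. h (a k) = 0)"

definition csum :: "(nat => 'v) => 'v" where
 "csum a = (SOME x. x \<in> V \<and> (\<forall>h\<in>Dual. h x = sum (\<lambda>k. h (a k)) {k. h (a k) \<noteq> 0}))"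

lemma summD: "summ a ==> h \<in> Dual ==> \<exists>N. \<forall>k\<ge>N. h (a k) = 0"
 by (simp add: summ_def)

lemma summI: "(\<And>h. h \<in> Dual ==> \<exists>N. \<forall>k\<ge>N. h (a k) = 0) ==> summ a"
 by (simp add: summ_def)

text \<open>The functional \<open>h \<mapsto> \<Sum>\<^sub>k h (a k)\<close>, a finite sum for each \<open>h\<close>, is the evaluation at an element because the
carrier is reflexive.\<close>

lemma csum_props:
 assumes "summ a"
 shows "csum a \<in> V" "h \<in> Dual ==> h (csum a) = sum (\<lambda>k. h (a k)) {k. h (a k) \<noteq> 0}"
proof -
 have fin: "finite {k. h (a k) \<noteq> 0}" if h: "h \<in> Dual" for h
 proof -
  obtain N where "\<forall>k\<ge>N. h (a k) = 0" using summD[OF assms h] by auto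
  hence "{k. h (a k) \<noteq> 0} \<subseteq> {..<N}"
   by (metis (mono_tags, lifting) lessThan_iff mem_Collect_eq not_le subsetI)
  thus ?thesis by (rule finite_subset) simp
 qed
 define F where "F h = sum (\<lambda>k. h (a k)) {k. h (a k) \<noteq> 0}" for h :: "'v => 'k"
 have F: "F h = sum (\<lambda>k. h (a k)) S" if "finite S" "{k. h (a k) \<noteq> 0} \<subseteq> S" for h S
  unfolding F_def by (rule sum.mono_neutral_left) (use that in auto)
 have "\<exists>x. P0 x + P1 x = x \<and> (\<forall>h\<in>Dual. F h = h x)"
 proof (rule Dual_refl)
  fix h g assume h: "h \<in> Dual" "g \<in> Dual"
  let ?S = "{k. h (a k) \<noteq> 0} \<union> {k. g (a k) \<noteq> 0}"
  have "finite ?S" using fin h by auto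
  hence "F (\<lambda>x. h x + g x) = (\<Sum>k\<in>?S. h (a k) + g (a k))" by (intro F) auto
  also have "\<dots> = (\<Sum>k\<in>?S. h (a k)) + (\<Sum>k\<in>?S. g (a k))" by (rule sum.distrib)
  also have "(\<Sum>k\<in>?S. h (a k)) = F h" using F[OF \<open>finite ?S\<close>, of h] by auto
  also have "(\<Sum>k\<in>?S. g (a k)) = F g" using F[OF \<open>finite ?S\<close>, of g] by auto
  finally show "F (\<lambda>x. h x + g x) = F h + F g" .
 next
  fix c h assume h: "h \<in> Dual"
  have "F (\<lambda>x. c * h x) = (\<Sum>k\<in>{k. h (a k) \<noteq> 0}. c * h (a k))" using fin[OF h] by (intro F) auto
  thus "F (\<lambda>x. c * h x) = c * F h" by (simp add: F_def sum_distrib_left)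
 qed
 then obtain x where "P0 x + P1 x = x" "\<forall>h\<in>Dual. F h = h x" by blast
 hence "x \<in> V \<and> (\<forall>h\<in>Dual. h x = F h)" by (simp add: V_def pi_def)
 hence "csum a \<in> V \<and> (\<forall>h\<in>Dual. h (csum a) = F h)"
  unfolding csum_def F_def by (rule someI)
 thus "csum a \<in> V" "h \<in> Dual ==> h (csum a) = sum (\<lambda>k. h (a k)) {k. h (a k) \<noteq> 0}"
  by (auto simp: F_def)
qed

lemma csum_eval:
 assumes "summ a" "h \<in> Dual" "\<And>k. k \<ge> N ==> h (a k) = 0"
 shows "h (csum a) = (\<Sum>k<N. h (a k))"
proof -
 have "{k. h (a k) \<noteq> 0} \<subseteq> {..<N}"
  using assms(3) by (metis (mono_tags, lifting) lessThan_iff mem_Collect_eq not_le subsetI)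
 hence "(\<Sum>k\<in>{k. h (a k) \<noteq> 0}. h (a k)) = (\<Sum>k<N. h (a k))"
  by (intro sum.mono_neutral_left) auto
 thus ?thesis using csum_props(2)[OF assms(1,2)] by simp
qed

lemma summ_cop: "summ a ==> cop L ==> summ (\<lambda>k. L (a k))"
 by (rule summI) (use summD cop_Dual in fastforce)

lemma csum_cop:
 assumes "summ a" "cop L" shows "L (csum a) = csum (\<lambda>k. L (a k))"
proof (rule Dual_eqI)
 note s = summ_cop[OF assms]
 show "L (csum a) \<in> V" using assms by (simp add: cop_V)
 show "csum (\<lambda>k. L (a k)) \<in> V" using csum_props[OF s] by simp
 fix h assume h: "h \<in> Dual"
 show "h (L (csum a)) = h (csum (\<lambda>k. L (a k)))"
  using csum_props(2)[OF s h] csum_props(2)[OF assms(1) cop_Dual[OF assms(2) h]] by simp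
qed

lemma csum_zero: "csum (\<lambda>k. 0) = 0"
proof (rule Dual_eqI)
 have s: "summ (\<lambda>k. 0)" by (simp add: summ_def)
 show "csum (\<lambda>k. 0) \<in> V" using csum_props[OF s] by simp
 show "h (csum (\<lambda>k. 0)) = h 0" if "h \<in> Dual" for h using csum_eval[OF s that, of 0] that by simp
qed simp

lemma csum_telescope:
 assumes "summ a" "\<And>k. a k \<in> V" shows "csum (\<lambda>k. a k - a (Suc k)) = a 0"
proof (rule Dual_eqI)
 have s: "summ (\<lambda>k. a k - a (Suc k))"
 proof (rule summI)
  fix h assume h: "h \<in> Dual"
  obtain N where "\<forall>k\<ge>N. h (a k) = 0" using summD[OF assms(1) h] by auto
  thus "\<exists>N. \<forall>k\<ge>N. h (a k - a (Suc k)) = 0" by (auto simp: Dual_diff[OF h] intro!: exI[of _ N])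
 qed
 show "csum (\<lambda>k. a k - a (Suc k)) \<in> V" using csum_props[OF s] by simp
 show "a 0 \<in> V" by (rule assms)
 fix h assume h: "h \<in> Dual"
 obtain N where N: "\<forall>k\<ge>N. h (a k) = 0" using summD[OF assms(1) h] by auto
 have "h (csum (\<lambda>k. a k - a (Suc k))) = (\<Sum>k<N. h (a k - a (Suc k)))"
  by (rule csum_eval[OF s h]) (use N in \<open>auto simp: Dual_diff[OF h]\<close>)
 also have "\<dots> = (\<Sum>k<N. h (a k) - h (a (Suc k)))" by (simp add: Dual_diff[OF h])
 also have "\<dots> = h (a 0) - h (a N)" by (rule sum_lessThan_telescope')
 finally show "h (csum (\<lambda>k. a k - a (Suc k))) = h (a 0)" using N by simp
qed

end

context calg
begin

lemma even_prd: "u \<in> H 0 ==> P0 (u \<odot> x) = u \<odot> P0 x" "u \<in> H 0 ==> P1 (u \<odot> x) = u \<odot> P1 x"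
proof -
 assume u: "u \<in> H 0"
 have "u \<odot> x = u \<odot> P0 x + u \<odot> P1 x" by (metis prd_pi(2) pi_def prd_addr)
 moreover have "P0 (u \<odot> P0 x) = u \<odot> P0 x \<and> P1 (u \<odot> P0 x) = 0"
  using H_comps(1)[OF prd_H[OF u, of "P0 x" 0]] by simp
 moreover have "P0 (u \<odot> P1 x) = 0 \<and> P1 (u \<odot> P1 x) = u \<odot> P1 x"
  using H_comps(2)[OF prd_H[OF u, of "P1 x" 1]] by simp
 ultimately show "P0 (u \<odot> x) = u \<odot> P0 x" "P1 (u \<odot> x) = u \<odot> P1 x" by (simp_all add: Plin)
qed

subsection \<open>A continuous character\<close>

definition act :: "('v => 'k) => 'v => 'v => 'k" where "act h a = (\<lambda>b. h (a \<odot> b))"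

lemma act_Dual: "h \<in> Dual ==> act h a \<in> Dual" by (simp add: act_def Dual_prdl)
lemma act_act: "act (act h a) b = act h (a \<odot> b)" by (simp add: act_def assoc)
lemma act_e: "h \<in> Dual ==> act h e = h" by (simp add: act_def)
lemma act_add: "h \<in> Dual ==> act h (a + b) = act h a + act h b"
 by (simp add: act_def fun_eq_iff prd_lin Dual_lin)
lemma act_scale: "h \<in> Dual ==> act h (c \<cdot> a) = (\<lambda>x. c * act h a x)"
 by (simp add: act_def fun_eq_iff prd_lin Dual_lin)
lemma act_zero: "h \<in> Dual ==> act h 0 = (\<lambda>x. 0)"
 by (simp add: act_def fun_eq_iff)

definition orbit :: "('v => 'k) => ('v => 'k) set" where "orbit h = range (act h)"

lemma orbit_subspace: "h \<in> Dual ==> fs.subspace (orbit h)"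
 unfolding fs.subspace_def orbit_def
proof (intro conjI allI ballI)
 assume h: "h \<in> Dual"
 show "0 \<in> range (act h)" using act_zero[OF h] by (auto simp: zero_fun_def intro!: image_eqI[of _ _ 0])
 fix f g c assume "f \<in> range (act h)"
 then obtain a where f: "f = act h a" by auto
 show "(\<lambda>x. c * f x) \<in> range (act h)" unfolding f act_scale[OF h, symmetric] by simp
 assume "g \<in> range (act h)"
 then obtain b where g: "g = act h b" by auto
 show "f + g \<in> range (act h)" unfolding f g act_add[OF h, symmetric] by simp
qed

lemma orbit_mono: "f \<in> orbit h ==> orbit f \<subseteq> orbit h"
 by (auto simp: orbit_def act_act)

lemma Dual_in_span:
 assumes "finite \<Phi>" "\<Phi> \<subseteq> Dual" "g \<in> Dual" "\<And>x. (\<forall>f\<in>\<Phi>. f x = 0) ==> g x = 0"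
 obtains c where "\<And>x. g x = (\<Sum>f\<in>\<Phi>. c f * f x)"
proof -
 have "\<exists>c. \<forall>x. g x = (\<Sum>f\<in>\<Phi>. c f * f x)"
 proof (rule functional_in_span[OF assms(1)])
  show "(\<forall>x y. f (x + y) = f x + f y) \<and> (\<forall>c x. f (c \<cdot> x) = c * f x)" if "f \<in> \<Phi>" for f
   using that assms(2) by (auto simp: Dual_add Dual_scale subset_eq)
  show "g (x + y) = g x + g y" for x y by (rule Dual_add[OF assms(3)])
  show "g (c \<cdot> x) = c * g x" for c x by (rule Dual_scale[OF assms(3)])
  show "g x = 0" if "\<And>f. f \<in> \<Phi> ==> f x = 0" for x using that assms(4) by blast
 qed
 then obtain c where "\<forall>x. g x = (\<Sum>f\<in>\<Phi>. c f * f x)" ..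
 thus thesis using that by auto
qed

text \<open>By continuity of the product, all translates of \<open>h\<close> vanish on a common subspace of finite codimension.\<close>

lemma orbit_finite:
 assumes h: "h \<in> Dual"
 obtains \<Phi> where "finite \<Phi>" "orbit h \<subseteq> fs.span \<Phi>"
proof -
 obtain \<Phi> where P: "finite \<Phi>" "\<Phi> \<subseteq> Dual"
   "\<And>x y. (\<forall>f\<in>\<Phi>. f x = 0) ==> h (y \<odot> x) = 0"
  using prd_fin[OF h] by auto
 have "act h a \<in> fs.span \<Phi>" for a
 proof -
  obtain c where c: "\<And>x. act h a x = (\<Sum>f\<in>\<Phi>. c f * f x)"
   by (rule Dual_in_span[OF P(1,2) act_Dual[OF h], of a]) (use P(3) in \<open>auto simp: act_def\<close>)
  have "act h a = (\<Sum>f\<in>\<Phi>. (\<lambda>x. c f * f x))"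
  proof
   fix x
   have "(\<Sum>f\<in>\<Phi>. (\<lambda>x. c f * f x)) x = (\<Sum>f\<in>\<Phi>. c f * f x)"
    using P(1) by (induction \<Phi> rule: finite_induct) auto
   thus "act h a x = (\<Sum>f\<in>\<Phi>. (\<lambda>x. c f * f x)) x" using c by simp
  qed
  also have "\<dots> \<in> fs.span \<Phi>"
   by (intro fs.span_sum fs.span_scale fs.span_base)
  finally show ?thesis .
 qed
 thus thesis using that[OF P(1)] by (auto simp: orbit_def)
qed

lemma orbit_minimal:
 assumes h: "h \<in> Dual" and f: "f \<in> orbit h" and d: "fs.dim (orbit h) \<le> fs.dim (orbit f)"
 shows "orbit f = orbit h"
proof -
 have fD: "f \<in> Dual" using f h by (auto simp: orbit_def act_Dual)
 obtain \<Phi> where P: "finite \<Phi>" "orbit h \<subseteq> fs.span \<Phi>" by (rule orbit_finite[OF h])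
 obtain B where B: "B \<subseteq> orbit f" "fs.independent B" "orbit f \<subseteq> fs.span B" "card B = fs.dim (orbit f)"
  by (rule fs.basis_exists)
 have "B \<subseteq> orbit h" using B(1) orbit_mono[OF f] by blast
 from fs.maximal_independent_subset_extend[OF this B(2)] obtain C where
  C: "B \<subseteq> C" "C \<subseteq> orbit h" "fs.independent C" "orbit h \<subseteq> fs.span C" by blast
 have "finite C" using fs.independent_span_bound[OF P(1) C(3)] C(2) P(2) by auto
 moreover have "card C = fs.dim (orbit h)" using C by (intro fs.basis_card_eq_dim) auto
 ultimately have "B = C" using B(4) C(1) d by (intro card_seteq) auto
 hence "orbit h \<subseteq> fs.span (orbit f)" using C(4) B(1) fs.span_mono by blast
 moreover have "fs.span (orbit f) = orbit f" using orbit_subspace[OF fD] by (simp only: fs.span_eq_iff)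
 ultimately show ?thesis using orbit_mono[OF f] by auto
qed

fun epow :: "'v => nat => 'v" where
 "epow x 0 = e" | "epow x (Suc n) = x \<odot> epow x n"

lemma epow_V [simp]: "epow x n \<in> V" by (cases n) auto

definition pe :: "'v => 'k poly => 'v" where "pe a p = (\<Sum>i\<le>degree p. coeff p i \<cdot> epow a i)"

lemma pe_upto: "degree p \<le> n ==> pe a p = (\<Sum>i\<le>n. coeff p i \<cdot> epow a i)"
 unfolding pe_def by (rule sum.mono_neutral_left) (auto simp: coeff_eq_0)

lemma pe_linear_factor: "pe a ([:- c, 1:] * q) = (a - c \<cdot> e) \<odot> pe a q"
proof -
 have d: "degree ([:- c, 1:] * q) \<le> Suc (degree q)"
  using degree_mult_le[of "[:- c, 1:]" q] by simp
 have "pe a ([:- c, 1:] * q) = (\<Sum>i\<le>Suc (degree q). coeff (pCons 0 q - smult c q) i \<cdot> epow a i)"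
  unfolding pe_upto[OF d] by (rule sum.cong) (auto simp: algebra_simps)
 also have "\<dots> = (\<Sum>i\<le>Suc (degree q). coeff (pCons 0 q) i \<cdot> epow a i) - c \<cdot> (\<Sum>i\<le>Suc (degree q). coeff q i \<cdot> epow a i)"
  by (simp add: scale_left_diff_distrib sum_subtractf scale_sum_right del: sum.atMost_Suc)
 also have "(\<Sum>i\<le>Suc (degree q). coeff q i \<cdot> epow a i) = pe a q"
  using pe_upto[of q "Suc (degree q)" a] by (simp del: sum.atMost_Suc)
 also have "(\<Sum>i\<le>Suc (degree q). coeff (pCons 0 q) i \<cdot> epow a i) = (\<Sum>i\<le>degree q. coeff q i \<cdot> epow a (Suc i))"
  by (subst sum.atMost_Suc_shift) simp
 also have "\<dots> = a \<odot> pe a q" by (simp add: pe_def prd_sum prd_lin)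
 finally show ?thesis by (simp add: prd_lin pi_V pe_def V_sum)
qed

text \<open>Take a functional \<open>h \<noteq> 0\<close> for which the space of translates has minimal dimension. By minimality an element either
kills \<open>h\<close> or acts invertibly on the translates. Odd elements are nilpotent, so they kill \<open>h\<close>. As the dimension is
finite, every even element \<open>a\<close> satisfies \<open>p(a) h = 0\<close> for a polynomial \<open>p \<noteq> 0\<close>, so some linear factor \<open>a - c\<close>
kills \<open>h\<close>. Hence every element acts on \<open>h\<close> by a scalar, and this scalar is the character.\<close>

lemma ex_character:
 obtains \<epsilon> where "\<epsilon> \<in> Dual" "\<epsilon> e = 1" "\<And>a b. \<epsilon> (a \<odot> b) = \<epsilon> a * \<epsilon> b" "\<And>a. \<epsilon> (P1 a) = 0"
proof -
 define \<N> where "\<N> = {h\<in>Dual. h \<noteq> (\<lambda>x. 0)}"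
 obtain h0 where "h0 \<in> Dual" "h0 e \<noteq> 0" using Dual_sep[of e] e_nz e_H(2) by (auto simp: V_def pi_def)
 hence "h0 \<in> \<N>" by (auto simp: \<N>_def)
 then obtain h where h: "h \<in> \<N>" "\<And>g. g \<in> \<N> ==> fs.dim (orbit h) \<le> fs.dim (orbit g)"
  using ex_has_least_nat[of "\<lambda>g. g \<in> \<N>" h0 "\<lambda>g. fs.dim (orbit g)"] by auto
 have hD: "h \<in> Dual" and h0: "h \<noteq> (\<lambda>x. 0)" using h by (auto simp: \<N>_def)
 have min: "\<exists>c. act h (a \<odot> c) = h" if "act h a \<noteq> (\<lambda>x. 0)" for a
 proof -
  have "orbit (act h a) = orbit h"
   by (rule orbit_minimal[OF hD]) (use h(2) that act_Dual[OF hD] in \<open>auto simp: \<N>_def orbit_def\<close>)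
  moreover have "h \<in> orbit h" unfolding orbit_def using act_e[OF hD] by (metis rangeI)
  ultimately have "h \<in> range (act (act h a))" by (simp add: orbit_def)
  then obtain c where "h = act (act h a) c" by blast
  thus ?thesis by (metis act_act)
 qed
 have odd: "act h (P1 a) = (\<lambda>x. 0)" for a
 proof (rule ccontr)
  assume "act h (P1 a) \<noteq> (\<lambda>x. 0)"
  then obtain c where c: "act h (P1 a \<odot> c) = h" using min by blast
  have "P1 a \<odot> c \<odot> (P1 a \<odot> c) = P1 a \<odot> (tw 1 (tw 1 c) \<odot> P1 a) \<odot> c"
   by (metis assoc prd_tw_l)
  also have "tw 1 (tw 1 c) \<odot> P1 a = P1 a \<odot> tw 1 c" by (metis comm_tw P_in_H(3))
  also have "P1 a \<odot> (P1 a \<odot> tw 1 c) \<odot> c = 0"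
   using odd_square[of "P1 a" 1] by (simp flip: assoc)
  finally have "h = (\<lambda>x. 0)" using c act_act[of h "P1 a \<odot> c" "P1 a \<odot> c"] act_zero[OF hD] by simp
  thus False using h0 by simp
 qed
 have ev: "\<exists>c. act h (a - c \<cdot> e) = (\<lambda>x. 0)" if a: "a \<in> H 0" for a
 proof (rule ccontr)
  assume nc: "\<nexists>c. act h (a - c \<cdot> e) = (\<lambda>x. 0)"
  have nz: "act h (pe a p) \<noteq> (\<lambda>x. 0)" if "p \<noteq> 0" for p
   using that
  proof (induction "degree p" arbitrary: p)
   case 0
   then obtain c where p: "p = [:c:]" "c \<noteq> 0" by (metis degree_eq_zeroE pCons_0_0)
   have "act h (pe a p) = (\<lambda>x. c * h x)" using p by (simp add: pe_def act_scale[OF hD] act_e[OF hD])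
   moreover obtain x where "h x \<noteq> 0" using h0 by auto
   ultimately show ?case using p(2) by (metis mult_eq_0_iff)
  next
   case (Suc n)
   then obtain z where "poly p z = 0" using alg_closed_imp_poly_has_root[of p] by auto
   then obtain q where q: "p = [:- z, 1:] * q" by (metis poly_eq_0_iff_dvd dvdE)
   have q0: "q \<noteq> 0" using q Suc.prems by auto
   have "degree p = Suc (degree q)" using q0 unfolding q by (subst degree_mult_eq) auto
   hence "act h (pe a q) \<noteq> (\<lambda>x. 0)" using Suc q0 by simp
   then obtain d where d: "act h (pe a q \<odot> d) = h" using min by blast
   show ?case
   proof
    assume z: "act h (pe a p) = (\<lambda>x. 0)"
    have H: "a - z \<cdot> e \<in> H 0" using a by (intro H_in) auto
    have "act h (a - z \<cdot> e) = act h (pe a q \<odot> d \<odot> (a - z \<cdot> e))" by (metis d act_act)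
    also have "pe a q \<odot> d \<odot> (a - z \<cdot> e) = pe a p \<odot> d"
     unfolding q pe_linear_factor by (metis comm_e[OF H] assoc)
    also have "act h \<dots> = (\<lambda>x. 0)" using z by (metis act_act act_zero act_Dual hD prd_0(1) act_def)
    finally show False using nc by blast
   qed
  qed
  obtain \<Phi> where P: "finite \<Phi>" "\<Phi> \<subseteq> Dual"
    "\<And>x y. (\<forall>f\<in>\<Phi>. f x = 0) ==> h (y \<odot> x) = 0 \<and> h (x \<odot> y) = 0"
   using prd_fin[OF hD] by auto
  define N where "N = card \<Phi>"
  have "\<exists>c. (\<exists>i\<in>{..N}. c i \<noteq> 0) \<and> (\<forall>g\<in>(\<lambda>f i. f (epow a i)) ` \<Phi>. (\<Sum>i\<in>{..N}. c i * g i) = 0)"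
  proof (rule underdetermined_system)
   show "card ((\<lambda>f i. f (epow a i)) ` \<Phi>) < card {..N}"
    using card_image_le[OF P(1), of "\<lambda>f i. f (epow a i)"] by (simp add: N_def)
  qed (use P in auto)
  then obtain c where c: "\<exists>i\<le>N. c i \<noteq> 0" "\<And>f. f \<in> \<Phi> ==> (\<Sum>i\<le>N. c i * f (epow a i)) = 0" by auto
  define p where "p = (\<Sum>i\<le>N. monom (c i) i)"
  have cp: "coeff p i = (if i \<le> N then c i else 0)" for i
   by (simp add: p_def coeff_sum sum.delta)
  have "p \<noteq> 0" using c(1) cp by (metis coeff_0)
  have dp: "degree p \<le> N" by (rule degree_le) (simp add: cp)
  have "f (pe a p) = 0" if "f \<in> \<Phi>" for f
  proof -
   have f: "f \<in> Dual" using that P(2) by blast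
   have "f (pe a p) = (\<Sum>i\<le>N. coeff p i * f (epow a i))"
    unfolding pe_upto[OF dp] by (simp add: Dual_lin[OF f])
   also have "\<dots> = (\<Sum>i\<le>N. c i * f (epow a i))" by (rule sum.cong) (auto simp: cp)
   finally show ?thesis using c(2)[OF that] by simp
  qed
  hence "act h (pe a p) = (\<lambda>x. 0)" using P(3) by (auto simp: act_def)
  thus False using nz \<open>p \<noteq> 0\<close> by blast
 qed
 have "\<forall>a. \<exists>c. act h a = (\<lambda>x. c * h x)"
 proof
  fix a
  obtain c where c: "act h (P0 a - c \<cdot> e) = (\<lambda>x. 0)" using ev[of "P0 a"] by auto
  have "pi a = (P0 a - c \<cdot> e) + c \<cdot> e + P1 a" by (simp add: pi_def)
  hence "act h (pi a) = act h (P0 a - c \<cdot> e) + act h (c \<cdot> e) + act h (P1 a)"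
   by (simp only: act_add[OF hD])
  hence "act h (pi a) = (\<lambda>x. c * h x)"
   by (simp only: c odd act_scale[OF hD] act_e[OF hD]) (simp add: fun_eq_iff)
  thus "\<exists>c. act h a = (\<lambda>x. c * h x)" by (auto simp: act_def)
 qed
 then obtain \<epsilon> where eps: "\<And>a. act h a = (\<lambda>x. \<epsilon> a * h x)" by metis
 obtain b0 where "h b0 \<noteq> 0" using h0 by auto
 define b where "b = inverse (h b0) \<cdot> b0"
 have b: "h b = 1" using \<open>h b0 \<noteq> 0\<close> by (simp add: b_def Dual_scale[OF hD])
 have ee: "\<epsilon> = (\<lambda>a. h (a \<odot> b))"
 proof
  fix a show "\<epsilon> a = h (a \<odot> b)" using fun_cong[OF eps[of a], of b] b by (simp add: act_def)
 qed
 show thesis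
 proof (rule that[of \<epsilon>])
  show "\<epsilon> \<in> Dual" unfolding ee by (rule Dual_prdr[OF hD])
  show "\<epsilon> e = 1" using b by (simp add: ee hD)
  show "\<epsilon> (P1 a) = 0" for a using odd[of a] by (simp add: ee act_def fun_eq_iff)
  show "\<epsilon> (a \<odot> c) = \<epsilon> a * \<epsilon> c" for a c
  proof -
   have "\<epsilon> (a \<odot> c) = act (act h a) c b" by (simp add: ee act_def assoc)
   also have "\<dots> = act (\<lambda>x. \<epsilon> a * h x) c b" by (simp add: eps)
   also have "\<dots> = \<epsilon> a * act h c b" by (simp add: act_def)
   also have "\<dots> = \<epsilon> a * \<epsilon> c" using b by (simp add: eps)
   finally show ?thesis .
  qed
 qed
qed

end

subsection \<open>Generalized Poisson brackets\<close>

locale cgp = calg scale P0 P1 prd e Dual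
 for scale :: "'k::{alg_closed_field,field_char_0} => 'v::ab_group_add => 'v" (infixr "\<cdot>" 75)
  and P0 P1 :: "'v => 'v" and prd :: "'v => 'v => 'v" (infixl "\<odot>" 70)
  and e :: 'v and Dual :: "('v => 'k) set" +
 fixes br :: "'v => 'v => 'v"
 assumes br_addl: "br (x + y) z = br x z + br y z"
  and br_addr: "br x (y + z) = br x y + br x z"
  and br_scalel: "br (c \<cdot> x) y = c \<cdot> br x y"
  and br_scaler: "br x (c \<cdot> y) = c \<cdot> br x y"
  and br_pil: "br (pi x) y = br x y"
  and br_pir: "br x (pi y) = br x y"
  and br_H: "x \<in> H p ==> y \<in> H q ==> br x y \<in> H (p + q)"
  and br_skew: "x \<in> H p ==> br x y = - br (tw p y) x"
  and br_jacobi: "x \<in> H p ==> br x (br y z) = br (br x y) z + br (tw p y) (br x z)"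
  and br_leibniz: "x \<in> H p ==> br x (y \<odot> z) = br x y \<odot> z + tw p y \<odot> br x z + br e x \<odot> (y \<odot> z)"
  and Dual_br: "h \<in> Dual ==> (\<lambda>x. h (br a x)) \<in> Dual"
  and br_fin: "h \<in> Dual ==> \<exists>\<Phi>. finite \<Phi> \<and> \<Phi> \<subseteq> Dual \<and>
    (\<forall>x y. (\<forall>f\<in>\<Phi>. f x = 0) \<longrightarrow> h (br x y) = 0)"
  and simple: "subspace I ==> I \<subseteq> V ==> (\<And>x. x \<in> I ==> P0 x \<in> I) ==>
    (\<And>a x. x \<in> I ==> a \<odot> x \<in> I) ==> (\<And>a x. x \<in> I ==> br a x \<in> I) ==> I \<subseteq> {0} \<or> V \<subseteq> I"
begin

definition D where "D x = br e x"
text \<open>The correction term \<open>D f \<odot> x\<close> turns the Leibniz rule of a generalized Poisson bracket into that of a derivation.\<close>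

definition X where "X f x = br f x + D f \<odot> x"

lemma br_zero [simp]: "br 0 x = 0" "br x 0 = 0"
 using br_scalel[of 0 0 x] br_scaler[of x 0 0] by simp_all
lemma br_minus: "br (- x) y = - br x y" "br x (- y) = - br x y"
 using br_scalel[of "-1" x y] br_scaler[of x "-1" y] by simp_all
lemma br_diff: "br (x - y) z = br x z - br y z" "br x (y - z) = br x y - br x z"
 using br_addl[of x "-y" z] br_addr[of x y "-z"] by (simp_all add: br_minus)
lemmas br_lin = br_addl br_addr br_minus br_diff br_scalel br_scaler
lemma br_sum: "br (\<Sum>i\<in>A. f i) y = (\<Sum>i\<in>A. br (f i) y)" "br y (\<Sum>i\<in>A. f i) = (\<Sum>i\<in>A. br y (f i))"
 by (induction A rule: infinite_finite_induct) (auto simp: br_lin)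

lemma br_V [simp]: "br x y \<in> V"
proof -
 have "br x y = br (P0 x + P1 x) (P0 y + P1 y)" by (metis br_pil br_pir pi_def)
 also have "\<dots> = br (P0 x) (P0 y) + br (P0 x) (P1 y) + br (P1 x) (P0 y) + br (P1 x) (P1 y)"
  by (simp add: br_lin)
 also have "\<dots> \<in> V" by (intro V_in) (rule H_V[OF br_H], rule P_in_H, rule P_in_H)+
 finally show ?thesis .
qed

lemma cop_br: "cop (\<lambda>x. br a x)" by (auto simp: cop_def Dual_br)
lemma cop_D: "cop D" using cop_br[of e] by (simp add: D_def[abs_def])
lemma cop_X: "cop (X f)" unfolding X_def[abs_def] by (intro cop_plus cop_br cop_prdl)

lemma D_V [simp]: "D x \<in> V" and X_V [simp]: "X f x \<in> V" by (simp_all add: D_def X_def)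

lemmas D_lin = cop_lin[OF cop_D]
lemmas X_lin = cop_lin[OF cop_X]

lemma X_addl: "X (f + g) x = X f x + X g x" and X_scalel: "X (c \<cdot> f) x = c \<cdot> X f x"
 and X_minusl: "X (- f) x = - X f x" and X_diffl: "X (f - g) x = X f x - X g x"
 by (simp_all add: X_def D_lin br_lin prd_lin algebra_simps scale_right_distrib)

lemma D_H: "x \<in> H p ==> D x \<in> H p"
 using br_H[OF e_H(1), of x p] by (simp add: D_def)
lemma X_H: "f \<in> H p ==> x \<in> H q ==> X f x \<in> H (p + q)"
 unfolding X_def by (intro H_in br_H prd_H D_H)

lemma br_ee: "D e = 0"
proof -
 have "br e e = - br e e" using br_skew[OF e_H(1), of e] by (simp add: tw_def)
 thus ?thesis unfolding D_def using two_zero by (metis add.right_inverse)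
qed

lemma X_e: "X e x = D x" by (simp add: X_def br_ee) (simp add: D_def)

lemma X_deriv: "f \<in> H p ==> X f (x \<odot> y) = X f x \<odot> y + tw p x \<odot> X f y"
proof -
 assume f: "f \<in> H p"
 have "tw p x \<odot> (D f \<odot> y) = (tw p x \<odot> D f) \<odot> y" by (simp add: assoc)
 also have "tw p x \<odot> D f = D f \<odot> x"
  using comm_tw[OF D_H[OF f], of x] by simp
 finally have c: "tw p x \<odot> (D f \<odot> y) = D f \<odot> (x \<odot> y)" by (simp add: assoc)
 show ?thesis unfolding X_def
  by (simp add: br_leibniz[OF f] prd_lin c assoc flip: D_def)
qed

lemma D_deriv: "D (x \<odot> y) = D x \<odot> y + x \<odot> D y"
 using X_deriv[OF e_H(1), of x y] by (simp add: X_e tw_def)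

lemma br_D: "D (br x y) = br (D x) y + br x (D y)"
 using br_jacobi[OF e_H(1), of x y] by (simp add: D_def tw_def)

lemma br_e: "x \<in> V ==> br x e = - D x"
proof -
 have 0: "br (P0 x) e = - D (P0 x)" and 1: "br (P1 x) e = - D (P1 x)"
  using br_skew[of "P0 x" 0 e] br_skew[of "P1 x" 1 e] by (simp_all add: D_def)
 assume "x \<in> V"
 hence x: "P0 x + P1 x = x" by (simp add: V_def pi_def)
 have "br (P0 x + P1 x) e = - D (P0 x + P1 x)" using 0 1 by (simp add: br_lin D_lin)
 thus ?thesis by (simp add: x)
qed

lemma sg_br: "sg (br x y) = br (sg x) (sg y)"
proof -
 have b: "br x y = br (P0 x) (P0 y) + br (P0 x) (P1 y) + br (P1 x) (P0 y) + br (P1 x) (P1 y)" for x y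
  using br_pil[of x] br_pir[of _ y] by (simp add: br_lin pi_def) (metis br_addl br_addr add.assoc)
 have "sg (br (P0 x) (P0 y)) = br (P0 x) (P0 y)" "sg (br (P0 x) (P1 y)) = - br (P0 x) (P1 y)"
  "sg (br (P1 x) (P0 y)) = - br (P1 x) (P0 y)" "sg (br (P1 x) (P1 y)) = br (P1 x) (P1 y)"
  using sg_H[OF br_H[of "P0 x" 0 "P0 y" 0]] sg_H[OF br_H[of "P0 x" 0 "P1 y" 1]]
   sg_H[OF br_H[of "P1 x" 1 "P0 y" 0]] sg_H[OF br_H[of "P1 x" 1 "P1 y" 1]] by simp_all
 thus ?thesis unfolding b[of x y] b[of "sg x" "sg y"] by (simp add: sg_lin br_lin)
qed

lemma tw_br: "tw p (br x y) = br (tw p x) (tw p y)" by (simp add: tw_def sg_br)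
lemma sg_D: "sg (D x) = D (sg x)" using sg_br[of e x] by (simp add: D_def)

end

subsection \<open>The maximal ideal and the adic topology\<close>

locale lgp = cgp scale P0 P1 prd e Dual br
 for scale :: "'k::{alg_closed_field,field_char_0} => 'v::ab_group_add => 'v" (infixr "\<cdot>" 75)
  and P0 P1 :: "'v => 'v" and prd :: "'v => 'v => 'v" (infixl "\<odot>" 70)
  and e :: 'v and Dual :: "('v => 'k) set" and br :: "'v => 'v => 'v" +
 fixes \<epsilon> :: "'v => 'k"
 assumes eps_Dual: "\<epsilon> \<in> Dual" and eps_e [simp]: "\<epsilon> e = 1"
  and eps_prd: "\<epsilon> (a \<odot> b) = \<epsilon> a * \<epsilon> b" and eps_P1 [simp]: "\<epsilon> (P1 a) = 0"
begin

lemmas eps_lin = Dual_lin[OF eps_Dual]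
lemma eps_0 [simp]: "\<epsilon> 0 = 0" by (rule Dual_zero[OF eps_Dual])
lemma eps_pi [simp]: "\<epsilon> (pi x) = \<epsilon> x" by (rule Dual_pi'[OF eps_Dual])
lemma eps_P0 [simp]: "\<epsilon> (P0 x) = \<epsilon> x" using eps_pi[of x] by (simp add: pi_def eps_lin)
lemma eps_sg [simp]: "\<epsilon> (sg x) = \<epsilon> x" by (simp add: sg_def eps_lin)
lemma eps_tw [simp]: "\<epsilon> (tw p x) = \<epsilon> x" by (simp add: tw_def)
lemma eps_odd: "x \<in> H p ==> odd p ==> \<epsilon> x = 0" using eps_P1[of x] by (simp add: H_def)

definition m where "m = {x\<in>V. \<epsilon> x = 0}"

lemma m_in: "0 \<in> m" "x \<in> m ==> y \<in> m ==> x + y \<in> m" "x \<in> m ==> y \<in> m ==> x - y \<in> m"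
 "x \<in> m ==> c \<cdot> x \<in> m" "x \<in> m ==> - x \<in> m" "x \<in> m ==> y \<odot> x \<in> m" "x \<in> m ==> x \<odot> y \<in> m"
 "x \<in> m ==> tw p x \<in> m" "x \<in> m ==> P0 x \<in> m" "x \<in> V ==> x - \<epsilon> x \<cdot> e \<in> m"
 by (auto simp: m_def eps_lin eps_prd)

lemma m_V: "x \<in> m ==> x \<in> V" by (simp add: m_def)

fun mp :: "nat => 'v set" where
 "mp 0 = V" | "mp (Suc k) = span {a \<odot> b | a b. a \<in> m \<and> b \<in> mp k}"

lemma V_subspace: "subspace V" by (simp add: subspace_def)

lemma mp_subspace: "subspace (mp k)" by (cases k) (simp_all add: V_subspace)

lemmas mp_in = subspace_0[OF mp_subspace] subspace_add[OF mp_subspace] subspace_diff[OF mp_subspace]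
 subspace_scale[OF mp_subspace] subspace_sum[OF mp_subspace] subspace_neg[OF mp_subspace]

lemma mp_mult: "a \<in> m ==> b \<in> mp k ==> a \<odot> b \<in> mp (Suc k)"
 by (auto intro!: span_base)

lemma mp_SucE:
 assumes "x \<in> mp (Suc k)" "subspace S" "\<And>a b. a \<in> m ==> b \<in> mp k ==> a \<odot> b \<in> S"
 shows "x \<in> S"
proof -
 have "span {a \<odot> b | a b. a \<in> m \<and> b \<in> mp k} \<subseteq> S" using assms(2,3) by (intro span_minimal) auto
 thus ?thesis using assms(1) by auto
qed

lemma mp_m: "mp (Suc k) \<subseteq> m"
proof
 fix x assume "x \<in> mp (Suc k)"
 thus "x \<in> m" by (rule mp_SucE) (auto simp: subspace_def m_in)
qed

lemma mp_ideal: "x \<in> mp k ==> y \<odot> x \<in> mp k"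
proof (induction k arbitrary: x)
 case (Suc k)
 have s: "subspace {x. y \<odot> x \<in> mp (Suc k)}"
  using mp_subspace[of "Suc k"] unfolding subspace_def by (simp add: prd_lin del: mp.simps)
 have "x \<in> {x. y \<odot> x \<in> mp (Suc k)}"
  by (rule mp_SucE[OF Suc.prems s]) (simp add: mp_mult m_in assoc[symmetric] del: mp.simps)
 thus ?case by simp
qed simp

lemma mp_tw: "x \<in> mp k ==> tw p x \<in> mp k"
proof (induction k arbitrary: x)
 case (Suc k)
 have s: "subspace {x. tw p x \<in> mp (Suc k)}"
  using mp_subspace[of "Suc k"] unfolding subspace_def by (simp add: tw_lin del: mp.simps)
 have "x \<in> {x. tw p x \<in> mp (Suc k)}"
  by (rule mp_SucE[OF Suc.prems s]) (use Suc.IH in \<open>simp add: tw_prd mp_mult m_in del: mp.simps\<close>)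
 thus ?case by simp
qed simp

lemma mp_Suc: "mp (Suc k) \<subseteq> mp k"
proof
 fix x assume "x \<in> mp (Suc k)"
 thus "x \<in> mp k" by (rule mp_SucE) (auto simp: mp_subspace mp_ideal)
qed

lemma mp_mono: "j \<le> k ==> mp k \<subseteq> mp j"
 by (induction rule: dec_induct) (use mp_Suc in blast)+

lemma epow_mp: "x \<in> m ==> epow x k \<in> mp k"
 by (induction k) (auto intro: mp_mult simp del: mp.simps(2))

text \<open>Derivations lower the adic filtration by at most one.\<close>

lemma X_mp: "f \<in> H p ==> x \<in> mp (Suc k) ==> X f x \<in> mp k"
proof (induction k arbitrary: x)
 case (Suc k)
 have s: "subspace {x. X f x \<in> mp (Suc k)}"
  using mp_subspace[of "Suc k"] unfolding subspace_def by (simp add: X_lin del: mp.simps)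
 have "x \<in> {x. X f x \<in> mp (Suc k)}"
 proof (rule mp_SucE[OF Suc.prems(2) s])
  fix a b assume ab: "a \<in> m" "b \<in> mp (Suc k)"
  have "X f a \<odot> b \<in> mp (Suc k)" by (rule mp_ideal[OF ab(2)])
  moreover have "tw p a \<odot> X f b \<in> mp (Suc k)"
   using Suc.IH[OF Suc.prems(1) ab(2)] ab(1) by (intro mp_mult m_in)
  ultimately show "a \<odot> b \<in> {x. X f x \<in> mp (Suc k)}"
   by (simp add: X_deriv[OF Suc.prems(1)] mp_in del: mp.simps)
 qed
 thus ?case by simp
qed simp

text \<open>A subspace of the maximal ideal that is stable under multiplication and bracket vanishes, even
 if it is not graded: adding its image under the parity automorphism makes it graded.\<close>

lemma simple_in_m:
 assumes I: "subspace I" "I \<subseteq> m" and mul: "\<And>a x. x \<in> I ==> a \<odot> x \<in> I"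
  and brk: "\<And>p a x. a \<in> H p ==> x \<in> I ==> br a x \<in> I"
 shows "I \<subseteq> {0}"
proof -
 define J where "J = {x + sg y | x y. x \<in> I \<and> y \<in> I}"
 have IV: "x \<in> I ==> x \<in> V" for x using I(2) m_V by blast
 have brk': "br a x \<in> I" if "x \<in> I" for a x
 proof -
  have "br a x = br (P0 a) x + br (P1 a) x" by (metis br_addl br_pil pi_def)
  thus ?thesis using brk[of "P0 a" 0 x] brk[of "P1 a" 1 x] that subspace_add[OF I(1)] by simp
 qed
 have JJ: "a + sg b \<in> J" if "a \<in> I" "b \<in> I" for a b using that by (auto simp: J_def)
 have J: "subspace J"
  unfolding subspace_def
 proof (intro conjI ballI allI)
  show "0 \<in> J" using subspace_0[OF I(1)] by (auto simp: J_def sg_lin intro!: exI[of _ 0])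
  fix x y c assume "x \<in> J"
  then obtain a b where x: "x = a + sg b" "a \<in> I" "b \<in> I" by (auto simp: J_def)
  have "c \<cdot> x = c \<cdot> a + sg (c \<cdot> b)" by (simp add: x sg_lin scale_right_distrib)
  moreover have "c \<cdot> a \<in> I" "c \<cdot> b \<in> I" using x subspace_scale[OF I(1)] by auto
  ultimately show "c \<cdot> x \<in> J" unfolding J_def by blast
  assume "y \<in> J"
  then obtain a' b' where y: "y = a' + sg b'" "a' \<in> I" "b' \<in> I" by (auto simp: J_def)
  have "x + y = (a + a') + sg (b + b')" by (simp add: x y sg_lin)
  moreover have "a + a' \<in> I" "b + b' \<in> I" using x y subspace_add[OF I(1)] by auto
  ultimately show "x + y \<in> J" unfolding J_def by blast
 qed
 have JI: "x \<in> J" if "x \<in> I" for x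
  using that subspace_0[OF I(1)] by (force simp: J_def sg_lin)
 have Jm: "J \<subseteq> m"
 proof
  fix x assume "x \<in> J"
  then obtain a b where x: "x = a + sg b" "a \<in> I" "b \<in> I" by (auto simp: J_def)
  have "a \<in> m" "b \<in> m" using x I(2) by auto
  thus "x \<in> m" by (simp add: m_def eps_lin x(1))
 qed
 have "J \<subseteq> {0} \<or> V \<subseteq> J"
 proof (rule simple[OF J])
  show "J \<subseteq> V" using Jm m_V by blast
  fix x assume "x \<in> J"
  then obtain a b where x: "x = a + sg b" "a \<in> I" "b \<in> I" by (auto simp: J_def)
  have "P0 z = (1/2) \<cdot> (z + sg z)" if "z \<in> V" for z
  proof -
   have "pi z + sg z = P0 z + P0 z" by (simp add: pi_def sg_def)
   hence "z + sg z = P0 z + P0 z" using pi_V[OF that] by simp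
   also have "\<dots> = (2::'k) \<cdot> P0 z" by (metis one_add_one scale_left_distrib scale_one)
   finally show ?thesis by simp
  qed
  hence "P0 x = (1/2) \<cdot> (a + b) + sg ((1/2) \<cdot> (a + b))"
   using x IV[OF x(2)] IV[OF x(3)] by (simp add: Plin sg_lin scale_right_distrib algebra_simps)
  moreover have "(1/2) \<cdot> (a + b) \<in> I" using x subspace_scale[OF I(1)] subspace_add[OF I(1)] by auto
  ultimately show "P0 x \<in> J" using JJ by simp
  fix c
  have "c \<odot> x = c \<odot> a + sg (sg c \<odot> b)" by (simp add: x prd_lin sg_prd)
  thus "c \<odot> x \<in> J" using x mul JJ by simp
  have "br c x = br c a + sg (br (sg c) b)" by (simp add: x br_lin sg_br br_pil)
  thus "br c x \<in> J" using x brk' JJ by simp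
 qed
 moreover have "e \<notin> J" using Jm by (auto simp: m_def)
 ultimately show ?thesis using JI e_H(2) by blast
qed

text \<open>The closure of \<open>0\<close> in the adic topology is stable under multiplication, and under every \<open>X\<^sub>a\<close> because \<open>X\<^sub>a\<close> shifts the
filtration by one. It lies in the maximal ideal, so simplicity makes it vanish.\<close>

lemma adic_separated:
 assumes "x \<in> V" "\<And>h k. h \<in> Dual ==> (\<And>y. y \<in> mp k ==> h y = 0) ==> h x = 0"
 shows "x = 0"
proof -
 define K where "K = {x\<in>V. \<forall>k. \<forall>h\<in>Dual. (\<forall>y\<in>mp k. h y = 0) \<longrightarrow> h x = 0}"
 have "K \<subseteq> {0}"
 proof (rule simple_in_m)
  have KI: "h x = 0" if "x \<in> K" "h \<in> Dual" "\<forall>y\<in>mp k. h y = 0" for x h k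
   using that by (simp add: K_def)
  show Ks: "subspace K" unfolding subspace_def
  proof (intro conjI ballI allI)
   show "0 \<in> K" by (simp add: K_def)
   show "c \<cdot> x \<in> K" if "x \<in> K" for x c
    using that by (simp add: K_def Dual_lin)
   show "x + y \<in> K" if "x \<in> K" "y \<in> K" for x y
    unfolding K_def
   proof (intro CollectI conjI allI ballI impI)
    show "x + y \<in> V" using that by (simp add: K_def)
    fix k h assume "h \<in> Dual" "\<forall>y\<in>mp k. h y = 0"
    with KI[OF that(1), of h k] KI[OF that(2), of h k] show "h (x + y) = 0" by (simp add: Dual_add)
   qed
  qed
  have "\<forall>y\<in>mp 1. \<epsilon> y = 0" using mp_m[of 0] by (auto simp: m_def simp del: mp.simps)
  thus "K \<subseteq> m" using KI[OF _ eps_Dual, of _ 1] by (auto simp: K_def m_def simp del: mp.simps)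
  fix a x assume x: "x \<in> K"
  show "a \<odot> x \<in> K" unfolding K_def
  proof (intro CollectI conjI allI ballI impI)
   fix k h assume h: "h \<in> Dual" "\<forall>y\<in>mp k. h y = 0"
   have "\<forall>y\<in>mp k. h (a \<odot> y) = 0" using h mp_ideal by blast
   thus "h (a \<odot> x) = 0" using KI[OF x Dual_prdl[OF h(1), of a], of "k"] by simp
  qed simp
  fix p assume a: "a \<in> H p"
  have Xk: "X a x \<in> K" unfolding K_def
  proof (intro CollectI conjI allI ballI impI)
   fix k h assume h: "h \<in> Dual" "\<forall>y\<in>mp k. h y = 0"
   have "\<forall>y\<in>mp (Suc k). h (X a y) = 0" using h X_mp[OF a] by blast
   thus "h (X a x) = 0" using KI[OF x cop_Dual[OF cop_X h(1), of a], of "Suc k"] by simp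
  qed simp
  have "D a \<odot> x \<in> K" unfolding K_def
  proof (intro CollectI conjI allI ballI impI)
   fix k h assume h: "h \<in> Dual" "\<forall>y\<in>mp k. h y = 0"
   have "\<forall>y\<in>mp k. h (D a \<odot> y) = 0" using h mp_ideal by blast
   thus "h (D a \<odot> x) = 0" using KI[OF x Dual_prdl[OF h(1), of "D a"], of "k"] by simp
  qed simp
  moreover have "br a x = X a x - D a \<odot> x" by (simp add: X_def)
  ultimately show "br a x \<in> K" using subspace_diff[OF Ks Xk] by simp
 qed
 moreover have "x \<in> K" using assms by (auto simp: K_def)
 ultimately show ?thesis by auto
qed

text \<open>A functional outside the space of those that vanish on a power of the maximal ideal could be separated from
this space by a linear form on \<open>Dual\<close>; by reflexivity this form is the evaluation at an element, which lies in
the adic closure of \<open>0\<close>.\<close>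

lemma Dual_nilpotent:
 assumes "h \<in> Dual" obtains k where "\<And>y. y \<in> mp k ==> h y = 0"
proof (rule ccontr)
 assume nk: "\<not> thesis"
 define U where "U = {g\<in>Dual. \<exists>k. \<forall>y\<in>mp k. g y = 0}"
 have U: "fs.subspace U"
  unfolding fs.subspace_def
 proof (intro conjI ballI allI)
  show "0 \<in> U" using Dual_0 by (auto simp: U_def zero_fun_def)
  fix f g c assume f: "f \<in> U"
  show "(\<lambda>x. c * f x) \<in> U" using f Dual_times by (auto simp: U_def)
  assume g: "g \<in> U"
  obtain i where i: "\<forall>y\<in>mp i. f y = 0" using f by (auto simp: U_def)
  obtain j where j: "\<forall>y\<in>mp j. g y = 0" using g by (auto simp: U_def)
  have "\<forall>y\<in>mp (max i j). f y + g y = 0"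
  proof
   fix y assume "y \<in> mp (max i j)"
   hence "y \<in> mp i" "y \<in> mp j" using mp_mono[of i "max i j"] mp_mono[of j "max i j"] by auto
   thus "f y + g y = 0" using i j by simp
  qed
  thus "f + g \<in> U" using f g Dual_plus by (auto simp: U_def plus_fun_def)
 qed
 have "h \<notin> U" using nk that assms by (auto simp: U_def)
 from fs.ex_functional[OF U this] obtain \<psi> where
  psi: "\<And>f g. \<psi> (f + g) = \<psi> f + \<psi> g" "\<And>c f. \<psi> (\<lambda>x. c * f x) = c * \<psi> f"
   "\<And>f. f \<in> U ==> \<psi> f = 0" "\<psi> h = 1" by blast
 have "\<exists>a. P0 a + P1 a = a \<and> (\<forall>g\<in>Dual. \<psi> g = g a)"
  using psi(1,2) by (intro Dual_refl) (auto simp: plus_fun_def)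
 then obtain a where a: "a \<in> V" "\<And>g. g \<in> Dual ==> \<psi> g = g a" by (auto simp: V_def pi_def)
 have "a = 0"
 proof (rule adic_separated[OF a(1)])
  fix g k assume "g \<in> Dual" "\<And>y. y \<in> mp k ==> g y = 0"
  hence "g \<in> U" by (auto simp: U_def)
  thus "g a = 0" using psi(3) a(2) \<open>g \<in> Dual\<close> by metis
 qed
 thus False using psi(4) a(2)[OF assms] Dual_zero[OF assms] by simp
qed

lemma mp_Inter: "x \<in> V ==> (\<And>k. x \<in> mp k) ==> x = 0"
 using adic_separated by blast

lemma summ_mp: "(\<And>k. a k \<in> mp k) ==> summ a"
proof (rule summI)
 fix h assume a: "\<And>k. a k \<in> mp k" and h: "h \<in> Dual"
 obtain N where "\<And>y. y \<in> mp N ==> h y = 0" using Dual_nilpotent[OF h] by blast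
 thus "\<exists>N. \<forall>k\<ge>N. h (a k) = 0" using a mp_mono by (intro exI[of _ N]) blast
qed

subsection \<open>Inverses, square roots\<close>

lemma ex_inverse:
 assumes u: "u \<in> H 0" "\<epsilon> u \<noteq> 0"
 obtains v where "v \<in> H 0" "u \<odot> v = e" "v \<odot> u = e" "\<epsilon> v = inverse (\<epsilon> u)"
proof -
 define n where "n = e - inverse (\<epsilon> u) \<cdot> u"
 have uV: "u \<in> V" by (rule H_V[OF u(1)])
 have n: "n \<in> m" using u uV by (auto simp: n_def m_def eps_lin)
 have s: "summ (epow n)" by (rule summ_mp[OF epow_mp[OF n]])
 define w where "w = csum (epow n)"
 have wV: "w \<in> V" unfolding w_def by (rule csum_props[OF s])
 have "(e - n) \<odot> w = csum (\<lambda>k. (e - n) \<odot> epow n k)"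
  unfolding w_def by (rule csum_cop[OF s cop_prdl])
 also have "(\<lambda>k. (e - n) \<odot> epow n k) = (\<lambda>k. epow n k - epow n (Suc k))"
  by (simp add: prd_lin pi_V)
 also have "csum \<dots> = epow n 0" by (rule csum_telescope[OF s]) simp
 finally have "(inverse (\<epsilon> u) \<cdot> u) \<odot> w = e" by (simp add: n_def)
 hence w1: "u \<odot> (inverse (\<epsilon> u) \<cdot> w) = e" by (simp add: prd_lin)
 define v where "v = P0 (inverse (\<epsilon> u) \<cdot> w)"
 have v: "v \<in> H 0" by (simp add: v_def)
 have "u \<odot> v = P0 (u \<odot> (inverse (\<epsilon> u) \<cdot> w))"
  unfolding v_def by (simp add: even_prd[OF u(1)])
 hence uv: "u \<odot> v = e" using w1 by simp
 moreover have vu: "v \<odot> u = e" using uv comm_e[OF v, of u] by simp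
 moreover have "\<epsilon> u * \<epsilon> v = 1" using arg_cong[OF uv, of \<epsilon>] by (simp add: eps_prd)
 hence "\<epsilon> v = inverse (\<epsilon> u)" using u(2) by (simp add: field_simps)
 ultimately show thesis using that[OF v] by blast
qed

lemma cancel_unit:
 assumes "u \<in> H 0" "\<epsilon> u \<noteq> 0" "x \<in> V" "u \<odot> x = 0" shows "x = 0"
proof -
 obtain v where "v \<odot> u = e" using ex_inverse[OF assms(1,2)] by blast
 hence "x = v \<odot> (u \<odot> x)" using assms(3) by (metis assoc unit(1) pi_V)
 thus ?thesis using assms(4) by simp
qed

lemma epow_add: "epow x (i + j) = epow x i \<odot> epow x j"
 by (induction i) (auto simp: pi_V assoc)

text \<open>The value of a formal power series in one variable at an element of the maximal ideal.\<close>

definition fpe :: "'v => 'k fps => 'v" where "fpe x f = csum (\<lambda>k. fps_nth f k \<cdot> epow x k)"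

lemma fpe_summ: "x \<in> m ==> summ (\<lambda>k. fps_nth f k \<cdot> epow x k)"
 by (intro summ_mp mp_in epow_mp)

lemma fpe_V: "x \<in> m ==> fpe x f \<in> V" unfolding fpe_def by (rule csum_props[OF fpe_summ])

lemma sum_triangle:
 fixes g :: "nat => 'k" and a b :: "nat => 'k"
 assumes "\<And>n. n \<ge> N ==> g n = 0"
 shows "(\<Sum>i<N. \<Sum>j<N. a i * b j * g (i + j)) = (\<Sum>n<N. (\<Sum>i=0..n. a i * b (n - i)) * g n)"
proof -
 have "(\<Sum>n<N. (\<Sum>i=0..n. a i * b (n - i)) * g n) = (\<Sum>n<N. \<Sum>i\<in>{..n}. a i * b (n - i) * g n)"
  by (simp add: sum_distrib_right atLeast0AtMost)
 also have "\<dots> = (\<Sum>(n, i)\<in>(SIGMA n:{..<N}. {..n}). a i * b (n - i) * g n)"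
  by (rule sum.Sigma) auto
 also have "\<dots> = (\<Sum>(i, j)\<in>{(i, j). i + j < N}. a i * b j * g (i + j))"
  by (rule sum.reindex_bij_witness[of _ "\<lambda>(i, j). (i + j, i)" "\<lambda>(n, i). (i, n - i)"]) auto
 also have "\<dots> = (\<Sum>(i, j)\<in>{..<N} \<times> {..<N}. a i * b j * g (i + j))"
  by (rule sum.mono_neutral_left) (auto intro!: assms)
 also have "\<dots> = (\<Sum>i<N. \<Sum>j<N. a i * b j * g (i + j))" by (rule sum.cartesian_product[symmetric])
 finally show ?thesis by simp
qed

lemma fpe_mult:
 assumes x: "x \<in> m" shows "fpe x f \<odot> fpe x g = fpe x (f * g)"
proof (rule Dual_eqI)
 fix h assume h: "h \<in> Dual"
 obtain N where N: "\<And>y. y \<in> mp N ==> h y = 0" using Dual_nilpotent[OF h] by blast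
 have Nh: "h y = 0" if "y \<in> mp k" "k \<ge> N" for y k using that N mp_mono by blast
 have 1: "h (y \<odot> fpe x g) = (\<Sum>j<N. fps_nth g j * h (y \<odot> epow x j))" if "y \<in> V" for y
 proof -
  have "h (y \<odot> fpe x g) = (\<Sum>j<N. h (y \<odot> (fps_nth g j \<cdot> epow x j)))"
   unfolding fpe_def
   by (rule csum_eval[OF fpe_summ[OF x] Dual_prdl[OF h]])
     (auto intro!: Nh mp_ideal mp_in epow_mp[OF x])
  thus ?thesis by (simp add: prd_lin Dual_lin[OF h])
 qed
 have "h (fpe x f \<odot> fpe x g) = (\<Sum>i<N. h ((fps_nth f i \<cdot> epow x i) \<odot> fpe x g))"
  unfolding fpe_def[of x f]
 proof (rule csum_eval[OF fpe_summ[OF x] Dual_prdr[OF h]])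
  fix k assume k: "k \<ge> N"
  have "h ((fps_nth f k \<cdot> epow x k) \<odot> fpe x g)
   = (\<Sum>j<N. fps_nth g j * h ((fps_nth f k \<cdot> epow x k) \<odot> epow x j))" by (rule 1) simp
  also have "\<dots> = (\<Sum>j<N. 0)"
  proof (rule sum.cong)
   fix j
   have "h (epow x (k + j)) = 0" using k by (intro Nh[OF epow_mp[OF x]]) simp
   thus "fps_nth g j * h ((fps_nth f k \<cdot> epow x k) \<odot> epow x j) = 0"
    by (simp add: prd_lin Dual_lin[OF h] epow_add)
  qed simp
  finally show "h ((fps_nth f k \<cdot> epow x k) \<odot> fpe x g) = 0" by simp
 qed
 also have "\<dots> = (\<Sum>i<N. fps_nth f i * (\<Sum>j<N. fps_nth g j * h (epow x (i + j))))"
  by (simp add: prd_lin Dual_lin[OF h] 1 epow_add)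
 also have "\<dots> = (\<Sum>i<N. \<Sum>j<N. fps_nth f i * fps_nth g j * h (epow x (i + j)))"
  by (simp add: sum_distrib_left mult.assoc)
 also have "\<dots> = (\<Sum>n<N. (\<Sum>i=0..n. fps_nth f i * fps_nth g (n - i)) * h (epow x n))"
  by (rule sum_triangle) (rule Nh[OF epow_mp[OF x]])
 also have "\<dots> = (\<Sum>n<N. h (fps_nth (f * g) n \<cdot> epow x n))"
  by (simp add: fps_mult_nth Dual_lin[OF h])
 also have "\<dots> = h (fpe x (f * g))"
  unfolding fpe_def by (rule csum_eval[symmetric, OF fpe_summ[OF x] h])
   (auto intro!: Nh mp_in epow_mp[OF x])
 finally show "h (fpe x f \<odot> fpe x g) = h (fpe x (f * g))" .
qed (auto simp: fpe_V x)

lemma fpe_poly: "x \<in> m ==> fpe x (1 + fps_X) = e + x"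
proof (rule Dual_eqI)
 fix h assume x: "x \<in> m" and h: "h \<in> Dual"
 have "h (fpe x (1 + fps_X)) = (\<Sum>k<2. h (fps_nth (1 + fps_X) k \<cdot> epow x k))"
  unfolding fpe_def by (rule csum_eval[OF fpe_summ[OF x] h]) (auto simp: fps_X_def h)
 thus "h (fpe x (1 + fps_X)) = h (e + x)" using x by (simp add: eval_nat_numeral Dual_lin[OF h] pi_V m_V h)
qed (auto simp: fpe_V m_V)

lemma eps_fpe: "x \<in> m ==> \<epsilon> (fpe x f) = fps_nth f 0"
proof -
 assume x: "x \<in> m"
 have "\<epsilon> (fpe x f) = (\<Sum>k<1. \<epsilon> (fps_nth f k \<cdot> epow x k))"
  unfolding fpe_def
 proof (rule csum_eval[OF fpe_summ[OF x] eps_Dual])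
  fix k :: nat assume "k \<ge> 1"
  then obtain j where "k = Suc j" by (cases k) auto
  thus "\<epsilon> (fps_nth f k \<cdot> epow x k) = 0" using x by (simp add: eps_lin eps_prd m_def)
 qed
 thus ?thesis by (simp add: eps_lin)
qed

text \<open>After scaling, \<open>u = 1 + x\<close> with \<open>x\<close> in the maximal ideal, and the square root of \<open>1 + X\<close> among formal power series can be
evaluated at \<open>x\<close>.\<close>

lemma ex_sqrt:
 assumes u: "u \<in> H 0" "\<epsilon> u \<noteq> 0"
 obtains v where "v \<in> H 0" "v \<odot> v = u" "\<epsilon> v \<noteq> 0"
proof -
 obtain c where c: "c ^ 2 = \<epsilon> u" using nth_root_exists[of 2 "\<epsilon> u"] by auto
 have c0: "c \<noteq> 0" using c u by auto
 define n where "n = inverse (\<epsilon> u) \<cdot> u - e"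
 have uV: "u \<in> V" by (rule H_V[OF u(1)])
 have n: "n \<in> m" using u uV by (auto simp: n_def m_def eps_lin)
 define b where "b = fps_binomial (1/2 :: 'k)"
 have "b * b = 1 + fps_X" unfolding b_def
  using fps_binomial_add_mult[of "1/2 :: 'k" "1/2"] by (simp add: fps_binomial_1)
 define w where "w = c \<cdot> fpe n b"
 have "w \<odot> w = (c * c) \<cdot> (fpe n b \<odot> fpe n b)" by (simp add: w_def prd_lin)
 also have "fpe n b \<odot> fpe n b = e + n" using fpe_mult[OF n] fpe_poly[OF n] \<open>b * b = _\<close> by simp
 also have "(c * c) \<cdot> (e + n) = u" using c u(2) by (simp add: n_def power2_eq_square)
 finally have ww: "w \<odot> w = u" .
 have wV: "w \<in> V" using fpe_V[OF n] by (simp add: w_def)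
 have ew: "\<epsilon> w = c" by (simp add: w_def eps_lin eps_fpe[OF n] b_def)
 \<comment> \<open>\<open>w\<close> is even: the odd part \<open>o\<close> of \<open>w\<close> satisfies \<open>w\<^sub>0 o + w\<^sub>0 o = 0\<close>.\<close>
 have "P1 (w \<odot> w) = P0 w \<odot> P1 w + P0 w \<odot> P1 w"
 proof -
  have "w \<odot> w = (P0 w + P1 w) \<odot> (P0 w + P1 w)" using V_decomp[OF wV] by simp
  also have "\<dots> = P0 w \<odot> P0 w + P1 w \<odot> P1 w + (P0 w \<odot> P1 w + P0 w \<odot> P1 w)"
   using comm_0[of w "P1 w"] by (simp add: prd_lin)
  finally have w: "w \<odot> w = P0 w \<odot> P0 w + P1 w \<odot> P1 w + (P0 w \<odot> P1 w + P0 w \<odot> P1 w)" .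
  have "P1 (P0 w \<odot> P0 w) = 0" "P1 (P1 w \<odot> P1 w) = 0" "P1 (P0 w \<odot> P1 w) = P0 w \<odot> P1 w"
   using prd_00[of w w] prd_11[of w w] prd_01[of w w] P10 by metis+
  thus ?thesis unfolding w by (simp add: Plin)
 qed
 moreover have "P1 u = 0" using H_comps[OF u(1)] by simp
 ultimately have "P0 w \<odot> P1 w = 0" using ww two_zero by metis
 hence "P1 w = 0" using cancel_unit[of "P0 w" "P1 w"] ew c0 by simp
 hence "w \<in> H 0" using V_decomp[OF wV] by (simp add: H_def)
 thus thesis using that ww ew c0 by auto
qed

end

context lgp
begin

subsection \<open>Integration along a variable\<close>

lemma mp_ideal_r: "x \<in> mp k ==> x \<odot> y \<in> mp k"
proof -
 assume x: "x \<in> mp k"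
 have "x \<odot> y = x \<odot> P0 y + x \<odot> P1 y" by (metis prd_pi(2) pi_def prd_addr)
 also have "x \<odot> P0 y = P0 y \<odot> x" by (metis comm_0)
 also have "x \<odot> P1 y = P1 y \<odot> tw 1 x"
  using comm_tw[of "P1 y" 1 "tw 1 x"] by (simp add: prd_tw_l)
 finally show ?thesis using mp_in(2) mp_ideal mp_tw x by simp
qed

lemma pow_V: "cop M ==> a \<in> V ==> (M ^^ k) a \<in> V"
 by (cases k) (auto simp: cop_V)

lemma csum_closed:
 assumes "summ a" "h \<in> Dual" "\<And>k. h (a k) = 0" shows "h (csum a) = 0"
 using csum_eval[OF assms(1,2), of 0] assms(3) by simp

text \<open>If \<open>[M, x] = 1\<close>, then \<open>a \<mapsto> \<Sum>\<^sub>k (-1)\<^sup>k x\<^sup>k\<^sup>+\<^sup>1 M\<^sup>k a / (k+1)!\<close> is a right inverse of \<open>M\<close>: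
 iterated integration by parts.\<close>

definition Jt :: "('v => 'v) => 'v => 'v => nat => 'v" where
 "Jt M x a k = ((-1) ^ k / fact (Suc k)) \<cdot> (epow x k \<odot> (M ^^ k) a)"
definition Jq where "Jq M x a = csum (Jt M x a)"

lemma Jt_summ: "x \<in> m ==> summ (Jt M x a)"
 unfolding Jt_def by (intro summ_mp mp_in mp_ideal_r epow_mp)

lemma Jq_V: "x \<in> m ==> Jq M x a \<in> V"
 unfolding Jq_def by (rule csum_props[OF Jt_summ])

lemma commutator_epow:
 assumes M: "cop M" and c: "\<And>b. b \<in> V ==> M (x \<odot> b) = b + x \<odot> M b" and b: "b \<in> V"
 shows "M (epow x (Suc k) \<odot> b) = of_nat (Suc k) \<cdot> (epow x k \<odot> b) + epow x (Suc k) \<odot> M b"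
proof (induction k)
 case 0
 show ?case using c[OF b] by (simp add: assoc pi_V b cop_V[OF M])
next
 case (Suc k)
 have "M (epow x (Suc (Suc k)) \<odot> b) = M (x \<odot> (epow x (Suc k) \<odot> b))" by (simp add: assoc)
 also have "\<dots> = epow x (Suc k) \<odot> b + x \<odot> M (epow x (Suc k) \<odot> b)" by (rule c) simp
 also have "\<dots> = (1 + of_nat (Suc k)) \<cdot> (epow x (Suc k) \<odot> b) + epow x (Suc (Suc k)) \<odot> M b"
  unfolding Suc.IH scale_left_distrib by (simp add: prd_lin assoc del: of_nat_Suc)
 also have "1 + of_nat (Suc k) = (of_nat (Suc (Suc k)) :: 'k)" by simp
 finally show ?case .
qed

lemma integration:
 assumes M: "cop M" and x: "x \<in> m" and c: "\<And>b. b \<in> V ==> M (x \<odot> b) = b + x \<odot> M b"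
  and a: "a \<in> V"
 shows "M (x \<odot> Jq M x a) = a"
proof -
 define u where "u k = ((-1) ^ k / fact k) \<cdot> (epow x k \<odot> (M ^^ k) a)" for k
 have su: "summ u" unfolding u_def by (intro summ_mp mp_in mp_ideal_r epow_mp x)
 have "M (x \<odot> Jq M x a) = csum (\<lambda>k. M (x \<odot> Jt M x a k))"
  unfolding Jq_def by (rule csum_cop[OF Jt_summ[OF x] cop_comp[OF M cop_prdl]])
 also have "(\<lambda>k. M (x \<odot> Jt M x a k)) = (\<lambda>k. u k - u (Suc k))"
 proof
  fix k
  have "M (x \<odot> Jt M x a k) = ((-1) ^ k / fact (Suc k)) \<cdot> M (epow x (Suc k) \<odot> (M ^^ k) a)"
   by (simp add: Jt_def prd_lin cop_scale[OF M] assoc del: fact_Suc)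
  also have "\<dots> = ((-1) ^ k / fact (Suc k)) \<cdot> (of_nat (Suc k) \<cdot> (epow x k \<odot> (M ^^ k) a))
    + ((-1) ^ k / fact (Suc k)) \<cdot> (epow x (Suc k) \<odot> (M ^^ Suc k) a)"
  proof -
   have "M (epow x (Suc k) \<odot> (M ^^ k) a) = of_nat (Suc k) \<cdot> (epow x k \<odot> (M ^^ k) a)
     + epow x (Suc k) \<odot> M ((M ^^ k) a)"
    by (rule commutator_epow[OF M c pow_V[OF M a]])
   thus ?thesis by (simp add: scale_right_distrib del: fact_Suc of_nat_Suc epow.simps)
  qed
  also have "((-1) ^ k / fact (Suc k)) \<cdot> (of_nat (Suc k) \<cdot> (epow x k \<odot> (M ^^ k) a)) = u k"
  proof -
   have "((-1) ^ k / fact (Suc k)) * of_nat (Suc k) = ((-1) ^ k / fact k :: 'k)"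
    by (simp add: fact_Suc divide_simps del: of_nat_Suc)
   thus ?thesis by (simp add: u_def)
  qed
  also have "((-1) ^ k / fact (Suc k)) \<cdot> (epow x (Suc k) \<odot> (M ^^ Suc k) a) = - u (Suc k)"
   by (simp add: u_def del: fact_Suc epow.simps)
  finally show "M (x \<odot> Jt M x a k) = u k - u (Suc k)" by simp
 qed
 also have "csum \<dots> = u 0" by (rule csum_telescope[OF su]) (simp add: u_def)
 finally show ?thesis using a by (simp add: u_def pi_V)
qed

lemma Jq_closed:
 assumes x: "x \<in> m" and h: "h \<in> Dual" and "\<And>k. h (epow x k \<odot> (M ^^ k) a) = 0"
 shows "h (Jq M x a) = 0"
 unfolding Jq_def by (rule csum_closed[OF Jt_summ[OF x] h]) (simp add: Jt_def Dual_lin[OF h] assms(3))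

lemma Jq_kernel:
 assumes x: "x \<in> m" and N: "cop N" and z: "\<And>k. N (epow x (Suc k) \<odot> (M ^^ k) a) = 0"
 shows "N (x \<odot> Jq M x a) = 0"
proof -
 have "N (x \<odot> Jq M x a) = csum (\<lambda>k. N (x \<odot> Jt M x a k))"
  unfolding Jq_def by (rule csum_cop[OF Jt_summ[OF x] cop_comp[OF N cop_prdl]])
 also have "(\<lambda>k. N (x \<odot> Jt M x a k)) = (\<lambda>k. 0)"
  using z by (simp add: Jt_def prd_lin cop_lin[OF N] assoc fun_eq_iff)
 finally show ?thesis by (simp add: csum_zero)
qed

subsection \<open>Frames\<close>

text \<open>Coordinates with dual derivations at the level of operators: \<open>[M\<^sub>i, y\<^sub>j] = \<delta>\<^sub>i\<^sub>j\<close> and \<open>[M\<^sub>i, M\<^sub>j] = 0\<close> in the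
graded sense. The operators need not be derivations, since the proof of \<open>casimir\<close> uses frames of first
order operators that do not annihilate the unit.\<close>

definition frame :: "nat => (nat => nat) => (nat => 'v) => (nat => 'v => 'v) => bool" where
 "frame r pr y M \<longleftrightarrow>
   (\<forall>i<r. y i \<in> m \<and> y i \<in> H (pr i) \<and> cop (M i)) \<and>
   (\<forall>i<r. \<forall>j<r. \<forall>b\<in>V. M i (y j \<odot> b) = (if i = j then b else 0) + ((-1) ^ (pr i * pr j)) \<cdot> (y j \<odot> M i b)) \<and>
   (\<forall>i<r. \<forall>j<r. \<forall>b\<in>V. M i (M j b) = ((-1) ^ (pr i * pr j)) \<cdot> M j (M i b))"

lemma frameD:
 assumes "frame r pr y M" "i < r"
 shows "y i \<in> m" "y i \<in> H (pr i)" "cop (M i)"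
  "j < r ==> b \<in> V ==> M i (y j \<odot> b) = (if i = j then b else 0) + ((-1) ^ (pr i * pr j)) \<cdot> (y j \<odot> M i b)"
  "j < r ==> b \<in> V ==> M i (M j b) = ((-1) ^ (pr i * pr j)) \<cdot> M j (M i b)"
 using assms unfolding frame_def by blast+

lemma frame_Suc: assumes "frame (Suc r) pr y M" shows "frame r pr y M"
 unfolding frame_def[of r]
 by (intro conjI allI impI ballI; (rule frameD[OF assms]; simp)?)

lemma minus_one_cases: "((-1) ^ n :: 'k) = (if even n then 1 else -1)" by simp

lemma frame_decomp_aux:
 assumes F: "frame (Suc r) pr y M" and \<Psi>: "\<Psi> \<subseteq> Dual"
  and Z: "Z = {a\<in>V. \<forall>h\<in>\<Psi>. h a = 0}"
  and st: "\<And>b. b \<in> Z ==> M r b \<in> Z \<and> y r \<odot> b \<in> Z"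
  and c: "c \<in> Z" "\<And>i. i < r ==> M i c = 0"
 shows "\<exists>q\<in>Z. c - y r \<odot> q \<in> Z \<and> (\<forall>i<Suc r. M i (c - y r \<odot> q) = 0)"
proof -
 note y = frameD(1,2)[OF F, of r, simplified]
 note cM = frameD(3)[OF F]
 have cV: "c \<in> V" using c Z by simp
 show ?thesis
 proof (cases "even (pr r)")
  case True
  have x: "y r \<in> m" by (rule y)
  let ?q = "Jq (M r) (y r) (M r c)"
  have cc: "M r (y r \<odot> b) = b + y r \<odot> M r b" if "b \<in> V" for b
   using frameD(4)[OF F, of r r b] that True by simp
  have ep: "epow (y r) k \<odot> b \<in> Z" if "b \<in> Z" for b k
   using that st by (induction k) (auto simp: Z assoc Dual_pi' subset_eq \<Psi>[THEN subsetD])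
  have pw: "(M r ^^ k) (M r c) \<in> Z" for k using st c(1) by (induction k) auto
  have qZ: "?q \<in> Z"
   unfolding Z
  proof (intro CollectI conjI ballI)
   show "?q \<in> V" by (rule Jq_V[OF x])
   fix h assume h: "h \<in> \<Psi>"
   show "h ?q = 0"
    by (rule Jq_closed[OF x]) (use h \<Psi> ep[OF pw] Z in auto)
  qed
  have r0: "M r (c - y r \<odot> ?q) = 0"
   using integration[OF cM[of r] x cc, of "M r c"] by (simp add: cop_lin[OF cM[of r]] cop_V[OF cM[of r]])
  have i0: "M i (c - y r \<odot> ?q) = 0" if i: "i < r" for i
  proof -
   have iS: "i < Suc r" using i by simp
   have p: "M i ((M r ^^ k) (M r c)) = 0" for k
   proof (induction k)
    case 0 show ?case using frameD(5)[OF F iS, of r c] c(2)[OF i] cV by (simp add: cop_lin[OF cM[of r]])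
   next
    case (Suc k)
    have "(M r ^^ k) (M r c) \<in> V" using pow_V[OF cM[of r]] cop_V[OF cM[of r]] by simp
    thus ?case using frameD(5)[OF F iS, of r "(M r ^^ k) (M r c)"] Suc by (simp add: cop_lin[OF cM[of r]])
   qed
   have e: "M i (epow (y r) k \<odot> b) = 0" if b: "M i b = 0" "b \<in> V" for b k
   proof (induction k)
    case 0 thus ?case using b by (simp add: pi_V)
   next
    case (Suc k)
    show ?case using frameD(4)[OF F iS, of r "epow (y r) k \<odot> b"] Suc i by (simp add: assoc)
   qed
   have "M i (y r \<odot> ?q) = 0"
    by (rule Jq_kernel[OF x cM[OF iS]]) (rule e[OF p], simp add: pow_V cM cop_V)
   thus ?thesis using c(2)[OF i] by (simp add: cop_lin[OF cM[OF iS]])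
  qed
  show ?thesis
  proof (intro bexI[OF _ qZ] conjI allI impI)
   show "c - y r \<odot> ?q \<in> Z" using st[OF qZ] c(1) \<Psi> by (auto simp: Z Dual_lin subset_eq)
   fix i assume "i < Suc r"
   thus "M i (c - y r \<odot> ?q) = 0" using r0 i0 by (cases "i = r") auto
  qed
 next
  case False
  let ?q = "M r c"
  have qZ: "?q \<in> Z" using st c by blast
  have qV: "?q \<in> V" using qZ Z by simp
  have "M r ?q = - M r ?q"
   using frameD(5)[OF F, of r r c] cV False by simp
  hence MM: "M r ?q = 0" using two_zero by (metis add.right_inverse)
  have r0: "M r (c - y r \<odot> ?q) = 0"
   using frameD(4)[OF F, of r r ?q] qV MM by (simp add: cop_lin[OF cM[of r]])
  have i0: "M i (c - y r \<odot> ?q) = 0" if i: "i < r" for i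
  proof -
   have iS: "i < Suc r" using i by simp
   have "M i ?q = 0" using frameD(5)[OF F iS, of r c] cV c(2)[OF i] by (simp add: cop_lin[OF cM[of r]])
   thus ?thesis using frameD(4)[OF F iS, of r ?q] qV c(2)[OF i] i by (simp add: cop_lin[OF cM[OF iS]])
  qed
  show ?thesis
  proof (intro bexI[OF _ qZ] conjI allI impI)
   show "c - y r \<odot> ?q \<in> Z" using st[OF qZ] c(1) \<Psi> by (auto simp: Z Dual_lin subset_eq)
   fix i assume "i < Suc r"
   thus "M i (c - y r \<odot> ?q) = 0" using r0 i0 by (cases "i = r") auto
  qed
 qed
qed

text \<open>Splitting off a kernel element of all \<open>M\<^sub>i\<close>, one variable at a time: subtracting \<open>y\<^sub>i\<close> times an integral of \<open>M\<^sub>i a\<close>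
kills \<open>M\<^sub>i a\<close>. The version with a closed subspace \<open>Z\<close> that is stable under the \<open>y\<^sub>i\<close> and the \<open>M\<^sub>i\<close> is what shows
the injectivity of Taylor expansion.\<close>

lemma frame_decomp:
 assumes "frame r pr y M" "\<Psi> \<subseteq> Dual" "Z = {a\<in>V. \<forall>h\<in>\<Psi>. h a = 0}"
  and "\<And>i b. i < r ==> b \<in> Z ==> M i b \<in> Z \<and> y i \<odot> b \<in> Z" and "a \<in> Z"
 shows "\<exists>c\<in>Z. \<exists>f. (\<forall>i<r. M i c = 0 \<and> f i \<in> Z) \<and> a = c + (\<Sum>i<r. y i \<odot> f i)"
 using assms
proof (induction r)
 case 0
 thus ?case by auto
next
 case (Suc r)
 have "\<exists>c\<in>Z. \<exists>f. (\<forall>i<r. M i c = 0 \<and> f i \<in> Z) \<and> a = c + (\<Sum>i<r. y i \<odot> f i)"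
  by (rule Suc.IH) (use Suc.prems frame_Suc in auto)
 then obtain c f where c: "c \<in> Z" "\<And>i. i < r ==> M i c = 0" "\<And>i. i < r ==> f i \<in> Z"
  "a = c + (\<Sum>i<r. y i \<odot> f i)" by blast
 have "\<exists>q\<in>Z. c - y r \<odot> q \<in> Z \<and> (\<forall>i<Suc r. M i (c - y r \<odot> q) = 0)"
  by (rule frame_decomp_aux[OF Suc.prems(1,2,3) _ c(1,2)]) (use Suc.prems(4) in auto)
 then obtain q where q: "q \<in> Z" "c - y r \<odot> q \<in> Z" "\<forall>i<Suc r. M i (c - y r \<odot> q) = 0" by blast
 have "a = (c - y r \<odot> q) + (\<Sum>i<Suc r. y i \<odot> (f(r := q)) i)"
  using c(4) by simp
 moreover have "\<forall>i<Suc r. M i (c - y r \<odot> q) = 0 \<and> (f(r := q)) i \<in> Z"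
  using q c(3) by (auto simp: less_Suc_eq)
 ultimately show ?case using q(2) by blast
qed

lemma frame_decomp_V:
 assumes "frame r pr y M" "a \<in> V"
 obtains c f where "c \<in> V" "\<And>i. i < r ==> M i c = 0" "\<And>i. i < r ==> f i \<in> V"
  "a = c + (\<Sum>i<r. y i \<odot> f i)"
proof -
 have "\<exists>c\<in>V. \<exists>f. (\<forall>i<r. M i c = 0 \<and> f i \<in> V) \<and> a = c + (\<Sum>i<r. y i \<odot> f i)"
  by (rule frame_decomp[OF assms(1), of "{}"]) (use assms frameD(3) cop_V in auto)
 thus thesis using that by metis
qed

text \<open>By continuity of the bracket, \<open>\<epsilon>{F, y}\<close> depends on \<open>F\<close> only through finitely many functionals. This is the
bound that makes both elimination procedures below terminate.\<close>

lemma rank_bound: "\<exists>N::nat. \<forall>r F y. (\<forall>i<r. \<forall>j<r. \<epsilon> (br (F i) (y j)) = (if i = j then 1 else 0)) \<longrightarrow> r \<le> N"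
proof -
 obtain \<Phi> where P: "finite \<Phi>" "\<Phi> \<subseteq> Dual" "\<And>x y. (\<forall>f\<in>\<Phi>. f x = 0) ==> \<epsilon> (br x y) = 0"
  using br_fin[OF eps_Dual] by auto
 have B: "r \<le> card \<Phi>" if *: "\<And>i j. i < r ==> j < r ==> \<epsilon> (br (F i) (y j)) = (if i = j then 1 else 0)" for r and F y :: "nat => 'v"
 proof (rule ccontr)
  assume "\<not> r \<le> card \<Phi>"
  have "\<exists>c. (\<exists>i\<in>{..<r}. c i \<noteq> 0) \<and> (\<forall>g\<in>(\<lambda>f i. f (F i)) ` \<Phi>. (\<Sum>i\<in>{..<r}. c i * g i) = 0)"
  proof (rule underdetermined_system)
   show "card ((\<lambda>f i. f (F i)) ` \<Phi>) < card {..<r}"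
    using card_image_le[OF P(1), of "\<lambda>f i. f (F i)"] \<open>\<not> r \<le> card \<Phi>\<close> by simp
  qed (use P in auto)
  then obtain c i where c: "i < r" "c i \<noteq> 0" "\<And>f. f \<in> \<Phi> ==> (\<Sum>i<r. c i * f (F i)) = 0" by auto
  have "f (\<Sum>i<r. c i \<cdot> F i) = 0" if "f \<in> \<Phi>" for f
  proof -
   have "f \<in> Dual" using that P(2) by blast
   thus ?thesis using c(3)[OF that] by (simp add: Dual_lin)
  qed
  hence "\<epsilon> (br (\<Sum>k<r. c k \<cdot> F k) (y i)) = 0" using P(3) by blast
  also have "\<epsilon> (br (\<Sum>k<r. c k \<cdot> F k) (y i)) = (\<Sum>k<r. c k * (if k = i then 1 else 0))"
   unfolding br_sum br_lin eps_lin by (rule sum.cong) (use *[OF _ c(1)] in auto)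
  also have "\<dots> = (\<Sum>k<r. if k = i then c k else 0)" by (rule sum.cong) auto
  also have "\<dots> = c i" using c(1) by simp
  finally show False using c(2) by simp
 qed
 show ?thesis
 proof (intro exI[of _ "card \<Phi>"] allI impI)
  fix r :: nat and F :: "nat => 'v" and y :: "nat => 'v"
  assume "\<forall>i<r. \<forall>j<r. \<epsilon> (br (F i) (y j)) = (if i = j then 1 else 0)"
  thus "r \<le> card \<Phi>" using B[where F = F and y = y] by simp
 qed
qed

subsection \<open>Gauge transformations\<close>

lemma even_inv:
 assumes "f \<in> H 0" "g \<odot> f = e" "g \<in> H 0" "x \<in> V"
 shows "f \<odot> (g \<odot> x) = x" "g \<odot> (f \<odot> x) = x"
proof -
 have "f \<odot> g = e" using comm_e[OF assms(1), of g] assms(2) by simp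
 thus "f \<odot> (g \<odot> x) = x" using assms(4) by (simp add: pi_V flip: assoc)
 show "g \<odot> (f \<odot> x) = x" using assms(2,4) by (simp add: pi_V flip: assoc)
qed

lemma even_left_commute: "f \<in> H 0 ==> x \<odot> (f \<odot> y) = f \<odot> (x \<odot> y)"
 by (metis assoc comm_e)

lemma gauge_leibniz:
 assumes f: "f \<in> H 0" and g: "g \<in> H 0" and gf: "g \<odot> f = e" and x: "x \<in> H p"
 shows "g \<odot> br (f \<odot> x) (f \<odot> (y \<odot> z)) = g \<odot> br (f \<odot> x) (f \<odot> y) \<odot> z
  + tw p y \<odot> (g \<odot> br (f \<odot> x) (f \<odot> z)) + g \<odot> br (f \<odot> e) (f \<odot> x) \<odot> (y \<odot> z)"
proof -
 let ?w = "f \<odot> x"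
 have w: "?w \<in> H p" using prd_H[OF f x] by simp
 have b: "br ?w u = X ?w u - D ?w \<odot> u" for u by (simp add: X_def)
 have twf: "tw p f = f" using tw_HH[OF f, of p] by simp
 have Xf: "X ?w (f \<odot> u) = X ?w f \<odot> u + f \<odot> X ?w u" for u
  using X_deriv[OF w, of f u] tw_HH[OF f, of p] by simp
 have XfH: "X ?w f \<in> H p" using X_H[OF w f] by simp
 have DwH: "D ?w \<in> H p" by (rule D_H[OF w])
 have m1: "tw p y \<odot> (X ?w f \<odot> z) = X ?w f \<odot> (y \<odot> z)" using comm_tw[OF XfH, of y] by (metis assoc)
 have m2: "tw p y \<odot> (D ?w \<odot> z) = D ?w \<odot> (y \<odot> z)" using comm_tw[OF DwH, of y] by (metis assoc)
 have s1: "br ?w (f \<odot> (y \<odot> z)) = X ?w f \<odot> (y \<odot> z) + f \<odot> (X ?w y \<odot> z) + f \<odot> (tw p y \<odot> X ?w z) - D ?w \<odot> (f \<odot> (y \<odot> z))"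
  by (simp add: b Xf X_deriv[OF w] prd_lin twf)
 have s2: "br ?w (f \<odot> y) \<odot> z = X ?w f \<odot> (y \<odot> z) + f \<odot> (X ?w y \<odot> z) - D ?w \<odot> (f \<odot> (y \<odot> z))"
  by (simp add: b Xf prd_lin assoc)
 have s3: "tw p y \<odot> br ?w (f \<odot> z) = X ?w f \<odot> (y \<odot> z) + f \<odot> (tw p y \<odot> X ?w z) - D ?w \<odot> (f \<odot> (y \<odot> z))"
  by (simp add: b Xf prd_lin m1 m2 even_left_commute[OF f])
 have s4: "br f ?w = - X ?w f + D ?w \<odot> f"
 proof -
  have "- br f ?w = X ?w f - D ?w \<odot> f" using br_skew[OF w, of f] twf by (simp add: b)
  from arg_cong[OF this, of uminus] show ?thesis by simp
 qed
 have "br ?w (f \<odot> (y \<odot> z)) = br ?w (f \<odot> y) \<odot> z + tw p y \<odot> br ?w (f \<odot> z) + br f ?w \<odot> (y \<odot> z)"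
  unfolding s1 s2 s3 s4 by (simp add: prd_lin assoc)
 hence "g \<odot> br ?w (f \<odot> (y \<odot> z)) = g \<odot> br ?w (f \<odot> y) \<odot> z + tw p y \<odot> (g \<odot> br ?w (f \<odot> z)) + g \<odot> br f ?w \<odot> (y \<odot> z)"
  by (simp add: prd_lin assoc even_left_commute[OF g])
 moreover have "br (f \<odot> e) ?w = br f ?w" by (simp add: br_pil)
 ultimately show ?thesis by simp
qed

definition gauge :: "'v => 'v => 'v => 'v => 'v" where
 "gauge f g x y = g \<odot> br (f \<odot> x) (f \<odot> y)"

text \<open>Gauge transformations preserve everything, in particular simplicity: the ideals are the same because the
gauge factor is invertible.\<close>

lemma gauge_lgp:
 assumes f: "f \<in> H 0" and g: "g \<in> H 0" and gf: "g \<odot> f = e"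
 shows "lgp scale P0 P1 prd e Dual (gauge f g) \<epsilon>"
proof -
 have ff: "f \<odot> (g \<odot> x) = x" if "x \<in> V" for x by (rule even_inv[OF f gf g that])
 have gg: "g \<odot> (f \<odot> x) = x" if "x \<in> V" for x by (rule even_inv[OF f gf g that])
 have twf: "tw p f = f" "tw p g = g" for p using tw_HH[OF f, of p] tw_HH[OF g, of p] by auto
 have fx: "f \<odot> x \<in> H p" "g \<odot> x \<in> H p" if "x \<in> H p" for x p using prd_H[OF f that] prd_H[OF g that] by auto
 show ?thesis
 proof (unfold_locales, goal_cases)
  case 1 show ?case by (simp add: gauge_def prd_lin br_lin)
 next case 2 show ?case by (simp add: gauge_def prd_lin br_lin)
 next case 3 show ?case by (simp add: gauge_def prd_lin br_lin)
 next case 4 show ?case by (simp add: gauge_def prd_lin br_lin)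
 next case 5 show ?case by (simp add: gauge_def)
 next case 6 show ?case by (simp add: gauge_def)
 next case (7 x p y q)
  show ?case using fx(2)[OF br_H[OF fx(1)[OF 7(1)] fx(1)[OF 7(2)]]] by (simp add: gauge_def)
 next case (8 x p y)
  show ?case using br_skew[OF fx(1)[OF 8], of "f \<odot> y"] by (simp add: gauge_def tw_prd twf prd_lin)
 next case (9 x p y z)
  show ?case using br_jacobi[OF fx(1)[OF 9], of "f \<odot> y" "f \<odot> z"]
   by (simp add: gauge_def tw_prd twf ff prd_lin)
 next case (10 x p y z)
  show ?case using gauge_leibniz[OF f g gf 10, of y z] by (simp add: gauge_def)
 next case (11 h a)
  have "cop (\<lambda>x. g \<odot> br (f \<odot> a) (f \<odot> x))"
   by (intro cop_mult cop_comp[OF cop_br cop_prdl])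
  thus ?case using 11 by (simp add: gauge_def cop_def)
 next case (12 h)
  obtain \<Phi> where P: "finite \<Phi>" "\<Phi> \<subseteq> Dual" "\<And>x y. (\<forall>f\<in>\<Phi>. f x = 0) ==> h (g \<odot> br x y) = 0"
   using br_fin[OF Dual_prdl[OF 12, of g]] by auto
  show ?case
  proof (intro exI conjI allI impI)
   show "finite ((\<lambda>h x. h (f \<odot> x)) ` \<Phi>)" using P by simp
   show "(\<lambda>h x. h (f \<odot> x)) ` \<Phi> \<subseteq> Dual" using P Dual_prdl by auto
   show "h (gauge f g x y) = 0" if "\<forall>k\<in>(\<lambda>h x. h (f \<odot> x)) ` \<Phi>. k x = 0" for x y
    unfolding gauge_def by (rule P(3)) (use that in auto)
  qed
 next case (13 I)
  show ?case
  proof (rule simple[OF 13(1,2,3,4)])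
   fix a x assume x: "x \<in> I"
   have "br a x = f \<odot> gauge f g (g \<odot> a) (g \<odot> x)"
    using comm_e[OF f, of g] gf by (simp add: gauge_def ff br_pil br_pir pi_V flip: assoc)
   thus "br a x \<in> I" using 13(4,5) x by simp
  qed
 next case 14 show ?case by (rule eps_Dual)
 next case 15 show ?case by simp
 next case 16 show ?case by (rule eps_prd)
 next case 17 show ?case by simp
 qed
qed

end

context lgp
begin

section \<open>A Casimir element when the derivation vanishes at the origin\<close>

text \<open>The operators \<open>Y a\<close> and \<open>D\<close> generate, under multiplication by elements, a module \<open>Op\<close> of first order operators that is closed
under graded commutators. It is a Lie algebroid: \<open>sy\<close> is the symbol (anchor), a derivation, and \<open>sc\<close> is the
bracket. The aim is an element killed by all of \<open>Op\<close>.\<close>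

definition Y where "Y a x = a \<odot> D x - br a x"

inductive Op :: "nat => ('v => 'v) => bool" where
 OpY: "a \<in> H p ==> Op p (Y a)"
| OpD: "Op 0 D"
| Op_add: "Op p M ==> Op p N ==> Op p (\<lambda>x. M x + N x)"
| Op_mul: "f \<in> H q ==> Op p M ==> Op (q + p) (\<lambda>x. f \<odot> M x)"
| Op_cong: "Op p M ==> even p = even q ==> Op q M"

definition sy :: "nat => ('v => 'v) => 'v => 'v" where "sy p M a = M a - tw p a \<odot> M e"

lemma Y_V [simp]: "Y a x \<in> V" by (simp add: Y_def)
lemma cop_Y: "cop (Y a)" unfolding Y_def[abs_def] by (intro cop_minus' cop_mult cop_D cop_br)

lemma Op_cop: "Op p M ==> cop M"
 by (induction rule: Op.induct) (auto intro: cop_Y cop_D cop_plus cop_mult)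

lemma Op_H: "Op p M ==> b \<in> H q ==> M b \<in> H (p + q)"
proof (induction arbitrary: b q rule: Op.induct)
 case (OpY a p) thus ?case unfolding Y_def by (intro H_in prd_H br_H D_H)
next case OpD thus ?case by (simp add: D_H)
next case Op_add thus ?case by (simp add: H_in)
next case (Op_mul f q' p M) thus ?case using prd_H by (metis add.assoc)
next case (Op_cong p M q') thus ?case using H_cong[of "p + q" "q' + q"] by auto
qed

lemma prd_tw_tw: "tw p (tw q x) \<odot> y = tw (p + q) x \<odot> y" "y \<odot> tw p (tw q x) = y \<odot> tw (p + q) x"
 by (simp_all add: tw_def)

lemma Op_leibniz: "Op p M ==> M (a \<odot> b) = sy p M a \<odot> b + tw p a \<odot> M b"
proof (induction arbitrary: a b rule: Op.induct)
 case (OpY f p)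
 have Ye: "Y f e = D f" by (simp add: Y_def br_ee br_e H_V[OF OpY])
 have c1: "tw p a \<odot> (D f \<odot> b) = D f \<odot> (a \<odot> b)" using comm_tw[OF D_H[OF OpY], of a] by (metis assoc)
 have c2: "tw p a \<odot> (f \<odot> D b) = f \<odot> (a \<odot> D b)" using comm_tw[OF OpY, of a] by (metis assoc)
 show ?case unfolding sy_def Ye
  by (simp add: Y_def prd_lin assoc c1 c2 D_deriv br_leibniz[OF OpY] flip: D_def)
next case OpD thus ?case by (simp add: sy_def br_ee D_deriv tw_def)
next case (Op_add p M N)
 show ?case unfolding Op_add.IH(1)[of a b] Op_add.IH(2)[of a b] by (simp add: sy_def prd_lin algebra_simps)
next case (Op_mul f q p M)
 have c: "tw (q + p) a \<odot> (f \<odot> z) = f \<odot> (tw p a \<odot> z)" for z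
  using comm_tw[OF Op_mul(1), of "tw p a"] by (metis assoc prd_tw_tw(1))
 show ?case using Op_mul.IH by (simp add: sy_def prd_lin assoc c)
next case (Op_cong p M q) thus ?case using tw_cong[of p q] by (simp add: sy_def)
qed

lemma Op_tw: "Op p M ==> b \<in> V ==> tw q (M b) = ((-1) ^ (p * q)) \<cdot> M (tw q b)"
proof -
 assume M: "Op p M" and b: "b \<in> V"
 note l = cop_lin[OF Op_cop[OF M]]
 have "tw q (M (P0 b)) = ((-1) ^ (p * q)) \<cdot> M (tw q (P0 b))"
  using tw_HH[OF Op_H[OF M, of "P0 b" 0], of q] by (simp add: tw_HH[of "P0 b" 0])
 moreover have "tw q (M (P1 b)) = ((-1) ^ (p * q)) \<cdot> M (tw q (P1 b))"
  using tw_HH[OF Op_H[OF M, of "P1 b" 1], of q] by (simp add: tw_HH[of "P1 b" 1] l)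
 ultimately have "tw q (M (P0 b + P1 b)) = ((-1) ^ (p * q)) \<cdot> M (tw q (P0 b + P1 b))"
  by (simp add: l tw_lin scale_right_distrib)
 thus ?thesis using V_decomp[OF b] by simp
qed

lemma Op_scale: "Op p M ==> Op p (\<lambda>x. c \<cdot> M x)"
proof -
 assume M: "Op p M"
 have "c \<cdot> e \<in> H 0" by (intro H_in e_H)
 from Op_mul[OF this M] have "Op p (\<lambda>x. (c \<cdot> e) \<odot> M x)" by simp
 thus ?thesis by (simp add: prd_lin pi_V cop_V[OF Op_cop[OF M]])
qed

lemma Op_zero: "Op p (\<lambda>x. 0)"
 using Op_scale[OF OpY[OF H_in(1)], of p 0] by simp
lemma Op_diff: "Op p M ==> Op p N ==> Op p (\<lambda>x. M x - N x)"
 using Op_add[of p M "\<lambda>x. (-1) \<cdot> N x"] Op_scale[of p N "-1"] by simp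
lemma Op_sum: "(\<And>i. i \<in> A ==> Op p (M i)) ==> Op p (\<lambda>x. \<Sum>i\<in>A. M i x)"
 by (induction A rule: infinite_finite_induct) (auto intro: Op_add Op_zero)
lemma Op_mul': "f \<in> H q ==> Op p M ==> even r = even (q + p) ==> Op r (\<lambda>x. f \<odot> M x)"
 using Op_mul Op_cong by metis

definition sc :: "nat => ('v => 'v) => nat => ('v => 'v) => 'v => 'v" where
 "sc p M q N x = M (N x) - ((-1) ^ (p * q)) \<cdot> N (M x)"

lemma sy_H: "Op q N ==> f \<in> H r ==> sy q N f \<in> H (r + q)"
 unfolding sy_def using Op_H[of q N f r] prd_H[OF tw_H[of f r q], of "N e" q] Op_H[of q N e 0]
 by (auto intro!: H_in simp: add.commute)

lemma sc_induct:
 assumes N: "Op q N"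
  and base: "\<And>a p. a \<in> H p ==> Op (p + q) (sc p (Y a) q N)" "Op q (sc 0 D q N)"
  and M: "Op p M"
 shows "Op (p + q) (sc p M q N)"
 using M
proof (induction rule: Op.induct)
 case (OpY a p) thus ?case by (rule base)
next case OpD thus ?case using base(2) by simp
next case (Op_add p M M')
 have "sc p (\<lambda>x. M x + M' x) q N = (\<lambda>x. sc p M q N x + sc p M' q N x)"
  by (simp add: sc_def fun_eq_iff cop_add[OF Op_cop[OF N]] scale_right_distrib)
 thus ?case using Op.Op_add[OF Op_add.IH] by simp
next case (Op_mul f r p M)
 have s: "tw q f = ((-1) ^ (r * q)) \<cdot> f" using tw_HH[OF Op_mul(1), of q] by auto
 have "sc (r + p) (\<lambda>x. f \<odot> M x) q N x = f \<odot> sc p M q N x - ((-1) ^ ((r + p) * q)) \<cdot> (sy q N f \<odot> M x)" for x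
 proof -
  have "((-1) ^ ((r + p) * q)) * ((-1) ^ (r * q)) = ((-1) ^ (p * q) :: 'k)"
   by (simp add: minus_one_cases)
  thus ?thesis by (simp add: sc_def Op_leibniz[OF N] s prd_lin scale_right_distrib scale_right_diff_distrib)
 qed
 hence "sc (r + p) (\<lambda>x. f \<odot> M x) q N = (\<lambda>x. f \<odot> sc p M q N x - ((-1) ^ ((r + p) * q)) \<cdot> (sy q N f \<odot> M x))" by blast
 moreover have "Op (r + p + q) (\<lambda>x. f \<odot> sc p M q N x)"
  using Op.Op_mul[OF Op_mul(1) Op_mul.IH] by (simp add: add.assoc)
 moreover have "Op (r + p + q) (\<lambda>x. sy q N f \<odot> M x)"
  using sy_H[OF N Op_mul(1)] Op_mul(2) by (rule Op_mul') auto
 ultimately show ?case using Op_diff Op_scale by simp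
next case (Op_cong p M p')
 have "((-1) ^ (p * q) :: 'k) = (-1) ^ (p' * q)" using Op_cong(2) by (simp add: minus_one_power_iff)
 hence "sc p' M q N = sc p M q N" by (simp add: sc_def fun_eq_iff)
 thus ?case using Op.Op_cong[OF Op_cong.IH, of "p' + q"] Op_cong(2) by simp
qed

lemma sc_flip: "Op p M ==> Op q N ==> sc q N p M = (\<lambda>x. (- ((-1) ^ (p * q))) \<cdot> sc p M q N x)"
 by (auto simp: sc_def fun_eq_iff scale_right_diff_distrib mult.commute)

lemma sc_base:
 assumes a: "a \<in> H p" and b: "b \<in> H q"
 shows "sc p (Y a) q (Y b) x = - Y (br a b) x + a \<odot> Y (D b) x - ((-1) ^ (p * q)) \<cdot> (b \<odot> Y (D a) x)
   - (br a b + D a \<odot> b - a \<odot> D b) \<odot> D x"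
proof -
 define s where "s = ((-1) ^ (p * q) :: 'k)"
 have s: "s \<cdot> (s \<cdot> z) = z" for z by (simp add: s_def flip: power_add)
 have ss: "s * s = 1" by (simp add: s_def flip: power_add)
 have tb: "tw p b = s \<cdot> b" using tw_HH[OF b, of p] by (auto simp: s_def)
 have ta: "tw q a = s \<cdot> a" using tw_HH[OF a, of q] by (auto simp: s_def)
 have ba: "b \<odot> (a \<odot> z) = s \<cdot> (a \<odot> (b \<odot> z))" for z
  using comm_tw[OF b, of a] unfolding ta by (metis assoc prd_scalel)
 have bDa: "b \<odot> (D a \<odot> z) = s \<cdot> (D a \<odot> (b \<odot> z))" for z
  using comm_tw[OF D_H[OF a], of b] unfolding tb by (metis assoc prd_scalel s)
 have Dba: "D b \<odot> (a \<odot> z) = s \<cdot> (a \<odot> (D b \<odot> z))" for z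
  using comm_tw[OF D_H[OF b], of a] unfolding ta by (metis assoc prd_scalel s)
 have sk: "br b a = - (s \<cdot> br a b)" using br_skew[OF b, of a] unfolding ta by (simp add: br_lin)
 have jac: "br a (br b x) = br (br a b) x + s \<cdot> br b (br a x)"
  using br_jacobi[OF a, of b x] unfolding tb by (simp add: br_lin)
 have la: "br a (b \<odot> z) = br a b \<odot> z + s \<cdot> (b \<odot> br a z) + D a \<odot> (b \<odot> z)" for z
  using br_leibniz[OF a, of b z] unfolding tb by (simp add: prd_lin D_def)
 have lb: "br b (a \<odot> z) = br b a \<odot> z + s \<cdot> (a \<odot> br b z) + D b \<odot> (a \<odot> z)" for z
  using br_leibniz[OF b, of a z] unfolding ta by (simp add: prd_lin D_def)
 have 1: "Y a (Y b x) = a \<odot> (D b \<odot> D x) + a \<odot> (b \<odot> D (D x)) - a \<odot> br (D b) x - a \<odot> br b (D x)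
   - br a b \<odot> D x - s \<cdot> (b \<odot> br a (D x)) - D a \<odot> (b \<odot> D x) + br (br a b) x + s \<cdot> br b (br a x)"
  by (simp add: Y_def D_lin D_deriv br_D br_lin la jac prd_lin algebra_simps)
 have 2: "Y b (Y a x) = b \<odot> (D a \<odot> D x) + b \<odot> (a \<odot> D (D x)) - b \<odot> br (D a) x - b \<odot> br a (D x)
   - br b a \<odot> D x - s \<cdot> (a \<odot> br b (D x)) - D b \<odot> (a \<odot> D x) + br b (br a x)"
  by (simp add: Y_def D_lin D_deriv br_D br_lin lb prd_lin algebra_simps)
 have 3: "s \<cdot> Y b (Y a x) = D a \<odot> (b \<odot> D x) + a \<odot> (b \<odot> D (D x)) - s \<cdot> (b \<odot> br (D a) x)
   - s \<cdot> (b \<odot> br a (D x)) + br a b \<odot> D x - a \<odot> br b (D x) - a \<odot> (D b \<odot> D x) + s \<cdot> br b (br a x)"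
  unfolding 2 by (simp add: scale_right_distrib scale_right_diff_distrib ba bDa Dba sk ss prd_lin)
 have "sc p (Y a) q (Y b) x = Y a (Y b x) - s \<cdot> Y b (Y a x)" by (simp add: sc_def s_def)
 also have "\<dots> = a \<odot> (D b \<odot> D x) + a \<odot> (D b \<odot> D x) - a \<odot> br (D b) x - br a b \<odot> D x - br a b \<odot> D x
   - D a \<odot> (b \<odot> D x) - D a \<odot> (b \<odot> D x) + br (br a b) x + s \<cdot> (b \<odot> br (D a) x)"
  unfolding 1 3 by (simp add: algebra_simps)
 also have "\<dots> = - Y (br a b) x + a \<odot> Y (D b) x - s \<cdot> (b \<odot> Y (D a) x)
   - (br a b + D a \<odot> b - a \<odot> D b) \<odot> D x"
  by (simp add: Y_def prd_lin assoc bDa ss scale_right_distrib scale_right_diff_distrib algebra_simps)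
 finally show ?thesis by (simp add: s_def)
qed

lemma sc_base_D: "sc 0 D q (Y b) x = Y (D b) x"
 by (simp add: sc_def Y_def D_lin D_deriv br_D)

lemma Op_sc:
 assumes "Op p M" "Op q N" shows "Op (p + q) (sc p M q N)"
proof -
 have YY: "Op (p + q) (sc p (Y a) q (Y b))" if a: "a \<in> H p" and b: "b \<in> H q" for a b p q
 proof -
  have "Op (p + q) (Y (br a b))" by (rule OpY[OF br_H[OF a b]])
  moreover have "Op (p + q) (\<lambda>x. a \<odot> Y (D b) x)" by (rule Op_mul[OF a OpY[OF D_H[OF b]]])
  moreover have "Op (p + q) (\<lambda>x. ((-1) ^ (p * q)) \<cdot> (b \<odot> Y (D a) x))"
   by (intro Op_scale Op_mul'[OF b OpY[OF D_H[OF a]]]) auto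
  moreover have "br a b + D a \<odot> b - a \<odot> D b \<in> H (p + q)"
   by (intro H_in br_H prd_H D_H a b)
  from Op_mul'[OF this OpD, of "p + q"] have "Op (p + q) (\<lambda>x. (br a b + D a \<odot> b - a \<odot> D b) \<odot> D x)" by simp
  ultimately have "Op (p + q) (\<lambda>x. - Y (br a b) x + a \<odot> Y (D b) x - ((-1) ^ (p * q)) \<cdot> (b \<odot> Y (D a) x)
   - (br a b + D a \<odot> b - a \<odot> D b) \<odot> D x)"
   using Op_scale[of "p + q" "Y (br a b)" "-1"] by (intro Op_diff Op_add) simp_all
  moreover have "sc p (Y a) q (Y b) = (\<lambda>x. - Y (br a b) x + a \<odot> Y (D b) x - ((-1) ^ (p * q)) \<cdot> (b \<odot> Y (D a) x)
   - (br a b + D a \<odot> b - a \<odot> D b) \<odot> D x)" using sc_base[OF a b] by blast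
  ultimately show ?thesis by simp
 qed
 have DY: "Op q (sc 0 D q (Y b))" if "b \<in> H q" for b q
 proof -
  have "sc 0 D q (Y b) = Y (D b)" using sc_base_D by blast
  thus ?thesis using OpY[OF D_H[OF that]] by simp
 qed
 have DD: "Op 0 (sc 0 D 0 D)"
 proof -
  have "sc 0 D 0 D = (\<lambda>x. 0)" by (auto simp: sc_def)
  thus ?thesis using Op_zero by simp
 qed
 have flip: "Op (q + p) (sc q N p M)" if "Op (p + q) (sc p M q N)" "Op p M" "Op q N" for p q M N
  using Op_scale[OF that(1), of "- ((-1) ^ (p * q))"] sc_flip[OF that(2,3)] by (simp add: add.commute)
 have MY: "Op (p + q) (sc p M q (Y b))" if "Op p M" "b \<in> H q" for p q M b
  by (rule sc_induct[OF OpY[OF that(2)] _ _ that(1)]) (use YY DY that in auto)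
 have MD: "Op (p + 0) (sc p M 0 D)" if "Op p M" for p M
 proof (rule sc_induct[OF OpD _ _ that])
  show "Op 0 (sc 0 D 0 D)" by (rule DD)
  fix a p assume a: "a \<in> H p"
  show "Op (p + 0) (sc p (Y a) 0 D)" using flip[of 0 p D "Y a"] DY[OF a] OpD OpY[OF a] by simp
 qed
 show ?thesis
 proof (rule sc_induct[OF assms(2) _ _ assms(1)])
  fix a p assume a: "a \<in> H p"
  show "Op (p + q) (sc p (Y a) q N)" by (rule flip[OF MY[OF assms(2) a] assms(2) OpY[OF a]])
 next
  show "Op q (sc 0 D q N)" using flip[OF MD[OF assms(2)] assms(2) OpD] by simp
 qed
qed

lemma sy_e: "Op p M ==> sy p M e = 0"
 by (simp add: sy_def pi_V cop_V[OF Op_cop])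

lemma sy_lin: "Op p M ==> sy p M (a + b) = sy p M a + sy p M b" "Op p M ==> sy p M (c \<cdot> a) = c \<cdot> sy p M a"
 "Op p M ==> sy p M (a - b) = sy p M a - sy p M b" "Op p M ==> sy p M 0 = 0"
 by (auto simp: sy_def cop_lin[OF Op_cop] tw_lin prd_lin scale_right_diff_distrib)

lemma sy_V: "Op p M ==> sy p M a \<in> V"
 by (simp add: sy_def cop_V[OF Op_cop])

lemma sy_decomp: "Op p M ==> a \<in> V ==> M a = sy p M a + tw p a \<odot> M e"
 by (simp add: sy_def)

lemma sy_sc:
 assumes M: "Op p M" and N: "Op q N" and y: "y \<in> V" and N0: "sy q N y = 0" and M0: "sy p M y = c \<cdot> e"
 shows "sy (p + q) (sc p M q N) y = 0"
proof -
 let ?s = "(-1) ^ (p * q) :: 'k"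
 have Ny: "N y = tw q y \<odot> N e" and My: "M y = c \<cdot> e + tw p y \<odot> M e"
  using sy_decomp[OF N y] sy_decomp[OF M y] N0 M0 by simp_all
 have "tw q (M y) = ?s \<cdot> M (tw q y)" by (rule Op_tw[OF M y])
 hence Mtw: "M (tw q y) = ?s \<cdot> tw q (M y)" by (simp flip: power_add)
 have "tw p (N y) = ?s \<cdot> N (tw p y)" using Op_tw[OF N y, of p] by (simp add: mult.commute)
 hence Ntw: "N (tw p y) = ?s \<cdot> tw p (N y)" by (simp flip: power_add)
 have syM: "sy p M (tw q y) = ?s \<cdot> (c \<cdot> e)"
 proof -
  have "tw q (M e) = ?s \<cdot> M e" using Op_tw[OF M e_H(2), of q] by simp
  hence "?s \<cdot> tw q (M y) = ?s \<cdot> (c \<cdot> e) + tw q (tw p y) \<odot> M e"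
   by (simp add: My tw_lin tw_prd scale_right_distrib prd_lin flip: power_add)
  thus ?thesis unfolding sy_def Mtw by (simp add: prd_tw_tw add.commute)
 qed
 have syN: "sy q N (tw p y) = 0"
 proof -
  have "tw p (N e) = ?s \<cdot> N e" using Op_tw[OF N e_H(2), of p] by (simp add: mult.commute)
  hence "?s \<cdot> tw p (N y) = tw p (tw q y) \<odot> N e"
   by (simp add: Ny tw_lin tw_prd scale_right_distrib prd_lin flip: power_add)
  thus ?thesis unfolding sy_def Ntw by (simp add: prd_tw_tw add.commute)
 qed
 have "M (N y) = ?s \<cdot> (c \<cdot> N e) + tw p (tw q y) \<odot> M (N e)"
  unfolding Ny Op_leibniz[OF M] syM by (simp add: prd_lin pi_V cop_V[OF Op_cop[OF N]])
 moreover have "N (M y) = c \<cdot> N e + tw q (tw p y) \<odot> N (M e)"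
  unfolding My cop_add[OF Op_cop[OF N]] cop_scale[OF Op_cop[OF N]] Op_leibniz[OF N] syN by simp
 ultimately have "sc p M q N y = tw (p + q) y \<odot> sc p M q N e"
  by (simp add: sc_def prd_lin scale_right_distrib prd_tw_tw add.commute)
 thus ?thesis by (simp add: sy_def)
qed

text \<open>At the origin, the symbol of an operator is the symbol of a bracket, so its rank is bounded by \<open>rank_bound\<close>.\<close>

lemma Op_rep:
 assumes D0: "\<And>x. \<epsilon> (D x) = 0" and "Op p M"
 shows "\<exists>F. \<forall>b. \<epsilon> (sy p M b) = \<epsilon> (br F b)"
 using assms(2)
proof (induction rule: Op.induct)
 case (OpY a p)
 have Ye: "Y a e = D a" by (simp add: Y_def br_ee br_e H_V[OF OpY])
 have "sy p (Y a) b = a \<odot> D b - br a b - tw p b \<odot> D a" for b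
  by (simp only: sy_def Ye) (simp add: Y_def)
 thus ?case by (intro exI[of _ "- a"]) (simp add: eps_lin eps_prd D0 br_lin)
next case OpD show ?case by (rule exI[of _ 0]) (simp add: sy_def eps_lin eps_prd D0 br_ee)
next case (Op_add p M N)
 have s: "sy p (\<lambda>x. M x + N x) b = sy p M b + sy p N b" for b
  by (simp add: sy_def prd_lin algebra_simps)
 from Op_add.IH(1) obtain F where F: "\<forall>b. \<epsilon> (sy p M b) = \<epsilon> (br F b)" ..
 from Op_add.IH(2) obtain G where G: "\<forall>b. \<epsilon> (sy p N b) = \<epsilon> (br G b)" ..
 show ?case by (intro exI[of _ "F + G"]) (simp add: s F G eps_lin br_lin)
next case (Op_mul f q p M)
 from Op_mul.IH obtain F where F: "\<forall>b. \<epsilon> (sy p M b) = \<epsilon> (br F b)" ..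
 have "\<epsilon> (sy (q + p) (\<lambda>x. f \<odot> M x) b) = \<epsilon> f * \<epsilon> (sy p M b)" for b
  by (simp add: sy_def eps_lin eps_prd algebra_simps)
 thus ?case using F by (intro exI[of _ "\<epsilon> f \<cdot> F"]) (simp add: br_lin eps_lin)
next case (Op_cong p M q) thus ?case using tw_cong[of p q] by (simp add: sy_def)
qed

lemma Op_eps_e:
 assumes D0: "\<And>x. \<epsilon> (D x) = 0" and "Op p M"
 shows "\<epsilon> (M e) = 0"
 using assms(2)
proof (induction rule: Op.induct)
 case (OpY a p)
 have Ye: "Y a e = D a" by (simp add: Y_def br_ee br_e H_V[OF OpY])
 show ?case by (simp add: Ye D0)
qed (simp_all add: D0 eps_lin eps_prd)

text \<open>Operators whose symbols are dual to coordinates: a partial straightening of the anchor of \<open>Op\<close>.\<close>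

definition elim :: "nat => (nat => nat) => (nat => 'v) => (nat => 'v => 'v) => bool" where
 "elim r pr y M \<longleftrightarrow> (\<forall>i<r. y i \<in> m \<and> y i \<in> H (pr i) \<and> Op (pr i) (M i)) \<and>
   (\<forall>i<r. \<forall>j<r. sy (pr i) (M i) (y j) = (if i = j then e else 0))"

lemma elim_extend:
 assumes E: "elim r pr y M" and N: "Op p N" and N0: "\<And>j. j < r ==> sy p N (y j) = 0"
  and x: "x \<in> V" "\<epsilon> (sy p N x) \<noteq> 0"
 shows "\<exists>pr y M. elim (Suc r) pr y M"
proof -
 define x' where "x' = (if even p then P0 x else P1 x)"
 have x'H: "x' \<in> H p" by (simp add: x'_def H_def)
 define x1 where "x1 = x' - \<epsilon> x' \<cdot> e"
 have "\<epsilon> x' \<cdot> e \<in> H p"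
 proof (cases "even p")
  case True
  hence "H p = H 0" by (intro H_cong) simp
  show ?thesis unfolding \<open>H p = H 0\<close> by (rule H_in(4)[OF e_H(1)])
 next
  case False
  thus ?thesis using eps_odd[OF x'H] H_in(1) by simp
 qed
 hence x1H: "x1 \<in> H p" unfolding x1_def by (rule H_in(3)[OF x'H])
 have x1m: "x1 \<in> m" unfolding x1_def by (rule m_in(10)[OF H_V[OF x'H]])
 define x'' where "x'' = (if even p then P1 x else P0 x)"
 have xx: "x = x' + x''" using V_decomp[OF x(1)] by (simp add: x'_def x''_def add.commute)
 have "x'' \<in> H (Suc p)" by (simp add: x''_def H_def)
 from eps_odd[OF sy_H[OF N this]] have "\<epsilon> (sy p N x'') = 0" by simp
 hence u0: "\<epsilon> (sy p N x1) \<noteq> 0"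
  using x(2) unfolding xx x1_def by (simp add: sy_lin[OF N] sy_e[OF N] eps_lin)
 define u where "u = sy p N x1"
 have uH: "u \<in> H 0" using sy_H[OF N x1H] H_cong[of "p + p" 0] by (simp add: u_def)
 obtain v where v: "v \<in> H 0" "v \<odot> u = e" using ex_inverse[OF uH] u0 by (auto simp: u_def)
 define Nn where "Nn = (\<lambda>x. v \<odot> N x)"
 have Nn: "Op p Nn" unfolding Nn_def by (rule Op_mul'[OF v(1) N]) simp
 have syNn: "sy p Nn z = v \<odot> sy p N z" for z
  using even_left_commute[OF v(1)] by (simp add: sy_def Nn_def prd_lin)
 have Nx: "sy p Nn x1 = e" unfolding syNn using v(2) by (simp add: u_def)
 have Ny: "sy p Nn (y j) = 0" if "j < r" for j unfolding syNn using N0[OF that] by simp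
 define a where "a i = sy (pr i) (M i) x1" for i
 have MO: "Op (pr i) (M i)" and yH: "y i \<in> H (pr i)" "y i \<in> m" if "i < r" for i
  using E that by (auto simp: elim_def)
 have aH: "a i \<in> H (p + pr i)" if "i < r" for i
  unfolding a_def by (rule sy_H[OF MO[OF that] x1H])
 define M' where "M' i = (if i < r then (\<lambda>x. M i x - a i \<odot> Nn x) else Nn)" for i
 have M'O: "Op (pr i) (M' i)" if "i < r" for i
 proof -
  have "even (pr i) = even (p + pr i + p)" by auto
  from Op_diff[OF MO[OF that] Op_mul'[OF aH[OF that] Nn this]] show ?thesis using that by (simp add: M'_def)
 qed
 have syM': "sy (pr i) (M' i) z = sy (pr i) (M i) z - a i \<odot> sy p Nn z" if "i < r" for i z
 proof -
  have "tw (pr i) z \<odot> (a i \<odot> w) = a i \<odot> (tw p z \<odot> w)" for w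
  proof -
   have "a i \<odot> tw p z = tw (p + pr i) (tw p z) \<odot> a i" by (rule comm_tw[OF aH[OF that]])
   hence "a i \<odot> (tw p z \<odot> w) = tw (p + pr i) (tw p z) \<odot> (a i \<odot> w)" by (metis assoc)
   also have "\<dots> = tw (pr i) z \<odot> (a i \<odot> w)"
   proof -
    have "tw (p + pr i + p) = tw (pr i)" by (rule tw_cong) auto
    thus ?thesis by (simp add: prd_tw_tw)
   qed
   finally show ?thesis ..
  qed
  thus ?thesis using that by (simp add: M'_def sy_def prd_lin)
 qed
 have "elim (Suc r) (pr(r := p)) (y(r := x1)) M'"
  unfolding elim_def
 proof (intro conjI allI impI)
  fix i assume i: "i < Suc r"
  show "(y(r := x1)) i \<in> m" "(y(r := x1)) i \<in> H ((pr(r := p)) i)" "Op ((pr(r := p)) i) (M' i)"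
   using i x1m x1H Nn yH M'O by (auto simp: less_Suc_eq M'_def)
  fix j assume j: "j < Suc r"
  show "sy ((pr(r := p)) i) (M' i) ((y(r := x1)) j) = (if i = j then e else 0)"
  proof (cases "i = r")
   case True
   thus ?thesis using j Nx Ny by (auto simp: less_Suc_eq M'_def)
  next
   case False
   hence ir: "i < r" using i by simp
   show ?thesis
   proof (cases "j = r")
    case True
    thus ?thesis using ir syM'[OF ir] Nx by (simp add: a_def pi_V sy_V[OF MO[OF ir]])
   next
    case False
    hence jr: "j < r" using j by simp
    show ?thesis using ir jr syM'[OF ir] Ny[OF jr] E by (simp add: elim_def)
   qed
  qed
 qed
 thus ?thesis by blast
qed

lemma elim_max:
 assumes D0: "\<And>x. \<epsilon> (D x) = 0"
 obtains r pr y M where "elim r pr y M" "\<And>pr y M. \<not> elim (Suc r) pr y M"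
proof -
 from rank_bound obtain N :: nat where
  N: "\<forall>r F y. (\<forall>i<r. \<forall>j<r. \<epsilon> (br (F i) (y j)) = (if i = j then 1 else 0)) \<longrightarrow> r \<le> N" ..
 define P where "P r \<longleftrightarrow> (\<exists>pr y M. elim r pr y M)" for r
 have b: "r \<le> N" if "P r" for r
 proof -
  obtain pr y M where E: "elim r pr y M" using \<open>P r\<close> by (auto simp: P_def)
  have "\<forall>i. \<exists>F. i < r \<longrightarrow> (\<forall>b. \<epsilon> (sy (pr i) (M i) b) = \<epsilon> (br F b))"
  proof
   fix i show "\<exists>F. i < r \<longrightarrow> (\<forall>b. \<epsilon> (sy (pr i) (M i) b) = \<epsilon> (br F b))"
    using Op_rep[OF D0, of "pr i" "M i"] E by (auto simp: elim_def)
  qed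
  from choice[OF this] obtain F where
   F: "\<forall>i. i < r \<longrightarrow> (\<forall>b. \<epsilon> (sy (pr i) (M i) b) = \<epsilon> (br (F i) b))" ..
  show ?thesis
  proof (rule N[rule_format])
   fix i j assume ij: "i < r" "j < r"
   have "sy (pr i) (M i) (y j) = (if i = j then e else 0)" using E ij by (simp add: elim_def)
   moreover have "\<epsilon> (br (F i) (y j)) = \<epsilon> (sy (pr i) (M i) (y j))" using F ij(1) by simp
   ultimately show "\<epsilon> (br (F i) (y j)) = (if i = j then 1 else 0)" by simp
  qed
 qed
 have "P 0" by (simp add: P_def elim_def)
 have G: "P (GREATEST r. P r)" using GreatestI_nat[of P 0 N] \<open>P 0\<close> b by blast
 have "\<not> P (Suc (GREATEST r. P r))"
  using Greatest_le_nat[of P "Suc (GREATEST r. P r)" N] b by auto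
 thus thesis using G that unfolding P_def by blast
qed

text \<open>Take a maximal family of operators \<open>M\<^sub>i\<close> whose symbols are dual to elements \<open>y\<^sub>i\<close>. The operators \<open>\<M>\<close> whose symbol
kills all \<open>y\<^sub>i\<close> have, by maximality, a symbol that vanishes at the origin. The span \<open>K\<close> of their images is an ideal inside the
maximal ideal, hence \<open>0\<close>; so \<open>\<M>\<close> consists of \<open>0\<close>, and every operator is a combination of the \<open>M\<^sub>i\<close>. The \<open>M\<^sub>i\<close>
commute, their commutators being in \<open>\<M>\<close>, and form a frame. Splitting \<open>e = c + \<Sum> y\<^sub>i f\<^sub>i\<close> with
\<open>M\<^sub>i c = 0\<close> gives an element \<open>c\<close> with \<open>\<epsilon>(c) = 1\<close> that all operators kill.\<close>

theorem casimir:
 assumes D0: "\<And>x. \<epsilon> (D x) = 0"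
 obtains \<phi> where "\<phi> \<in> H 0" "\<epsilon> \<phi> = 1" "\<And>x. X \<phi> x = 0"
proof -
 obtain r pr y M where E: "elim r pr y M" and mx: "\<And>pr y M. \<not> elim (Suc r) pr y M"
  using elim_max[OF D0] by blast
 have MO: "Op (pr i) (M i)" and yH: "y i \<in> H (pr i)" "y i \<in> m" if "i < r" for i
  using E that by (auto simp: elim_def)
 have yV: "y i \<in> V" if "i < r" for i using yH[OF that] m_V by blast
 have My: "sy (pr i) (M i) (y j) = (if i = j then e else 0)" if "i < r" "j < r" for i j
  using E that by (simp add: elim_def)
 define \<M> where "\<M> = {(p, N). Op p N \<and> (\<forall>j<r. sy p N (y j) = 0)}"
 have M0: "\<epsilon> (sy p N x) = 0" if "(p, N) \<in> \<M>" "x \<in> V" for p N x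
  using elim_extend[OF E, of p N x] that mx by (auto simp: \<M>_def)
 define K where "K = span {N a | p N a. (p, N) \<in> \<M> \<and> a \<in> V}"
 have Kb: "N a \<in> K" if "(p, N) \<in> \<M>" "a \<in> V" for p N a
  unfolding K_def by (rule span_base) (use that in blast)
 have Kind: "x \<in> S" if "x \<in> K" "subspace S" "\<And>p N a. (p, N) \<in> \<M> ==> a \<in> V ==> N a \<in> S" for x S
 proof -
  have "K \<subseteq> S" unfolding K_def using that(2,3) by (intro span_minimal) auto
  thus ?thesis using that(1) by auto
 qed
 have Ks: "subspace K" by (simp add: K_def)
 have mulM: "(q + p, \<lambda>x. f \<odot> N x) \<in> \<M>" if "(p, N) \<in> \<M>" "f \<in> H q" for p q N f
 proof -
  have "sy (q + p) (\<lambda>x. f \<odot> N x) z = f \<odot> sy p N z" for z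
  proof -
   have "tw (q + p) z \<odot> (f \<odot> w) = f \<odot> (tw p z \<odot> w)" for w
    using comm_tw[OF that(2), of "tw p z"] by (metis assoc prd_tw_tw(1))
   thus ?thesis by (simp add: sy_def prd_lin)
  qed
  thus ?thesis using that Op_mul by (auto simp: \<M>_def)
 qed
 have scM: "(pr i + p, sc (pr i) (M i) p N) \<in> \<M>" if "(p, N) \<in> \<M>" "i < r" for p N i
 proof -
  have "sy (pr i + p) (sc (pr i) (M i) p N) (y j) = 0" if "j < r" for j
   by (rule sy_sc[OF MO[OF \<open>i < r\<close>] _ yV[OF that], of p N "if i = j then 1 else 0"])
     (use \<open>(p, N) \<in> \<M>\<close> that My[OF \<open>i < r\<close> that] in \<open>auto simp: \<M>_def\<close>)
  thus ?thesis using Op_sc[OF MO[OF that(2)]] that(1) by (auto simp: \<M>_def)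
 qed
 have red: "(q, \<lambda>x. N x - (\<Sum>i<r. sy q N (y i) \<odot> M i x)) \<in> \<M>" if N: "Op q N" for q N
 proof -
  have aH: "sy q N (y i) \<in> H (pr i + q)" if "i < r" for i by (rule sy_H[OF N yH(1)[OF that]])
  have "Op q (\<lambda>x. sy q N (y i) \<odot> M i x)" if "i < r" for i
   by (rule Op_mul'[OF aH[OF that] MO[OF that]]) auto
  hence O: "Op q (\<lambda>x. N x - (\<Sum>i<r. sy q N (y i) \<odot> M i x))"
   by (intro Op_diff N Op_sum) auto
  have "sy q (\<lambda>x. N x - (\<Sum>i<r. sy q N (y i) \<odot> M i x)) z
   = sy q N z - (\<Sum>i<r. sy q N (y i) \<odot> sy (pr i) (M i) z)" for z
  proof -
   have "tw q z \<odot> (sy q N (y i) \<odot> w) = sy q N (y i) \<odot> (tw (pr i) z \<odot> w)" if "i < r" for i w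
   proof -
    have "sy q N (y i) \<odot> tw (pr i) z = tw (pr i + q) (tw (pr i) z) \<odot> sy q N (y i)"
     by (rule comm_tw[OF aH[OF that]])
    hence "sy q N (y i) \<odot> (tw (pr i) z \<odot> w) = tw (pr i + q) (tw (pr i) z) \<odot> (sy q N (y i) \<odot> w)" by (metis assoc)
    also have "\<dots> = tw q z \<odot> (sy q N (y i) \<odot> w)"
    proof -
     have "tw (pr i + q + pr i) = tw q" by (rule tw_cong) auto
     thus ?thesis by (simp add: prd_tw_tw)
    qed
    finally show ?thesis ..
   qed
   hence "(\<Sum>i<r. tw q z \<odot> (sy q N (y i) \<odot> M i e)) = (\<Sum>i<r. sy q N (y i) \<odot> (tw (pr i) z \<odot> M i e))" by simp
   thus ?thesis by (simp add: sy_def[of q "\<lambda>x. N x - (\<Sum>i<r. sy q N (y i) \<odot> M i x)"] sy_def[of "pr _"] sy_def[of q N z]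
     prd_lin prd_sum sum_subtractf algebra_simps)
  qed
  moreover have "(\<Sum>i<r. sy q N (y i) \<odot> sy (pr i) (M i) (y j)) = sy q N (y j)" if "j < r" for j
  proof -
   have "(\<Sum>i<r. sy q N (y i) \<odot> sy (pr i) (M i) (y j)) = (\<Sum>i<r. if i = j then sy q N (y i) else 0)"
    by (rule sum.cong) (use My that in \<open>auto simp: pi_V sy_V[OF N]\<close>)
   thus ?thesis using that by simp
  qed
  ultimately show ?thesis using O by (auto simp: \<M>_def)
 qed
 have NK: "N x \<in> K" if N: "Op q N" and x: "x \<in> K" for q N x
 proof -
  have "subspace {x. N x \<in> K}"
   using Ks unfolding subspace_def by (simp add: cop_lin[OF Op_cop[OF N]])
  moreover have "N (N' a) \<in> K" if N': "(p, N') \<in> \<M>" and a: "a \<in> V" for p N' a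
  proof -
   let ?R = "\<lambda>x. N x - (\<Sum>i<r. sy q N (y i) \<odot> M i x)"
   have N'V: "N' a \<in> V" using N' by (auto simp: \<M>_def intro: cop_V[OF Op_cop])
   have 1: "?R (N' a) \<in> K" by (rule Kb[OF red[OF N] N'V])
   have "M i (N' a) \<in> K" if i: "i < r" for i
   proof -
    have "M i (N' a) = sc (pr i) (M i) p N' a + ((-1) ^ (pr i * p)) \<cdot> N' (M i a)"
     by (simp add: sc_def)
    moreover have "M i a \<in> V" by (rule cop_V[OF Op_cop[OF MO[OF i]]])
    ultimately show ?thesis
     using Kb[OF scM[OF N' i] a] Kb[OF N'] subspace_scale[OF Ks] subspace_add[OF Ks] by metis
   qed
   hence "sy q N (y i) \<odot> M i (N' a) \<in> K" if i: "i < r" for i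
   proof -
    have s: "subspace {x. sy q N (y i) \<odot> x \<in> K}"
     using Ks unfolding subspace_def by (simp add: prd_lin)
    have "M i (N' a) \<in> {x. sy q N (y i) \<odot> x \<in> K}"
    proof (rule Kind[OF _ s])
     show "M i (N' a) \<in> K" using \<open>\<And>i. i < r ==> M i (N' a) \<in> K\<close> i by blast
     fix p N'' b assume "(p, N'') \<in> \<M>" "b \<in> V"
     from Kb[OF mulM[OF this(1) sy_H[OF N yH(1)[OF i]]] this(2)]
     show "N'' b \<in> {x. sy q N (y i) \<odot> x \<in> K}" by simp
    qed
    thus ?thesis by simp
   qed
   hence "(\<Sum>i<r. sy q N (y i) \<odot> M i (N' a)) \<in> K" by (intro subspace_sum[OF Ks]) auto
   from subspace_add[OF Ks 1 this] show ?thesis by simp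
  qed
  ultimately have "x \<in> {x. N x \<in> K}" by (intro Kind[OF x]) auto
  thus ?thesis by simp
 qed
 have "K \<subseteq> {0}"
 proof (rule simple_in_m[OF Ks])
  show "K \<subseteq> m"
  proof
   fix x assume "x \<in> K"
   thus "x \<in> m"
   proof (rule Kind)
    show "subspace m" by (auto simp: subspace_def m_in)
    fix p N a assume N: "(p, N) \<in> \<M>" and a: "a \<in> V"
    hence O: "Op p N" by (simp add: \<M>_def)
    have "\<epsilon> (N a) = \<epsilon> (sy p N a) + \<epsilon> (tw p a \<odot> N e)"
     by (subst sy_decomp[OF O a]) (rule Dual_add[OF eps_Dual])
    thus "N a \<in> m" using M0[OF N a] Op_eps_e[OF D0 O] cop_V[OF Op_cop[OF O]] by (simp add: m_def eps_prd)
   qed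
  qed
  have hom: "b \<odot> x \<in> K" if b: "b \<in> H q" and x: "x \<in> K" for b q x
  proof -
   have s: "subspace {x. b \<odot> x \<in> K}"
    using Ks unfolding subspace_def by (simp add: prd_lin)
   have "x \<in> {x. b \<odot> x \<in> K}"
   proof (rule Kind[OF x s])
    fix p N a assume "(p, N) \<in> \<M>" "a \<in> V"
    from Kb[OF mulM[OF this(1) b] this(2)] show "N a \<in> {x. b \<odot> x \<in> K}" by simp
   qed
   thus ?thesis by simp
  qed
  show "b \<odot> x \<in> K" if x: "x \<in> K" for b x
  proof -
   have "b \<odot> x = P0 b \<odot> x + P1 b \<odot> x" by (metis prd_pil prd_addl)
   thus ?thesis using hom[OF _ x] subspace_add[OF Ks] P_in_H by metis
  qed
  show "br a x \<in> K" if a: "a \<in> H p" and x: "x \<in> K" for p a x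
  proof -
   have "br a x = a \<odot> D x - Y a x" by (simp add: Y_def)
   moreover have "a \<odot> D x \<in> K" by (rule hom[OF a NK[OF OpD x]])
   moreover have "Y a x \<in> K" by (rule NK[OF OpY[OF a] x])
   ultimately show ?thesis using subspace_diff[OF Ks] by simp
  qed
 qed
 hence Mz: "N a = 0" if "(p, N) \<in> \<M>" "a \<in> V" for p N a using Kb[OF that] by auto
 have F: "frame r pr y M"
  unfolding frame_def
 proof (intro conjI allI impI ballI)
  fix i assume i: "i < r"
  show "y i \<in> m" "y i \<in> H (pr i)" "cop (M i)" using yH[OF i] Op_cop[OF MO[OF i]] by auto
  fix j b assume j: "j < r" and b: "b \<in> V"
  have "tw (pr i) (y j) = ((-1) ^ (pr i * pr j)) \<cdot> y j" using tw_HH[OF yH(1)[OF j], of "pr i"] by auto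
  thus "M i (y j \<odot> b) = (if i = j then b else 0) + ((-1) ^ (pr i * pr j)) \<cdot> (y j \<odot> M i b)"
   using Op_leibniz[OF MO[OF i], of "y j" b] My[OF i j] b by (simp add: prd_lin pi_V)
  have "sc (pr i) (M i) (pr j) (M j) b = 0"
  proof (rule Mz[OF _ b])
   have "sy (pr i + pr j) (sc (pr i) (M i) (pr j) (M j)) (y k) = 0" if k: "k < r" for k
   proof (cases "j = k")
    case False
    show ?thesis
     by (rule sy_sc[OF MO[OF i] MO[OF j] yV[OF k], of "if i = k then 1 else 0"])
       (use My[OF j k] My[OF i k] False in auto)
   next
    case True
    show ?thesis
    proof (cases "i = k")
     case False
     have "sy (pr j + pr i) (sc (pr j) (M j) (pr i) (M i)) (y k) = 0"
      by (rule sy_sc[OF MO[OF j] MO[OF i] yV[OF k], of 1])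
       (use My[OF j k] My[OF i k] False True in auto)
     moreover have "sc (pr i) (M i) (pr j) (M j) = (\<lambda>x. (- ((-1) ^ (pr j * pr i))) \<cdot> sc (pr j) (M j) (pr i) (M i) x)"
      by (rule sc_flip[OF MO[OF j] MO[OF i]])
     ultimately show ?thesis by (auto simp: sy_def prd_lin add.commute)
    next
     case True2: True
     show ?thesis
     proof (cases "even (pr i)")
      case True
      hence "sc (pr i) (M i) (pr j) (M j) = (\<lambda>x. 0)"
       using \<open>j = k\<close> True2 by (auto simp: sc_def)
      thus ?thesis by (simp add: sy_def)
     next
      case False
      have O: "Op (pr k) (M k)" by (rule MO[OF k])
      have oddk: "odd (pr k)" using False True2 by simp
      have Mk: "M k (M k (y k)) = y k \<odot> M k (M k e)"
      proof -
       have tk: "tw (pr k) (y k) = - y k" using tw_HH[OF yH(1)[OF k], of "pr k"] oddk by simp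
       have "M k (y k) = e + tw (pr k) (y k) \<odot> M k e" using sy_decomp[OF O yV[OF k]] My[OF k k] by simp
       hence 1: "M k (y k) = e - y k \<odot> M k e" by (simp add: tk prd_lin)
       have "M k (y k \<odot> M k e) = e \<odot> M k e - y k \<odot> M k (M k e)"
        using Op_leibniz[OF O, of "y k" "M k e"] My[OF k k] by (simp add: tk prd_lin)
       thus ?thesis by (simp add: 1 cop_lin[OF Op_cop[OF O]] pi_V cop_V[OF Op_cop[OF O]])
      qed
      have "tw (pr k + pr k) (y k) = y k" by (simp add: tw_def)
      hence "sy (pr k + pr k) (sc (pr k) (M k) (pr k) (M k)) (y k) = 0"
       using oddk by (simp add: sy_def sc_def Mk prd_lin)
      thus ?thesis using \<open>j = k\<close> True2 by simp
     qed
    qed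
   qed
   thus "(pr i + pr j, sc (pr i) (M i) (pr j) (M j)) \<in> \<M>"
    using Op_sc[OF MO[OF i] MO[OF j]] by (auto simp: \<M>_def)
  qed
  thus "M i (M j b) = ((-1) ^ (pr i * pr j)) \<cdot> M j (M i b)" by (simp add: sc_def)
 qed
 obtain c f where c: "c \<in> V" "\<And>i. i < r ==> M i c = 0" "e = c + (\<Sum>i<r. y i \<odot> f i)"
  by (rule frame_decomp_V[OF F e_H(2)]) blast
 have Nc: "N c = 0" if N: "Op q N" for q N
 proof -
  have "N c - (\<Sum>i<r. sy q N (y i) \<odot> M i c) = 0" using Mz[OF red[OF N] c(1)] .
  thus ?thesis using c(2) by simp
 qed
 have "\<epsilon> (\<Sum>i<r. y i \<odot> f i) = 0"
  using yH(2) by (simp add: eps_lin eps_prd m_def)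
 hence ec: "\<epsilon> c = 1" using arg_cong[OF c(3), of \<epsilon>] by (simp add: eps_lin)
 have Nc0: "N (P0 c) = 0" if N: "Op q N" for q N
 proof -
  have "N (P0 c) + N (P1 c) = 0"
   using Nc[OF N] V_decomp[OF c(1)] cop_add[OF Op_cop[OF N]] by metis
  moreover have "N (P0 c) \<in> H q" "N (P1 c) \<in> H (Suc q)"
   using Op_H[OF N, of "P0 c" 0] Op_H[OF N, of "P1 c" 1] by auto
  moreover have "x = 0" if "x + z = 0" "x \<in> H q" "z \<in> H (Suc q)" for x z
   using that by (auto simp: H_def split: if_splits)
    (metis P01 P10 P0_add P1_add add.right_neutral add.left_neutral lin_simps(1,2))+
  ultimately show ?thesis by blast
 qed
 show thesis
 proof (rule that[of "P0 c"])
  show "P0 c \<in> H 0" by simp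
  show "\<epsilon> (P0 c) = 1" using ec by simp
  have hom: "X (P0 c) x = 0" if x: "x \<in> H p" for x p
  proof -
   have "x \<odot> D (P0 c) = D (P0 c) \<odot> x" using comm_e[OF D_H[of "P0 c" 0], of x] by simp
   moreover have "br x (P0 c) = - br (P0 c) x" using br_skew[of "P0 c" 0 x] by (simp add: tw_def)
   ultimately show ?thesis using Nc0[OF OpY[OF x]] by (simp add: Y_def X_def add.commute)
  qed
  fix x
  have "X (P0 c) x = X (P0 c) (P0 x + P1 x)" using cop_pi[OF cop_X, of "P0 c" x] by (simp add: pi_def)
  thus "X (P0 c) x = 0" using hom[of "P0 x" 0] hom[of "P1 x" 1] by (simp add: X_lin)
 qed
qed

end

context lgp
begin

section \<open>Canonical coordinates\<close>

subsection \<open>Centralizers\<close>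

text \<open>Because \<open>e \<in> S\<close>, elements \<open>c\<close> of the centralizer satisfy \<open>D c = 0\<close>; because \<open>D\<close> vanishes on \<open>S\<close>, the bracket with an
element of \<open>S\<close> is a derivation, so the centralizer is a subalgebra. It is again closed under the bracket.\<close>

definition admissible :: "'v set => bool" where
 "admissible S \<longleftrightarrow> e \<in> S \<and> (\<forall>z\<in>S. D z = 0 \<and> (\<exists>p. z \<in> H p))"

definition cen :: "'v set => 'v set" where "cen S = {c\<in>V. \<forall>z\<in>S. br z c = 0}"

lemma br_zero_sym: "x \<in> H p ==> y \<in> H q ==> br x y = 0 ==> br y x = 0"
 using br_skew[of y q x] tw_HH[of x p q] by (auto simp: br_lin split: if_splits)

lemma even_br: "f \<in> H 0 ==> P0 (br f x) = br f (P0 x)"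
proof -
 assume f: "f \<in> H 0"
 have "br f x = br f (P0 x) + br f (P1 x)" by (metis br_addr br_pir pi_def)
 moreover have "P0 (br f (P0 x)) = br f (P0 x)" using H_comps(1)[OF br_H[OF f, of "P0 x" 0]] by simp
 moreover have "P0 (br f (P1 x)) = 0" using H_comps(2)[OF br_H[OF f, of "P1 x" 1]] by simp
 ultimately show ?thesis by (simp add: Plin)
qed

lemma even_self: "f \<in> H 0 ==> br f f = 0"
 using br_skew[of f 0 f] two_zero[of "br f f"] by (simp add: tw_def) (metis add.right_inverse)

lemma even_skew: "f \<in> H 0 ==> x \<in> H p ==> br x f = - br f x"
 using br_skew[of x p f] tw_HH[of f 0 p] by simp

context
 fixes S assumes S: "admissible S"
begin

lemma cenD: "c \<in> cen S ==> z \<in> S ==> br z c = 0" "c \<in> cen S ==> D c = 0" "c \<in> cen S ==> c \<in> V"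
 using S by (auto simp: cen_def admissible_def D_def)

lemma S_H: assumes "z \<in> S" obtains p where "z \<in> H p"
 using S assms by (auto simp: admissible_def)

lemma S_D: "z \<in> S ==> D z = 0" using S by (simp add: admissible_def)

lemma S_deriv: "z \<in> S ==> z \<in> H p ==> br z (x \<odot> y) = br z x \<odot> y + tw p x \<odot> br z y"
 using br_leibniz[of z p x y] S_D[of z] by (simp flip: D_def)

lemma cen_in: "0 \<in> cen S" "e \<in> cen S" "x \<in> cen S ==> y \<in> cen S ==> x + y \<in> cen S"
 "x \<in> cen S ==> y \<in> cen S ==> x - y \<in> cen S" "x \<in> cen S ==> c \<cdot> x \<in> cen S" "x \<in> cen S ==> - x \<in> cen S"
 "x \<in> cen S ==> P0 x \<in> cen S" "x \<in> cen S ==> P1 x \<in> cen S"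
 "x \<in> cen S ==> y \<in> cen S ==> x \<odot> y \<in> cen S" "x \<in> cen S ==> y \<in> cen S ==> br x y \<in> cen S"
proof -
 show "0 \<in> cen S" by (simp add: cen_def)
 have "br z e = 0" if "z \<in> S" for z
  using br_e[of z] S_D[OF that] S_H[OF that] H_V by (metis neg_0_equal_iff_equal)
 thus "e \<in> cen S" by (simp add: cen_def)
 show "x + y \<in> cen S" "x - y \<in> cen S" if "x \<in> cen S" "y \<in> cen S"
  using that by (auto simp: cen_def br_lin)
 show "c \<cdot> x \<in> cen S" "- x \<in> cen S" if "x \<in> cen S" using that by (auto simp: cen_def br_lin)
 have P: "P0 x \<in> cen S \<and> P1 x \<in> cen S" if x: "x \<in> cen S" for x
 proof -
  have "br z (P0 x) = 0 \<and> br z (P1 x) = 0" if z: "z \<in> S" for z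
  proof -
   obtain p where p: "z \<in> H p" by (rule S_H[OF z])
   have "br z (P0 x) + br z (P1 x) = 0" using cenD(1)[OF x z] V_decomp[OF cenD(3)[OF x]] by (metis br_addr)
   moreover have "br z (P0 x) \<in> H p" "br z (P1 x) \<in> H (Suc p)"
    using br_H[OF p, of "P0 x" 0] br_H[OF p, of "P1 x" 1] by auto
   moreover have "a = 0 \<and> b = 0" if "a + b = 0" "a \<in> H p" "b \<in> H (Suc p)" for a b
   proof -
    have "P0 (a + b) = 0" "P1 (a + b) = 0" using that(1) by (simp_all add: Plin)
    thus ?thesis using H_comps[OF that(2)] H_comps[OF that(3)] by (cases "even p") (simp_all add: Plin)
   qed
   ultimately show ?thesis by blast
  qed
  thus ?thesis by (simp add: cen_def)
 qed
 show "P0 x \<in> cen S" "P1 x \<in> cen S" if "x \<in> cen S" using P[OF that] by auto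
 show "x \<odot> y \<in> cen S" if "x \<in> cen S" "y \<in> cen S"
 proof -
  have "br z (x \<odot> y) = 0" if z: "z \<in> S" for z
  proof -
   obtain p where p: "z \<in> H p" by (rule S_H[OF z])
   show ?thesis using S_deriv[OF z p, of x y] cenD(1)[OF \<open>x \<in> cen S\<close> z] cenD(1)[OF \<open>y \<in> cen S\<close> z] by simp
  qed
  thus ?thesis by (simp add: cen_def)
 qed
 show "br x y \<in> cen S" if "x \<in> cen S" "y \<in> cen S"
 proof -
  have "br z (br x y) = 0" if z: "z \<in> S" for z
  proof -
   obtain p where p: "z \<in> H p" by (rule S_H[OF z])
   show ?thesis using br_jacobi[OF p, of x y] cenD(1)[OF \<open>x \<in> cen S\<close> z] cenD(1)[OF \<open>y \<in> cen S\<close> z] by simp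
  qed
  thus ?thesis by (simp add: cen_def)
 qed
qed

lemma cen_m: "c \<in> cen S ==> c - \<epsilon> c \<cdot> e \<in> cen S \<inter> m"
 using cen_in cenD(3) m_in(10) by simp

lemma cen_inverse:
 assumes "u \<in> cen S" "u \<in> H 0" "\<epsilon> u \<noteq> 0" "v \<in> H 0" "u \<odot> v = e" shows "v \<in> cen S"
proof -
 have "br z v = 0" if z: "z \<in> S" for z
 proof -
  obtain p where p: "z \<in> H p" by (rule S_H[OF z])
  have "br z (u \<odot> v) = u \<odot> br z v"
   using S_deriv[OF z p, of u v] cenD(1)[OF assms(1) z] tw_HH[OF assms(2), of p] by simp
  hence "u \<odot> br z v = 0" using cenD(1)[OF cen_in(2) z] assms(5) by simp
  thus ?thesis using cancel_unit[OF assms(2,3)] by simp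
 qed
 thus ?thesis using H_V[OF assms(4)] by (simp add: cen_def)
qed

lemma cen_Jq:
 assumes x: "x \<in> cen S" "x \<in> m" and M: "\<And>c. c \<in> cen S ==> M c \<in> cen S" and a: "a \<in> cen S"
 shows "x \<odot> Jq M x a \<in> cen S"
proof -
 have pw: "(M ^^ k) a \<in> cen S" for k using a M by (induction k) auto
 have ep: "epow x k \<in> cen S" for k using x cen_in by (induction k) auto
 have "br z (x \<odot> Jq M x a) = 0" if z: "z \<in> S" for z
  by (rule Jq_kernel[OF x(2) cop_br]) (rule cenD(1)[OF cen_in(9)[OF ep pw] z])
 thus ?thesis by (simp add: cen_def)
qed

lemma cen_deriv: "z \<in> cen S ==> z \<in> H p ==> br z (x \<odot> y) = br z x \<odot> y + tw p x \<odot> br z y"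
 using br_leibniz[of z p x y] cenD(2)[of z] by (simp flip: D_def)

text \<open>Straightening of an even pair: with \<open>u = {p, x}\<close> invertible, \<open>u\<inverse> {p, \<cdot>}\<close> is integrated along \<open>x\<close> to solve
\<open>{p, q} = 1\<close>.\<close>

lemma even_pair:
 assumes p0: "p0 \<in> cen S" "p0 \<in> H 0" and q0: "q0 \<in> cen S" "q0 \<in> H 0" and nz: "\<epsilon> (br p0 q0) \<noteq> 0"
 obtains p q where "p \<in> cen S" "p \<in> m" "p \<in> H 0" "q \<in> cen S" "q \<in> m" "q \<in> H 0" "br p q = e"
proof -
 define p where "p = p0 - \<epsilon> p0 \<cdot> e"
 define x where "x = q0 - \<epsilon> q0 \<cdot> e"
 have p: "p \<in> cen S" "p \<in> m" "p \<in> H 0" and x: "x \<in> cen S" "x \<in> m" "x \<in> H 0"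
  using cen_m[OF p0(1)] cen_m[OF q0(1)] H_in(3)[OF p0(2) H_in(4)[OF e_H(1)]]
   H_in(3)[OF q0(2) H_in(4)[OF e_H(1)]] by (auto simp: p_def x_def)
 define u where "u = br p x"
 have "u = br p0 q0"
  using br_e[OF cenD(3)[OF p0(1)]] cenD(2)[OF p0(1)] cenD(2)[OF q0(1)] br_ee
  by (simp add: u_def p_def x_def br_lin flip: D_def)
 hence eu: "\<epsilon> u \<noteq> 0" using nz by simp
 have u: "u \<in> cen S" "u \<in> H 0" using cen_in(10)[OF p(1) x(1)] br_H[OF p(3) x(3)] by (auto simp: u_def)
 obtain v where v: "v \<in> H 0" "u \<odot> v = e" "v \<odot> u = e" by (rule ex_inverse[OF u(2) eu])
 have vC: "v \<in> cen S" by (rule cen_inverse[OF u eu v(1,2)])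
 define M where "M = (\<lambda>b. v \<odot> br p b)"
 have cM: "cop M" unfolding M_def by (intro cop_mult cop_br)
 have comm: "M (x \<odot> b) = b + x \<odot> M b" if "b \<in> V" for b
 proof -
  have "M (x \<odot> b) = v \<odot> (u \<odot> b) + v \<odot> (x \<odot> br p b)"
   using cen_deriv[OF p(1,3), of x b] by (simp add: M_def u_def prd_lin tw_def)
  also have "v \<odot> (u \<odot> b) = b" using v(3) that by (simp add: pi_V flip: assoc)
  also have "v \<odot> (x \<odot> br p b) = x \<odot> M b" unfolding M_def by (rule even_left_commute[OF v(1), symmetric])
  finally show ?thesis .
 qed
 define q' where "q' = x \<odot> Jq M x v"
 have "M q' = v" unfolding q'_def by (rule integration[OF cM x(2) comm H_V[OF v(1)]])
 hence "u \<odot> (v \<odot> br p q') = e" using v(2) by (simp add: M_def)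
 hence pq: "br p q' = e" using v(2) by (simp add: pi_V flip: assoc)
 have q'C: "q' \<in> cen S"
  unfolding q'_def by (rule cen_Jq[OF x(1,2)]) (use vC p(1) cen_in in \<open>auto simp: M_def\<close>)
 have q'm: "q' \<in> m" unfolding q'_def by (rule m_in(7)[OF x(2)])
 show thesis
 proof (rule that[of p "P0 q'"])
  show "br p (P0 q') = e" using even_br[OF p(3), of q'] pq by simp
 qed (use p q'C q'm cen_in m_in in auto)
qed

text \<open>The square \<open>c = {\<eta>, \<eta>}\<close> commutes with \<open>\<eta>\<close> by the Jacobi identity, so \<open>\<eta>\<close> can be multiplied by a square root of
\<open>-c\<inverse>\<close>.\<close>

lemma odd_unit:
 assumes n0: "\<eta> \<in> cen S" "\<eta> \<in> H 1" and nz: "\<epsilon> (br \<eta> \<eta>) \<noteq> 0"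
 obtains \<xi> where "\<xi> \<in> cen S" "\<xi> \<in> H 1" "br \<xi> \<xi> = - e"
proof -
 define c where "c = br \<eta> \<eta>"
 have c: "c \<in> cen S" "c \<in> H 0" using cen_in(10)[OF n0(1) n0(1)] br_H[OF n0(2) n0(2)] H_cong[of "1 + 1" 0] by (auto simp: c_def)
 have ec: "\<epsilon> c \<noteq> 0" using nz by (simp add: c_def)
 have nc: "br \<eta> c = 0"
 proof -
  have t: "tw 1 \<eta> = - \<eta>" using tw_HH[OF n0(2), of 1] by simp
  have "br \<eta> c = br c \<eta> + br (tw 1 \<eta>) (br \<eta> \<eta>)" unfolding c_def by (rule br_jacobi[OF n0(2)])
  also have "br c \<eta> = - br \<eta> c" using br_skew[OF c(2), of \<eta>] by (simp add: tw_def)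
  also have "br (tw 1 \<eta>) (br \<eta> \<eta>) = - br \<eta> c" unfolding t by (simp add: br_lin c_def)
  finally have "br \<eta> c + br \<eta> c + br \<eta> c = 0" by (simp add: algebra_simps)
  moreover have "(3::'k) \<cdot> br \<eta> c = br \<eta> c + br \<eta> c + br \<eta> c"
  proof -
   have "(3::'k) = 1 + 1 + 1" by simp
   thus ?thesis by (simp only: scale_left_distrib scale_one)
  qed
  ultimately have "(3::'k) \<cdot> br \<eta> c = 0" by simp
  thus ?thesis by simp
 qed
 obtain v where v: "v \<in> H 0" "c \<odot> v = e" "v \<odot> c = e" "\<epsilon> v = inverse (\<epsilon> c)" by (rule ex_inverse[OF c(2) ec])
 have ev: "\<epsilon> (- v) \<noteq> 0" using v(4) ec by (simp add: eps_lin)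
 obtain f where f: "f \<in> H 0" "f \<odot> f = - v" "\<epsilon> f \<noteq> 0"
  by (rule ex_sqrt[OF H_in(5)[OF v(1)] ev])
 have kill: "br z f = 0" if dz: "\<And>x y. br z (x \<odot> y) = br z x \<odot> y + tw p x \<odot> br z y"
  and z: "z \<in> H p" and zc: "br z c = 0" and ze: "br z e = 0" for z p
 proof -
  have "br z (c \<odot> v) = c \<odot> br z v" using dz[of c v] zc tw_HH[OF c(2), of p] by simp
  hence "c \<odot> br z v = 0" using ze v(2) by simp
  hence zv: "br z v = 0" using cancel_unit[OF c(2) ec] by simp
  have "br z (f \<odot> f) = f \<odot> br z f + f \<odot> br z f"
   using dz[of f f] tw_HH[OF f(1), of p] comm_e[OF f(1), of "br z f"] by simp
  hence "f \<odot> br z f + f \<odot> br z f = 0" using f(2) zv by (simp add: br_lin)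
  hence "f \<odot> br z f = 0" by (rule two_zero)
  thus ?thesis using cancel_unit[OF f(1,3)] by simp
 qed
 have fC: "f \<in> cen S"
 proof -
  have "br z f = 0" if z: "z \<in> S" for z
  proof -
   obtain p where p: "z \<in> H p" by (rule S_H[OF z])
   show ?thesis
    by (rule kill[OF S_deriv[OF z p] p cenD(1)[OF c(1) z] cenD(1)[OF cen_in(2) z]])
  qed
  thus ?thesis using H_V[OF f(1)] by (simp add: cen_def)
 qed
 have nf: "br \<eta> f = 0"
  by (rule kill[OF cen_deriv[OF n0] n0(2) nc]) (use br_e[OF cenD(3)[OF n0(1)]] cenD(2)[OF n0(1)] in simp)
 have fn: "br f \<eta> = 0" using br_zero_sym[OF n0(2) f(1) nf] .
 define w where "w = f \<odot> \<eta>"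
 have w: "w \<in> cen S" "w \<in> H 1" using cen_in(9)[OF fC n0(1)] prd_H[OF f(1) n0(2)] by (auto simp: w_def)
 have "br f w = 0"
  unfolding w_def using cen_deriv[OF fC f(1), of f \<eta>] fn even_self[OF f(1)] by simp
 hence wf: "br w f = 0" by (rule br_zero_sym[OF f(1) w(2)])
 have nw: "br \<eta> w = f \<odot> c"
  unfolding w_def using cen_deriv[OF n0, of f \<eta>] nf tw_HH[OF f(1), of 1] by (simp add: c_def)
 have tn: "tw 1 \<eta> = - \<eta>" using tw_HH[OF n0(2), of 1] by simp
 have wn: "br w \<eta> = f \<odot> c" using br_skew[OF w(2), of \<eta>] unfolding tn by (simp add: br_lin nw)
 have "br w w = f \<odot> (f \<odot> c)"
  using cen_deriv[OF w, of f \<eta>] wf wn tw_HH[OF f(1), of 1] by (simp add: w_def)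
 also have "\<dots> = - e" using f(2) v(3) by (simp add: prd_lin flip: assoc)
 finally show thesis using that[OF w] by simp
qed

text \<open>A bracket that is non-zero at the origin is non-zero on two even or on two odd elements; in the odd case,
polarization gives an element whose square is non-zero at the origin.\<close>

lemma split_step:
 assumes "a \<in> cen S" "b \<in> cen S" "\<epsilon> (br a b) \<noteq> 0"
 obtains (even) p q where "p \<in> cen S" "p \<in> m" "p \<in> H 0" "q \<in> cen S" "q \<in> m" "q \<in> H 0" "br p q = e"
 | (odd) \<xi> where "\<xi> \<in> cen S" "\<xi> \<in> m" "\<xi> \<in> H 1" "br \<xi> \<xi> = - e"
proof -
 have "br a b = br (P0 a + P1 a) (P0 b + P1 b)" using V_decomp cenD(3) assms(1,2) by metis
 hence "br a b = br (P0 a) (P0 b) + br (P0 a) (P1 b) + (br (P1 a) (P0 b) + br (P1 a) (P1 b))"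
  by (simp add: br_lin)
 moreover have "\<epsilon> (br (P0 a) (P1 b)) = 0" "\<epsilon> (br (P1 a) (P0 b)) = 0"
  using eps_odd[OF br_H[of "P0 a" 0 "P1 b" 1]] eps_odd[OF br_H[of "P1 a" 1 "P0 b" 0]] by auto
 ultimately have "\<epsilon> (br (P0 a) (P0 b)) \<noteq> 0 \<or> \<epsilon> (br (P1 a) (P1 b)) \<noteq> 0" using assms(3) by (auto simp: eps_lin)
 thus thesis
 proof
  assume "\<epsilon> (br (P0 a) (P0 b)) \<noteq> 0"
  from even_pair[OF _ _ _ _ this] assms cen_in even show thesis by auto
 next
  assume nz: "\<epsilon> (br (P1 a) (P1 b)) \<noteq> 0"
  let ?a = "P1 a" and ?b = "P1 b"
  have ab: "?a \<in> cen S" "?b \<in> cen S" "?a \<in> H 1" "?b \<in> H 1" using assms cen_in by auto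
  have "br ?b ?a = br ?a ?b"
   using br_skew[OF ab(4), of ?a] tw_HH[OF ab(3), of 1] by (simp add: br_lin)
  hence "\<epsilon> (br (?a + ?b) (?a + ?b)) = \<epsilon> (br ?a ?a) + \<epsilon> (br ?b ?b) + 2 * \<epsilon> (br ?a ?b)"
   by (simp add: br_lin eps_lin)
  hence "\<epsilon> (br ?a ?a) \<noteq> 0 \<or> \<epsilon> (br ?b ?b) \<noteq> 0 \<or> \<epsilon> (br (?a + ?b) (?a + ?b)) \<noteq> 0" using nz by auto
  moreover have "?a + ?b \<in> cen S" "?a + ?b \<in> H 1" using ab cen_in(3) H_in(2) by auto
  ultimately obtain \<eta> where \<eta>: "\<eta> \<in> cen S" "\<eta> \<in> H 1" "\<epsilon> (br \<eta> \<eta>) \<noteq> 0" using ab by blast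
  obtain \<xi> where x: "\<xi> \<in> cen S" "\<xi> \<in> H 1" "br \<xi> \<xi> = - e" by (rule odd_unit[OF \<eta>])
  have "\<xi> \<in> m" using eps_odd[OF x(2)] H_V[OF x(2)] by (simp add: m_def)
  thus thesis using odd x by blast
 qed
qed

end

subsection \<open>Canonical systems\<close>

text \<open>The involution \<open>\<tau>\<close> pairs the odd elements, \<open>{\<xi>\<^sub>i, \<xi>\<^sub>\<tau>\<^sub>i} = -1\<close>: it is the identity while the system is
being built, and exchanges the last two indices in the final normal form.\<close>

definition sys :: "(nat => nat) => nat => nat => (nat => 'v) => (nat => 'v) => (nat => 'v) => bool" where
 "sys \<tau> k n P Q E \<longleftrightarrow>
   (\<forall>i<k. P i \<in> m \<and> P i \<in> H 0 \<and> D (P i) = 0 \<and> Q i \<in> m \<and> Q i \<in> H 0 \<and> D (Q i) = 0) \<and>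
   (\<forall>i<n. E i \<in> m \<and> E i \<in> H 1 \<and> D (E i) = 0) \<and>
   (\<forall>i<k. \<forall>j<k. br (P i) (P j) = 0 \<and> br (Q i) (Q j) = 0 \<and> br (P i) (Q j) = (if i = j then e else 0)) \<and>
   (\<forall>i<k. \<forall>j<n. br (P i) (E j) = 0 \<and> br (Q i) (E j) = 0) \<and>
   (\<forall>i<n. \<forall>j<n. br (E i) (E j) = (if \<tau> i = j then - e else 0)) \<and>
   (\<forall>i<n. \<tau> i < n \<and> \<tau> (\<tau> i) = i)"

definition sysS :: "nat => nat => (nat => 'v) => (nat => 'v) => (nat => 'v) => 'v set" where
 "sysS k n P Q E = insert e (P ` {..<k} \<union> Q ` {..<k} \<union> E ` {..<n})"

lemma sysS_admissible: "sys \<tau> k n P Q E ==> admissible (sysS k n P Q E)"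
 unfolding admissible_def sysS_def sys_def
 using br_ee exI[where P = "\<lambda>p. e \<in> H p", OF e_H(1)] by auto

lemma sys_skew:
 assumes "sys \<tau> k n P Q E" "i < k"
 shows "j < k ==> br (Q i) (P j) = (if i = j then - e else 0)"
  "j < n ==> br (E j) (P i) = 0" "j < n ==> br (E j) (Q i) = 0"
proof -
 note s = assms(1)[unfolded sys_def]
 show "br (Q i) (P j) = (if i = j then - e else 0)" if "j < k"
  using even_skew[of "P j" "Q i" 0] s assms(2) that by auto
 show "br (E j) (P i) = 0" "br (E j) (Q i) = 0" if "j < n"
  using even_skew[of "P i" "E j" 1] even_skew[of "Q i" "E j" 1] s assms(2) that by auto
qed

text \<open>\<open>yv i\<close> and \<open>zv i\<close> are dual: \<open>{z\<^sub>i, y\<^sub>j} = \<delta>\<^sub>i\<^sub>j\<close>. The index \<open>2k\<close> is that of the contact variable \<open>t\<close>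
 when \<open>mm = 2k + 1\<close>.\<close>

definition yv :: "nat => nat => (nat => 'v) => (nat => 'v) => (nat => 'v) => 'v => nat => 'v" where
 "yv mm k P Q E t i = (if i < k then P i else if i < 2 * k then Q (i - k) else if i < mm then t else E (i - mm))"

definition zv :: "(nat => nat) => nat => nat => (nat => 'v) => (nat => 'v) => (nat => 'v) => nat => 'v" where
 "zv \<tau> mm k P Q E i = (if i < k then - Q i else if i < 2 * k then P (i - k) else - E (\<tau> (i - mm)))"

definition prty :: "nat => nat => nat" where "prty mm i = (if i < mm then 0 else 1)"

definition ordinary :: "nat => nat => nat => nat => bool" where
 "ordinary mm k n i \<longleftrightarrow> i < 2 * k \<or> mm \<le> i \<and> i < mm + n"

lemma yz_facts:
 assumes s: "sys \<tau> k n P Q E" and mm: "2 * k \<le> mm" and i: "ordinary mm k n i"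
 shows "yv mm k P Q E t i \<in> m" "yv mm k P Q E t i \<in> H (prty mm i)" "D (yv mm k P Q E t i) = 0"
  "zv \<tau> mm k P Q E i \<in> H (prty mm i)" "D (zv \<tau> mm k P Q E i) = 0"
  "ordinary mm k n j ==> br (zv \<tau> mm k P Q E i) (yv mm k P Q E t j) = (if i = j then e else 0)"
  "ordinary mm k n j ==> \<exists>c. br (zv \<tau> mm k P Q E i) (zv \<tau> mm k P Q E j) = c \<cdot> e"
proof -
 note S = s[unfolded sys_def]
 note sk = sys_skew[OF s]
 consider (P) "i < k" | (Q) l where "l < k" "i = k + l" | (E) l where "l < n" "i = mm + l"
  using i mm unfolding ordinary_def by (metis add_diff_inverse_nat less_diff_conv2 mult_2 not_le nat_add_left_cancel_less)
 note ci = this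
 show "yv mm k P Q E t i \<in> m" "yv mm k P Q E t i \<in> H (prty mm i)" "D (yv mm k P Q E t i) = 0"
  "zv \<tau> mm k P Q E i \<in> H (prty mm i)" "D (zv \<tau> mm k P Q E i) = 0"
  by (cases rule: ci; use S mm H_in(5) in \<open>simp add: yv_def zv_def prty_def D_lin\<close>)+
 assume j: "ordinary mm k n j"
 consider (P) "j < k" | (Q) l where "l < k" "j = k + l" | (E) l where "l < n" "j = mm + l"
  using j mm unfolding ordinary_def by (metis add_diff_inverse_nat less_diff_conv2 mult_2 not_le nat_add_left_cancel_less)
 note cj = this
 show "br (zv \<tau> mm k P Q E i) (yv mm k P Q E t j) = (if i = j then e else 0)"
  by (cases rule: ci; cases rule: cj; use S mm sk in \<open>auto simp: yv_def zv_def br_lin\<close>)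
 show "\<exists>c. br (zv \<tau> mm k P Q E i) (zv \<tau> mm k P Q E j) = c \<cdot> e"
 proof -
  have "br (zv \<tau> mm k P Q E i) (zv \<tau> mm k P Q E j) \<in> {0, e, - e}"
   by (cases rule: ci; cases rule: cj; use S mm sk in \<open>auto simp: zv_def br_lin\<close>)
  moreover have "0 = 0 \<cdot> e" "e = 1 \<cdot> e" "- e = (-1) \<cdot> e" by simp_all
  ultimately show ?thesis by (metis insertE singletonD)
 qed
qed

lemma sys_bound: "\<exists>N. \<forall>\<tau> k n P Q E. sys \<tau> k n P Q E \<longrightarrow> 2 * k + n \<le> N"
proof -
 from rank_bound obtain N :: nat where
  N: "\<forall>r F y. (\<forall>i<r. \<forall>j<r. \<epsilon> (br (F i) (y j)) = (if i = j then 1 else 0)) \<longrightarrow> r \<le> N" ..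
 have "2 * k + n \<le> N" if s: "sys \<tau> k n P Q E" for \<tau> k n P Q E
 proof (rule N[rule_format])
  fix i j assume "i < 2 * k + n" "j < 2 * k + n"
  hence "ordinary (2 * k) k n i" "ordinary (2 * k) k n j" by (auto simp: ordinary_def)
  from yz_facts(6)[OF s order_refl this, of 0]
  show "\<epsilon> (br (zv \<tau> (2 * k) k P Q E i) (yv (2 * k) k P Q E 0 j)) = (if i = j then 1 else 0)" by simp
 qed
 thus ?thesis by blast
qed

text \<open>The new pair lies in the centralizer of the system, so all mixed brackets vanish.\<close>

lemma sys_add_even:
 assumes s: "sys id k n P Q E" and pq: "p \<in> cen (sysS k n P Q E)" "p \<in> m" "p \<in> H 0"
  "q \<in> cen (sysS k n P Q E)" "q \<in> m" "q \<in> H 0" "br p q = e"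
 shows "sys id (Suc k) n (P(k := p)) (Q(k := q)) E"
proof -
 note S = s[unfolded sys_def]
 note A = sysS_admissible[OF s]
 have z: "br x p = 0 \<and> br x q = 0" if "x \<in> sysS k n P Q E" for x
  using cenD(1)[OF A pq(1) that] cenD(1)[OF A pq(4) that] by simp
 have zs: "br p x = 0 \<and> br q x = 0" if "x \<in> sysS k n P Q E" for x
 proof -
  obtain r where r: "x \<in> H r" using S_H[OF A \<open>x \<in> _\<close>] by blast
  show ?thesis using z[OF that] br_zero_sym[OF r pq(3)] br_zero_sym[OF r pq(6)] by simp
 qed
 have "br q q = 0" "br p p = 0" using even_self pq by auto
 moreover have "D p = 0" "D q = 0" using cenD(2)[OF A] pq by auto
 moreover have "P i \<in> sysS k n P Q E" "Q i \<in> sysS k n P Q E" if "i < k" for i using that by (auto simp: sysS_def)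
 moreover have "E i \<in> sysS k n P Q E" if "i < n" for i using that by (auto simp: sysS_def)
 ultimately show ?thesis using S pq z zs unfolding sys_def by (auto simp: less_Suc_eq)
qed

lemma sys_add_odd:
 assumes s: "sys id k n P Q E" and x: "\<xi> \<in> cen (sysS k n P Q E)" "\<xi> \<in> m" "\<xi> \<in> H 1" "br \<xi> \<xi> = - e"
 shows "sys id k (Suc n) P Q (E(n := \<xi>))"
proof -
 note S = s[unfolded sys_def]
 note A = sysS_admissible[OF s]
 have z: "br y \<xi> = 0" if "y \<in> sysS k n P Q E" for y using cenD(1)[OF A x(1) that] .
 have zs: "br \<xi> y = 0" if "y \<in> sysS k n P Q E" for y
 proof -
  obtain r where r: "y \<in> H r" using S_H[OF A \<open>y \<in> _\<close>] by blast
  show ?thesis using z[OF that] br_zero_sym[OF r x(3)] by simp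
 qed
 have "D \<xi> = 0" using cenD(2)[OF A x(1)] .
 moreover have "P i \<in> sysS k n P Q E" "Q i \<in> sysS k n P Q E" if "i < k" for i using that by (auto simp: sysS_def)
 moreover have "E i \<in> sysS k n P Q E" if "i < n" for i using that by (auto simp: sysS_def)
 ultimately show ?thesis using S x z zs unfolding sys_def by (auto simp: less_Suc_eq)
qed

end

context lgp
begin

subsection \<open>The centralizer of a maximal canonical system\<close>

text \<open>Let \<open>G\<close> be the ideal of the product generated by the homogeneous elements of the centralizer that vanish at
the origin. Its adic closure is stable under the bracket, because modulo each power of \<open>m\<close> the derivation \<open>X\<^sub>c\<close> of
a generator \<open>c\<close> has values in \<open>G\<close>: on kernel elements of the frame by smallness, and on the coordinates by
hypothesis. It lies in the maximal ideal, so simplicity applies.\<close>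

lemma center_trivial:
 assumes F: "frame r pr y M" and A: "admissible S"
  and ker: "\<And>c. c \<in> V ==> (\<And>i. i < r ==> M i c = 0) ==> c \<in> cen S"
  and small: "\<And>c c'. c \<in> cen S ==> c' \<in> cen S ==> \<epsilon> (br c c') = 0"
  and ys: "\<And>i p c. i < r ==> c \<in> cen S ==> c \<in> m ==> c \<in> H p ==> X c (y i) \<in> cen S \<and> X c (y i) \<in> m"
  and c: "c \<in> cen S"
 shows "c = \<epsilon> c \<cdot> e"
proof -
 note cD = cenD[OF A] and ci = cen_in[OF A]
 define G where "G = span {a \<odot> c | a c. a \<in> V \<and> c \<in> cen S \<and> c \<in> m \<and> (\<exists>q. c \<in> H q)}"
 have Gs: "subspace G" by (simp add: G_def)
 have Gb: "a \<odot> c \<in> G" if "c \<in> cen S" "c \<in> m" "c \<in> H q" for a c q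
 proof -
  have "pi a \<odot> c \<in> G" unfolding G_def by (rule span_base) (use that in blast)
  thus ?thesis by simp
 qed
 have Gind: "x \<in> T" if "x \<in> G" "subspace T"
  "\<And>a c q. c \<in> cen S ==> c \<in> m ==> c \<in> H q ==> a \<odot> c \<in> T" for x T
 proof -
  have "G \<subseteq> T" unfolding G_def using that(2,3) by (intro span_minimal) auto
  thus ?thesis using that(1) by auto
 qed
 have Gmul: "b \<odot> x \<in> G" if "x \<in> G" for b x
 proof -
  have "x \<in> {x. b \<odot> x \<in> G}"
  proof (rule Gind[OF that])
   show "subspace {x. b \<odot> x \<in> G}" using Gs unfolding subspace_def by (simp add: prd_lin)
   fix a c q assume "c \<in> cen S" "c \<in> m" "c \<in> H q"
   from Gb[OF this, of "b \<odot> a"] show "a \<odot> c \<in> {x. b \<odot> x \<in> G}" by (simp add: assoc)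
  qed
  thus ?thesis by simp
 qed
 have Gc: "c \<in> G" if "c \<in> cen S" "c \<in> m" for c
 proof -
  have "P1 c \<in> m" using eps_P1 by (simp add: m_def)
  hence "e \<odot> P0 c \<in> G" "e \<odot> P1 c \<in> G"
   using that ci m_in by (auto intro!: Gb[of "P0 c" 0] Gb[of "P1 c" 1] simp del: unit)
  hence "P0 c + P1 c \<in> G" using subspace_add[OF Gs] by simp
  thus ?thesis using V_decomp[OF cD(3)[OF that(1)]] by simp
 qed
 define GG where "GG k = {g + x | g x. g \<in> G \<and> x \<in> mp k}" for k
 have GGs: "subspace (GG k)" for k unfolding GG_def by (rule subspace_sums[OF Gs mp_subspace])
 have GGG: "g \<in> G ==> g \<in> GG k" for g k using mp_in(1)[of k] by (force simp: GG_def)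
 have Xc: "X c f \<in> GG k" if c: "c \<in> cen S" "c \<in> m" "c \<in> H p" and f: "f \<in> V" for c p f k
  using f
 proof (induction k arbitrary: f)
  case 0
  have "0 \<in> G" using subspace_0[OF Gs] .
  thus ?case by (force simp: GG_def)
 next
  case (Suc k)
  obtain c0 g where f: "c0 \<in> V" "\<And>i. i < r ==> M i c0 = 0" "\<And>i. i < r ==> g i \<in> V" "f = c0 + (\<Sum>i<r. y i \<odot> g i)"
   by (rule frame_decomp_V[OF F Suc.prems]) blast
  have c0: "c0 \<in> cen S" by (rule ker[OF f(1,2)])
  have "X c c0 = br c c0" using cD(2)[OF c(1)] by (simp add: X_def)
  moreover have "br c c0 \<in> m" using small[OF c(1) c0] by (simp add: m_def)
  ultimately have 1: "X c c0 \<in> GG (Suc k)" using Gc[OF ci(10)[OF c(1) c0]] GGG by simp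
  have 2: "X c (y i \<odot> g i) \<in> GG (Suc k)" if i: "i < r" for i
  proof -
   note yi = frameD(1,2)[OF F i]
   have yc: "X c (y i) \<in> cen S" "X c (y i) \<in> m" using ys[OF i c] by auto
   have "X c (y i) \<in> H (p + pr i)" by (rule X_H[OF c(3) yi(2)])
   hence "X c (y i) \<odot> g i = tw (p + pr i) (g i) \<odot> X c (y i)" by (rule comm_tw)
   hence a: "X c (y i) \<odot> g i \<in> GG (Suc k)"
    using Gb[OF yc \<open>X c (y i) \<in> H _\<close>] GGG by simp
   obtain g1 x1 where gx: "X c (g i) = g1 + x1" "g1 \<in> G" "x1 \<in> mp k"
    using Suc.IH[OF f(3)[OF i]] by (auto simp: GG_def)
   have "tw p (y i) \<odot> X c (g i) = tw p (y i) \<odot> g1 + tw p (y i) \<odot> x1" by (simp add: gx prd_lin)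
   moreover have "tw p (y i) \<odot> x1 \<in> mp (Suc k)" by (rule mp_mult[OF m_in(8)[OF yi(1)] gx(3)])
   ultimately have b: "tw p (y i) \<odot> X c (g i) \<in> GG (Suc k)" using Gmul[OF gx(2)] by (auto simp: GG_def simp del: mp.simps)
   show ?thesis using X_deriv[OF c(3), of "y i" "g i"] subspace_add[OF GGs a b] by simp
  qed
  have "(\<Sum>i<r. X c (y i \<odot> g i)) \<in> GG (Suc k)" using 2 by (intro subspace_sum[OF GGs]) auto
  with 1 have "X c c0 + (\<Sum>i<r. X c (y i \<odot> g i)) \<in> GG (Suc k)" by (rule subspace_add[OF GGs])
  thus ?case unfolding f(4) by (simp add: X_lin)
 qed
 define I where "I = {a\<in>V. \<forall>h\<in>Dual. (\<forall>g\<in>G. h g = 0) \<longrightarrow> h a = 0}"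
 have II: "h a = 0" if "a \<in> I" "h \<in> Dual" "\<And>g. g \<in> G ==> h g = 0" for a h
  using that by (simp add: I_def)
 have XI: "X c f \<in> I" if c: "c \<in> cen S" "c \<in> m" "c \<in> H p" and f: "f \<in> V" for c p f
  unfolding I_def
 proof (intro CollectI conjI ballI impI)
  fix h assume h: "h \<in> Dual" "\<forall>g\<in>G. h g = 0"
  obtain k where k: "\<And>x. x \<in> mp k ==> h x = 0" using Dual_nilpotent[OF h(1)] by blast
  obtain g x where "X c f = g + x" "g \<in> G" "x \<in> mp k" using Xc[OF c f, of k] by (auto simp: GG_def)
  thus "h (X c f) = 0" using h k by (simp add: Dual_add[OF h(1)])
 qed simp
 have GV: "g \<in> V" if "g \<in> G" for g using Gind[OF that V_subspace] by simp
 have "I \<subseteq> {0}"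
 proof (rule simple_in_m)
  show Is: "subspace I" unfolding subspace_def
  proof (intro conjI ballI allI)
   show "0 \<in> I" by (simp add: I_def)
   show "d \<cdot> x \<in> I" if "x \<in> I" for x d using that by (simp add: I_def Dual_scale)
   show "x + z \<in> I" if "x \<in> I" "z \<in> I" for x z
    unfolding I_def
   proof (intro CollectI conjI ballI impI)
    show "x + z \<in> V" using that by (simp add: I_def)
    fix h assume "h \<in> Dual" "\<forall>g\<in>G. h g = 0"
    thus "h (x + z) = 0" using II[OF that(1), of h] II[OF that(2), of h] by (simp add: Dual_add)
   qed
  qed
  have "\<epsilon> g = 0" if "g \<in> G" for g
  proof -
   have "g \<in> {x. \<epsilon> x = 0}"
    by (rule Gind[OF that]) (auto simp: subspace_def eps_lin eps_prd m_def)
   thus ?thesis by simp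
  qed
  thus "I \<subseteq> m" using II[OF _ eps_Dual] by (auto simp: I_def m_def)
  fix a x assume x: "x \<in> I"
  show mulI: "a \<odot> x \<in> I" unfolding I_def
  proof (intro CollectI conjI ballI impI)
   fix h assume h: "h \<in> Dual" "\<forall>g\<in>G. h g = 0"
   show "h (a \<odot> x) = 0" by (rule II[OF x Dual_prdl[OF h(1)]]) (use h Gmul in auto)
  qed simp
  fix p assume a: "a \<in> H p"
  show "br a x \<in> I" unfolding I_def
  proof (intro CollectI conjI ballI impI)
   fix h assume h: "h \<in> Dual" "\<forall>g\<in>G. h g = 0"
   show "h (br a x) = 0"
   proof (rule II[OF x Dual_br[OF h(1)]])
    fix g assume "g \<in> G"
    hence "g \<in> {x. h (br a x) = 0}"
    proof (rule Gind)
     show "subspace {x. h (br a x) = 0}" by (auto simp: subspace_def br_lin Dual_lin[OF h(1)] h(1))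
     fix b c q assume c: "c \<in> cen S" "c \<in> m" "c \<in> H q"
     have Da: "br a c = - X c (tw q a)"
     proof -
      have "br c (tw q a) = X c (tw q a)" using cD(2)[OF c(1)] by (simp add: X_def)
      moreover have "br a c = - br (tw p c) a" by (rule br_skew[OF a])
      moreover have "br (tw p c) a = br c (tw q a)"
       using tw_HH[OF c(3), of p] tw_HH[OF a, of q] by (auto simp: br_lin)
      ultimately show ?thesis by simp
     qed
     have 1: "h (br a b \<odot> c) = 0" using h(2) Gb[OF c] by blast
     have 2: "h (br e a \<odot> (b \<odot> c)) = 0" using h(2) Gmul[OF Gb[OF c]] by blast
     have "h (tw p b \<odot> X c (tw q a)) = 0"
      by (rule II[OF XI[OF c] Dual_prdl[OF h(1)]]) (use H_V[OF a] h Gmul in auto)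
     hence 3: "h (tw p b \<odot> br a c) = 0" by (simp add: Da prd_lin Dual_lin[OF h(1)])
     show "b \<odot> c \<in> {x. h (br a x) = 0}"
      using 1 2 3 by (simp add: br_leibniz[OF a] Dual_lin[OF h(1)])
    qed
    thus "h (br a g) = 0" by simp
   qed
  qed simp
 qed
 moreover have "G \<subseteq> I" using GV by (auto simp: I_def)
 ultimately have G0: "G \<subseteq> {0}" by blast
 have "c - \<epsilon> c \<cdot> e \<in> cen S \<inter> m" by (rule cen_m[OF A c])
 hence "c - \<epsilon> c \<cdot> e \<in> G" using Gc by blast
 thus ?thesis using G0 by auto
qed

subsection \<open>Normal forms\<close>

text \<open>On coordinates \<open>y\<close> with \<open>D y = 0\<close> this is \<open>{z, y}\<close>; the second term makes it vanish on the
contact variable \<open>t\<close>, where \<open>D t = 2\<close> and \<open>{z, t} = z\<close>.\<close>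

definition Mz :: "'v => 'v => 'v" where "Mz z b = br z b - (1/2) \<cdot> (z \<odot> D b)"

lemma cop_Mz: "cop (Mz z)"
 unfolding Mz_def[abs_def] by (intro cop_minus' cop_br cop_smult cop_mult cop_D)

lemma Mz_deriv:
 assumes "z \<in> H p" "D z = 0" shows "Mz z (a \<odot> b) = Mz z a \<odot> b + tw p a \<odot> Mz z b"
proof -
 have "tw p a \<odot> (z \<odot> D b) = z \<odot> (a \<odot> D b)" using comm_tw[OF assms(1), of a] by (metis assoc)
 thus ?thesis using br_leibniz[OF assms(1), of a b] assms(2)
  by (simp add: Mz_def D_deriv prd_lin scale_right_distrib assoc flip: D_def)
qed

lemma Mz_comm:
 assumes z: "z \<in> H p" "D z = 0" and w: "w \<in> H q" "D w = 0" and c: "br z w = c \<cdot> e"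
 shows "Mz z (Mz w b) = ((-1) ^ (p * q)) \<cdot> Mz w (Mz z b)"
proof -
 define s where "s = ((-1) ^ (p * q) :: 'k)"
 have ss: "s * s = 1" by (simp add: s_def flip: power_add)
 have tw: "tw p w = s \<cdot> w" using tw_HH[OF w(1), of p] by (auto simp: s_def)
 have tz: "tw q z = s \<cdot> z" using tw_HH[OF z(1), of q] by (auto simp: s_def)
 have wz: "w \<odot> (z \<odot> x) = s \<cdot> (z \<odot> (w \<odot> x))" for x
  using comm_tw[OF w(1), of z] unfolding tz by (metis assoc prd_scalel)
 have c': "br w z = - ((s * c) \<cdot> e)" using br_skew[OF w(1), of z] unfolding tz by (simp add: br_lin c)
 have jac: "br z (br w b) = c \<cdot> D b + s \<cdot> br w (br z b)"
  using br_jacobi[OF z(1), of w b] unfolding tw c by (simp add: br_lin D_def)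
 have lz: "br z (w \<odot> x) = c \<cdot> pi x + s \<cdot> (w \<odot> br z x)" for x
  using br_leibniz[OF z(1), of w x] z(2) unfolding tw c by (simp add: prd_lin flip: D_def)
 have lw: "br w (z \<odot> x) = - ((s * c) \<cdot> pi x) + s \<cdot> (z \<odot> br w x)" for x
  using br_leibniz[OF w(1), of z x] w(2) unfolding tz c' by (simp add: prd_lin flip: D_def)
 have pD: "pi (D x) = D x" for x by (simp add: pi_V)
 have 1: "Mz z (Mz w b) = c \<cdot> D b + s \<cdot> br w (br z b) - (1/2) \<cdot> (c \<cdot> D b + s \<cdot> (w \<odot> br z (D b)))
   - (1/2) \<cdot> (z \<odot> br w (D b)) + (1/2) \<cdot> ((1/2) \<cdot> (z \<odot> (w \<odot> D (D b))))"
  by (simp add: Mz_def br_lin jac lz pD D_lin br_D D_deriv w(2) z(2) prd_lin scale_right_diff_distrib)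
 have 2: "Mz w (Mz z b) = br w (br z b) - (1/2) \<cdot> (- ((s * c) \<cdot> D b) + s \<cdot> (z \<odot> br w (D b)))
   - (1/2) \<cdot> (w \<odot> br z (D b)) + (1/2) \<cdot> ((1/2) \<cdot> (w \<odot> (z \<odot> D (D b))))"
  by (simp add: Mz_def br_lin lw pD D_lin br_D D_deriv w(2) z(2) prd_lin scale_right_diff_distrib)
 have ssc: "s * (s * a) = a" for a using ss by (simp flip: mult.assoc)
 have 3: "s \<cdot> Mz w (Mz z b) = s \<cdot> br w (br z b) + (c / 2) \<cdot> D b - (1/2) \<cdot> (z \<odot> br w (D b))
   - (s / 2) \<cdot> (w \<odot> br z (D b)) + (1/2) \<cdot> ((1/2) \<cdot> (z \<odot> (w \<odot> D (D b))))"
  unfolding 2 by (simp add: scale_right_distrib scale_right_diff_distrib wz ss ssc mult.assoc)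
 have "c - c / 2 = c / 2" by (simp add: field_simps)
 hence h: "c \<cdot> x - (c / 2) \<cdot> x = (c / 2) \<cdot> x" for x
  using scale_left_diff_distrib[of c "c / 2" x] by simp
 have "Mz z (Mz w b) = s \<cdot> br w (br z b) + (c \<cdot> D b - (c / 2) \<cdot> D b) - (1/2) \<cdot> (z \<odot> br w (D b))
   - (s / 2) \<cdot> (w \<odot> br z (D b)) + (1/2) \<cdot> ((1/2) \<cdot> (z \<odot> (w \<odot> D (D b))))"
  unfolding 1 by (simp add: scale_right_distrib algebra_simps)
 thus ?thesis unfolding s_def[symmetric] 3 h .
qed

definition MM :: "(nat => nat) => nat => nat => (nat => 'v) => (nat => 'v) => (nat => 'v) => nat => 'v => 'v" where
 "MM \<tau> mm k P Q E i = (if 2 * k \<le> i \<and> i < mm then (\<lambda>b. (1/2) \<cdot> D b) else Mz (zv \<tau> mm k P Q E i))"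

text \<open>\<open>ct\<close> distinguishes the contact case, where \<open>t\<close> has \<open>D t = 2\<close> and its bracket acts by \<open>-1\<close> on the other
coordinates, from the Poisson case \<open>D = 0\<close>, where \<open>t\<close> is a dummy.\<close>

definition nf :: "bool => (nat => nat) => nat => nat => (nat => 'v) => (nat => 'v) => (nat => 'v) => 'v => bool" where
 "nf ct \<tau> k n P Q E t \<longleftrightarrow> sys \<tau> k n P Q E \<and>
   (if ct then t \<in> m \<and> t \<in> H 0 \<and> D t = 2 \<cdot> e \<and>
    (\<forall>i<k. br t (P i) = - P i \<and> br t (Q i) = - Q i) \<and> (\<forall>i<n. br t (E i) = - E i)
   else (\<forall>x. D x = 0))"

definition dm :: "bool => nat => nat" where "dm ct k = 2 * k + (if ct then 1 else 0)"

context
 fixes ct \<tau> k n P Q E t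
 assumes nf: "nf ct \<tau> k n P Q E t"
begin

abbreviation (input) "mm \<equiv> dm ct k"
abbreviation (input) "yy \<equiv> yv (dm ct k) k P Q E t"
abbreviation (input) "zz \<equiv> zv \<tau> (dm ct k) k P Q E"
abbreviation (input) "M' \<equiv> MM \<tau> (dm ct k) k P Q E"

lemma nf_sys: "sys \<tau> k n P Q E" using nf by (simp add: nf_def)

lemma mm_ge: "2 * k \<le> mm" by (simp add: dm_def)

lemma nf_index: assumes "i < mm + n"
 obtains "ordinary mm k n i" "M' i = Mz (zz i)" | "ct" "i = 2 * k" "yy i = t" "M' i = (\<lambda>b. (1/2) \<cdot> D b)" "prty mm i = 0"
proof (cases "ordinary mm k n i")
 case True
 thus thesis by (intro that(1)) (auto simp: MM_def ordinary_def dm_def split: if_splits)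
next
 case False
 hence "ct" "i = 2 * k" using assms by (auto simp: ordinary_def dm_def split: if_splits)
 thus thesis by (intro that(2)) (simp_all add: yv_def MM_def dm_def prty_def)
qed

lemmas oz = yz_facts[OF nf_sys mm_ge]

lemma nf_t: "ct ==> t \<in> m \<and> t \<in> H 0 \<and> D t = 2 \<cdot> e" using nf by (simp add: nf_def)

lemma t_zz: "ct ==> ordinary mm k n i ==> br t (zz i) = - zz i"
proof -
 assume c: ct and i: "ordinary mm k n i"
 note S = nf_sys[unfolded sys_def]
 have b: "br t (P j) = - P j" "br t (Q j) = - Q j" if "j < k" for j using nf c that by (auto simp: nf_def)
 have b2: "br t (E j) = - E j" if "j < n" for j using nf c that by (auto simp: nf_def)
 have "\<tau> (i - mm) < n" if "mm \<le> i" using S i that by (auto simp: ordinary_def dm_def)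
 thus ?thesis using i b b2 c by (auto simp: zv_def ordinary_def dm_def br_lin)
qed

lemma t_yy: "ct ==> ordinary mm k n i ==> br t (yy i) = - yy i"
proof -
 assume c: ct and i: "ordinary mm k n i"
 have b: "br t (P j) = - P j" "br t (Q j) = - Q j" if "j < k" for j using nf c that by (auto simp: nf_def)
 have b2: "br t (E j) = - E j" if "j < n" for j using nf c that by (auto simp: nf_def)
 show ?thesis using i b b2 c by (auto simp: yv_def ordinary_def dm_def br_lin)
qed

lemma yy_mH: "i < mm + n ==> yy i \<in> m \<and> yy i \<in> H (prty mm i)"
 by (erule nf_index) (use oz(1,2) nf_t in auto)

lemma MM_cop: "cop (M' i)"
 by (simp add: MM_def cop_Mz cop_smult cop_D)

lemma MM_deriv: "i < mm + n ==> M' i (a \<odot> b) = M' i a \<odot> b + tw (prty mm i) a \<odot> M' i b"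
proof -
 assume "i < mm + n"
 thus ?thesis
proof (cases rule: nf_index)
 case 1
 thus ?thesis using Mz_deriv[OF oz(4,5)[OF 1(1)]] by simp
next
 case 2
 thus ?thesis by (simp add: D_deriv prd_lin scale_right_distrib tw_def)
qed
qed

lemma MM_yy: "i < mm + n ==> j < mm + n ==> M' i (yy j) = (if i = j then e else 0)"
proof -
 assume i: "i < mm + n" and j: "j < mm + n"
 show ?thesis
 proof (cases rule: nf_index[OF i])
  case oi: 1
  show ?thesis
  proof (cases rule: nf_index[OF j])
   case 1
   thus ?thesis using oi oz(3)[OF 1(1)] oz(6)[OF oi(1) 1(1)] by (simp add: Mz_def)
  next
   case 2
   have "br (zz i) t = zz i"
    using even_skew[of t "zz i"] nf_t[OF 2(1)] oz(4)[OF oi(1)] t_zz[OF 2(1) oi(1)] by simp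
   moreover have "zz i \<in> V" using H_V[OF oz(4)[OF oi(1)]] .
   ultimately have "Mz (zz i) t = 0" using nf_t[OF 2(1)] by (simp add: Mz_def prd_lin pi_V)
   moreover have "i \<noteq> j" using oi(1) 2(1,2) by (auto simp: ordinary_def dm_def)
   ultimately show ?thesis using oi 2 by simp
  qed
 next
  case ti: 2
  show ?thesis
  proof (cases rule: nf_index[OF j])
   case 1
   have "i \<noteq> j" using 1(1) ti(1,2) by (auto simp: ordinary_def dm_def)
   thus ?thesis using ti oz(3)[OF 1(1)] by simp
  next
   case 2
   thus ?thesis using ti nf_t by simp
  qed
 qed
qed

lemma MM_comm: "i < mm + n ==> j < mm + n ==> M' i (M' j b) = ((-1) ^ (prty mm i * prty mm j)) \<cdot> M' j (M' i b)"
proof -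
 assume i: "i < mm + n" and j: "j < mm + n"
 have Dz: "D (Mz (zz l) b) = Mz (zz l) (D b)" if "ordinary mm k n l" for l b
  using oz(5)[OF that] by (simp add: Mz_def D_lin br_D D_deriv)
 have Ms: "Mz z (c \<cdot> b) = c \<cdot> Mz z b" for z c b by (rule cop_scale[OF cop_Mz])
 show ?thesis
 proof (cases rule: nf_index[OF i])
  case oi: 1
  show ?thesis
  proof (cases rule: nf_index[OF j])
   case 1
   obtain c where "br (zz i) (zz j) = c \<cdot> e" using oz(7)[OF oi(1) 1(1)] by blast
   from Mz_comm[OF oz(4,5)[OF oi(1)] oz(4,5)[OF 1(1)] this] show ?thesis using oi 1 by simp
  next
   case 2
   thus ?thesis using oi Dz by (simp add: Ms)
  qed
 next
  case ti: 2
  show ?thesis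
  proof (cases rule: nf_index[OF j])
   case 1
   thus ?thesis using ti Dz by (simp add: Ms)
  next
   case 2
   thus ?thesis using ti by simp
  qed
 qed
qed

lemma nf_frame: "frame (mm + n) (prty mm) yy M'"
 unfolding frame_def
proof (intro conjI allI impI ballI)
 fix i assume i: "i < mm + n"
 show "yy i \<in> m" "yy i \<in> H (prty mm i)" using yy_mH[OF i] by auto
 show "cop (M' i)" by (rule MM_cop)
 fix j b assume j: "j < mm + n" and b: "b \<in> V"
 show "M' i (M' j b) = ((-1) ^ (prty mm i * prty mm j)) \<cdot> M' j (M' i b)" by (rule MM_comm[OF i j])
 have "tw (prty mm i) (yy j) = ((-1) ^ (prty mm i * prty mm j)) \<cdot> yy j"
  using tw_HH[of "yy j" "prty mm j" "prty mm i"] yy_mH[OF j] by auto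
 thus "M' i (yy j \<odot> b) = (if i = j then b else 0) + ((-1) ^ (prty mm i * prty mm j)) \<cdot> (yy j \<odot> M' i b)"
  using MM_deriv[OF i, of "yy j" b] MM_yy[OF i j] b by (simp add: prd_lin pi_V)
qed

lemma nf_kernel:
 assumes c: "c \<in> V" and z: "\<And>i. i < mm + n ==> M' i c = 0"
 shows "c \<in> cen (sysS k n P Q E)"
proof -
 have Dc: "D c = 0"
 proof (cases ct)
  case True
  have "M' (2 * k) c = (1/2) \<cdot> D c" using True by (simp add: MM_def dm_def)
  moreover have "M' (2 * k) c = 0" using True by (intro z) (simp add: dm_def)
  ultimately show ?thesis by simp
 next
  case False
  thus ?thesis using nf by (simp add: nf_def)
 qed
 have zc: "br (zz i) c = 0" if o: "ordinary mm k n i" for i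
 proof -
  have i: "i < mm + n" using o by (auto simp: ordinary_def dm_def)
  show ?thesis
  proof (cases rule: nf_index[OF i])
   case 1
   thus ?thesis using z[OF i] Dc by (simp add: Mz_def)
  next
   case 2
   thus ?thesis using o by (auto simp: ordinary_def dm_def)
  qed
 qed
 have "br (P i) c = 0 \<and> br (Q i) c = 0" if "i < k" for i
  using zc[of "k + i"] zc[of i] that by (simp add: zv_def ordinary_def br_lin)
 moreover have "br (E i) c = 0" if "i < n" for i
 proof -
  have t: "\<tau> i < n" "\<tau> (\<tau> i) = i" using nf_sys that by (auto simp: sys_def)
  thus ?thesis using zc[of "mm + \<tau> i"] that by (simp add: zv_def ordinary_def br_lin dm_def)
 qed
 ultimately show ?thesis using c Dc by (auto simp: cen_def sysS_def simp flip: D_def)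
qed

lemma nf_X_yy:
 assumes c: "c \<in> cen (sysS k n P Q E)" "c \<in> H p" and i: "i < mm + n"
 shows "X c (yy i) = (if i = 2 * k \<and> ct then - br t c else 0)"
proof -
 note A = sysS_admissible[OF nf_sys]
 have Dc: "D c = 0" by (rule cenD(2)[OF A c(1)])
 show ?thesis
 proof (cases rule: nf_index[OF i])
  case 1
  have "yy i \<in> sysS k n P Q E" using 1(1) by (auto simp: ordinary_def yv_def sysS_def dm_def)
  hence "br (yy i) c = 0" by (rule cenD(1)[OF A c(1)])
  hence "br c (yy i) = 0" by (rule br_zero_sym[OF oz(2)[OF 1(1)] c(2)])
  thus ?thesis using 1(1) Dc by (auto simp: X_def ordinary_def dm_def)
 next
  case 2
  have "br c t = - br t c" using even_skew[of t c p] nf_t[OF 2(1)] c(2) by simp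
  thus ?thesis using 2 Dc by (simp add: X_def)
 qed
qed

lemma t_cen: "ct ==> c \<in> cen (sysS k n P Q E) ==> br t c \<in> cen (sysS k n P Q E)"
proof -
 assume ct: ct and c: "c \<in> cen (sysS k n P Q E)"
 note A = sysS_admissible[OF nf_sys]
 note t = nf_t[OF ct]
 have Dc: "D c = 0" by (rule cenD(2)[OF A c])
 have "br z (br t c) = 0" if z: "z \<in> sysS k n P Q E" for z
 proof (cases "z = e")
  case True
  have "D (br t c) = br (D t) c" using Dc by (simp add: br_D)
  thus ?thesis using True t Dc by (simp add: br_lin flip: D_def)
 next
  case False
  then consider i where "i < k" "z = P i" | i where "i < k" "z = Q i" | i where "i < n" "z = E i"
   using z by (auto simp: sysS_def)
  hence tz: "br t z = - z" and "\<exists>p. z \<in> H p"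
   using nf ct nf_sys by (cases; auto simp: nf_def sys_def)+
  then obtain p where p: "z \<in> H p" by blast
  have zt: "br z t = z" using even_skew[of t z p] t p tz by simp
  have "br z c = 0" by (rule cenD(1)[OF A c z])
  moreover have "tw p t = t" using tw_HH[of t 0 p] t by simp
  ultimately show ?thesis using br_jacobi[OF p, of t c] by (simp add: zt)
 qed
 thus ?thesis by (simp add: cen_def)
qed

text \<open>In the contact case \<open>center_trivial\<close> needs \<open>\<epsilon>{t, c} = 0\<close> for even \<open>c\<close> in the centralizer with \<open>\<epsilon>(c) = 0\<close>. Otherwise
\<open>\<phi> = e + l c\<close>, with \<open>l\<close> chosen such that \<open>X\<^sub>\<phi> t\<close> vanishes at the origin, would satisfy \<open>\<epsilon> \<circ> X\<^sub>\<phi> = 0\<close>, so the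
algebra would be gauge equivalent to one whose derivation vanishes at the origin.\<close>

lemma nf_center:
 assumes small: "\<And>c c'. c \<in> cen (sysS k n P Q E) ==> c' \<in> cen (sysS k n P Q E) ==> \<epsilon> (br c c') = 0"
  and gen: "ct ==> \<forall>\<phi>\<in>H 0. \<epsilon> \<phi> \<noteq> 0 \<longrightarrow> (\<exists>b\<in>V. \<epsilon> (X \<phi> b) \<noteq> 0)"
  and c: "c \<in> cen (sysS k n P Q E)"
 shows "c = \<epsilon> c \<cdot> e"
proof (rule center_trivial[OF nf_frame sysS_admissible[OF nf_sys] nf_kernel small _ c])
 note A = sysS_admissible[OF nf_sys]
 fix i p c assume i: "i < mm + n" and c: "c \<in> cen (sysS k n P Q E)" "c \<in> m" "c \<in> H p"
 show "X c (yy i) \<in> cen (sysS k n P Q E) \<and> X c (yy i) \<in> m"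
 proof (cases "i = 2 * k \<and> ct")
  case False
  have "X c (yy i) = 0" unfolding nf_X_yy[OF c(1,3) i] by (simp only: False if_False)
  thus ?thesis using cen_in(1)[OF A] m_in(1) by simp
 next
  case True
  hence ct: ct by simp
  have Xt: "X c (yy i) = - br t c" using nf_X_yy[OF c(1,3) i] True by simp
  have "\<epsilon> (br t c) = 0"
  proof (cases "even p")
   case False
   thus ?thesis using eps_odd[OF br_H[of t 0 c p]] nf_t[OF ct] c(3) by simp
  next
   case True
   hence c0: "c \<in> H 0" using c(3) H_cong[of p 0] by simp
   show ?thesis
   proof (rule ccontr)
    assume s0: "\<epsilon> (br t c) \<noteq> 0"
    \<comment> \<open>since \<open>X\<^sub>c t = - {t, c}\<close>, this is the value for which \<open>\<epsilon> (X\<^sub>\<phi> t) = 2 - l \<epsilon> {t, c} = 0\<close>\<close>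
    define l where "l = 2 / \<epsilon> (br t c)"
    define \<phi> where "\<phi> = e + l \<cdot> c"
    have Xp: "X \<phi> b = D b + l \<cdot> X c b" for b by (simp add: \<phi>_def X_addl X_scalel X_e)
    have "\<phi> \<in> H 0" unfolding \<phi>_def using c0 H_in(2,4) e_H(1) by blast
    moreover have "\<epsilon> \<phi> \<noteq> 0" using c(2) by (simp add: \<phi>_def eps_lin m_def)
    ultimately obtain b where b: "b \<in> V" "\<epsilon> (X \<phi> b) \<noteq> 0" using gen[OF ct] by blast
    obtain c0 f where f: "c0 \<in> V" "\<And>j. j < mm + n ==> M' j c0 = 0" "b = c0 + (\<Sum>j<mm + n. yy j \<odot> f j)"
     by (rule frame_decomp_V[OF nf_frame b(1)]) blast
    have c0: "c0 \<in> cen (sysS k n P Q E)" by (rule nf_kernel[OF f(1,2)])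
    have z0: "\<epsilon> (X \<phi> c0) = 0"
     using small[OF c(1) c0] cenD(2)[OF A c(1)] cenD(2)[OF A c0] unfolding Xp by (simp add: X_def eps_lin)
    have zj: "\<epsilon> (X \<phi> (yy j \<odot> f j)) = 0" if j: "j < mm + n" for j
    proof -
     have ey: "\<epsilon> (yy j) = 0" using yy_mH[OF j] by (simp add: m_def)
     have "\<epsilon> (X \<phi> (yy j)) = 0"
     proof (cases rule: nf_index[OF j])
      case 1
      hence nj: "\<not> (j = 2 * k \<and> ct)" by (auto simp: ordinary_def dm_def)
      have "X c (yy j) = 0" unfolding nf_X_yy[OF c(1,3) j] by (simp only: nj if_False)
      thus ?thesis using oz(3)[OF 1(1)] by (simp add: Xp)
     next
      case 2
      have "X \<phi> (yy j) = 2 \<cdot> e - l \<cdot> br t c" using 2 nf_t[OF ct] nf_X_yy[OF c(1,3) j] by (simp add: Xp)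
      thus ?thesis using s0 by (simp add: eps_lin l_def)
     qed
     moreover have "X \<phi> (yy j \<odot> f j) = X \<phi> (yy j) \<odot> f j + yy j \<odot> X \<phi> (f j)"
      using X_deriv[OF \<open>\<phi> \<in> H 0\<close>] by (simp add: tw_def)
     ultimately show ?thesis using ey by (simp add: eps_lin eps_prd)
    qed
    have "X \<phi> b = X \<phi> c0 + (\<Sum>j<mm + n. X \<phi> (yy j \<odot> f j))" unfolding f(3) by (simp add: X_lin)
    hence "\<epsilon> (X \<phi> b) = 0" using z0 zj by (simp add: eps_lin)
    thus False using b(2) by simp
   qed
  qed
  thus ?thesis using Xt cen_in(6)[OF A t_cen[OF ct c(1)]] by (simp add: m_def eps_lin)
 qed
qed

end

end

lemma sum_lessThan_add:
 fixes f :: "nat => 'a::comm_monoid_add"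
 shows "(\<Sum>i<a + b. f i) = (\<Sum>i<a. f i) + (\<Sum>j<b. f (a + j))"
 by (induction b) (simp_all add: add.assoc)

context lgp
begin

subsection \<open>Existence of normal forms\<close>

text \<open>\<open>u = D x\<close> is invertible for a suitable \<open>x\<close>, and \<open>u\<inverse> D\<close> can be integrated along \<open>x\<close>.\<close>

lemma contact_start:
 assumes b: "\<epsilon> (D b) \<noteq> 0"
 obtains t where "t \<in> m" "t \<in> H 0" "D t = 2 \<cdot> e"
proof -
 define x where "x = P0 b - \<epsilon> b \<cdot> e"
 have x: "x \<in> m" using m_in(10)[of "P0 b"] by (simp add: x_def)
 have xH: "x \<in> H 0" unfolding x_def by (rule H_in(3)[OF P_in_H(1) H_in(4)[OF e_H(1)]])
 have DP: "D (P0 z) = P0 (D z)" for z using even_br[OF e_H(1), of z] by (simp add: D_def)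
 define u where "u = D x"
 have "u = P0 (D b)" by (simp add: u_def x_def D_lin br_ee DP)
 hence eu: "\<epsilon> u \<noteq> 0" using b by simp
 have uH: "u \<in> H 0" unfolding u_def by (rule D_H[OF xH])
 obtain v where v: "v \<in> H 0" "u \<odot> v = e" "v \<odot> u = e" by (rule ex_inverse[OF uH eu])
 define M where "M = (\<lambda>b. v \<odot> D b)"
 have cM: "cop M" unfolding M_def by (intro cop_mult cop_D)
 have comm: "M (x \<odot> b) = b + x \<odot> M b" if "b \<in> V" for b
 proof -
  have "M (x \<odot> b) = v \<odot> (u \<odot> b) + v \<odot> (x \<odot> D b)" by (simp add: M_def D_deriv prd_lin u_def)
  also have "v \<odot> (u \<odot> b) = b" using v(3) that by (simp add: pi_V flip: assoc)
  also have "v \<odot> (x \<odot> D b) = x \<odot> M b" unfolding M_def by (rule even_left_commute[OF v(1), symmetric])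
  finally show ?thesis .
 qed
 define t' where "t' = x \<odot> Jq M x (2 \<cdot> v)"
 have "M t' = 2 \<cdot> v" unfolding t'_def by (rule integration[OF cM x comm]) (use H_V[OF v(1)] in auto)
 hence "u \<odot> (v \<odot> D t') = 2 \<cdot> e" using v(2) by (simp add: M_def prd_lin)
 hence "D t' = 2 \<cdot> e" using v(2) by (simp add: pi_V flip: assoc)
 moreover have "t' \<in> m" unfolding t'_def by (rule m_in(7)[OF x])
 ultimately show thesis by (intro that[of "P0 t'"]) (auto simp: m_in DP Plin)
qed

lemma shift_t:
 assumes nf: "nf True \<tau> k n P Q E t" and h: "h \<in> cen (sysS k n P Q E)" "h \<in> H 0"
 shows "nf True \<tau> k n P Q E (t + h - \<epsilon> h \<cdot> e)"
proof -
 note s = nf_sys[OF nf]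
 note A = sysS_admissible[OF s]
 have z: "br h y = 0 \<and> br e y = 0" if y: "y \<in> sysS k n P Q E" for y
 proof -
  obtain p where p: "y \<in> H p" using S_H[OF A y] by blast
  show ?thesis using br_zero_sym[OF p h(2) cenD(1)[OF A h(1) y]] S_D[OF A y] by (simp add: D_def)
 qed
 have "br (t + h - \<epsilon> h \<cdot> e) y = - y" if "y \<in> sysS k n P Q E" "br t y = - y" for y
  using z[OF that(1)] that(2) by (simp add: br_lin)
 moreover have "P i \<in> sysS k n P Q E" "Q i \<in> sysS k n P Q E" if "i < k" for i using that by (auto simp: sysS_def)
 moreover have "E i \<in> sysS k n P Q E" if "i < n" for i using that by (auto simp: sysS_def)
 moreover have "t + (h - \<epsilon> h \<cdot> e) \<in> m" using nf m_in(10)[OF H_V[OF h(2)]] by (auto simp: nf_def intro: m_in)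
 moreover have "t + h - \<epsilon> h \<cdot> e \<in> H 0"
  using nf h(2) H_in(2,3,4) e_H(1) by (auto simp: nf_def)
 moreover have "D (t + h - \<epsilon> h \<cdot> e) = 2 \<cdot> e"
  using nf cenD(2)[OF A h(1)] by (simp add: nf_def D_lin br_ee)
 ultimately show ?thesis using nf by (simp add: nf_def add_diff_eq)
qed

text \<open>For \<open>t\<close> corrected by \<open>h\<close> to act on \<open>p\<close> and \<open>q\<close> by \<open>-1\<close>, one has to solve \<open>{p, h} = g\<^sub>p\<close>, \<open>{q, h} = g\<^sub>q\<close> inside the
centralizer. The compatibility condition \<open>{p, g\<^sub>q} = {q, g\<^sub>p}\<close> is the Jacobi identity for \<open>t, p, q\<close>; the
solution is a double integration, along \<open>q\<close> and then along \<open>p\<close>.\<close>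

lemma contact_even:
 assumes nf: "nf True id k n P Q E t" and p: "p \<in> cen (sysS k n P Q E)" "p \<in> m" "p \<in> H 0"
  and q: "q \<in> cen (sysS k n P Q E)" "q \<in> m" "q \<in> H 0" and pq: "br p q = e"
 shows "\<exists>t. nf True id (Suc k) n (P(k := p)) (Q(k := q)) E t"
proof -
 let ?C = "cen (sysS k n P Q E)"
 note s = nf_sys[OF nf]
 note A = sysS_admissible[OF s]
 note ci = cen_in[OF A] and cD = cenD[OF A]
 have t: "t \<in> m" "t \<in> H 0" "D t = 2 \<cdot> e" using nf by (auto simp: nf_def)
 define gp where "gp = br t p + p"
 define gq where "gq = br t q + q"
 have g: "gp \<in> ?C" "gq \<in> ?C" using t_cen[OF nf] p q ci by (auto simp: gp_def gq_def)
 have gH: "gp \<in> H 0" "gq \<in> H 0" using br_H[OF t(2) p(3)] br_H[OF t(2) q(3)] p q H_in(2) by (auto simp: gp_def gq_def)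
 have qp: "br q p = - e" using even_skew[OF p(3) q(3)] pq by simp
 have te: "br t e = - (2 \<cdot> e)" using br_e[OF H_V[OF t(2)]] t(3) by simp
 have "br t (br p q) = br (br t p) q + br p (br t q)" using br_jacobi[OF t(2), of p q] by (simp add: tw_def)
 hence "- (2 \<cdot> e) = br gp q - e + (br p gq - e)" using te pq by (simp add: gp_def gq_def br_lin)
 moreover have "(2::'k) \<cdot> e = e + e" by (metis one_add_one scale_left_distrib scale_one)
 ultimately have "br gp q + br p gq = 0" by (simp add: algebra_simps)
 moreover have "br gp q = - br q gp" using even_skew[OF q(3) gH(1)] .
 ultimately have rel: "br p gq = br q gp" by (simp add: algebra_simps)
 \<comment> \<open>\<open>h1\<close> solves the first equation; \<open>h2\<close> corrects the second one and commutes with \<open>p\<close>\<close>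
 define h1 where "h1 = q \<odot> Jq (br p) q gp"
 have ph1: "br p h1 = gp" unfolding h1_def
  by (rule integration[OF cop_br q(2)]) (use cen_deriv[OF A p(1,3)] pq cD(3)[OF g(1)] in \<open>auto simp: tw_def pi_V\<close>)
 have h1C: "h1 \<in> ?C" unfolding h1_def by (rule cen_Jq[OF A q(1,2) _ g(1)]) (use p ci in auto)
 define r where "r = gq - br q h1"
 have rC: "r \<in> ?C" unfolding r_def using g q h1C ci by auto
 have pqc: "br p (br q c) = br q (br p c)" if "c \<in> ?C" for c
  using br_jacobi[OF p(3), of q c] pq cD(2)[OF that] by (simp add: tw_def flip: D_def)
 have pr: "br p r = 0" using pqc[OF h1C] ph1 rel by (simp add: r_def br_lin)
 define M where "M = (\<lambda>b. - br q b)"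
 have cM: "cop M" unfolding M_def by (intro cop_uminus cop_br)
 have MC: "M c \<in> ?C" if "c \<in> ?C" for c using that q ci by (auto simp: M_def)
 have comm: "M (p \<odot> b) = b + p \<odot> M b" if "b \<in> V" for b
  using cen_deriv[OF A q(1,3), of p b] qp that by (simp add: M_def tw_def prd_lin pi_V)
 define h2 where "h2 = p \<odot> Jq M p (- r)"
 have "M h2 = - r" unfolding h2_def by (rule integration[OF cM p(2) comm]) (use cD(3)[OF rC] in auto)
 hence qh2: "br q h2 = r" by (simp add: M_def)
 have h2C: "h2 \<in> ?C" unfolding h2_def by (rule cen_Jq[OF A p(1,2) MC]) (use rC ci in auto)
 have pw: "(M ^^ i) (- r) \<in> ?C \<and> br p ((M ^^ i) (- r)) = 0" for i
 proof (induction i)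
  case 0 show ?case using rC ci pr by (simp add: br_lin)
 next
  case (Suc i)
  have "br p (M ((M ^^ i) (- r))) = M (br p ((M ^^ i) (- r)))"
   using pqc[of "(M ^^ i) (- r)"] Suc by (simp add: M_def br_lin)
  thus ?case using Suc MC by (simp add: M_def)
 qed
 have ep: "br p (epow p i) = 0" for i
 proof (induction i)
  case 0 show ?case using br_e[OF H_V[OF p(3)]] cD(2)[OF p(1)] by simp
 next
  case (Suc i)
  thus ?case using cen_deriv[OF A p(1,3), of p "epow p i"] even_self[OF p(3)] by simp
 qed
 have ph2: "br p h2 = 0" unfolding h2_def
 proof (rule Jq_kernel[OF p(2) cop_br])
  fix i
  show "br p (epow p (Suc i) \<odot> (M ^^ i) (- r)) = 0"
   using cen_deriv[OF A p(1,3), of "epow p (Suc i)"] ep[of "Suc i"] pw[of i] by simp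
 qed
 define h where "h = P0 (h1 + h2)"
 have hC: "h \<in> ?C" "h \<in> H 0" using h1C h2C ci by (auto simp: h_def)
 have "br p h = P0 gp" unfolding h_def even_br[OF p(3), symmetric] using ph1 ph2 by (simp add: br_lin)
 hence ph: "br p h = gp" using gH(1) by (simp add: H_def)
 have "br q h = P0 gq" unfolding h_def even_br[OF q(3), symmetric] using qh2 by (simp add: br_lin r_def)
 hence qh: "br q h = gq" using gH(2) by (simp add: H_def)
 have hp: "br h p = - gp" "br h q = - gq"
  using even_skew[OF p(3) hC(2)] even_skew[OF q(3) hC(2)] ph qh by simp_all
 define t' where "t' = t + h - \<epsilon> h \<cdot> e"
 have "br t' p = - p" "br t' q = - q"
  using hp cD(2)[OF p(1)] cD(2)[OF q(1)] by (simp_all add: t'_def br_lin gp_def gq_def flip: D_def)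
 moreover have "nf True id k n P Q E t'" unfolding t'_def by (rule shift_t[OF nf hC])
 ultimately have "nf True id (Suc k) n (P(k := p)) (Q(k := q)) E t'"
  using sys_add_even[OF s p q pq] by (auto simp: nf_def less_Suc_eq)
 thus ?thesis by blast
qed

lemma contact_odd:
 assumes nf: "nf True id k n P Q E t" and x: "\<xi> \<in> cen (sysS k n P Q E)" "\<xi> \<in> m" "\<xi> \<in> H 1" and xx: "br \<xi> \<xi> = - e"
 shows "\<exists>t. nf True id k (Suc n) P Q (E(n := \<xi>)) t"
proof -
 let ?C = "cen (sysS k n P Q E)"
 note s = nf_sys[OF nf]
 note A = sysS_admissible[OF s]
 note ci = cen_in[OF A] and cD = cenD[OF A]
 have t: "t \<in> m" "t \<in> H 0" "D t = 2 \<cdot> e" using nf by (auto simp: nf_def)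
 define g where "g = br t \<xi> + \<xi>"
 have gC: "g \<in> ?C" using t_cen[OF nf] x ci by (auto simp: g_def)
 have gH: "g \<in> H 1" using br_H[OF t(2) x(3)] x(3) H_in(2) by (auto simp: g_def)
 have te: "br t e = - (2 \<cdot> e)" using br_e[OF H_V[OF t(2)]] t(3) by simp
 have two: "(2::'k) \<cdot> z = z + z" for z by (metis one_add_one scale_left_distrib scale_one)
 have sx: "br g \<xi> = br \<xi> g" using br_skew[OF gH, of \<xi>] tw_HH[OF x(3), of 1] by (simp add: br_lin)
 have "br t (br \<xi> \<xi>) = br (br t \<xi>) \<xi> + br \<xi> (br t \<xi>)" using br_jacobi[OF t(2), of \<xi> \<xi>] by (simp add: tw_def)
 hence "2 \<cdot> e = (br g \<xi> + e) + (br \<xi> g + e)" using te xx by (simp add: g_def br_lin)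
 hence "br \<xi> g + br \<xi> g = 0" unfolding two sx by (simp add: algebra_simps)
 hence xg: "br \<xi> g = 0" by (rule two_zero)
 define h where "h = - (\<xi> \<odot> g)"
 have hC: "h \<in> ?C" "h \<in> H 0"
  using ci(6)[OF ci(9)[OF x(1) gC]] H_in(5)[OF prd_H[OF x(3) gH]] H_cong[of "1 + 1" 0] by (auto simp: h_def)
 have "br \<xi> h = g"
  using cen_deriv[OF A x(1,3), of \<xi> g] xx xg cD(3)[OF gC] by (simp add: h_def br_lin prd_lin pi_V)
 hence hx: "br h \<xi> = - g" using even_skew[OF hC(2) x(3)] by (metis minus_minus)
 define t' where "t' = t + h - \<epsilon> h \<cdot> e"
 have "br t' \<xi> = - \<xi>" using hx cD(2)[OF x(1)] by (simp add: t'_def br_lin g_def flip: D_def)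
 moreover have "nf True id k n P Q E t'" unfolding t'_def by (rule shift_t[OF nf hC])
 ultimately have "nf True id k (Suc n) P Q (E(n := \<xi>)) t'"
  using sys_add_odd[OF s x xx] by (auto simp: nf_def less_Suc_eq)
 thus ?thesis by blast
qed

text \<open>A normal form with the largest possible number of coordinates has a centralizer whose bracket vanishes at the
origin, for otherwise \<open>split_step\<close> would enlarge it.\<close>

lemma nf_exists:
 assumes "(\<forall>x. D x = 0) \<or> (\<forall>\<phi>\<in>H 0. \<epsilon> \<phi> \<noteq> 0 \<longrightarrow> (\<exists>b\<in>V. \<epsilon> (X \<phi> b) \<noteq> 0))"
 shows "\<exists>ct k n P Q E t. nf ct id k n P Q E t \<and> (\<forall>c\<in>cen (sysS k n P Q E). c = \<epsilon> c \<cdot> e)"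
proof -
 define ct where "ct \<longleftrightarrow> \<not> (\<forall>x. D x = 0)"
 have gen: "\<forall>\<phi>\<in>H 0. \<epsilon> \<phi> \<noteq> 0 \<longrightarrow> (\<exists>b\<in>V. \<epsilon> (X \<phi> b) \<noteq> 0)" if ct using that assms by (auto simp: ct_def)
 define R where "R r \<longleftrightarrow> (\<exists>k n P Q E t. nf ct id k n P Q E t \<and> 2 * k + n = r)" for r
 obtain N where N: "\<And>\<tau> k n P Q E. sys \<tau> k n P Q E ==> 2 * k + n \<le> N" using sys_bound by blast
 have bound: "r \<le> N" if "R r" for r using that N nf_sys unfolding R_def by blast
 have "R 0"
 proof (cases ct)
  case True
  obtain b where "\<epsilon> (X e b) \<noteq> 0" using gen[OF True] e_H(1) eps_e by (metis zero_neq_one)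
  then obtain t where "t \<in> m" "t \<in> H 0" "D t = 2 \<cdot> e" using contact_start[of b] by (auto simp: X_e)
  hence "nf True id 0 0 (\<lambda>_. 0) (\<lambda>_. 0) (\<lambda>_. 0) t" by (simp add: nf_def sys_def)
  thus ?thesis using True unfolding R_def by (metis add_0 mult_0_right)
 next
  case False
  hence "nf False id 0 0 (\<lambda>_. 0) (\<lambda>_. 0) (\<lambda>_. 0) 0" by (simp add: nf_def sys_def ct_def)
  thus ?thesis using False unfolding R_def by (metis add_0 mult_0_right)
 qed
 define r where "r = (GREATEST r. R r)"
 have Rr: "R r" unfolding r_def using GreatestI_nat[of R 0 N] \<open>R 0\<close> bound by blast
 have mx: "\<not> R r'" if "r' > r" for r'
  using Greatest_le_nat[of R r' N] bound that unfolding r_def by (metis not_le)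
 obtain k n P Q E t where nf: "nf ct id k n P Q E t" and rr: "2 * k + n = r" using Rr unfolding R_def by blast
 note s = nf_sys[OF nf]
 note A = sysS_admissible[OF s]
 have small: "\<epsilon> (br a b) = 0" if ab: "a \<in> cen (sysS k n P Q E)" "b \<in> cen (sysS k n P Q E)" for a b
 proof (rule ccontr)
  assume nz: "\<epsilon> (br a b) \<noteq> 0"
  show False
  proof (rule split_step[OF A ab nz])
   fix p q assume *: "p \<in> cen (sysS k n P Q E)" "p \<in> m" "p \<in> H 0"
    "q \<in> cen (sysS k n P Q E)" "q \<in> m" "q \<in> H 0" "br p q = e"
   have "\<exists>t. nf ct id (Suc k) n (P(k := p)) (Q(k := q)) E t"
   proof (cases ct)
    case True
    thus ?thesis using contact_even[of k n P Q E t p q] nf * by simp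
   next
    case False
    thus ?thesis using sys_add_even[OF s *] nf by (auto simp: nf_def)
   qed
   hence "R (2 * Suc k + n)" unfolding R_def by blast
   thus False using mx rr by simp
  next
   fix \<xi> assume *: "\<xi> \<in> cen (sysS k n P Q E)" "\<xi> \<in> m" "\<xi> \<in> H 1" "br \<xi> \<xi> = - e"
   have "\<exists>t. nf ct id k (Suc n) P Q (E(n := \<xi>)) t"
   proof (cases ct)
    case True
    thus ?thesis using contact_odd[of k n P Q E t \<xi>] nf * by simp
   next
    case False
    thus ?thesis using sys_add_odd[OF s *] nf by (auto simp: nf_def)
   qed
   hence "R (2 * k + Suc n)" unfolding R_def by blast
   thus False using mx rr by simp
  qed
 qed
 have "\<forall>c\<in>cen (sysS k n P Q E). c = \<epsilon> c \<cdot> e"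
  using nf_center[OF nf small gen] by blast
 with nf show ?thesis by blast
qed

definition swap2 :: "nat => nat => nat" where
 "swap2 n i = (if 2 \<le> n \<and> i = n - 2 then n - 1 else if 2 \<le> n \<and> i = n - 1 then n - 2 else i)"

text \<open>Over an algebraically closed field, two orthogonal odd elements of square \<open>-1\<close> span a hyperbolic plane; this
gives the shape of the last two odd variables in \<open>P(m,n)\<close>.\<close>

lemma nf_hyperbolic:
 assumes nf: "nf ct id k n P Q E t"
 shows "\<exists>E'. nf ct (swap2 n) k n P Q E' t \<and> cen (sysS k n P Q E') \<subseteq> cen (sysS k n P Q E)"
proof (cases "2 \<le> n")
 case False
 hence "swap2 n = id" by (auto simp: swap2_def)
 thus ?thesis using nf by auto
next
 case True
 note S = nf_sys[OF nf, unfolded sys_def]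
 define a b where "a = n - 2" and "b = n - 1"
 have ab: "a < n" "b < n" "a \<noteq> b" using True by (auto simp: a_def b_def)
 obtain c where c: "c ^ 2 = (1/2 :: 'k)" using nth_root_exists[of 2 "1/2 :: 'k"] by auto
 obtain w where w: "w ^ 2 = (-1 :: 'k)" using nth_root_exists[of 2 "-1 :: 'k"] by auto
 have cc: "c * c = 1/2" and ww: "w * w = -1" using c w by (simp_all add: power2_eq_square)
 have c0: "c \<noteq> 0" using c by auto
 \<comment> \<open>\<open>E a \<plusminus> w E b\<close> are isotropic, and \<open>c\<close> makes their mutual bracket \<open>-1\<close>\<close>
 define E' where "E' = E(a := c \<cdot> (E a + w \<cdot> E b), b := c \<cdot> (E a - w \<cdot> E b))"
 have sw: "swap2 n i = (if i = a then b else if i = b then a else i)" for i using True by (simp add: swap2_def a_def b_def)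
 have EE: "br (E i) (E j) = (if i = j then - e else 0)" if "i < n" "j < n" for i j using S that by simp
 have E'a: "E' a = c \<cdot> (E a + w \<cdot> E b)" and E'b: "E' b = c \<cdot> (E a - w \<cdot> E b)"
  and E'i: "i \<noteq> a ==> i \<noteq> b ==> E' i = E i" for i using ab by (auto simp: E'_def)
 have lin: "\<exists>u v i' j'. E' i = u \<cdot> E i' + v \<cdot> E j' \<and> i' < n \<and> j' < n" if "i < n" for i
 proof -
  consider "i = a" | "i = b" | "i \<noteq> a" "i \<noteq> b" by blast
  thus ?thesis
  proof cases
   case 1
   have "E' i = c \<cdot> E a + (c * w) \<cdot> E b" using 1 E'a by (simp add: scale_right_distrib)
   thus ?thesis using ab by blast
  next
   case 2
   have "E' i = c \<cdot> E a + (- (c * w)) \<cdot> E b" using 2 E'b by (simp add: scale_right_diff_distrib)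
   thus ?thesis using ab by blast
  next
   case 3
   have "E' i = 1 \<cdot> E i + 0 \<cdot> E i" using E'i[OF 3] by simp
   thus ?thesis using that by blast
  qed
 qed
 have E1: "E' i \<in> m \<and> E' i \<in> H 1 \<and> D (E' i) = 0" if i: "i < n" for i
 proof -
  obtain u v i' j' where l: "E' i = u \<cdot> E i' + v \<cdot> E j'" "i' < n" "j' < n" using lin[OF i] by blast
  thus ?thesis using S m_in(2,4) H_in(2,4) by (simp add: D_lin)
 qed
 have E2: "br x (E' j) = 0" if "\<And>j. j < n ==> br x (E j) = 0" "j < n" for x j
  using lin[OF that(2)] that(1) by (auto simp: br_lin)
 have E3: "br (E' i) (E' j) = (if swap2 n i = j then - e else 0)" if ij: "i < n" "j < n" for i j
 proof -
  have cwcw: "c * (w * (c * w)) = - (1/2)" by (metis cc ww mult.assoc mult.left_commute mult_minus1_right)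
  consider (a) "i = a" | (b) "i = b" | (o) "i \<noteq> a" "i \<noteq> b" by blast
  note ci = this
  consider (a) "j = a" | (b) "j = b" | (o) "j \<noteq> a" "j \<noteq> b" by blast
  note cj = this
  have "(1/2::'k) \<cdot> e + (1/2) \<cdot> e = e" by (simp flip: scale_left_distrib)
  hence half: "- ((1/2::'k) \<cdot> e) - (1/2) \<cdot> e = - e" by (metis minus_add_distrib uminus_add_conv_diff add.commute)
  show ?thesis
   using ab ij EE half
   by (cases rule: ci; cases rule: cj;
     simp add: E'a E'b E'i sw br_lin scale_right_distrib scale_right_diff_distrib cc ww cwcw mult.assoc)
 qed
 have "sys (swap2 n) k n P Q E'"
  unfolding sys_def using S E1 E2 E3 ab sw by auto
 moreover have "br t (E' i) = - E' i" if ct: ct and i: "i < n" for i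
 proof -
  obtain u v i' j' where l: "E' i = u \<cdot> E i' + v \<cdot> E j'" "i' < n" "j' < n" using lin[OF i] by blast
  thus ?thesis using nf ct by (simp add: nf_def br_lin)
 qed
 ultimately have "nf ct (swap2 n) k n P Q E' t" using nf by (simp add: nf_def)
 moreover have "cen (sysS k n P Q E') \<subseteq> cen (sysS k n P Q E)"
 proof
  fix z assume z: "z \<in> cen (sysS k n P Q E')"
  have zE': "br (E' i) z = 0" if "i < n" for i using z that by (auto simp: cen_def sysS_def)
  have 1: "c \<cdot> br (E a) z + (c * w) \<cdot> br (E b) z = 0" "c \<cdot> br (E a) z - (c * w) \<cdot> br (E b) z = 0"
   using zE'[OF ab(1)] zE'[OF ab(2)] by (simp_all add: E'a E'b br_lin scale_right_distrib scale_right_diff_distrib)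
  have "c \<cdot> br (E a) z + c \<cdot> br (E a) z = 0" using 1 by (metis add.commute add_diff_cancel_left' diff_add_cancel diff_zero eq_iff_diff_eq_0)
  hence Ea: "br (E a) z = 0" using two_zero c0 by (metis scale_eq_0_iff)
  hence Eb: "br (E b) z = 0" using 1(1) c0 ww by auto
  have "br (E i) z = 0" if "i < n" for i using zE'[OF that] Ea Eb E'i[of i] by (cases "i = a"; cases "i = b") auto
  thus "z \<in> cen (sysS k n P Q E)" using z by (auto simp: cen_def sysS_def)
 qed
 ultimately show ?thesis by blast
qed

theorem canonical_coordinates:
 assumes "(\<forall>x. D x = 0) \<or> (\<forall>\<phi>\<in>H 0. \<epsilon> \<phi> \<noteq> 0 \<longrightarrow> (\<exists>b\<in>V. \<epsilon> (X \<phi> b) \<noteq> 0))"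
 shows "\<exists>ct k n P Q E t. nf ct (swap2 n) k n P Q E t \<and> (\<forall>c\<in>cen (sysS k n P Q E). c = \<epsilon> c \<cdot> e)"
 using nf_exists[OF assms] nf_hyperbolic by (meson subsetD)

subsection \<open>The bracket in canonical coordinates\<close>

context
 fixes ct \<tau> k n P Q E t
 assumes nf: "nf ct \<tau> k n P Q E t" and cen: "\<And>c. c \<in> cen (sysS k n P Q E) ==> c = \<epsilon> c \<cdot> e"
begin

abbreviation (input) "mc \<equiv> dm ct k"
abbreviation (input) "yc \<equiv> yv (dm ct k) k P Q E t"
abbreviation (input) "Mc \<equiv> MM \<tau> (dm ct k) k P Q E"

lemma coord_decomp:
 assumes a: "a \<in> V"
 obtains f where "\<And>i. i < mc + n ==> f i \<in> V" "a = \<epsilon> a \<cdot> e + (\<Sum>i<mc + n. yc i \<odot> f i)"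
proof -
 obtain c f where f: "c \<in> V" "\<And>i. i < mc + n ==> Mc i c = 0" "\<And>i. i < mc + n ==> f i \<in> V"
  "a = c + (\<Sum>i<mc + n. yc i \<odot> f i)"
  by (rule frame_decomp_V[OF nf_frame[OF nf] a]) blast
 have c: "c = \<epsilon> c \<cdot> e" by (rule cen[OF nf_kernel[OF nf f(1,2)]])
 have "\<epsilon> (\<Sum>i<mc + n. yc i \<odot> f i) = 0" using yy_mH[OF nf] by (simp add: eps_lin eps_prd m_def)
 hence "\<epsilon> a = \<epsilon> c" using arg_cong[OF f(4), of \<epsilon>] by (simp add: eps_lin)
 thus thesis using that f(3,4) c by metis
qed

text \<open>A derivation that kills the coordinates is zero: it maps everything into every power of the maximal ideal.\<close>

lemma deriv_zero:
 assumes add: "\<And>x z. d (x + z) = d x + d z" and sc: "\<And>c x. d (c \<cdot> x) = c \<cdot> d x"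
  and der: "\<And>x z. d (x \<odot> z) = d x \<odot> z + tw p x \<odot> d z" and dV: "\<And>x. d x \<in> V" and de: "d e = 0"
  and dy: "\<And>i. i < mc + n ==> d (yc i) = 0" and a: "a \<in> V"
 shows "d a = 0"
proof (rule mp_Inter[OF dV])
 have d0: "d 0 = 0" using sc[of 0 0] by simp
 have ds: "d (\<Sum>i\<in>A. g i) = (\<Sum>i\<in>A. d (g i))" for A :: "nat set" and g
  by (induction A rule: infinite_finite_induct) (auto simp: d0 add)
 fix l
 show "d a \<in> mp l" using a
 proof (induction l arbitrary: a)
  case 0 show ?case using dV by simp
 next
  case (Suc l)
  obtain f where f: "\<And>i. i < mc + n ==> f i \<in> V" "a = \<epsilon> a \<cdot> e + (\<Sum>i<mc + n. yc i \<odot> f i)"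
   by (rule coord_decomp[OF Suc.prems]) blast
  have "d a = (\<Sum>i<mc + n. d (yc i \<odot> f i))" by (subst f(2)) (simp add: add sc de ds)
  also have "\<dots> = (\<Sum>i<mc + n. tw p (yc i) \<odot> d (f i))" by (rule sum.cong) (auto simp: der dy)
  also have "\<dots> \<in> mp (Suc l)"
   using Suc.IH f(1) yy_mH[OF nf] by (intro mp_in(5) mp_mult m_in(8)) auto
  finally show ?case .
 qed
qed

lemma X_expand:
 assumes a: "a \<in> H p" and b: "b \<in> V"
 shows "X a b = (\<Sum>i<mc + n. X a (yc i) \<odot> Mc i b)"
proof -
 define d where "d b = X a b - (\<Sum>i<mc + n. X a (yc i) \<odot> Mc i b)" for b
 note Ml = cop_lin[OF MM_cop[OF nf]]
 have "d b = 0"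
 proof (rule deriv_zero[OF _ _ _ _ _ _ b])
  show "d (x + z) = d x + d z" for x z by (simp add: d_def X_lin Ml prd_lin sum.distrib)
  show "d (c \<cdot> x) = c \<cdot> d x" for c x by (simp add: d_def X_lin Ml prd_lin scale_right_diff_distrib scale_sum_right)
  show "d x \<in> V" for x unfolding d_def by (intro V_in V_sum) auto
  show "d e = 0"
  proof -
   have "Mc i e = 0" if "i < mc + n" for i
   proof -
    have "Mc i (e \<odot> e) = Mc i e \<odot> e + tw (prty mc i) e \<odot> Mc i e" by (rule MM_deriv[OF nf that])
    thus ?thesis by (simp add: pi_V cop_V[OF MM_cop[OF nf]])
   qed
   moreover have "X a e = 0" using X_deriv[OF a, of e e] by (simp add: pi_V)
   ultimately show ?thesis by (simp add: d_def)
  qed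
  show "d (yc j) = 0" if j: "j < mc + n" for j
  proof -
   have "(\<Sum>i<mc + n. X a (yc i) \<odot> Mc i (yc j)) = (\<Sum>i<mc + n. if i = j then X a (yc i) else 0)"
    by (rule sum.cong) (use MM_yy[OF nf _ j] in \<open>auto simp: pi_V\<close>)
   thus ?thesis using j by (simp add: d_def)
  qed
  show "d (x \<odot> z) = d x \<odot> z + tw p x \<odot> d z" for x z
  proof -
   have "X a (yc i) \<odot> Mc i (x \<odot> z) = X a (yc i) \<odot> Mc i x \<odot> z + tw p x \<odot> (X a (yc i) \<odot> Mc i z)" if i: "i < mc + n" for i
   proof -
    have "X a (yc i) \<in> H (p + prty mc i)" using X_H[OF a] yy_mH[OF nf i] by blast
    hence "X a (yc i) \<odot> tw (prty mc i) x = tw (p + prty mc i) (tw (prty mc i) x) \<odot> X a (yc i)" by (rule comm_tw)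
    hence "X a (yc i) \<odot> (tw (prty mc i) x \<odot> w) = tw (p + prty mc i) (tw (prty mc i) x) \<odot> (X a (yc i) \<odot> w)" for w
     by (metis assoc)
    also have "tw (p + prty mc i) (tw (prty mc i) x) \<odot> w = tw p x \<odot> w" for w
    proof -
     have "tw (p + prty mc i + prty mc i) = tw p" by (rule tw_cong) auto
     thus ?thesis by (simp add: prd_tw_tw)
    qed
    finally show ?thesis by (simp add: MM_deriv[OF nf i] prd_lin assoc)
   qed
   thus ?thesis by (simp add: d_def X_deriv[OF a] prd_lin prd_sum sum.distrib algebra_simps)
  qed
 qed
 thus ?thesis by (simp add: d_def)
qed

definition Eul where "Eul a = (\<Sum>i<k. P i \<odot> Mc i a + Q i \<odot> Mc (k + i) a) + (\<Sum>j<n. E j \<odot> Mc (mc + j) a)"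

lemma sum_coords:
 fixes g :: "nat => 'v"
 shows "(\<Sum>i<mc + n. g i) = (\<Sum>i<k. g i + g (k + i)) + (if ct then g (2 * k) else 0) + (\<Sum>j<n. g (mc + j))"
proof -
 have "(\<Sum>i<mc. g i) = (\<Sum>i<k + k. g i) + (if ct then g (2 * k) else 0)" by (simp add: dm_def mult_2)
 also have "(\<Sum>i<k + k. g i) = (\<Sum>i<k. g i + g (k + i))" by (simp add: sum_lessThan_add sum.distrib)
 finally show ?thesis by (simp add: sum_lessThan_add)
qed

lemma t_expand: assumes ct and a: "a \<in> V" shows "br t a = Eul a + t \<odot> D a - 2 \<cdot> a"
proof -
 note t = nf_t[OF nf assms(1)]
 have Xt: "X t z = br t z + 2 \<cdot> pi z" for z using t by (simp add: X_def prd_lin)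
 have o: "X t (yc i) = yc i" if "ordinary mc k n i" for i
 proof -
  have "i < mc + n" using that by (auto simp: ordinary_def dm_def)
  hence "pi (yc i) = yc i" using yy_mH[OF nf] m_V pi_V by blast
  moreover have "(2::'k) \<cdot> z = z + z" for z by (metis one_add_one scale_left_distrib scale_one)
  ultimately show ?thesis using t_yy[OF nf assms(1) that] by (simp add: Xt)
 qed
 have oP: "X t (P i) = P i" "X t (Q i) = Q i" if "i < k" for i
  using o[of i] o[of "k + i"] that by (simp_all add: ordinary_def yv_def)
 have oE: "X t (E j) = E j" if "j < n" for j
  using o[of "mc + j"] that by (simp add: ordinary_def yv_def dm_def)
 have Xtt: "X t t = 2 \<cdot> t" using even_self[of t] t m_V pi_V by (simp add: Xt)
 have "X t a = (\<Sum>i<mc + n. X t (yc i) \<odot> Mc i a)" by (rule X_expand[of t 0]) (use t a in auto)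
 also have "\<dots> = (\<Sum>i<k. P i \<odot> Mc i a + Q i \<odot> Mc (k + i) a) + X t t \<odot> Mc (2 * k) a + (\<Sum>j<n. E j \<odot> Mc (mc + j) a)"
  unfolding sum_coords using assms(1) oP oE by (simp add: yv_def dm_def)
 also have "X t t \<odot> Mc (2 * k) a = t \<odot> D a" using assms(1) by (simp add: Xtt MM_def dm_def prd_lin)
 finally show ?thesis using a by (simp add: Xt Eul_def pi_V algebra_simps)
qed

text \<open>The derivation \<open>X\<^sub>a\<close> is determined by its values on the coordinates, and these values are given by the derivations dual to the
coordinates; the Euler operator appears in the contact case through \<open>{t, a} = Eul a + t D a - 2 a\<close>.\<close>

theorem bracket_formula:
 assumes a: "a \<in> H p" and b: "b \<in> V"
 shows "br a b = (\<Sum>i<k. Mc i a \<odot> Mc (k + i) b - Mc (k + i) a \<odot> Mc i b)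
  + (\<Sum>j<n. Mc (mc + \<tau> j) (sg a) \<odot> Mc (mc + j) b)
  + (if ct then (2 \<cdot> a - Eul a) \<odot> Mc (2 * k) b - Mc (2 * k) a \<odot> (2 \<cdot> b - Eul b) else 0)"
proof -
 note S = nf_sys[OF nf, unfolded sys_def]
 have aV: "a \<in> V" by (rule H_V[OF a])
 have DaH: "D a \<in> H p" by (rule D_H[OF a])
 define h where "h = (1/2) \<cdot> D a"
 have hH: "h \<in> H p" unfolding h_def by (rule H_in(4)[OF DaH])
 have Da: "D a = h + h" by (simp add: h_def flip: scale_left_distrib)
 have XP: "X a (P i) = - Mc (k + i) a + h \<odot> P i" if i: "i < k" for i
 proof -
  have "Mc (k + i) a = br (P i) a - (1/2) \<cdot> (P i \<odot> D a)" using i by (simp add: MM_def Mz_def zv_def)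
  moreover have "(1/2) \<cdot> (P i \<odot> D a) = h \<odot> P i" using S i comm_e[of "P i" "D a"] by (simp add: h_def prd_lin)
  moreover have "br a (P i) = - br (P i) a" using even_skew[of "P i" a p] S i a by simp
  ultimately show ?thesis by (simp add: X_def Da prd_lin)
 qed
 have XQ: "X a (Q i) = Mc i a + h \<odot> Q i" if i: "i < k" for i
 proof -
  have "Mc i a = - br (Q i) a + (1/2) \<cdot> (Q i \<odot> D a)" using i by (simp add: MM_def Mz_def zv_def br_lin prd_lin)
  moreover have "(1/2) \<cdot> (Q i \<odot> D a) = h \<odot> Q i" using S i comm_e[of "Q i" "D a"] by (simp add: h_def prd_lin)
  moreover have "br a (Q i) = - br (Q i) a" using even_skew[of "Q i" a p] S i a by simp
  ultimately show ?thesis by (simp add: X_def Da prd_lin)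
 qed
 have XE: "X a (E j) = Mc (mc + \<tau> j) (sg a) + h \<odot> E j" if j: "j < n" for j
 proof -
  define s where "s = ((-1) ^ p :: 'k)"
  have ss: "s * s = 1" by (simp add: s_def flip: power_add)
  have EH: "E j \<in> H 1" and tt: "\<tau> (\<tau> j) = j" using S j by auto
  have sga: "sg a = s \<cdot> a" using sg_H[OF a] by (simp add: s_def)
  have twE: "tw p (E j) = s \<cdot> E j" using tw_HH[OF EH, of p] by (simp add: s_def)
  have "Mc (mc + \<tau> j) (sg a) = - br (E j) (sg a) + (1/2) \<cdot> (E j \<odot> D (sg a))"
   using tt by (simp add: MM_def Mz_def zv_def br_lin prd_lin dm_def)
  also have "E j \<odot> D (sg a) = D a \<odot> E j"
  proof -
   have "D a \<odot> E j = tw p (E j) \<odot> D a" by (rule comm_tw[OF DaH])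
   thus ?thesis by (simp add: twE sga D_lin prd_lin)
  qed
  also have "(1/2) \<cdot> (D a \<odot> E j) = h \<odot> E j" by (simp add: h_def prd_lin)
  also have "br (E j) (sg a) = - br a (E j)" using br_skew[OF a, of "E j"] by (simp add: twE sga br_lin)
  finally show ?thesis by (simp add: X_def Da prd_lin)
 qed
 have "X a b = (\<Sum>i<k. X a (P i) \<odot> Mc i b + X a (Q i) \<odot> Mc (k + i) b)
   + (if ct then X a t \<odot> Mc (2 * k) b else 0) + (\<Sum>j<n. X a (E j) \<odot> Mc (mc + j) b)"
  unfolding X_expand[OF a b] sum_coords by (simp add: yv_def dm_def)
 also have "(\<Sum>i<k. X a (P i) \<odot> Mc i b + X a (Q i) \<odot> Mc (k + i) b)
   = (\<Sum>i<k. Mc i a \<odot> Mc (k + i) b - Mc (k + i) a \<odot> Mc i b) + h \<odot> (\<Sum>i<k. P i \<odot> Mc i b + Q i \<odot> Mc (k + i) b)"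
  unfolding prd_sum sum.distrib[symmetric] by (rule sum.cong) (auto simp: XP XQ prd_lin assoc algebra_simps)
 also have "(\<Sum>j<n. X a (E j) \<odot> Mc (mc + j) b)
   = (\<Sum>j<n. Mc (mc + \<tau> j) (sg a) \<odot> Mc (mc + j) b) + h \<odot> (\<Sum>j<n. E j \<odot> Mc (mc + j) b)"
  unfolding prd_sum sum.distrib[symmetric] by (rule sum.cong) (auto simp: XE prd_lin assoc)
 finally have X: "X a b = (\<Sum>i<k. Mc i a \<odot> Mc (k + i) b - Mc (k + i) a \<odot> Mc i b)
   + (\<Sum>j<n. Mc (mc + \<tau> j) (sg a) \<odot> Mc (mc + j) b) + h \<odot> Eul b + (if ct then X a t \<odot> Mc (2 * k) b else 0)"
  by (simp add: Eul_def prd_lin algebra_simps)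
 have br: "br a b = X a b - D a \<odot> b" by (simp add: X_def)
 show ?thesis
 proof (cases ct)
  case False
  hence "D a = 0" using nf by (simp add: nf_def)
  thus ?thesis unfolding br X using False by (simp add: h_def)
 next
  case True
  note t = nf_t[OF nf True]
  have "br a t = - br t a" using even_skew[of t a p] t a by simp
  moreover have "D a \<odot> t = t \<odot> D a" using comm_e[of t] t by simp
  ultimately have Xat: "X a t = 2 \<cdot> a - Eul a" using t_expand[OF True aV] by (simp add: X_def)
  have Mt: "Mc (2 * k) a = h" using True by (simp add: MM_def dm_def h_def)
  have Dab: "D a \<odot> b = h \<odot> (2 \<cdot> b)" by (simp add: h_def prd_lin)
  show ?thesis unfolding br X if_P[OF True] Xat Dab Mt by (simp add: prd_lin algebra_simps)
 qed
qed

end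

end

section \<open>The algebra of formal power series in even and odd indeterminates\<close>

subsection \<open>Grassmann algebra\<close>

text \<open>The exponent of the sign that sorts a product of odd variables indexed by \<open>S\<close>, followed by those indexed by \<open>T\<close>.\<close>

definition inversions :: "nat set => nat set => nat" where
 "inversions S T = card {(i, j). i \<in> S \<and> j \<in> T \<and> j < i}"

lemma finite_inversions: "finite S ==> finite T ==> finite {(i, j). i \<in> S \<and> j \<in> T \<and> j < (i::nat)}"
 by (rule finite_subset[of _ "S \<times> T"]) auto

lemma inversions_insert_left:
 assumes "finite S" "finite T" "i \<notin> S"
 shows "inversions (insert i S) T = inversions S T + card {b\<in>T. b < i}"
proof -
 have "{(a, b). a \<in> insert i S \<and> b \<in> T \<and> b < a} = {(a, b). a \<in> S \<and> b \<in> T \<and> b < a} \<union> Pair i ` {b\<in>T. b < i}" by auto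
 moreover have "{(a, b). a \<in> S \<and> b \<in> T \<and> b < a} \<inter> Pair i ` {b\<in>T. b < i} = {}" using assms(3) by auto
 ultimately show ?thesis
  unfolding inversions_def using finite_inversions[OF assms(1,2)] assms(2)
  by (simp add: card_Un_disjoint card_image inj_on_def)
qed

lemma inversions_insert_right:
 assumes "finite S" "finite T" "i \<notin> T"
 shows "inversions S (insert i T) = inversions S T + card {a\<in>S. i < a}"
proof -
 have "{(a, b). a \<in> S \<and> b \<in> insert i T \<and> b < a} = {(a, b). a \<in> S \<and> b \<in> T \<and> b < a} \<union> (\<lambda>a. (a, i)) ` {a\<in>S. i < a}" by auto
 moreover have "{(a, b). a \<in> S \<and> b \<in> T \<and> b < a} \<inter> (\<lambda>a. (a, i)) ` {a\<in>S. i < a} = {}" using assms(3) by auto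
 ultimately show ?thesis
  unfolding inversions_def using finite_inversions[OF assms(1,2)] assms(1)
  by (simp add: card_Un_disjoint card_image inj_on_def)
qed

lemma wedge_inversions: "wedge u v U = (\<Sum>S\<in>Pow U. (-1) ^ inversions S (U - S) * u S * v (U - S))"
 by (simp add: wedge_def inversions_def)

lemma wedge_infinite: "infinite U ==> wedge u v U = 0"
 by (simp add: wedge_def)

lemma sum_Pow_insert:
 assumes "finite U" "i \<notin> U"
 shows "(\<Sum>S\<in>Pow (insert i U). f S) = (\<Sum>S\<in>Pow U. f S + f (insert i S))"
proof -
 have "(\<Sum>S\<in>Pow (insert i U). f S) = (\<Sum>S\<in>Pow U. f S) + (\<Sum>S\<in>insert i ` Pow U. f S)"
  unfolding Pow_insert by (rule sum.union_disjoint) (use assms in auto)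
 also have "(\<Sum>S\<in>insert i ` Pow U. f S) = (\<Sum>S\<in>Pow U. f (insert i S))"
  by (rule sum.reindex_cong[where l = "insert i"]) (use assms in \<open>auto simp: inj_on_def\<close>)
 finally show ?thesis by (simp add: sum.distrib)
qed

definition dw :: "nat => 'k::field grassmann => 'k grassmann" where
 "dw i u = (\<lambda>S. if i \<in> S then 0 else (-1) ^ card {j\<in>S. j < i} * u (insert i S))"
definition sgw :: "'k::field grassmann => 'k grassmann" where
 "sgw u = (\<lambda>S. (-1) ^ card S * u S)"

lemma minus_one_power_parity: "even m = even n ==> ((-1) ^ m :: 'k::field) = (-1) ^ n"
 by (simp add: minus_one_power_iff)

lemma card_split_less:
 assumes "finite (S :: nat set)" "i \<notin> S"
 shows "card S = card {j\<in>S. j < i} + card {j\<in>S. i < j}"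
proof -
 have "S = {j\<in>S. j < i} \<union> {j\<in>S. i < j}" using assms(2) by (auto simp: not_less_iff_gr_or_eq)
 hence "card S = card ({j\<in>S. j < i} \<union> {j\<in>S. i < j})" by simp
 also have "\<dots> = card {j\<in>S. j < i} + card {j\<in>S. i < j}" using assms(1) by (intro card_Un_disjoint) auto
 finally show ?thesis .
qed

lemma wedge_derivation: "dw i (wedge u v) = (\<lambda>U. wedge (dw i u) v U + wedge (sgw u) (dw i v) U)"
proof
 fix U :: "nat set"
 show "dw i (wedge u v) U = wedge (dw i u) v U + wedge (sgw u) (dw i v) U"
 proof (cases "finite U")
  case False
  thus ?thesis by (simp add: dw_def wedge_infinite)
 next
  case fU: True
  define c where "c S = card {j\<in>S. j < i}" for S
  have cU: "c U = c S + c (U - S)" if "S \<subseteq> U" "finite U" for S U :: "nat set"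
  proof -
   have "{j\<in>U. j < i} = {j\<in>S. j < i} \<union> {j\<in>U - S. j < i}" using \<open>S \<subseteq> U\<close> by auto
   hence "c U = card ({j\<in>S. j < i} \<union> {j\<in>U - S. j < i})" by (simp add: c_def)
   also have "\<dots> = c S + c (U - S)" unfolding c_def
    by (rule card_Un_disjoint) (use that finite_subset[OF \<open>S \<subseteq> U\<close>] in auto)
   finally show ?thesis .
  qed
  show ?thesis
  proof (cases "i \<in> U")
   case False
   have "dw i (wedge u v) U = (-1) ^ c U * wedge u v (insert i U)" using False by (simp add: dw_def c_def)
   also have "\<dots> = (\<Sum>S\<in>Pow U. (-1) ^ c U * ((-1) ^ inversions S (insert i U - S) * u S * v (insert i U - S)
     + (-1) ^ inversions (insert i S) (insert i U - insert i S) * u (insert i S) * v (insert i U - insert i S)))"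
    unfolding wedge_inversions sum_Pow_insert[OF fU False] by (rule sum_distrib_left)
   also have "\<dots> = (\<Sum>S\<in>Pow U. (-1) ^ inversions S (U - S) * dw i u S * v (U - S)
     + (-1) ^ inversions S (U - S) * sgw u S * dw i v (U - S))"
   proof (rule sum.cong)
    fix S assume "S \<in> Pow U"
    hence S: "S \<subseteq> U" "i \<notin> S" "i \<notin> U - S" "finite S" "finite (U - S)" using False fU finite_subset by auto
    have 1: "insert i U - S = insert i (U - S)" "insert i U - insert i S = U - S" using S False by auto
    have 2: "(-1) ^ c U * (-1) ^ inversions S (insert i (U - S)) = ((-1) ^ inversions S (U - S) * (-1) ^ card S * (-1) ^ c (U - S) :: 'a)"
     unfolding inversions_insert_right[OF S(4,5,3)] power_add[symmetric]
     by (rule minus_one_power_parity) (use cU[OF S(1) fU] card_split_less[OF S(4,2)] in \<open>auto simp: c_def\<close>)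
    have 3: "(-1) ^ c U * (-1) ^ inversions (insert i S) (U - S) = ((-1) ^ inversions S (U - S) * (-1) ^ c S :: 'a)"
     unfolding inversions_insert_left[OF S(4,5,2)] power_add[symmetric]
     by (rule minus_one_power_parity) (use cU[OF S(1) fU] in \<open>auto simp: c_def\<close>)
    have d: "dw i u S = (-1) ^ c S * u (insert i S)" "dw i v (U - S) = (-1) ^ c (U - S) * v (insert i (U - S))"
     using S by (simp_all add: dw_def c_def)
    show "(-1) ^ c U * ((-1) ^ inversions S (insert i U - S) * u S * v (insert i U - S)
     + (-1) ^ inversions (insert i S) (insert i U - insert i S) * u (insert i S) * v (insert i U - insert i S))
     = (-1) ^ inversions S (U - S) * dw i u S * v (U - S)
     + (-1) ^ inversions S (U - S) * sgw u S * dw i v (U - S)"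
     unfolding 1 d sgw_def distrib_left mult.assoc[symmetric] 2 3 by (simp add: mult_ac)
   qed simp
   finally show ?thesis by (simp add: wedge_inversions sum.distrib)
  next
   case True
   define U' where "U' = U - {i}"
   have U': "U = insert i U'" "i \<notin> U'" "finite U'" using True fU by (auto simp: U'_def)
   define g where "g S = (-1) ^ inversions S (U - S) * dw i u S * v (U - S)
    + (-1) ^ inversions S (U - S) * sgw u S * dw i v (U - S)" for S
   have "wedge (dw i u) v U + wedge (sgw u) (dw i v) U = (\<Sum>S\<in>Pow (insert i U'). g S)"
    unfolding U'(1)[symmetric] by (simp add: wedge_inversions sum.distrib g_def)
   also have "\<dots> = (\<Sum>S\<in>Pow U'. g S + g (insert i S))" by (rule sum_Pow_insert[OF U'(3,2)])
   also have "\<dots> = (\<Sum>S\<in>Pow U'. 0)"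
   proof (rule sum.cong)
    fix S assume "S \<in> Pow U'"
    hence S: "S \<subseteq> U'" "i \<notin> S" "i \<notin> U' - S" "finite S" "finite (U' - S)" using U' finite_subset by auto
    have 1: "U - S = insert i (U' - S)" "U - insert i S = U' - S" using S U' by auto
    have d: "dw i u S = (-1) ^ c S * u (insert i S)" "dw i u (insert i S) = 0"
     "dw i v (insert i (U' - S)) = 0" "dw i v (U' - S) = (-1) ^ c (U' - S) * v (insert i (U' - S))"
     using S by (simp_all add: dw_def c_def)
    have cS: "card (insert i S) = Suc (card S)" using S by simp
    have "(-1) ^ inversions S (insert i (U' - S)) * (-1) ^ c S
     = - ((-1) ^ inversions (insert i S) (U' - S) * (-1) ^ card (insert i S) * (-1) ^ c (U' - S) :: 'a)"
     unfolding inversions_insert_right[OF S(4,5,3)] inversions_insert_left[OF S(4,5,2)] cS power_Suc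
     using card_split_less[OF S(4,2)]
     by (simp add: minus_one_power_iff c_def)
    thus "g S + g (insert i S) = 0"
     unfolding g_def 1 d sgw_def by (simp add: mult_ac)
   qed simp
   finally show ?thesis using True by (simp add: dw_def)
  qed
 qed
qed

lemma wedge_lin:
 "wedge (\<lambda>S. u S + u' S) v = (\<lambda>U. wedge u v U + wedge u' v U)"
 "wedge u (\<lambda>S. v S + v' S) = (\<lambda>U. wedge u v U + wedge u v' U)"
 "wedge (\<lambda>S. c * u S) v = (\<lambda>U. c * wedge u v U)"
 "wedge u (\<lambda>S. c * v S) = (\<lambda>U. c * wedge u v U)"
 by (auto simp: wedge_def fun_eq_iff algebra_simps sum.distrib sum_distrib_left)

lemma wedge_zero: "wedge (\<lambda>S. 0) v = (\<lambda>U. 0)" "wedge u (\<lambda>S. 0) = (\<lambda>U. 0)"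
 by (auto simp: wedge_def)

lemma wedge_delta:
 assumes "finite A" "finite B" "A \<inter> B = {}"
 shows "wedge (\<lambda>S. if S = A then 1 else 0) (\<lambda>S. if S = B then 1 else 0)
  = (\<lambda>U. if U = A \<union> B then (-1) ^ inversions A B else 0)"
proof
 fix U
 show "wedge (\<lambda>S. if S = A then 1 else 0) (\<lambda>S. if S = B then 1 else 0) U = (if U = A \<union> B then (-1) ^ inversions A B else 0)"
 proof (cases "finite U")
  case False
  thus ?thesis using assms by (auto simp: wedge_infinite)
 next
  case True
  have BU: "U - A = B" if "U = A \<union> B" using that assms(3) by auto
  have "wedge (\<lambda>S. if S = A then 1 else 0) (\<lambda>S. if S = B then 1 else 0) U
   = (\<Sum>S\<in>Pow U. if S = A then (if U - A = B then (-1) ^ inversions A B else 0) else 0)"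
   unfolding wedge_inversions by (rule sum.cong) auto
  also have "\<dots> = (if A \<subseteq> U then (if U - A = B then (-1) ^ inversions A B else 0) else 0)"
   using True by (simp add: sum.delta)
  also have "\<dots> = (if U = A \<union> B then (-1) ^ inversions A B else 0)" using BU by auto
  finally show ?thesis .
 qed
qed

subsection \<open>Power series\<close>

lemma finite_splittings: "finite {(\<alpha>, \<beta>). \<alpha> + \<beta> = (\<gamma> :: nat \<Rightarrow>\<^sub>0 nat)}"
proof -
 let ?F = "{f. \<forall>x. (x \<in> Poly_Mapping.keys \<gamma> \<longrightarrow> f x \<in> {..(\<Sum>i\<in>Poly_Mapping.keys \<gamma>. Poly_Mapping.lookup \<gamma> i)}) \<and> (x \<notin> Poly_Mapping.keys \<gamma> \<longrightarrow> f x = (0::nat))}"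
 have fF: "finite ?F" by (intro finite_set_of_finite_funs) auto
 have le: "Poly_Mapping.lookup \<alpha> \<in> ?F" if "\<alpha> + \<beta> = \<gamma>" for \<alpha> \<beta>
 proof -
  have "Poly_Mapping.lookup \<alpha> x \<le> Poly_Mapping.lookup \<gamma> x" for x using that by (auto simp: lookup_add)
  moreover have "Poly_Mapping.lookup \<gamma> x \<le> (\<Sum>i\<in>Poly_Mapping.keys \<gamma>. Poly_Mapping.lookup \<gamma> i)" if "x \<in> Poly_Mapping.keys \<gamma>" for x
   by (rule member_le_sum) (use that in auto)
  ultimately show ?thesis by (auto simp: in_keys_iff) (metis le_trans, metis le_zero_eq)
 qed
 have "finite {\<alpha>. \<exists>\<beta>. \<alpha> + \<beta> = \<gamma>}"
  by (rule inj_on_finite[OF _ _ fF, of Poly_Mapping.lookup]) (use le in \<open>auto simp: inj_on_def lookup_inject\<close>)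
 hence "finite ((\<lambda>\<alpha>. (\<alpha>, \<gamma> - \<alpha>)) ` {\<alpha>. \<exists>\<beta>. \<alpha> + \<beta> = \<gamma>})" by simp
 moreover have "{(\<alpha>, \<beta>). \<alpha> + \<beta> = \<gamma>} \<subseteq> (\<lambda>\<alpha>. (\<alpha>, \<gamma> - \<alpha>)) ` {\<alpha>. \<exists>\<beta>. \<alpha> + \<beta> = \<gamma>}" by force
 ultimately show ?thesis by (rule finite_subset[rotated])
qed

abbreviation e1 :: "nat => (nat \<Rightarrow>\<^sub>0 nat)" where "e1 i \<equiv> Poly_Mapping.single i 1"

lemma ser_mult_apply: "ser_mult f g \<gamma> U = (\<Sum>(\<alpha>, \<beta>)\<in>{(\<alpha>, \<beta>). \<alpha> + \<beta> = \<gamma>}. wedge (f \<alpha>) (g \<beta>) U)"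
proof -
 have "(\<Sum>x\<in>A. h x) U = (\<Sum>x\<in>A. h x U)" for A and h :: "'b => 'a grassmann"
  by (induction A rule: infinite_finite_induct) auto
 thus ?thesis unfolding ser_mult_def by (simp add: case_prod_unfold)
qed

lemma ser_mult_lin:
 "ser_mult (f + f') g = ser_mult f g + ser_mult f' g"
 "ser_mult f (g + g') = ser_mult f g + ser_mult f g'"
 "ser_mult (ser_scale c f) g = ser_scale c (ser_mult f g)"
 "ser_mult f (ser_scale c g) = ser_scale c (ser_mult f g)"
 by (auto simp: fun_eq_iff ser_mult_apply ser_scale_def plus_fun_def wedge_lin sum.distrib sum_distrib_left case_prod_unfold)

lemma ser_scale_minus: "ser_scale (-1) f = - f" by (auto simp: ser_scale_def fun_eq_iff)

lemma ser_mult_lin':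
 "ser_mult (- f) g = - ser_mult f g" "ser_mult f (- g) = - ser_mult f g"
 "ser_mult (f - f') g = ser_mult f g - ser_mult f' g" "ser_mult f (g - g') = ser_mult f g - ser_mult f g'"
proof -
 show 1: "ser_mult (- f) g = - ser_mult f g" "ser_mult f (- g) = - ser_mult f g" for f g :: "'a series"
  using ser_mult_lin(3)[of "-1" f g] ser_mult_lin(4)[of f "-1" g] by (simp_all add: ser_scale_minus)
 show "ser_mult (f - f') g = ser_mult f g - ser_mult f' g" "ser_mult f (g - g') = ser_mult f g - ser_mult f g'"
  using ser_mult_lin(1)[of f "- f'" g] ser_mult_lin(2)[of f g "- g'"] by (simp_all add: 1)
qed

lemma ser_mult_zero: "ser_mult 0 g = 0" "ser_mult f 0 = 0"
 using ser_mult_lin'(3)[of 0 0 g] ser_mult_lin'(4)[of f 0 0] by simp_all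

lemma ser_mult_const: "ser_mult f g 0 {} = f 0 {} * g 0 {}"
proof -
 have "{(\<alpha>, \<beta>). \<alpha> + \<beta> = (0 :: nat \<Rightarrow>\<^sub>0 nat)} = {(0, 0)}"
 proof -
  have "\<alpha> = 0 \<and> \<beta> = 0" if "\<alpha> + \<beta> = 0" for \<alpha> \<beta> :: "nat \<Rightarrow>\<^sub>0 nat"
  proof -
   have "Poly_Mapping.lookup \<alpha> x + Poly_Mapping.lookup \<beta> x = 0" for x using arg_cong[OF that, of "\<lambda>z. Poly_Mapping.lookup z x"] by (simp add: lookup_add)
   hence "Poly_Mapping.lookup \<alpha> x = 0" "Poly_Mapping.lookup \<beta> x = 0" for x by simp_all
   thus ?thesis by (intro conjI poly_mapping_eqI) simp_all
  qed
  hence "{(\<alpha>, \<beta>). \<alpha> + \<beta> = (0 :: nat \<Rightarrow>\<^sub>0 nat)} \<subseteq> {(0, 0)}" by blast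
  moreover have "(0, 0) \<in> {(\<alpha>, \<beta>). \<alpha> + \<beta> = (0 :: nat \<Rightarrow>\<^sub>0 nat)}" by simp
  ultimately show ?thesis by blast
 qed
 thus ?thesis by (simp add: ser_mult_apply wedge_def)
qed

lemma d_xi_dw: "d_xi i f = (\<lambda>\<alpha>. dw i (f \<alpha>))" by (simp add: d_xi_def dw_def fun_eq_iff)
lemma ser_sign_sgw: "ser_sign f = (\<lambda>\<alpha>. sgw (f \<alpha>))" by (simp add: ser_sign_def sgw_def fun_eq_iff)

lemma dw_sum: "dw i (\<lambda>U. \<Sum>x\<in>A. h x U) = (\<lambda>U. \<Sum>x\<in>A. dw i (h x) U)"
 by (auto simp: dw_def fun_eq_iff sum_distrib_left)

lemma d_xi_mult: "d_xi i (ser_mult f g) = ser_mult (d_xi i f) g + ser_mult (ser_sign f) (d_xi i g)"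
proof -
 have "d_xi i (ser_mult f g) \<gamma> U = ser_mult (d_xi i f) g \<gamma> U + ser_mult (ser_sign f) (d_xi i g) \<gamma> U" for \<gamma> U
 proof -
  have "d_xi i (ser_mult f g) \<gamma> U = dw i (\<lambda>U. \<Sum>x\<in>{(\<alpha>, \<beta>). \<alpha> + \<beta> = \<gamma>}. wedge (f (fst x)) (g (snd x)) U) U"
   unfolding d_xi_dw by (rule arg_cong[where f = "\<lambda>u. dw i u U"]) (simp add: fun_eq_iff ser_mult_apply case_prod_unfold)
  also have "\<dots> = (\<Sum>x\<in>{(\<alpha>, \<beta>). \<alpha> + \<beta> = \<gamma>}. dw i (wedge (f (fst x)) (g (snd x))) U)" by (simp add: dw_sum)
  finally show ?thesis
   unfolding wedge_derivation ser_mult_apply sum.distrib by (simp add: d_xi_dw ser_sign_sgw case_prod_unfold)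
 qed
 thus ?thesis by (simp add: fun_eq_iff)
qed

lemma shift_sum:
 fixes w :: "(nat \<Rightarrow>\<^sub>0 nat) => (nat \<Rightarrow>\<^sub>0 nat) => 'k::field"
 shows "(\<Sum>(\<alpha>, \<beta>)\<in>{(\<alpha>, \<beta>). \<alpha> + \<beta> = \<gamma> + e1 i}. of_nat (Poly_Mapping.lookup \<alpha> i) * w \<alpha> \<beta>)
  = (\<Sum>(\<alpha>, \<beta>)\<in>{(\<alpha>, \<beta>). \<alpha> + \<beta> = \<gamma>}. of_nat (Poly_Mapping.lookup \<alpha> i + 1) * w (\<alpha> + e1 i) \<beta>)"
proof -
 have inv: "\<alpha> - e1 i + e1 i = \<alpha>" if "Poly_Mapping.lookup \<alpha> i \<noteq> 0" for \<alpha> :: "nat \<Rightarrow>\<^sub>0 nat"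
  by (rule poly_mapping_eqI) (use that in \<open>auto simp: lookup_add lookup_minus lookup_single when_def\<close>)
 have "(\<Sum>(\<alpha>, \<beta>)\<in>{(\<alpha>, \<beta>). \<alpha> + \<beta> = \<gamma> + e1 i}. of_nat (Poly_Mapping.lookup \<alpha> i) * w \<alpha> \<beta>)
   = (\<Sum>(\<alpha>, \<beta>)\<in>{(\<alpha>, \<beta>). \<alpha> + \<beta> = \<gamma> + e1 i \<and> Poly_Mapping.lookup \<alpha> i \<noteq> 0}. of_nat (Poly_Mapping.lookup \<alpha> i) * w \<alpha> \<beta>)"
  by (rule sum.mono_neutral_right[OF finite_splittings]) (auto intro!: Nat.gr0I)
 also have "\<dots> = (\<Sum>(\<alpha>, \<beta>)\<in>{(\<alpha>, \<beta>). \<alpha> + \<beta> = \<gamma>}. of_nat (Poly_Mapping.lookup \<alpha> i + 1) * w (\<alpha> + e1 i) \<beta>)"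
 proof (rule sum.reindex_bij_witness[where i = "\<lambda>(\<alpha>, \<beta>). (\<alpha> + e1 i, \<beta>)" and j = "\<lambda>(\<alpha>, \<beta>). (\<alpha> - e1 i, \<beta>)"])
  fix x assume "x \<in> {(\<alpha>, \<beta>). \<alpha> + \<beta> = \<gamma> + e1 i \<and> Poly_Mapping.lookup \<alpha> i \<noteq> 0}"
  then obtain \<alpha> \<beta> where x: "x = (\<alpha>, \<beta>)" "\<alpha> + \<beta> = \<gamma> + e1 i" "Poly_Mapping.lookup \<alpha> i \<noteq> 0" by auto
  note a = inv[OF x(3)]
  show "(case (case x of (\<alpha>, \<beta>) => (\<alpha> - e1 i, \<beta>)) of (\<alpha>, \<beta>) => (\<alpha> + e1 i, \<beta>)) = x" using a by (simp add: x)
  have "(\<alpha> - e1 i + \<beta>) + e1 i = \<gamma> + e1 i" using x(2) a by (metis add.commute add.left_commute)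
  thus "(case x of (\<alpha>, \<beta>) => (\<alpha> - e1 i, \<beta>)) \<in> {(\<alpha>, \<beta>). \<alpha> + \<beta> = \<gamma>}" by (simp add: x)
  have "Poly_Mapping.lookup (\<alpha> - e1 i) i + 1 = Poly_Mapping.lookup \<alpha> i" using x(3) by (simp add: lookup_minus)
  thus "(case case x of (\<alpha>, \<beta>) => (\<alpha> - e1 i, \<beta>) of (\<alpha>, \<beta>) => of_nat (Poly_Mapping.lookup \<alpha> i + 1) * w (\<alpha> + e1 i) \<beta>)
   = (case x of (\<alpha>, \<beta>) => of_nat (Poly_Mapping.lookup \<alpha> i) * w \<alpha> \<beta>)" using a by (simp only: x case_prod_conv)
 next
  fix y assume "y \<in> {(\<alpha>, \<beta>). \<alpha> + \<beta> = \<gamma>}"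
  then obtain \<alpha> \<beta> where y: "y = (\<alpha>, \<beta>)" "\<alpha> + \<beta> = \<gamma>" by auto
  show "(case (case y of (\<alpha>, \<beta>) => (\<alpha> + e1 i, \<beta>)) of (\<alpha>, \<beta>) => (\<alpha> - e1 i, \<beta>)) = y" by (simp add: y)
  show "(case y of (\<alpha>, \<beta>) => (\<alpha> + e1 i, \<beta>)) \<in> {(\<alpha>, \<beta>). \<alpha> + \<beta> = \<gamma> + e1 i \<and> Poly_Mapping.lookup \<alpha> i \<noteq> 0}"
   using y by (auto simp: lookup_add add_ac)
 qed
 finally show ?thesis .
qed

lemma shift_sum':
 fixes w :: "(nat \<Rightarrow>\<^sub>0 nat) => (nat \<Rightarrow>\<^sub>0 nat) => 'k::field"
 shows "(\<Sum>(\<alpha>, \<beta>)\<in>{(\<alpha>, \<beta>). \<alpha> + \<beta> = \<gamma> + e1 i}. of_nat (Poly_Mapping.lookup \<beta> i) * w \<alpha> \<beta>)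
  = (\<Sum>(\<alpha>, \<beta>)\<in>{(\<alpha>, \<beta>). \<alpha> + \<beta> = \<gamma>}. of_nat (Poly_Mapping.lookup \<beta> i + 1) * w \<alpha> (\<beta> + e1 i))"
proof -
 have sw: "(\<Sum>(\<alpha>, \<beta>)\<in>{(\<alpha>, \<beta>). \<alpha> + \<beta> = \<delta>}. F \<alpha> \<beta>) = (\<Sum>(\<alpha>, \<beta>)\<in>{(\<alpha>, \<beta>). \<alpha> + \<beta> = \<delta>}. F \<beta> \<alpha>)"
  for \<delta> and F :: "(nat \<Rightarrow>\<^sub>0 nat) => (nat \<Rightarrow>\<^sub>0 nat) => 'k"
  by (rule sum.reindex_bij_witness[where i = prod.swap and j = prod.swap]) (auto simp: add.commute)
 show ?thesis
  using shift_sum[of i "\<lambda>\<alpha> \<beta>. w \<beta> \<alpha>" \<gamma>]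
   sw[of "\<lambda>\<alpha> \<beta>. of_nat (Poly_Mapping.lookup \<beta> i) * w \<alpha> \<beta>" "\<gamma> + e1 i"]
   sw[of "\<lambda>\<alpha> \<beta>. of_nat (Poly_Mapping.lookup \<beta> i + 1) * w \<alpha> (\<beta> + e1 i)" \<gamma>] by simp
qed

lemma d_x_mult: "d_x i (ser_mult f g) = ser_mult (d_x i f) g + ser_mult f (d_x i g)"
proof -
 have "d_x i (ser_mult f g) \<gamma> U = ser_mult (d_x i f) g \<gamma> U + ser_mult f (d_x i g) \<gamma> U" for \<gamma> U
 proof -
  let ?A = "{(\<alpha>, \<beta>). \<alpha> + \<beta> = \<gamma> + e1 i}"
  have "d_x i (ser_mult f g) \<gamma> U = (\<Sum>(\<alpha>, \<beta>)\<in>?A. of_nat (Poly_Mapping.lookup \<gamma> i + 1) * wedge (f \<alpha>) (g \<beta>) U)"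
   by (simp add: d_x_def ser_mult_apply sum_distrib_left case_prod_unfold)
  also have "\<dots> = (\<Sum>(\<alpha>, \<beta>)\<in>?A. of_nat (Poly_Mapping.lookup \<alpha> i) * wedge (f \<alpha>) (g \<beta>) U + of_nat (Poly_Mapping.lookup \<beta> i) * wedge (f \<alpha>) (g \<beta>) U)"
  proof (rule sum.cong)
   fix x assume "x \<in> ?A"
   then obtain \<alpha> \<beta> where x: "x = (\<alpha>, \<beta>)" "\<alpha> + \<beta> = \<gamma> + e1 i" by auto
   have "Poly_Mapping.lookup \<alpha> i + Poly_Mapping.lookup \<beta> i = Poly_Mapping.lookup \<gamma> i + 1"
    using arg_cong[OF x(2), of "\<lambda>z. Poly_Mapping.lookup z i"] by (simp add: lookup_add)
   thus "(case x of (\<alpha>, \<beta>) => of_nat (Poly_Mapping.lookup \<gamma> i + 1) * wedge (f \<alpha>) (g \<beta>) U)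
    = (case x of (\<alpha>, \<beta>) => of_nat (Poly_Mapping.lookup \<alpha> i) * wedge (f \<alpha>) (g \<beta>) U + of_nat (Poly_Mapping.lookup \<beta> i) * wedge (f \<alpha>) (g \<beta>) U)"
    unfolding x(1) prod.case by (metis of_nat_add distrib_right)
  qed simp
  also have "\<dots> = (\<Sum>(\<alpha>, \<beta>)\<in>?A. of_nat (Poly_Mapping.lookup \<alpha> i) * wedge (f \<alpha>) (g \<beta>) U) + (\<Sum>(\<alpha>, \<beta>)\<in>?A. of_nat (Poly_Mapping.lookup \<beta> i) * wedge (f \<alpha>) (g \<beta>) U)"
   by (simp add: sum.distrib case_prod_unfold)
  also have "\<dots> = (\<Sum>(\<alpha>, \<beta>)\<in>{(\<alpha>, \<beta>). \<alpha> + \<beta> = \<gamma>}. of_nat (Poly_Mapping.lookup \<alpha> i + 1) * wedge (f (\<alpha> + e1 i)) (g \<beta>) U)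
    + (\<Sum>(\<alpha>, \<beta>)\<in>{(\<alpha>, \<beta>). \<alpha> + \<beta> = \<gamma>}. of_nat (Poly_Mapping.lookup \<beta> i + 1) * wedge (f \<alpha>) (g (\<beta> + e1 i)) U)"
   unfolding shift_sum[of i "\<lambda>\<alpha> \<beta>. wedge (f \<alpha>) (g \<beta>) U"] shift_sum'[of i "\<lambda>\<alpha> \<beta>. wedge (f \<alpha>) (g \<beta>) U"] ..
  finally show ?thesis by (simp add: ser_mult_apply d_x_def wedge_lin)
 qed
 thus ?thesis by (simp add: fun_eq_iff)
qed

text \<open>Induction principle for coefficients: every non-constant monomial has a variable that can be removed, an odd
one at the front, so that its coefficient can be read off from a derivative.\<close>

lemma coeff_reduce:
 fixes m n :: nat
 assumes "Poly_Mapping.keys \<alpha> \<subseteq> {..<m}" "S \<subseteq> {..<n}" "\<not> (\<alpha> = 0 \<and> S = {})"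
 obtains (x) i \<alpha>' where "i < m" "\<alpha> = \<alpha>' + e1 i" "Poly_Mapping.keys \<alpha>' \<subseteq> {..<m}"
  | (xi) j S' where "j < n" "S = insert j S'" "j \<notin> S'" "\<And>s. s \<in> S' ==> j < s" "S' \<subseteq> {..<n}"
proof (cases "\<alpha> = 0")
 case False
 then obtain i where i: "i \<in> Poly_Mapping.keys \<alpha>" by (metis keys_eq_empty ex_in_conv)
 define \<alpha>' where "\<alpha>' = \<alpha> - e1 i"
 have "\<alpha> = \<alpha>' + e1 i"
  by (rule poly_mapping_eqI) (use i in \<open>auto simp: \<alpha>'_def lookup_add lookup_minus lookup_single when_def in_keys_iff\<close>)
 moreover have "Poly_Mapping.keys \<alpha>' \<subseteq> Poly_Mapping.keys \<alpha>"
  by (auto simp: \<alpha>'_def in_keys_iff lookup_minus)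
 ultimately show thesis using x[of i \<alpha>'] i assms(1) by blast
next
 case True
 have S: "S \<noteq> {}" "finite S" using True assms(3) finite_subset[OF assms(2)] by simp_all
 show thesis
 proof (rule xi[of "Min S" "S - {Min S}"])
  show "Min S < n" "S = insert (Min S) (S - {Min S})" using Min_in[OF S(2,1)] assms(2) by auto
  show "Min S < s" if "s \<in> S - {Min S}" for s using that S Min_le[OF S(2), of s] by (auto simp: less_le)
  show "S - {Min S} \<subseteq> {..<n}" using assms(2) by auto
 qed simp
qed

definition ser_deg :: "nat => (nat \<Rightarrow>\<^sub>0 nat) => nat set => nat" where
 "ser_deg m \<alpha> S = (\<Sum>i<m. Poly_Mapping.lookup \<alpha> i) + card S"

lemma ser_deg_x: "i < m ==> ser_deg m (\<alpha> + e1 i) S = Suc (ser_deg m \<alpha> S)"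
 by (simp add: ser_deg_def lookup_add lookup_single sum.distrib when_def)

lemma ser_deg_xi: "finite S ==> j \<notin> S ==> ser_deg m \<alpha> (insert j S) = Suc (ser_deg m \<alpha> S)"
 by (simp add: ser_deg_def)

lemma coeff_x: "f (\<alpha> + e1 i) S = d_x i f \<alpha> S / of_nat (Poly_Mapping.lookup \<alpha> i + 1)" for f :: "'k::field_char_0 series"
 by (simp add: d_x_def del: of_nat_add of_nat_Suc)

lemma coeff_xi: "j \<notin> S ==> (\<And>s. s \<in> S ==> j < s) ==> f \<alpha> (insert j S) = d_xi j f \<alpha> S"
proof -
 assume "j \<notin> S" "\<And>s. s \<in> S ==> j < s"
 hence "{s\<in>S. s < j} = {}" by fastforce
 thus ?thesis using \<open>j \<notin> S\<close> unfolding d_xi_def by (simp only: if_False card.empty) simp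
qed

lemma Ser_outside: "f \<in> Ser m n ==> \<not> (Poly_Mapping.keys \<alpha> \<subseteq> {..<m} \<and> S \<subseteq> {..<n}) ==> f \<alpha> S = 0"
 unfolding Ser_def Lam_def by fastforce

text \<open>A series is determined by its constant term and its partial derivatives.\<close>

lemma ser_eqI:
 fixes f g :: "'k::field_char_0 series"
 assumes f: "f \<in> Ser m n" and g: "g \<in> Ser m n" and c: "f 0 {} = g 0 {}"
  and x: "\<And>i. i < m ==> d_x i f = d_x i g" and xi: "\<And>j. j < n ==> d_xi j f = d_xi j g"
 shows "f = g"
proof -
 have "f \<alpha> S = g \<alpha> S" for \<alpha> S
 proof (cases "Poly_Mapping.keys \<alpha> \<subseteq> {..<m} \<and> S \<subseteq> {..<n}")
  case False
  thus ?thesis using Ser_outside[OF f] Ser_outside[OF g] by metis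
 next
  case True
  show ?thesis
  proof (cases "\<alpha> = 0 \<and> S = {}")
   case False
   show ?thesis
   proof (rule coeff_reduce[of \<alpha> m S n])
    fix i \<alpha>' assume "i < m" "\<alpha> = \<alpha>' + e1 i"
    thus "f \<alpha> S = g \<alpha> S" using x[of i] by (simp only: coeff_x)
   next
    fix j S' assume *: "j < n" "S = insert j S'" "j \<notin> S'" "\<And>s. s \<in> S' ==> j < s"
    have "h \<alpha> (insert j S') = d_xi j h \<alpha> S'" for h :: "'k series"
     by (rule coeff_xi[OF *(3)]) (rule *(4))
    thus "f \<alpha> S = g \<alpha> S" unfolding *(2) using xi[OF *(1)] by metis
   qed (use True False in auto)
  qed (use c in simp)
 qed
 thus ?thesis by blast
qed

definition ind :: "(nat \<Rightarrow>\<^sub>0 nat) => nat set => 'k::field series" where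
 "ind \<alpha> S = (\<lambda>\<beta> U. if \<beta> = \<alpha> \<and> U = S then 1 else 0)"

lemma ser_x_ind: "ser_x i = ind (e1 i) {}" and ser_xi_ind: "ser_xi j = ind 0 {j}"
 by (simp_all add: ser_x_def ser_xi_def ind_def fun_eq_iff)

lemma ind_Ser: "Poly_Mapping.keys \<alpha> \<subseteq> {..<m} ==> S \<subseteq> {..<n} ==> ind \<alpha> S \<in> Ser m n"
 by (auto simp: ind_def Ser_def Lam_def fun_eq_iff)

lemma ser_mult_ind:
 assumes "finite A" "finite B" "A \<inter> B = {}"
 shows "ser_mult (ind \<alpha> A) (ind \<beta> B) = ser_scale ((-1) ^ inversions A B) (ind (\<alpha> + \<beta>) (A \<union> B))"
proof -
 have "ser_mult (ind \<alpha> A) (ind \<beta> B) \<gamma> U = ser_scale ((-1) ^ inversions A B) (ind (\<alpha> + \<beta>) (A \<union> B)) \<gamma> U" for \<gamma> U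
 proof -
  have i: "ind \<alpha> A \<alpha>' = (if \<alpha>' = \<alpha> then (\<lambda>S. if S = A then 1 else 0) else (\<lambda>S. 0))" for \<alpha>' \<alpha> A
   by (auto simp: ind_def)
  have "ser_mult (ind \<alpha> A) (ind \<beta> B) \<gamma> U
   = (\<Sum>x\<in>{(\<alpha>, \<beta>). \<alpha> + \<beta> = \<gamma>}. if x = (\<alpha>, \<beta>) then (if U = A \<union> B then (-1) ^ inversions A B else 0) else 0)"
   unfolding ser_mult_apply
  proof (rule sum.cong)
   fix x :: "(nat \<Rightarrow>\<^sub>0 nat) \<times> (nat \<Rightarrow>\<^sub>0 nat)"
   obtain a b where x: "x = (a, b)" by (cases x)
   show "(case x of (\<alpha>', \<beta>') => wedge (ind \<alpha> A \<alpha>') (ind \<beta> B \<beta>') U)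
    = (if x = (\<alpha>, \<beta>) then (if U = A \<union> B then (-1) ^ inversions A B else 0) else 0)"
    unfolding x prod.case i by (cases "a = \<alpha>"; cases "b = \<beta>") (simp_all add: wedge_zero wedge_delta[OF assms])
  qed simp
  also have "\<dots> = (if \<alpha> + \<beta> = \<gamma> then (if U = A \<union> B then (-1) ^ inversions A B else 0) else 0)"
   by (simp add: sum.delta[OF finite_splittings])
  also have "\<dots> = ser_scale ((-1) ^ inversions A B) (ind (\<alpha> + \<beta>) (A \<union> B)) \<gamma> U"
   by (auto simp: ser_scale_def ind_def)
  finally show ?thesis .
 qed
 thus ?thesis by blast
qed

lemma bracket_odd_part_swap:
 "bracket_odd_part n f g = (\<Sum>j<n. ser_mult (d_xi (if 2 \<le> n \<and> j = n - 2 then n - 1 else if 2 \<le> n \<and> j = n - 1 then n - 2 else j) f) (d_xi j g))"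
 (is "_ = (\<Sum>j<n. ?F j)")
proof -
 consider "n = 0" | "n = 1" | k where "n = Suc (Suc k)" by (metis One_nat_def not0_implies_Suc)
 thus ?thesis
 proof cases
  case 3
  have "(\<Sum>j<n. ?F j) = (\<Sum>j<k. ?F j) + ?F k + ?F (Suc k)" by (simp add: 3)
  also have "(\<Sum>j<k. ?F j) = (\<Sum>j<k. ser_mult (d_xi j f) (d_xi j g))" by (rule sum.cong) (auto simp: 3)
  finally show ?thesis by (simp add: bracket_odd_part_def 3 add_ac)
 qed (simp_all add: bracket_odd_part_def)
qed

lemma keys_add_nat: "Poly_Mapping.keys (\<alpha> + \<beta>) = Poly_Mapping.keys \<alpha> \<union> Poly_Mapping.keys (\<beta> :: nat \<Rightarrow>\<^sub>0 nat)"
 by (auto simp: in_keys_iff lookup_add)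

lemma Ser_I: "(\<And>\<alpha> S. f \<alpha> S \<noteq> 0 ==> Poly_Mapping.keys \<alpha> \<subseteq> {..<m} \<and> S \<subseteq> {..<n}) ==> f \<in> Ser m n"
 unfolding Ser_def Lam_def by (auto simp: fun_eq_iff)

lemma Ser_mult:
 assumes f: "f \<in> Ser m n" and g: "g \<in> Ser m n" shows "ser_mult f g \<in> Ser m n"
proof (rule Ser_I, rule ccontr)
 fix \<gamma> U assume nz: "ser_mult f g \<gamma> U \<noteq> 0" and o: "\<not> (Poly_Mapping.keys \<gamma> \<subseteq> {..<m} \<and> U \<subseteq> {..<n})"
 have "wedge (f \<alpha>) (g \<beta>) U = 0" if "\<alpha> + \<beta> = \<gamma>" for \<alpha> \<beta>
  unfolding wedge_inversions
 proof (rule sum.neutral, rule ballI)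
  fix S assume "S \<in> Pow U"
  hence "\<not> (Poly_Mapping.keys \<alpha> \<subseteq> {..<m} \<and> S \<subseteq> {..<n}) \<or> \<not> (Poly_Mapping.keys \<beta> \<subseteq> {..<m} \<and> U - S \<subseteq> {..<n})"
   using o that keys_add_nat[of \<alpha> \<beta>] by blast
  thus "(-1) ^ inversions S (U - S) * f \<alpha> S * g \<beta> (U - S) = 0"
   using Ser_outside[OF f, of \<alpha> S] Ser_outside[OF g, of \<beta> "U - S"] by auto
 qed
 hence "ser_mult f g \<gamma> U = 0" unfolding ser_mult_apply by (intro sum.neutral) auto
 with nz show False by simp
qed

text \<open>The derivatives along the odd variables in increasing order of the index, the smallest being applied
first, which matches the left derivative that takes a variable from the front of a sorted product.\<close>

fun Nl :: "(nat => 'a => 'a) => nat list => 'a => 'a" where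
 "Nl N [] a = a" | "Nl N (j # js) a = Nl N js (N j a)"

fun Mp :: "(nat => 'a => 'a) => nat => (nat \<Rightarrow>\<^sub>0 nat) => 'a => 'a" where
 "Mp M 0 \<alpha> a = a" | "Mp M (Suc i) \<alpha> a = Mp M i \<alpha> ((M i ^^ Poly_Mapping.lookup \<alpha> i) a)"

lemma d_x_ind: "d_x l (ind (e1 i) {}) = (if l = i then ind 0 {} else (0 :: 'k::field series))"
 "d_x l (ind 0 S) = (0 :: 'k::field series)"
proof -
 have ne: "\<alpha> + Poly_Mapping.single l (Suc 0) \<noteq> 0" for \<alpha> :: "nat \<Rightarrow>\<^sub>0 nat"
 proof
  assume "\<alpha> + Poly_Mapping.single l (Suc 0) = 0"
  from arg_cong[OF this, of "\<lambda>z. Poly_Mapping.lookup z l"] show False by (simp add: lookup_add)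
 qed
 thus "d_x l (ind 0 S) = (0 :: 'k series)" by (auto simp: d_x_def ind_def fun_eq_iff)
 have eq: "\<alpha> + e1 l = e1 i \<longleftrightarrow> l = i \<and> \<alpha> = 0" for \<alpha> :: "nat \<Rightarrow>\<^sub>0 nat"
 proof
  assume a: "\<alpha> + e1 l = e1 i"
  have "l = i"
   using arg_cong[OF a, of "\<lambda>z. Poly_Mapping.lookup z l"] by (simp add: lookup_add lookup_single when_def split: if_splits)
  with a show "l = i \<and> \<alpha> = 0" by simp
 qed simp
 show "d_x l (ind (e1 i) {}) = (if l = i then ind 0 {} else (0 :: 'k series))"
  by (auto simp: d_x_def ind_def fun_eq_iff eq[unfolded One_nat_def])
qed

lemma d_xi_ind: "d_xi l (ind \<alpha> {}) = (0 :: 'k::field series)"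
 "d_xi l (ind \<alpha> {j}) = (if l = j then ind \<alpha> {} else (0 :: 'k::field series))"
proof -
 show "d_xi l (ind \<alpha> {}) = (0 :: 'k series)" by (auto simp: d_xi_def ind_def fun_eq_iff)
 have "insert l S = {j} \<and> l \<notin> S \<longleftrightarrow> l = j \<and> S = {}" for S by auto
 hence "d_xi l (ind \<alpha> {j}) \<beta> S = (if l = j then ind \<alpha> {} else (0 :: 'k series)) \<beta> S" for \<beta> S
  unfolding d_xi_def ind_def by auto
 thus "d_xi l (ind \<alpha> {j}) = (if l = j then ind \<alpha> {} else (0 :: 'k series))" by blast
qed

section \<open>Taylor expansion\<close>

text \<open>A frame of commuting derivations whose common kernel is the field of scalars; the first \<open>r\<close> coordinates are even.\<close>

locale taylor_frame = lgp scale P0 P1 prd e Dual br \<epsilon>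
 for scale :: "'k::{alg_closed_field,field_char_0} => 'v::ab_group_add => 'v" (infixr "\<cdot>" 75)
  and P0 P1 :: "'v => 'v" and prd :: "'v => 'v => 'v" (infixl "\<odot>" 70)
  and e :: 'v and Dual :: "('v => 'k) set" and br :: "'v => 'v => 'v" and \<epsilon> :: "'v => 'k" +
 fixes r n :: nat and y :: "nat => 'v" and M :: "nat => 'v => 'v"
 assumes F: "frame (r + n) (prty r) y M"
  and dM: "\<And>i a b. i < r + n ==> M i (a \<odot> b) = M i a \<odot> b + tw (prty r i) a \<odot> M i b"
  and sM: "\<And>i a. i < r + n ==> a \<in> V ==> M i (sg a) = (if i < r then sg (M i a) else - sg (M i a))"
  and ctr: "\<And>c. c \<in> V ==> (\<And>i. i < r + n ==> M i c = 0) ==> c = \<epsilon> c \<cdot> e"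
begin

abbreviation (input) "N \<equiv> \<lambda>j. M (r + j)"

lemma cM: "i < r + n ==> cop (M i)" by (rule frameD(3)[OF F])

lemma MV: "i < r + n ==> M i a \<in> V" by (rule cop_V[OF cM])

lemma Me: "i < r + n ==> M i e = 0"
 using dM[of i e e] by (simp add: pi_V MV)

lemma Mcomm: "i < r + n ==> l < r ==> a \<in> V ==> M i (M l a) = M l (M i a)"
 using frameD(5)[OF F, of i l a] by (simp add: prty_def)

lemma Ncomm: "i < n ==> j < n ==> a \<in> V ==> N i (N j a) = - N j (N i a)"
 using frameD(5)[OF F, of "r + i" "r + j" a] by (simp add: prty_def)

lemma Nsquare: "j < n ==> a \<in> V ==> N j (N j a) = 0"
 using Ncomm[of j j a] two_zero by (metis add.right_inverse)

lemma My: "i < r + n ==> j < r + n ==> M i (y j) = (if i = j then e else 0)"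
proof -
 assume ij: "i < r + n" "j < r + n"
 have "M i (y j \<odot> e) = (if i = j then e else 0)"
  using frameD(4)[OF F ij(1) ij(2), of e] Me[OF ij(1)] by simp
 moreover have "y j \<in> V" using frameD(1)[OF F ij(2)] m_V by blast
 ultimately show ?thesis by (simp add: pi_V)
qed

lemma cop_Nl: "set js \<subseteq> {..<n} ==> cop L ==> cop (\<lambda>a. Nl N js (L a))"
proof (induction js arbitrary: L)
 case (Cons j js)
 have "cop (\<lambda>a. N j (L a))" by (rule cop_comp[OF cM Cons.prems(2)]) (use Cons.prems(1) in simp)
 from Cons.IH[OF _ this] Cons.prems show ?case by simp
qed simp

lemma cop_funpow: "cop L ==> cop K ==> cop (\<lambda>a. (K ^^ p) (L a))"
proof (induction p)
 case (Suc p)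
 from cop_comp[OF Suc.prems(2) Suc.IH[OF Suc.prems]] show ?case by simp
qed simp

lemma cop_Mp: "k \<le> r ==> cop L ==> cop (\<lambda>a. Mp M k \<alpha> (L a))"
proof (induction k arbitrary: L)
 case (Suc k)
 have "cop (\<lambda>a. (M k ^^ Poly_Mapping.lookup \<alpha> k) (L a))"
  by (rule cop_funpow[OF Suc.prems(2) cM]) (use Suc.prems(1) in simp)
 from Suc.IH[OF _ this] Suc.prems show ?case by simp
qed simp

lemma Mp_V: "k \<le> r ==> a \<in> V ==> Mp M k \<alpha> a \<in> V"
 using cop_V[OF cop_Mp[OF _ cop_pi_op], of k \<alpha> a] by (simp add: pi_V)

lemma Nl_lin:
 assumes "set js \<subseteq> {..<n}" "a \<in> V"
 shows "Nl N js (c \<cdot> a) = c \<cdot> Nl N js a" "Nl N js (- a) = - Nl N js a" "Nl N js 0 = 0"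
proof -
 note c = cop_Nl[OF assms(1) cop_pi_op]
 show "Nl N js (c \<cdot> a) = c \<cdot> Nl N js a" using cop_scale[OF c, of c a] assms(2) by (simp add: pi_lin pi_V)
 show "Nl N js (- a) = - Nl N js a" using cop_minus[OF c, of a] assms(2) by (simp add: pi_lin pi_V)
 show "Nl N js 0 = 0" using cop_zero[OF c] by (simp add: pi_lin)
qed

lemma funpow_comm: "i < r + n ==> l < r ==> a \<in> V ==> (M l ^^ p) (M i a) = M i ((M l ^^ p) a)"
proof (induction p)
 case (Suc p)
 have "(M l ^^ p) a \<in> V" using Suc.prems pow_V[OF cM] by simp
 thus ?case using Suc Mcomm[of i l "(M l ^^ p) a"] by simp
qed simp

lemma Mp_comm: "i < r + n ==> k \<le> r ==> a \<in> V ==> Mp M k \<alpha> (M i a) = M i (Mp M k \<alpha> a)"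
proof (induction k arbitrary: a)
 case (Suc k)
 have "(M k ^^ Poly_Mapping.lookup \<alpha> k) a \<in> V" using Suc.prems pow_V[OF cM] by simp
 thus ?case using Suc funpow_comm[of i k a] by simp
qed simp

lemma Mp_e1:
 "i < r ==> k \<le> r ==> a \<in> V ==> Mp M k (\<alpha> + e1 i) a = (if i < k then M i (Mp M k \<alpha> a) else Mp M k \<alpha> a)"
proof (induction k arbitrary: a)
 case (Suc k)
 have kV: "(M k ^^ p) a \<in> V" for p using Suc.prems pow_V[OF cM] by simp
 show ?case
 proof (cases "i = k")
  case True
  have "Mp M (Suc k) (\<alpha> + e1 i) a = Mp M k (\<alpha> + e1 i) (M k ((M k ^^ Poly_Mapping.lookup \<alpha> k) a))"
   using True by (simp add: lookup_add)
  also have "\<dots> = Mp M k \<alpha> (M k ((M k ^^ Poly_Mapping.lookup \<alpha> k) a))"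
   using Suc.IH[of "M k ((M k ^^ Poly_Mapping.lookup \<alpha> k) a)"] Suc.prems True MV by simp
  also have "\<dots> = M k (Mp M k \<alpha> ((M k ^^ Poly_Mapping.lookup \<alpha> k) a))"
   using Mp_comm[of k k "(M k ^^ Poly_Mapping.lookup \<alpha> k) a"] kV Suc.prems by simp
  finally show ?thesis using True by simp
 next
  case False
  have "Mp M (Suc k) (\<alpha> + e1 i) a = Mp M k (\<alpha> + e1 i) ((M k ^^ Poly_Mapping.lookup \<alpha> k) a)"
   using False by (simp add: lookup_add lookup_single when_def)
  thus ?thesis using Suc.IH[of "(M k ^^ Poly_Mapping.lookup \<alpha> k) a"] Suc.prems kV False by (auto simp: less_Suc_eq)
 qed
qed simp

lemma Nl_insort:
 "sorted js ==> distinct js ==> j \<notin> set js ==> j < n ==> set js \<subseteq> {..<n} ==> a \<in> V ==>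
  Nl N (insort j js) a = ((-1) ^ card {s \<in> set js. s < j}) \<cdot> Nl N js (N j a)"
proof (induction js arbitrary: a)
 case (Cons x xs)
 show ?case
 proof (cases "j \<le> x")
  case True
  hence e: "{s \<in> set (x # xs). s < j} = {}" using Cons.prems by auto
  show ?thesis unfolding e using True by simp
 next
  case False
  hence "{s \<in> set (x # xs). s < j} = insert x {s \<in> set xs. s < j}" by auto
  moreover have "x \<notin> {s \<in> set xs. s < j}" using Cons.prems by simp
  ultimately have c: "card {s \<in> set (x # xs). s < j} = Suc (card {s \<in> set xs. s < j})" by simp
  have xn: "x < n" using Cons.prems by simp
  have xa: "N x a \<in> V" using MV xn by simp
  have "Nl N (insort j (x # xs)) a = ((-1) ^ card {s \<in> set xs. s < j}) \<cdot> Nl N xs (N j (N x a))"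
   using False Cons.IH[OF _ _ _ _ _ xa] Cons.prems by simp
  also have "N j (N x a) = - N x (N j a)" using Ncomm[of j x a] xn Cons.prems by simp
  also have "Nl N xs (- N x (N j a)) = - Nl N xs (N x (N j a))"
   by (rule Nl_lin(2)) (use Cons.prems MV xn in auto)
  finally show ?thesis unfolding c by simp
 qed
qed simp

lemma Nl_repeat: "j \<in> set js ==> set js \<subseteq> {..<n} ==> a \<in> V ==> Nl N js (N j a) = 0"
proof (induction js arbitrary: a)
 case (Cons x xs)
 have jx: "j < n" "x < n" using Cons.prems by auto
 show ?case
 proof (cases "x = j")
  case True
  thus ?thesis using Nsquare[OF jx(1) Cons.prems(3)] Nl_lin(3)[of xs 0] Cons.prems by simp
 next
  case False
  have "N x (N j a) = - N j (N x a)" using Ncomm[OF jx(2,1) Cons.prems(3)] .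
  moreover have "Nl N xs (- N j (N x a)) = - Nl N xs (N j (N x a))"
   by (rule Nl_lin(2)) (use Cons.prems MV jx in auto)
  ultimately show ?thesis using Cons.IH[of "N x a"] Cons.prems False MV jx by simp
 qed
qed simp

text \<open>The coefficients of the Taylor expansion at the origin are the values of iterated derivatives there, divided by
factorials.\<close>

definition T :: "'v => 'k series" where
 "T a = (\<lambda>\<alpha> S. if Poly_Mapping.keys \<alpha> \<subseteq> {..<r} \<and> S \<subseteq> {..<n}
   then \<epsilon> (Nl N (sorted_list_of_set S) (Mp M r \<alpha> (pi a))) / (\<Prod>i<r. fact (Poly_Mapping.lookup \<alpha> i)) else 0)"

lemma T_Ser: "T a \<in> Ser r n"
 by (rule Ser_I) (auto simp: T_def split: if_splits)

lemma sls: "S \<subseteq> {..<n} ==> set (sorted_list_of_set S) \<subseteq> {..<n}"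
 by (metis finite_lessThan finite_subset set_sorted_list_of_set)

lemma T_Dual: "(\<lambda>a. T a \<alpha> S) \<in> Dual"
proof (cases "Poly_Mapping.keys \<alpha> \<subseteq> {..<r} \<and> S \<subseteq> {..<n}")
 case True
 have "cop (\<lambda>a. Nl N (sorted_list_of_set S) (Mp M r \<alpha> (pi a)))"
  by (rule cop_Nl[OF sls cop_Mp[OF order_refl cop_pi_op]]) (use True in simp)
 from Dual_times[OF cop_Dual[OF this eps_Dual], of "1 / (\<Prod>i<r. fact (Poly_Mapping.lookup \<alpha> i))"]
 show ?thesis using True by (simp add: T_def)
next
 case False
 thus ?thesis using Dual_0 by (simp add: T_def if_not_P)
qed

lemma T_lin: "T (a + b) = T a + T b" "T (c \<cdot> a) = ser_scale c (T a)" "T (- a) = - T a" "T (a - b) = T a - T b" "T 0 = 0"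
 "T (pi a) = T a" "T (\<Sum>x\<in>A. g x) = (\<Sum>x\<in>A. T (g x))"
proof -
 show a: "T (a + b) = T a + T b" for a b using Dual_add[OF T_Dual] by (auto simp: fun_eq_iff)
 show "T (c \<cdot> a) = ser_scale c (T a)" using Dual_scale[OF T_Dual] by (auto simp: fun_eq_iff ser_scale_def)
 show "T (- a) = - T a" using Dual_minus[OF T_Dual] by (auto simp: fun_eq_iff)
 show "T (a - b) = T a - T b" using Dual_diff[OF T_Dual] by (auto simp: fun_eq_iff)
 show z: "T 0 = 0" using Dual_zero[OF T_Dual] by (auto simp: fun_eq_iff)
 show "T (pi a) = T a" using Dual_pi'[OF T_Dual] by (auto simp: fun_eq_iff)
 show "T (\<Sum>x\<in>A. g x) = (\<Sum>x\<in>A. T (g x))"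
  by (induction A rule: infinite_finite_induct) (auto simp: a z)
qed

lemma T_const: "T a 0 {} = \<epsilon> a"
proof -
 have "Mp M k 0 b = b" for k b by (induction k) auto
 thus ?thesis by (simp add: T_def)
qed

lemma T_x: assumes i: "i < r" and a: "a \<in> V" shows "d_x i (T a) = T (M i a)"
proof -
 have "d_x i (T a) \<alpha> S = T (M i a) \<alpha> S" for \<alpha> S
 proof -
  have k: "Poly_Mapping.keys (\<alpha> + e1 i) = insert i (Poly_Mapping.keys \<alpha>)" by (simp add: keys_add_nat)
  have p: "(\<Prod>l<r. fact (Poly_Mapping.lookup (\<alpha> + e1 i) l)) = of_nat (Poly_Mapping.lookup \<alpha> i + 1) * (\<Prod>l<r. fact (Poly_Mapping.lookup \<alpha> l) :: 'k)"
  proof -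
   have "(\<Prod>l<r. fact (Poly_Mapping.lookup (\<alpha> + e1 i) l) :: 'k)
    = (\<Prod>l<r. (if l = i then of_nat (Poly_Mapping.lookup \<alpha> i + 1) else 1) * fact (Poly_Mapping.lookup \<alpha> l))"
    by (rule prod.cong) (auto simp: lookup_add lookup_single when_def)
   thus ?thesis using i by (simp add: prod.distrib)
  qed
  have m: "Mp M r (\<alpha> + e1 i) (pi a) = Mp M r \<alpha> (M i a)"
   using Mp_e1[of i r a \<alpha>] Mp_comm[of i r a \<alpha>] i a by (simp add: pi_V)
  show ?thesis
  proof (cases "Poly_Mapping.keys \<alpha> \<subseteq> {..<r} \<and> S \<subseteq> {..<n}")
   case True
   have nz: "of_nat (Poly_Mapping.lookup \<alpha> i + 1) \<noteq> (0 :: 'k)" by (simp del: of_nat_add of_nat_Suc)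
   have "d_x i (T a) \<alpha> S = of_nat (Poly_Mapping.lookup \<alpha> i + 1) * (\<epsilon> (Nl N (sorted_list_of_set S) (Mp M r \<alpha> (M i a)))
     / (of_nat (Poly_Mapping.lookup \<alpha> i + 1) * (\<Prod>l<r. fact (Poly_Mapping.lookup \<alpha> l))))"
    unfolding d_x_def T_def k using True i by (simp only: p m) simp
   also have "\<dots> = T (M i a) \<alpha> S" using True nz i by (simp add: T_def MV pi_V del: of_nat_add of_nat_Suc)
   finally show ?thesis .
  next
   case False
   thus ?thesis unfolding d_x_def T_def k by auto
  qed
 qed
 thus ?thesis by blast
qed

lemma T_xi: assumes j: "j < n" and a: "a \<in> V" shows "d_xi j (T a) = T (N j a)"
proof -
 have "d_xi j (T a) \<alpha> S = T (N j a) \<alpha> S" for \<alpha> S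
 proof (cases "Poly_Mapping.keys \<alpha> \<subseteq> {..<r} \<and> S \<subseteq> {..<n}")
  case True
  have fS: "finite S" using True finite_subset by blast
  have m: "Mp M r \<alpha> (pi (N j a)) = N j (Mp M r \<alpha> a)"
   using Mp_comm[of "r + j" r a \<alpha>] j a by (simp add: pi_V MV)
  have mV: "Mp M r \<alpha> a \<in> V" using Mp_V a by simp
  note s = sls[of S]
  show ?thesis
  proof (cases "j \<in> S")
   case jS: True
   have "Nl N (sorted_list_of_set S) (N j (Mp M r \<alpha> a)) = 0"
    by (rule Nl_repeat) (use jS fS s True mV in auto)
   thus ?thesis using jS True m by (simp add: d_xi_def T_def)
  next
   case jS: False
   have "Nl N (sorted_list_of_set (insert j S)) (Mp M r \<alpha> a)
     = ((-1) ^ card {s\<in>S. s < j}) \<cdot> Nl N (sorted_list_of_set S) (N j (Mp M r \<alpha> a))"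
    using Nl_insort[of "sorted_list_of_set S" j "Mp M r \<alpha> a"] fS jS j s True mV
    by simp
   hence "T a \<alpha> (insert j S) = (-1) ^ card {s\<in>S. s < j} * T (N j a) \<alpha> S"
    using True j m a by (simp add: T_def eps_lin pi_V)
   thus ?thesis using jS by (simp add: d_xi_def flip: power_add mult.assoc)
  qed
 next
  case False
  thus ?thesis unfolding d_xi_def T_def by auto
 qed
 thus ?thesis by blast
qed

lemma T_sg: "T (sg a) = ser_sign (T a)"
proof -
 have p: "(M k ^^ p) (sg b) = sg ((M k ^^ p) b)" if "k < r" "b \<in> V" for k p b
 proof (induction p)
  case (Suc p)
  thus ?case using sM[of k "(M k ^^ p) b"] that pow_V[OF cM] by simp
 qed simp
 have m: "Mp M k \<alpha> (sg b) = sg (Mp M k \<alpha> b)" if "k \<le> r" "b \<in> V" for k \<alpha> b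
  using that
 proof (induction k arbitrary: b)
  case (Suc k)
  have "(M k ^^ Poly_Mapping.lookup \<alpha> k) b \<in> V" using Suc.prems pow_V[OF cM] by simp
  thus ?case using Suc p[of k b] by simp
 qed simp
 have l: "Nl N js (sg b) = ((-1) ^ length js) \<cdot> sg (Nl N js b)" if "set js \<subseteq> {..<n}" "b \<in> V" for js b
  using that
 proof (induction js arbitrary: b)
  case (Cons j js)
  have jn: "j < n" using Cons.prems by simp
  have "Nl N (j # js) (sg b) = Nl N js (- sg (N j b))" using sM[of "r + j" b] jn Cons.prems by simp
  also have "\<dots> = - Nl N js (sg (N j b))" by (rule Nl_lin(2)) (use Cons.prems in auto)
  finally show ?case using Cons.IH[of "N j b"] Cons.prems MV jn by simp
 qed simp
 have "T (sg a) \<alpha> S = ser_sign (T a) \<alpha> S" for \<alpha> S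
 proof (cases "Poly_Mapping.keys \<alpha> \<subseteq> {..<r} \<and> S \<subseteq> {..<n}")
  case True
  have "length (sorted_list_of_set S) = card S" by simp
  thus ?thesis using True m[of r "pi a" \<alpha>] l[OF sls[of S], of "Mp M r \<alpha> (pi a)"] Mp_V[of r "pi a" \<alpha>]
   by (simp add: T_def ser_sign_def eps_lin)
 next
  case False
  thus ?thesis unfolding T_def ser_sign_def by auto
 qed
 thus ?thesis by blast
qed

text \<open>Both sides satisfy the same derivation rules and agree at the origin, so their coefficients agree by induction on
the degree.\<close>

lemma T_mult: "T (a \<odot> b) = ser_mult (T a) (T b)"
proof -
 have main: "T (a \<odot> b) \<alpha> S = ser_mult (T a) (T b) \<alpha> S"
  if "a \<in> V" "b \<in> V" "Poly_Mapping.keys \<alpha> \<subseteq> {..<r}" "S \<subseteq> {..<n}" "ser_deg r \<alpha> S = d" for d a b \<alpha> S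
  using that
 proof (induction d arbitrary: a b \<alpha> S)
  case 0
  have "\<alpha> = 0 \<and> S = {}"
  proof (rule ccontr)
   assume "\<not> (\<alpha> = 0 \<and> S = {})"
   from 0(3,4) this show False
   proof (rule coeff_reduce)
    fix i \<alpha>' assume "i < r" "\<alpha> = \<alpha>' + e1 i"
    thus False using 0(5) ser_deg_x[of i r \<alpha>' S] by simp
   next
    fix j S' assume "S = insert j S'" "j \<notin> S'" "S' \<subseteq> {..<n}"
    thus False using 0(5) ser_deg_xi[of S' j r \<alpha>] finite_subset by fastforce
   qed
  qed
  thus ?case by (simp add: T_const ser_mult_const eps_prd)
 next
  case (Suc d)
  have "\<not> (\<alpha> = 0 \<and> S = {})" using Suc.prems(5) by (auto simp: ser_deg_def)
  from Suc.prems(3,4) this show ?case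
  proof (rule coeff_reduce)
   fix i \<alpha>' assume i: "i < r" "\<alpha> = \<alpha>' + e1 i" "Poly_Mapping.keys \<alpha>' \<subseteq> {..<r}"
   have d: "ser_deg r \<alpha>' S = d" using Suc.prems(5) ser_deg_x[OF i(1), of \<alpha>' S] i(2) by simp
   have MVi: "M i a \<in> V" "M i b \<in> V" using MV i(1) by simp_all
   have "d_x i (T (a \<odot> b)) = T (M i a \<odot> b) + T (a \<odot> M i b)"
    using T_x[OF i(1), of "a \<odot> b"] dM[of i a b] i(1) by (simp add: T_lin prty_def tw_def)
   hence "d_x i (T (a \<odot> b)) \<alpha>' S = ser_mult (T (M i a)) (T b) \<alpha>' S + ser_mult (T a) (T (M i b)) \<alpha>' S"
    using Suc.IH[OF MVi(1) Suc.prems(2) i(3) Suc.prems(4) d] Suc.IH[OF Suc.prems(1) MVi(2) i(3) Suc.prems(4) d] by simp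
   also have "\<dots> = d_x i (ser_mult (T a) (T b)) \<alpha>' S"
    using T_x[OF i(1) Suc.prems(1)] T_x[OF i(1) Suc.prems(2)] by (simp add: d_x_mult)
   finally show ?thesis unfolding i(2) coeff_x by simp
  next
   fix j S' assume j: "j < n" "S = insert j S'" "j \<notin> S'" "\<And>s. s \<in> S' ==> j < s" "S' \<subseteq> {..<n}"
   have d: "ser_deg r \<alpha> S' = d" using Suc.prems(5) ser_deg_xi[of S' j r \<alpha>] j finite_subset by fastforce
   have NV: "N j a \<in> V" "N j b \<in> V" using MV j(1) by simp_all
   have "d_xi j (T (a \<odot> b)) = T (N j a \<odot> b) + T (sg a \<odot> N j b)"
    using T_xi[OF j(1), of "a \<odot> b"] dM[of "r + j" a b] j(1) by (simp add: T_lin prty_def tw_def)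
   hence "d_xi j (T (a \<odot> b)) \<alpha> S' = ser_mult (T (N j a)) (T b) \<alpha> S' + ser_mult (T (sg a)) (T (N j b)) \<alpha> S'"
    using Suc.IH[OF NV(1) Suc.prems(2,3) j(5) d] Suc.IH[OF V_in(9) NV(2) Suc.prems(3) j(5) d] by simp
   also have "\<dots> = d_xi j (ser_mult (T a) (T b)) \<alpha> S'"
    using T_xi[OF j(1) Suc.prems(1)] T_xi[OF j(1) Suc.prems(2)] by (simp add: d_xi_mult T_sg)
   finally have "d_xi j (T (a \<odot> b)) \<alpha> S' = d_xi j (ser_mult (T a) (T b)) \<alpha> S'" .
   moreover have "f \<alpha> (insert j S') = d_xi j f \<alpha> S'" for f :: "'k series"
    by (rule coeff_xi[OF j(3)]) (rule j(4))
   ultimately show ?thesis unfolding j(2) by metis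
  qed
 qed
 have "T (pi a \<odot> pi b) \<alpha> S = ser_mult (T (pi a)) (T (pi b)) \<alpha> S" for \<alpha> S
 proof (cases "Poly_Mapping.keys \<alpha> \<subseteq> {..<r} \<and> S \<subseteq> {..<n}")
  case True
  thus ?thesis using main[of "pi a" "pi b" \<alpha> S] by simp
 next
  case False
  thus ?thesis using Ser_outside[OF T_Ser] Ser_outside[OF Ser_mult[OF T_Ser T_Ser]] by metis
 qed
 thus ?thesis by (simp add: T_lin fun_eq_iff)
qed

lemma T_e: "T e = ind 0 {}"
 by (rule ser_eqI[OF T_Ser ind_Ser])
   (simp_all add: T_const T_x T_xi Me T_lin d_x_ind d_xi_ind, simp add: ind_def)

lemma T_even: "i < r ==> T (y i) = ser_x i"
proof -
 assume i: "i < r"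
 have yi: "y i \<in> m" "y i \<in> V" using frameD(1)[OF F, of i] m_V i by auto
 show ?thesis unfolding ser_x_ind
 proof (rule ser_eqI[OF T_Ser ind_Ser])
  show "Poly_Mapping.keys (e1 i) \<subseteq> {..<r}" using i by simp
  have "e1 i \<noteq> 0" by (metis lookup_single_eq lookup_zero one_neq_zero)
  thus "T (y i) 0 {} = ind (e1 i) {} 0 {}" using yi by (simp add: T_const m_def ind_def)
  show "d_x l (T (y i)) = d_x l (ind (e1 i) {})" if "l < r" for l
   using T_x[OF that yi(2)] My[of l i] that i by (simp add: d_x_ind T_e T_lin del: One_nat_def)
  show "d_xi l (T (y i)) = d_xi l (ind (e1 i) {})" if "l < n" for l
   using T_xi[OF that yi(2)] My[of "r + l" i] that i by (simp add: d_xi_ind T_lin)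
 qed simp
qed

lemma T_odd: "j < n ==> T (y (r + j)) = ser_xi j"
proof -
 assume j: "j < n"
 have yj: "y (r + j) \<in> m" "y (r + j) \<in> V" using frameD(1)[OF F, of "r + j"] m_V j by auto
 show ?thesis unfolding ser_xi_ind
 proof (rule ser_eqI[OF T_Ser ind_Ser])
  show "{j} \<subseteq> {..<n}" using j by simp
  show "T (y (r + j)) 0 {} = ind 0 {j} 0 {}" using yj by (simp add: T_const m_def ind_def)
  show "d_x l (T (y (r + j))) = d_x l (ind 0 {j})" if "l < r" for l
   using T_x[OF that yj(2)] My[of l "r + j"] that j by (simp add: d_x_ind T_lin)
  show "d_xi l (T (y (r + j))) = d_xi l (ind 0 {j})" if "l < n" for l
   using T_xi[OF that yj(2)] My[of "r + l" "r + j"] that j by (simp add: d_xi_ind T_e T_lin)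
 qed simp
qed

lemma T_monomial:
 "Poly_Mapping.keys \<alpha> \<subseteq> {..<r} ==> S \<subseteq> {..<n} ==> \<exists>b. b \<in> V \<and> T b = ind \<alpha> S"
proof (induction "ser_deg r \<alpha> S" arbitrary: \<alpha> S rule: less_induct)
 case less
 show ?case
 proof (cases "\<alpha> = 0 \<and> S = {}")
  case True
  thus ?thesis using T_e e_H(2) by blast
 next
  case False
  from less.prems False show ?thesis
  proof (rule coeff_reduce)
   fix i \<alpha>' assume i: "i < r" "\<alpha> = \<alpha>' + e1 i" "Poly_Mapping.keys \<alpha>' \<subseteq> {..<r}"
   have "ser_deg r \<alpha>' S < ser_deg r \<alpha> S" using ser_deg_x[OF i(1), of \<alpha>' S] i(2) by simp
   then obtain b where b: "b \<in> V" "T b = ind \<alpha>' S" using less.hyps i(3) less.prems(2) by blast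
   have fS: "finite S" using less.prems(2) finite_subset by blast
   have "T (y i \<odot> b) = ind \<alpha> S"
    unfolding T_mult T_even[OF i(1)] b(2) ser_x_ind ser_mult_ind[OF finite.emptyI fS Int_empty_left]
    by (simp add: inversions_def ser_scale_def i(2) add.commute)
   thus ?thesis using prd_V by blast
  next
   fix j S' assume j: "j < n" "S = insert j S'" "j \<notin> S'" "\<And>s. s \<in> S' ==> j < s" "S' \<subseteq> {..<n}"
   have fS: "finite S'" using j(5) finite_subset by blast
   have "ser_deg r \<alpha> S' < ser_deg r \<alpha> S" using ser_deg_xi[OF fS j(3), of r \<alpha>] j(2) by simp
   then obtain b where b: "b \<in> V" "T b = ind \<alpha> S'" using less.hyps j(5) less.prems(1) by blast
   have "{(i, l). i \<in> {j} \<and> l \<in> S' \<and> l < i} = {}" using j(4) by fastforce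
   hence e: "inversions {j} S' = 0" unfolding inversions_def by (metis card.empty)
   have "{j} \<inter> S' = {}" using j(3) by simp
   hence "T (y (r + j) \<odot> b) = ind \<alpha> S"
    unfolding T_mult T_odd[OF j(1)] b(2) ser_xi_ind using ser_mult_ind[of "{j}" S' 0 \<alpha>] fS e
    by (simp add: ser_scale_def j(2))
   thus ?thesis using prd_V by blast
  qed
 qed
qed

text \<open>The kernel \<open>Z\<close> of \<open>T\<close> is stable under the frame, so \<open>frame_decomp\<close> inside \<open>Z\<close> writes each of its elements as a combination of
coordinates with coefficients in \<open>Z\<close>, up to a scalar that \<open>\<epsilon>\<close> shows to be \<open>0\<close>. Iterating, \<open>Z\<close> lies in all powers
of the maximal ideal.\<close>

lemma T_inj: assumes a: "a \<in> V" "T a = 0" shows "a = 0"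
proof -
 define \<Psi> where "\<Psi> = {(\<lambda>a. T a \<alpha> S) | \<alpha> S. True}"
 define Z where "Z = {a\<in>V. \<forall>h\<in>\<Psi>. h a = 0}"
 have Z: "x \<in> Z \<longleftrightarrow> x \<in> V \<and> T x = 0" for x
 proof -
  have "(\<forall>h\<in>\<Psi>. h x = 0) \<longleftrightarrow> (\<forall>\<alpha> S. T x \<alpha> S = 0)" unfolding \<Psi>_def by fastforce
  thus ?thesis unfolding Z_def fun_eq_iff by simp
 qed
 have Psi: "\<Psi> \<subseteq> Dual" using T_Dual by (auto simp: \<Psi>_def)
 have st: "M i b \<in> Z \<and> y i \<odot> b \<in> Z" if "i < r + n" "b \<in> Z" for i b
 proof -
  have b: "b \<in> V" "T b = 0" using that Z by auto
  have z: "d_x i 0 = (0 :: 'k series)" "d_xi i 0 = (0 :: 'k series)" for i by (auto simp: d_x_def d_xi_def fun_eq_iff)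
  have "T (M i b) = 0"
  proof (cases "i < r")
   case True thus ?thesis using T_x[OF True b(1)] b(2) z by simp
  next
   case False
   hence "i = r + (i - r)" "i - r < n" using that by auto
   thus ?thesis using T_xi[of "i - r" b] b z by simp
  qed
  thus ?thesis using Z MV[OF that(1)] b T_mult[of "y i" b] by (simp add: ser_mult_zero)
 qed
 have step: "\<exists>f. (\<forall>i<r + n. f i \<in> Z) \<and> x = (\<Sum>i<r + n. y i \<odot> f i)" if x: "x \<in> Z" for x
 proof -
  obtain c f where c: "c \<in> Z" "\<And>i. i < r + n ==> M i c = 0" "\<And>i. i < r + n ==> f i \<in> Z" "x = c + (\<Sum>i<r + n. y i \<odot> f i)"
   using frame_decomp[OF F Psi Z_def st x] by blast
  have "c = \<epsilon> c \<cdot> e" using ctr[of c] c Z by blast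
  moreover have "\<epsilon> c = 0" using c(1) Z T_const[of c] by (simp add: fun_eq_iff)
  ultimately have "c = 0" by simp
  thus ?thesis using c by auto
 qed
 have "x \<in> mp k" if "x \<in> Z" for x k
  using that
 proof (induction k arbitrary: x)
  case 0 thus ?case using Z by simp
 next
  case (Suc k)
  obtain f where f: "\<And>i. i < r + n ==> f i \<in> Z" "x = (\<Sum>i<r + n. y i \<odot> f i)" using step[OF Suc.prems] by blast
  show ?case unfolding f(2) using frameD(1)[OF F] Suc.IH[OF f(1)] by (intro mp_in(5) mp_mult) auto
 qed
 moreover have "a \<in> Z" using a Z by simp
 ultimately show ?thesis using mp_Inter[OF a(1)] by blast
qed

text \<open>The coefficients span the continuous dual, by injectivity and reflexivity. This is the continuity of the
inverse of \<open>T\<close>, and reflexivity then yields surjectivity.\<close>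

lemma T_span: "Dual \<subseteq> fs.span {(\<lambda>a. T a \<alpha> S) | \<alpha> S. True}"
proof (rule ccontr)
 let ?\<Psi> = "{(\<lambda>a. T a \<alpha> S) | \<alpha> S. True}"
 assume "\<not> Dual \<subseteq> fs.span ?\<Psi>"
 then obtain h where h: "h \<in> Dual" "h \<notin> fs.span ?\<Psi>" by blast
 obtain \<psi> :: "('v => 'k) => 'k" where
  psi: "\<And>f g. \<psi> (f + g) = \<psi> f + \<psi> g" "\<And>c f. \<psi> (\<lambda>x. c * f x) = c * \<psi> f"
   "\<And>f. f \<in> fs.span ?\<Psi> ==> \<psi> f = 0" "\<psi> h = 1"
 proof (rule fs.ex_functional[OF fs.subspace_span h(2)])
  fix \<psi> :: "('v => 'k) => 'k"
  assume a: "\<And>f g. \<psi> (f + g) = \<psi> f + \<psi> g" "\<And>c f. \<psi> (\<lambda>x. c * f x) = c * \<psi> f"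
   "\<And>f. f \<in> fs.span ?\<Psi> ==> \<psi> f = 0" "\<psi> h = 1"
  show thesis by (rule that[OF a])
 qed
 have "\<exists>a. P0 a + P1 a = a \<and> (\<forall>g\<in>Dual. \<psi> g = g a)"
 proof (rule Dual_refl)
  show "\<psi> (\<lambda>x. h x + g x) = \<psi> h + \<psi> g" for h g using psi(1)[of h g] by (simp only: plus_fun_def)
  show "\<psi> (\<lambda>x. c * h x) = c * \<psi> h" for c h by (rule psi(2))
 qed
 then obtain a where a: "a \<in> V" "\<And>g. g \<in> Dual ==> \<psi> g = g a" by (auto simp: V_def pi_def)
 have "T a \<alpha> S = 0" for \<alpha> S
 proof -
  have "(\<lambda>a. T a \<alpha> S) \<in> fs.span ?\<Psi>" by (rule fs.span_base) blast
  from psi(3)[OF this] show ?thesis unfolding a(2)[OF T_Dual] .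
 qed
 hence "a = 0" using T_inj[OF a(1)] by (simp add: fun_eq_iff)
 thus False using psi(4) a(2)[OF h(1)] h(1) by simp
qed

lemma T_finite: assumes "h \<in> Dual" shows "\<exists>X. finite X \<and> (\<forall>a. (\<forall>(\<alpha>, S)\<in>X. T a \<alpha> S = 0) \<longrightarrow> h a = 0)"
proof -
 have "h \<in> fs.span {(\<lambda>a. T a \<alpha> S) | \<alpha> S. True}" using T_span assms by blast
 thus ?thesis
 proof (induction rule: fs.span_induct_alt)
  case base show ?case by (intro exI[of _ "{}"]) simp
 next
  case (step c f g)
  then obtain \<alpha> S where f: "f = (\<lambda>a. T a \<alpha> S)" by blast
  obtain X where "finite X" "\<forall>a. (\<forall>(\<alpha>, S)\<in>X. T a \<alpha> S = 0) \<longrightarrow> g a = 0" using step by blast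
  thus ?case by (intro exI[of _ "insert (\<alpha>, S) X"]) (auto simp: f)
 qed
qed

lemma T_surj: assumes f: "f \<in> Ser r n" shows "\<exists>a\<in>V. T a = f"
proof -
 define R :: "((nat \<Rightarrow>\<^sub>0 nat) \<times> nat set) set" where "R = {(\<alpha>, S). Poly_Mapping.keys \<alpha> \<subseteq> {..<r} \<and> S \<subseteq> {..<n}}"
 have "\<forall>x\<in>R. \<exists>b. b \<in> V \<and> T b = ind (fst x) (snd x)" using T_monomial by (auto simp: R_def)
 then obtain b where b: "\<And>x. x \<in> R ==> b x \<in> V \<and> T (b x) = ind (fst x) (snd x)" by metis
 have fin: "finite {x\<in>R. h (b x) \<noteq> 0}" if h: "h \<in> Dual" for h
 proof -
  obtain X where X: "finite X" "\<And>a. (\<forall>(\<alpha>, S)\<in>X. T a \<alpha> S = 0) ==> h a = 0" using T_finite[OF h] by blast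
  have "{x\<in>R. h (b x) \<noteq> 0} \<subseteq> X"
  proof
   fix x assume x: "x \<in> {x\<in>R. h (b x) \<noteq> 0}"
   show "x \<in> X"
   proof (rule ccontr)
    assume "x \<notin> X"
    have "T (b x) \<alpha> S = 0" if "(\<alpha>, S) \<in> X" for \<alpha> S
     using that \<open>x \<notin> X\<close> b[of x] x by (cases x) (auto simp: ind_def)
    hence "h (b x) = 0" by (intro X(2)) auto
    thus False using x by simp
   qed
  qed
  thus ?thesis using X(1) finite_subset by blast
 qed
 \<comment> \<open>the would-be value of \<open>h\<close> at the element with expansion \<open>f\<close>\<close>
 define G where "G h = (\<Sum>x\<in>{x\<in>R. h (b x) \<noteq> 0}. f (fst x) (snd x) * h (b x))" for h :: "'v => 'k"
 have G: "G h = (\<Sum>x\<in>Y. f (fst x) (snd x) * h (b x))" if "finite Y" "{x\<in>R. h (b x) \<noteq> 0} \<subseteq> Y" "Y \<subseteq> R" for h Y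
  unfolding G_def by (rule sum.mono_neutral_left) (use that in auto)
 have "\<exists>a. P0 a + P1 a = a \<and> (\<forall>h\<in>Dual. G h = h a)"
 proof (rule Dual_refl)
  fix h g assume h: "h \<in> Dual" "g \<in> Dual"
  let ?Y = "{x\<in>R. h (b x) \<noteq> 0} \<union> {x\<in>R. g (b x) \<noteq> 0}"
  have fY: "finite ?Y" using fin h by blast
  have "G (\<lambda>x. h x + g x) = (\<Sum>x\<in>?Y. f (fst x) (snd x) * (h (b x) + g (b x)))" by (rule G[OF fY]) auto
  moreover have "G h = (\<Sum>x\<in>?Y. f (fst x) (snd x) * h (b x))" "G g = (\<Sum>x\<in>?Y. f (fst x) (snd x) * g (b x))"
   by (rule G[OF fY]; auto)+
  ultimately show "G (\<lambda>x. h x + g x) = G h + G g" by (simp add: distrib_left sum.distrib)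
 next
  fix c h assume h: "h \<in> Dual"
  have "G (\<lambda>x. c * h x) = (\<Sum>x\<in>{x\<in>R. h (b x) \<noteq> 0}. f (fst x) (snd x) * (c * h (b x)))"
   by (rule G[OF fin[OF h]]) auto
  thus "G (\<lambda>x. c * h x) = c * G h" by (simp add: G_def sum_distrib_left mult.left_commute)
 qed
 then obtain a where a: "a \<in> V" "\<And>h. h \<in> Dual ==> G h = h a" by (auto simp: V_def pi_def)
 have "T a \<alpha> S = f \<alpha> S" for \<alpha> S
 proof (cases "(\<alpha>, S) \<in> R")
  case True
  have "T a \<alpha> S = G (\<lambda>a. T a \<alpha> S)" using a(2)[OF T_Dual] by simp
  also have "\<dots> = (\<Sum>x\<in>{(\<alpha>, S)}. f (fst x) (snd x) * T (b x) \<alpha> S)"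
  proof (rule G)
   show "{x\<in>R. T (b x) \<alpha> S \<noteq> 0} \<subseteq> {(\<alpha>, S)}" using b by (auto simp: ind_def split: if_splits)
  qed (use True in auto)
  also have "\<dots> = f \<alpha> S" using b[OF True] by (simp add: ind_def)
  finally show ?thesis .
 next
  case False
  thus ?thesis using Ser_outside[OF T_Ser] Ser_outside[OF f] unfolding R_def by (metis (no_types, lifting) case_prodI mem_Collect_eq)
 qed
 thus ?thesis using a(1) by blast
qed

end

text \<open>A topological isomorphism of superalgebras from the carrier to \<open>\<O>(r,n)\<close>, expressed through functionals; the bracket
is left out because it varies with the gauge. Continuity of \<open>T\<close> is that its coefficients are in \<open>Dual\<close>, and
continuity of the inverse is the last conjunct.\<close>

definition (in calg) coords :: "nat => nat => ('v => 'k series) => bool" where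
 "coords r n T \<longleftrightarrow> (\<forall>a b. T (a + b) = T a + T b) \<and> (\<forall>c a. T (c \<cdot> a) = ser_scale c (T a)) \<and>
   (\<forall>a b. T (a \<odot> b) = ser_mult (T a) (T b)) \<and> (\<forall>a. T (sg a) = ser_sign (T a)) \<and>
   (\<forall>a. T a \<in> Ser r n) \<and> (\<forall>a\<in>V. T a = 0 \<longrightarrow> a = 0) \<and> (\<forall>f\<in>Ser r n. \<exists>a\<in>V. T a = f) \<and>
   (\<forall>\<alpha> S. (\<lambda>a. T a \<alpha> S) \<in> Dual) \<and>
   (\<forall>h\<in>Dual. \<exists>Y. finite Y \<and> (\<forall>a. (\<forall>(\<alpha>, S)\<in>Y. T a \<alpha> S = 0) \<longrightarrow> h a = 0))"

definition P_brk :: "nat => nat => 'k::field series => 'k series => 'k series" where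
 "P_brk m n = (if even m then bracket_H (m div 2) n else bracket_K (m div 2) n)"

context lgp
begin

lemma MM_sg:
 assumes nf: "nf ct \<tau> k n P Q E t" and i: "i < dm ct k + n"
 shows "MM \<tau> (dm ct k) k P Q E i (sg a) = (if i < dm ct k then sg (MM \<tau> (dm ct k) k P Q E i a) else - sg (MM \<tau> (dm ct k) k P Q E i a))"
proof (rule nf_index[OF nf i])
 assume o: "ordinary (dm ct k) k n i" and M: "MM \<tau> (dm ct k) k P Q E i = Mz (zv \<tau> (dm ct k) k P Q E i)"
 show ?thesis
  using sg_H[OF oz(4)[OF nf o]]
  by (simp add: M Mz_def sg_lin sg_br sg_prd sg_D prty_def br_lin prd_lin split: if_splits)
next
 assume c: "ct" "i = 2 * k" and M: "MM \<tau> (dm ct k) k P Q E i = (\<lambda>b. (1/2) \<cdot> D b)"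
 thus ?thesis by (simp add: M sg_lin sg_D dm_def)
qed

theorem formal_coordinates:
 assumes nf: "nf ct (swap2 n) k n P Q E t" and cen: "\<And>c. c \<in> cen (sysS k n P Q E) ==> c = \<epsilon> c \<cdot> e"
 shows "\<exists>T. coords (dm ct k) n T \<and> (\<forall>a b. T (br a b) = P_brk (dm ct k) n (T a) (T b)) \<and>
  (\<forall>b. T (br e b) = P_deriv (dm ct k) (T b))"
proof -
 define r where "r = dm ct k"
 define y where "y = yv r k P Q E t"
 define M where "M = MM (swap2 n) r k P Q E"
 have F: "frame (r + n) (prty r) y M" unfolding r_def y_def M_def by (rule nf_frame[OF nf])
 have dM: "M i (a \<odot> b) = M i a \<odot> b + tw (prty r i) a \<odot> M i b" if "i < r + n" for i a b
  using MM_deriv[OF nf] that unfolding r_def M_def by blast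
 have sM: "M i (sg a) = (if i < r then sg (M i a) else - sg (M i a))" if "i < r + n" "a \<in> V" for i a
  using MM_sg[OF nf] that unfolding r_def M_def by blast
 have ctr: "c = \<epsilon> c \<cdot> e" if "c \<in> V" "\<And>i. i < r + n ==> M i c = 0" for c
  using cen[OF nf_kernel[OF nf that(1) that(2)[unfolded r_def M_def]]] unfolding r_def by blast
 interpret t: taylor_frame scale P0 P1 prd e Dual br \<epsilon> r n y M
  by unfold_locales (fact F, rule dM, assumption, rule sM, assumption+, rule ctr, assumption, blast)
 define T' where "T' = t.T"
 note Tx = t.T_x[folded T'_def] and Txi = t.T_xi[folded T'_def] and Tl = t.T_lin[folded T'_def]
  and Tm = t.T_mult[folded T'_def] and Ts = t.T_sg[folded T'_def]
  and Tev = t.T_even[folded T'_def] and Tod = t.T_odd[folded T'_def]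
 have co: "coords r n T'" unfolding coords_def T'_def
  by (intro conjI allI ballI impI t.T_lin(1,2) t.T_mult t.T_sg t.T_Ser t.T_surj t.T_Dual t.T_finite) (erule t.T_inj)
 have cM: "cop (M i)" for i unfolding M_def r_def by (rule MM_cop[OF nf])
 have Madd: "M i (a + b) = M i a + M i b" for i a b by (rule cop_add[OF cM])
 have MV: "M i a \<in> V" for i a by (rule cop_V[OF cM])
 have rk: "2 * k \<le> r" "ct ==> r = Suc (2 * k)" "\<not> ct ==> r = 2 * k" by (simp_all add: r_def dm_def)
 define Eu where "Eu a = (\<Sum>i<k. P i \<odot> M i a + Q i \<odot> M (k + i) a) + (\<Sum>j<n. E j \<odot> M (r + j) a)" for a
 define R where "R a b = (\<Sum>i<k. M i a \<odot> M (k + i) b - M (k + i) a \<odot> M i b)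
  + (\<Sum>j<n. M (r + swap2 n j) (sg a) \<odot> M (r + j) b)
  + (if ct then (2 \<cdot> a - Eu a) \<odot> M (2 * k) b - M (2 * k) a \<odot> (2 \<cdot> b - Eu b) else 0)" for a b
 have Eul: "Eul ct (swap2 n) k n P Q E a = Eu a" for a by (simp add: Eul_def[OF nf cen] Eu_def M_def r_def)
 have hom: "br a b = R a b" if "a \<in> H p" "b \<in> V" for a b p
 proof -
  note bracket_formula[OF nf _ that, unfolded Eul, folded r_def, folded M_def]
  thus ?thesis unfolding R_def using cen by blast
 qed
 have Euadd: "Eu (a + b) = Eu a + Eu b" for a b
  by (simp add: Eu_def Madd prd_lin sum.distrib add_ac)
 have Radd: "R (a + a') b = R a b + R a' b" for a a' b
  by (cases ct) (simp_all add: R_def Madd Euadd prd_lin sg_lin sum.distrib sum_subtractf scale_right_distrib algebra_simps)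
 have brR: "br a b = R a b" if "a \<in> V" "b \<in> V" for a b
 proof -
  have "br a b = br (P0 a) b + br (P1 a) b" using V_decomp[OF that(1)] br_addl by metis
  also have "\<dots> = R (P0 a) b + R (P1 a) b" using hom[OF P_in_H(1) that(2)] hom[OF P_in_H(2) that(2)] by simp
  also have "\<dots> = R a b" using V_decomp[OF that(1)] Radd by metis
  finally show ?thesis .
 qed
 have TM: "T' (M i a) = d_x i (T' a)" if "i < r" "a \<in> V" for i a using Tx[OF that] by simp
 have TN: "T' (M (r + j) a) = d_xi j (T' a)" if "j < n" "a \<in> V" for j a using Txi[OF that] by simp
 have TP: "T' (P i) = ser_x i" "T' (Q i) = ser_x (k + i)" if "i < k" for i
  using Tev[of i] Tev[of "k + i"] that rk(1) by (simp_all add: y_def yv_def)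
 have TE: "T' (E j) = ser_xi j" if "j < n" for j
  using Tod[of j] that rk(1) by (simp add: y_def yv_def)
 have sw: "swap2 n j < n" if "j < n" for j using that by (auto simp: swap2_def)
 have TEu: "T' (Eu a) = euler k n (T' a)" if "a \<in> V" for a
 proof -
  have "T' (Eu a) = (\<Sum>i<k. T' (P i \<odot> M i a + Q i \<odot> M (k + i) a)) + (\<Sum>j<n. T' (E j \<odot> M (r + j) a))"
   by (simp add: Eu_def Tl)
  also have "\<dots> = euler k n (T' a)" unfolding euler_def
   by (intro arg_cong2[where f = "(+)"] sum.cong refl)
     (use rk(1) that in \<open>simp_all add: Tl Tm TM TN TP TE\<close>)
  finally show ?thesis .
 qed
 have even: "T' (\<Sum>i<k. M i a \<odot> M (k + i) b - M (k + i) a \<odot> M i b) = bracket_even_part k (T' a) (T' b)"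
  if "a \<in> V" "b \<in> V" for a b
  unfolding bracket_even_part_def Tl(7) by (rule sum.cong) (use rk(1) that in \<open>simp_all add: Tl Tm TM\<close>)
 have odd: "T' (\<Sum>j<n. M (r + swap2 n j) (sg a) \<odot> M (r + j) b) = bracket_odd_part n (ser_sign (T' a)) (T' b)"
  if "a \<in> V" "b \<in> V" for a b
  unfolding bracket_odd_part_swap swap2_def[symmetric] Tl(7)
  by (rule sum.cong) (use that sw in \<open>simp_all add: Tm TN Ts V_in\<close>)
 have contact: "T' ((2 \<cdot> a - Eu a) \<odot> M (2 * k) b - M (2 * k) a \<odot> (2 \<cdot> b - Eu b))
   = ser_mult (ser_scale 2 (T' a) - euler k n (T' a)) (d_x (2 * k) (T' b))
   - ser_mult (d_x (2 * k) (T' a)) (ser_scale 2 (T' b) - euler k n (T' b))" if "a \<in> V" "b \<in> V" ct for a b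
  using rk(2)[OF that(3)] that by (simp add: Tl Tm TM TEu)
 have TR: "T' (R a b) = P_brk r n (T' a) (T' b)" if "a \<in> V" "b \<in> V" for a b
 proof (cases ct)
  case True
  have "even r \<longleftrightarrow> False" "r div 2 = k" using rk(2)[OF True] by simp_all
  thus ?thesis unfolding R_def P_brk_def Tl(1) even[OF that] odd[OF that] bracket_K_def bracket_H_def
   using contact[OF that True] True by simp
 next
  case False
  have "even r \<longleftrightarrow> True" "r div 2 = k" using rk(3)[OF False] by simp_all
  thus ?thesis unfolding R_def P_brk_def Tl(1) even[OF that] odd[OF that] bracket_H_def
   using False Tl(5) by simp
 qed
 have "T' (br a b) = P_brk r n (T' a) (T' b)" for a b
  using TR[of "pi a" "pi b"] brR[of "pi a" "pi b"] by (simp add: br_pil br_pir Tl)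
 moreover have "T' (br e b) = P_deriv r (T' b)" for b
 proof (cases ct)
  case True
  have "M (2 * k) b = (1/2) \<cdot> D b" for b using rk(2)[OF True] by (simp add: M_def MM_def)
  hence "br e b = 2 \<cdot> M (2 * k) (pi b)" by (simp add: D_def br_pir)
  hence "T' (br e b) = ser_scale 2 (T' (M (2 * k) (pi b)))" by (simp only: Tl)
  also have "\<dots> = ser_scale 2 (d_x (2 * k) (T' b))" using rk(2)[OF True] by (simp add: TM Tl)
  finally show ?thesis using rk(2)[OF True] by (simp add: P_deriv_def)
 next
  case False
  thus ?thesis using nf rk(3) Tl(5) by (simp add: nf_def D_def P_deriv_def)
 qed
 ultimately show ?thesis using co unfolding r_def by blast
qed

lemma poisson_coordinates:
 assumes D: "\<forall>x. br e x = 0"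
 shows "\<exists>r n T. even r \<and> coords r n T \<and> (\<forall>a b. T (br a b) = P_brk r n (T a) (T b)) \<and>
  (\<forall>b. T (br e b) = P_deriv r (T b))"
proof -
 obtain ct k n P Q E t where nf: "nf ct (swap2 n) k n P Q E t" and c: "\<forall>c\<in>cen (sysS k n P Q E). c = \<epsilon> c \<cdot> e"
  using canonical_coordinates D unfolding D_def by blast
 have "\<not> ct"
 proof
  assume ct
  hence "2 \<cdot> e = 0" using nf D by (simp add: nf_def D_def)
  thus False using e_nz by simp
 qed
 hence "even (dm ct k)" by (simp add: dm_def)
 moreover have "c = \<epsilon> c \<cdot> e" if "c \<in> cen (sysS k n P Q E)" for c using c that by (rule bspec)
 note formal_coordinates[OF nf this]
 ultimately show ?thesis by blast
qed

lemma contact_coordinates: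
 assumes "\<forall>\<phi>\<in>H 0. \<epsilon> \<phi> \<noteq> 0 \<longrightarrow> (\<exists>b\<in>V. \<epsilon> (br \<phi> b + br e \<phi> \<odot> b) \<noteq> 0)"
 shows "\<exists>r n T. coords r n T \<and> (\<forall>a b. T (br a b) = P_brk r n (T a) (T b)) \<and>
  (\<forall>b. T (br e b) = P_deriv r (T b))"
proof -
 have "\<forall>\<phi>\<in>H 0. \<epsilon> \<phi> \<noteq> 0 \<longrightarrow> (\<exists>b\<in>V. \<epsilon> (X \<phi> b) \<noteq> 0)" using assms unfolding X_def D_def .
 then obtain ct k n P Q E t where nf: "nf ct (swap2 n) k n P Q E t" and c: "\<forall>c\<in>cen (sysS k n P Q E). c = \<epsilon> c \<cdot> e"
  using canonical_coordinates by blast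
 have "c = \<epsilon> c \<cdot> e" if "c \<in> cen (sysS k n P Q E)" for c using c that by (rule bspec)
 note formal_coordinates[OF nf this]
 thus ?thesis by blast
qed

lemma gauge_D:
 assumes f: "f \<in> H 0" and g: "g \<in> H 0" and gf: "g \<odot> f = e"
 shows "gauge f g e x = br f x + br e f \<odot> x"
proof -
 have "br f (f \<odot> x) = f \<odot> (br f x + br e f \<odot> x)"
  using br_leibniz[OF f, of f x] even_self[OF f] by (simp add: tw_def prd_lin even_left_commute[OF f])
 thus ?thesis using f gf by (simp add: gauge_def H_V pi_V flip: assoc)
qed

lemma casimir_gauge:
 assumes "\<forall>x. \<epsilon> (br e x) = 0"
 shows "\<exists>\<phi>\<in>H 0. \<exists>g\<in>H 0. g \<odot> \<phi> = e \<and> (\<forall>x. gauge \<phi> g e x = 0)"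
proof -
 obtain \<phi> where p: "\<phi> \<in> H 0" "\<epsilon> \<phi> = 1" "\<And>x. X \<phi> x = 0"
  using casimir assms unfolding D_def by metis
 have "\<epsilon> \<phi> \<noteq> 0" using p(2) by simp
 from ex_inverse[OF p(1) this] obtain g where g: "g \<in> H 0" "g \<odot> \<phi> = e" by metis
 have "gauge \<phi> g e x = 0" for x using gauge_D[OF p(1) g] p(3)[of x] by (simp add: X_def D_def)
 thus ?thesis using p(1) g by blast
qed

lemma gauge_e: "gauge e e a b = br a b"
 by (simp add: gauge_def br_pil br_pir pi_V)

text \<open>Either \<open>D = 0\<close> already, or no gauge kills the derivation at the origin and the contact normal form applies
directly, or two gauge transformations, combined into one, reduce to \<open>D = 0\<close>.\<close>

theorem structure_theorem:
 "\<exists>r n T \<phi> g. \<phi> \<in> H 0 \<and> g \<in> H 0 \<and> g \<odot> \<phi> = e \<and> coords r n T \<and>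
   (\<forall>a b. T (gauge \<phi> g a b) = P_brk r n (T a) (T b)) \<and> (\<forall>b. T (gauge \<phi> g e b) = P_deriv r (T b)) \<and>
   ((\<forall>x. br e x = 0) \<longrightarrow> even r \<and> \<phi> = e \<and> g = e)"
proof (cases "\<forall>x. br e x = 0")
 case True
 from poisson_coordinates[OF this] obtain r n T where
  "even r" "coords r n T" "\<forall>a b. T (br a b) = P_brk r n (T a) (T b)" "\<forall>b. T (br e b) = P_deriv r (T b)" by blast
 thus ?thesis
   by - (rule exI[of _ r], rule exI[of _ n], rule exI[of _ T], rule exI[of _ e], rule exI[of _ e], simp add: gauge_e pi_V)
next
 case D: False
 show ?thesis
 proof (cases "\<forall>\<phi>\<in>H 0. \<epsilon> \<phi> \<noteq> 0 \<longrightarrow> (\<exists>b\<in>V. \<epsilon> (br \<phi> b + br e \<phi> \<odot> b) \<noteq> 0)")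
  case True
  from contact_coordinates[OF this] obtain r n T where
   "coords r n T" "\<forall>a b. T (br a b) = P_brk r n (T a) (T b)" "\<forall>b. T (br e b) = P_deriv r (T b)" by blast
  thus ?thesis
   by - (rule exI[of _ r], rule exI[of _ n], rule exI[of _ T], rule exI[of _ e], rule exI[of _ e], simp add: gauge_e pi_V D)
 next
  case False
  then obtain \<psi> where psi: "\<psi> \<in> H 0" "\<epsilon> \<psi> \<noteq> 0" "\<And>b. b \<in> V ==> \<epsilon> (br \<psi> b + br e \<psi> \<odot> b) = 0" by blast
  from ex_inverse[OF psi(1,2)] obtain \<psi>' where g: "\<psi>' \<in> H 0" "\<psi>' \<odot> \<psi> = e" by metis
  note L = gauge_lgp[OF psi(1) g]
  have "\<epsilon> (gauge \<psi> \<psi>' e x) = 0" for x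
   using psi(3)[of "pi x"] gauge_D[OF psi(1) g, of x] by (simp add: br_pir)
  hence "\<forall>x. \<epsilon> (gauge \<psi> \<psi>' e x) = 0" by blast
  from lgp.casimir_gauge[OF L this] obtain \<phi> \<phi>' where
   phi: "\<phi> \<in> H 0" "\<phi>' \<in> H 0" "\<phi>' \<odot> \<phi> = e" "\<forall>x. lgp.gauge prd (gauge \<psi> \<psi>') \<phi> \<phi>' e x = 0" by blast
  note L2 = lgp.gauge_lgp[OF L phi(1,2,3)]
  from lgp.poisson_coordinates[OF L2 phi(4)] obtain r n T where T: "coords r n T"
   "\<forall>a b. T (lgp.gauge prd (gauge \<psi> \<psi>') \<phi> \<phi>' a b) = P_brk r n (T a) (T b)"
   "\<forall>b. T (lgp.gauge prd (gauge \<psi> \<psi>') \<phi> \<phi>' e b) = P_deriv r (T b)" by blast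
  have gg: "lgp.gauge prd (gauge \<psi> \<psi>') \<phi> \<phi>' a b = gauge (\<psi> \<odot> \<phi>) (\<phi>' \<odot> \<psi>') a b" for a b
  proof -
   interpret G: lgp scale P0 P1 prd e Dual "gauge \<psi> \<psi>'" \<epsilon> by (rule L)
   show ?thesis by (simp add: G.gauge_def gauge_def assoc)
  qed
  have H: "\<psi> \<odot> \<phi> \<in> H 0" "\<phi>' \<odot> \<psi>' \<in> H 0" using prd_H[OF psi(1) phi(1)] prd_H[OF phi(2) g(1)] by simp_all
  have "\<phi>' \<odot> \<psi>' \<odot> (\<psi> \<odot> \<phi>) = \<phi>' \<odot> ((\<psi>' \<odot> \<psi>) \<odot> \<phi>)" by (simp add: assoc)
  also have "\<dots> = e" using g(2) phi by simp
  finally show ?thesis using H T D unfolding gg by blast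
 qed
qed

end

section \<open>Coordinate functionals of a linearly compact space\<close>

lemma (in vector_space) representation_combination:
 assumes B: "independent B" "finite B" and b: "b \<in> B"
 shows "representation B (\<Sum>b\<in>B. scale (c b) b) b = c b"
proof -
 have "representation B (\<Sum>b\<in>B. scale (c b) b) = (\<lambda>b. if b \<in> B then c b else 0)"
 proof (rule representation_eqI[OF B(1)])
  show "(\<Sum>b\<in>B. scale (c b) b) \<in> span B" by (intro span_sum span_scale span_base)
  show "finite {b. (if b \<in> B then c b else 0) \<noteq> 0}" by (rule finite_subset[OF _ B(2)]) auto
  show "(\<Sum>b | (if b \<in> B then c b else 0) \<noteq> 0. scale (if b \<in> B then c b else 0) b) = (\<Sum>b\<in>B. scale (c b) b)"
   by (rule sum.mono_neutral_cong_left) (use B in auto)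
 qed (auto split: if_splits)
 thus ?thesis using b by simp
qed

text \<open>\<open>\<Gamma>\<close> consists of the coordinate functionals of the finite-dimensional factors with respect to chosen
bases. The projections to the factors turn the properties of a product topology into properties of \<open>\<Gamma>\<close>.\<close>

lemma linearly_compact_coordinates:
 assumes vs: "vector_space (scl A)" and lc: "linearly_compact_space A" and ts: "topspace (topo A) = space_of A"
 obtains \<Gamma> :: "('v::ab_group_add => 'k::field) set" where
  "\<And>f a b. f \<in> \<Gamma> ==> a \<in> space_of A ==> b \<in> space_of A ==> f (a + b) = f a + f b"
  "\<And>f c a. f \<in> \<Gamma> ==> a \<in> space_of A ==> f (scl A c a) = c * f a"
  "\<And>U a. openin (topo A) U ==> a \<in> U ==> \<exists>\<Phi>. finite \<Phi> \<and> \<Phi> \<subseteq> \<Gamma> \<and> {b\<in>space_of A. \<forall>f\<in>\<Phi>. f b = f a} \<subseteq> U"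
  "\<And>f c. f \<in> \<Gamma> ==> openin (topo A) {b\<in>space_of A. f b = c}"
  "\<And>F. \<exists>a\<in>space_of A. \<forall>f\<in>\<Gamma>. f a = F f"
  "\<And>a b. a \<in> space_of A ==> b \<in> space_of A ==> (\<And>f. f \<in> \<Gamma> ==> f a = f b) ==> a = b"
proof -
 interpret vector_space "scl A" by (rule vs)
 obtain I W and g :: "'v => 'v => 'v" where
  W: "\<forall>i\<in>I. \<exists>B. finite B \<and> W i = span B"
  and hom: "homeomorphic_map (topo A) (product_topology (\<lambda>i. discrete_topology (W i)) I) g"
  and lin: "\<forall>i\<in>I. linear_on_space A (scl A) (\<lambda>v. g v i)"
  using lc unfolding linearly_compact_space_def by blast
 have "\<forall>i\<in>I. \<exists>B. finite B \<and> independent B \<and> W i = span B"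
 proof
  fix i assume "i \<in> I"
  then obtain C where C: "finite C" "W i = span C" using W by blast
  obtain B where B: "B \<subseteq> C" "independent B" "C \<subseteq> span B" using maximal_independent_subset by blast
  have "span C = span B" using B span_mono[OF B(1)] span_minimal[OF B(3) subspace_span] by blast
  thus "\<exists>B. finite B \<and> independent B \<and> W i = span B" using B(1,2) C finite_subset by blast
 qed
 then obtain B where B: "\<And>i. i \<in> I ==> finite (B i) \<and> independent (B i) \<and> W i = span (B i)" by metis
 have cont: "continuous_map (topo A) (discrete_topology (W i)) (\<lambda>v. g v i)" if "i \<in> I" for i
  using homeomorphic_imp_continuous_map[OF hom] that unfolding continuous_map_componentwise by blast
 have gi: "g a i \<in> span (B i)" if "i \<in> I" "a \<in> space_of A" for a i
  using continuous_map_image_subset_topspace[OF cont[OF that(1)]] that ts B by auto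
 have img: "g ` space_of A = Pi\<^sub>E I W"
  using homeomorphic_imp_surjective_map[OF hom] ts by simp
 have inj: "inj_on g (space_of A)" using homeomorphic_imp_injective_map[OF hom] ts by simp
 define f where "f i b = (\<lambda>v. representation (B i) (g v i) b)" for i b
 define \<Gamma> where "\<Gamma> = {f i b | i b. i \<in> I \<and> b \<in> B i}"
 have eq: "g a i = g b i" if "i \<in> I" "a \<in> space_of A" "b \<in> space_of A" "\<And>x. x \<in> B i ==> f i x a = f i x b" for i a b
 proof -
  have "g a i = (\<Sum>x\<in>B i. scl A (f i x a) x)" "g b i = (\<Sum>x\<in>B i. scl A (f i x b) x)"
   using sum_representation_eq[of "B i" _ "B i"] B[OF that(1)] gi[OF that(1)] that(2,3) by (simp_all add: f_def)
  thus ?thesis using that(4) by simp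
 qed
 show thesis
 proof (rule that[of \<Gamma>])
  fix h assume "h \<in> \<Gamma>"
  then obtain i b where h: "h = f i b" "i \<in> I" "b \<in> B i" by (auto simp: \<Gamma>_def)
  have l: "linear_on_space A (scl A) (\<lambda>v. g v i)" using lin h by blast
  show "h (x + y) = h x + h y" if "x \<in> space_of A" "y \<in> space_of A" for x y
   using l that representation_add[of "B i" "g y i" "g x i"] B gi h by (simp add: f_def linear_on_space_def)
  show "h (scl A c x) = c * h x" if "x \<in> space_of A" for c x
   using l that representation_scale[of "B i" "g x i" c] B gi h by (simp add: f_def linear_on_space_def)
  show "openin (topo A) {x\<in>space_of A. h x = c}" for c
  proof -
   have "openin (topo A) {x \<in> topspace (topo A). g x i \<in> {w \<in> W i. representation (B i) w b = c}}"
    by (rule openin_continuous_map_preimage[OF cont[OF h(2)]]) auto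
   moreover have "{x \<in> topspace (topo A). g x i \<in> {w \<in> W i. representation (B i) w b = c}} = {x\<in>space_of A. h x = c}"
    using gi[OF h(2)] B[OF h(2)] by (auto simp: ts h f_def)
   ultimately show ?thesis by simp
  qed
 next
  fix U a assume U: "openin (topo A) U" "a \<in> U"
  have US: "U \<subseteq> space_of A" using openin_subset[OF U(1)] ts by simp
  have "openin (product_topology (\<lambda>i. discrete_topology (W i)) I) (g ` U)"
   using homeomorphic_imp_open_map[OF hom] U(1) by (simp add: open_map_def)
  from iffD1[OF openin_product_topology_alt this, THEN bspec, OF imageI[OF U(2)]]
  obtain N where N: "finite {i \<in> I. N i \<noteq> W i}" "g a \<in> Pi\<^sub>E I N" "Pi\<^sub>E I N \<subseteq> g ` U"
   unfolding topspace_discrete_topology by (elim exE conjE)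
  let ?J = "{i \<in> I. N i \<noteq> W i}"
  define \<Phi> where "\<Phi> = (\<Union>i\<in>?J. f i ` B i)"
  have "finite \<Phi>" unfolding \<Phi>_def using N(1) B by (intro finite_UN_I) auto
  moreover have "\<Phi> \<subseteq> \<Gamma>" by (auto simp: \<Phi>_def \<Gamma>_def)
  moreover have "b \<in> U" if b: "b \<in> space_of A" "\<And>h. h \<in> \<Phi> ==> h b = h a" for b
  proof -
   have "g b \<in> Pi\<^sub>E I N"
   proof (rule PiE_I)
    fix i assume i: "i \<in> I"
    show "g b i \<in> N i"
    proof (cases "i \<in> ?J")
     case True
     have "f i x b = f i x a" if "x \<in> B i" for x by (rule b(2)) (use True that in \<open>auto simp: \<Phi>_def\<close>)
     hence "g b i = g a i" using eq[OF i b(1)] US U(2) by blast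
     thus ?thesis using N(2) i by auto
    next
     case False
     thus ?thesis using gi[OF i b(1)] B[OF i] i by auto
    qed
   next
    fix i assume "i \<notin> I"
    thus "g b i = undefined" using img b(1) by (metis PiE_arb imageI)
   qed
   then obtain c where "c \<in> U" "g c = g b" using N(3) by auto
   thus ?thesis using inj b(1) US by (metis inj_onD subsetD)
  qed
  ultimately show "\<exists>\<Phi>. finite \<Phi> \<and> \<Phi> \<subseteq> \<Gamma> \<and> {b\<in>space_of A. \<forall>h\<in>\<Phi>. h b = h a} \<subseteq> U"
   by (intro exI[of _ \<Phi>]) auto
 next
  fix F :: "('v => 'k) => 'k"
  define w where "w = restrict (\<lambda>i. \<Sum>b\<in>B i. scl A (F (f i b)) b) I"
  have "w \<in> Pi\<^sub>E I W"
  proof (rule PiE_I)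
   fix i assume i: "i \<in> I"
   have "(\<Sum>b\<in>B i. scl A (F (f i b)) b) \<in> span (B i)" by (intro span_sum span_scale span_base)
   thus "w i \<in> W i" using i B by (simp add: w_def)
  qed (simp add: w_def)
  hence "w \<in> g ` space_of A" unfolding img .
  then obtain a where a: "a \<in> space_of A" "g a = w" by blast
  have "h a = F h" if "h \<in> \<Gamma>" for h
  proof -
   obtain i b where h: "h = f i b" "i \<in> I" "b \<in> B i" using \<open>h \<in> \<Gamma>\<close> by (auto simp: \<Gamma>_def)
   thus ?thesis using representation_combination[of "B i" b "\<lambda>b. F (f i b)"] B[OF h(2)] a(2)
    by (simp add: f_def[of i b] w_def)
  qed
  thus "\<exists>a\<in>space_of A. \<forall>h\<in>\<Gamma>. h a = F h" using a(1) by blast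
 next
  fix a b assume ab: "a \<in> space_of A" "b \<in> space_of A" and h: "\<And>h. h \<in> \<Gamma> ==> h a = h b"
  have "g a i = g b i" if "i \<in> I" for i
   by (rule eq[OF that ab]) (use h that in \<open>auto simp: \<Gamma>_def\<close>)
  moreover have "g a \<in> extensional I" "g b \<in> extensional I" using img ab by (auto simp: PiE_def)
  ultimately have "g a = g b" by (metis extensionalityI)
  thus "a = b" using inj ab by (simp add: inj_on_def)
 qed
qed

text \<open>The carrier may be a proper subspace of the ambient type; a linear retraction onto it exists by the choice of a
complement.\<close>

lemma superspace_projections:
 assumes A: "is_superspace A"
 obtains P0 P1 :: "'v::ab_group_add => 'v" where
  "\<And>x y. P0 (x + y) = P0 x + P0 y" "\<And>c x. P0 (scl A c x) = scl A c (P0 x)"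
  "\<And>x y. P1 (x + y) = P1 x + P1 y" "\<And>c x. P1 (scl A c x) = scl A c (P1 x)"
  "\<And>x. P0 x \<in> evens A" "\<And>x. P1 x \<in> odds A"
  "\<And>x. x \<in> evens A ==> P0 x = x" "\<And>x. x \<in> odds A ==> P1 x = x"
  "\<And>x. x \<in> evens A ==> P1 x = 0" "\<And>x. x \<in> odds A ==> P0 x = 0"
proof -
 interpret vector_space "scl A" using A by (simp add: is_superspace_def)
 interpret vector_space_pair "scl A" "scl A" ..
 have S: "subspace (evens A)" "subspace (odds A)" "evens A \<inter> odds A = {0}" using A by (auto simp: is_superspace_def)
 have "subspace {x + y | x y. x \<in> evens A \<and> y \<in> odds A}" using subspace_sums[OF S(1,2)] .
 hence W: "subspace (space_of A)" by (simp add: space_of_def)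
 have "Vector_Spaces.linear (scl A) (scl A) (\<lambda>x. x)" by unfold_locales simp_all
 from linear_exists_left_inverse_on[OF this W] obtain g where
  g: "range g \<subseteq> space_of A" "Vector_Spaces.linear (scl A) (scl A) g" "\<forall>v\<in>space_of A. g v = v" by (auto simp: inj_on_def)
 interpret g: Vector_Spaces.linear "scl A" "scl A" g by (rule g(2))
 have "\<forall>x. \<exists>p. fst p \<in> evens A \<and> snd p \<in> odds A \<and> g x = fst p + snd p"
  using g(1) by (force simp: space_of_def)
 then obtain p where p: "\<And>x. fst (p x) \<in> evens A \<and> snd (p x) \<in> odds A \<and> g x = fst (p x) + snd (p x)" by metis
 have uniq: "fst (p x) = u \<and> snd (p x) = v" if "u \<in> evens A" "v \<in> odds A" "g x = u + v" for x u v
 proof -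
  have "fst (p x) - u = v - snd (p x)" using p[of x] that(3) by (simp add: algebra_simps)
  moreover have "fst (p x) - u \<in> evens A" by (rule subspace_diff[OF S(1)]) (use p that in auto)
  moreover have "v - snd (p x) \<in> odds A" by (rule subspace_diff[OF S(2)]) (use p that in auto)
  ultimately have "fst (p x) - u = 0" "v - snd (p x) = 0" using S(3) by (metis IntI singletonD)+
  thus ?thesis by simp
 qed
 have z: "0 \<in> evens A" "0 \<in> odds A" using S subspace_0 by blast+
 have "x \<in> space_of A" if "x \<in> evens A \<or> x \<in> odds A" for x
  unfolding space_of_def using that z by (metis (mono_tags, lifting) add.left_neutral add.right_neutral mem_Collect_eq)
 hence gx: "g x = x" if "x \<in> evens A \<or> x \<in> odds A" for x using g(3) that by blast
 have "fst (p (x + y)) = fst (p x) + fst (p y) \<and> snd (p (x + y)) = snd (p x) + snd (p y)" for x y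
  by (rule uniq) (use p[of x] p[of y] S subspace_add in \<open>auto simp: g.add\<close>)
 moreover have "fst (p (scl A c x)) = scl A c (fst (p x)) \<and> snd (p (scl A c x)) = scl A c (snd (p x))" for c x
  by (rule uniq) (use p[of x] S subspace_scale in \<open>auto simp: g.scale scale_right_distrib\<close>)
 moreover have "fst (p x) = x \<and> snd (p x) = 0" if "x \<in> evens A" for x by (rule uniq) (use that gx z in auto)
 moreover have "fst (p x) = 0 \<and> snd (p x) = x" if "x \<in> odds A" for x by (rule uniq) (use that gx z in auto)
 ultimately show thesis using p by (intro that[of "\<lambda>x. fst (p x)" "\<lambda>x. snd (p x)"]) auto
qed

section \<open>Totalized operations\<close>

text \<open>The given data together with the choices that make the operations total and the topology accessible.\<close>

locale lc_gp =
 fixes A :: "('k::{alg_closed_field, field_char_0}, 'v::ab_group_add) gp_superalg" and D :: "'v => 'v"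
  and P0 P1 :: "'v => 'v" and \<Gamma> :: "('v => 'k) set" and e :: 'v
 assumes gp: "generalized_poisson A D" and unit: "is_unit_element A e" and gp_simple: "gp_simple A"
  and lc: "linearly_compact_gp A"
  and P0_lin: "P0 (x + y) = P0 x + P0 y" "P0 (scl A c x) = scl A c (P0 x)"
  and P1_lin: "P1 (x + y) = P1 x + P1 y" "P1 (scl A c x) = scl A c (P1 x)"
  and P_in: "P0 x \<in> evens A" "P1 x \<in> odds A"
  and P_id: "x \<in> evens A ==> P0 x = x" "x \<in> odds A ==> P1 x = x"
  and P_0: "x \<in> evens A ==> P1 x = 0" "x \<in> odds A ==> P0 x = 0"
  and \<Gamma>_add: "f \<in> \<Gamma> ==> a \<in> space_of A ==> b \<in> space_of A ==> f (a + b) = f a + f b"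
  and \<Gamma>_scale: "f \<in> \<Gamma> ==> a \<in> space_of A ==> f (scl A c a) = c * f a"
  and \<Gamma>_open: "openin (topo A) U ==> a \<in> U ==> \<exists>\<Phi>. finite \<Phi> \<and> \<Phi> \<subseteq> \<Gamma> \<and> {b\<in>space_of A. \<forall>f\<in>\<Phi>. f b = f a} \<subseteq> U"
  and open_\<Gamma>: "f \<in> \<Gamma> ==> openin (topo A) {b\<in>space_of A. f b = c}"
  and \<Gamma>_surj: "\<exists>a\<in>space_of A. \<forall>f\<in>\<Gamma>. f a = F f"
  and \<Gamma>_inj: "a \<in> space_of A ==> b \<in> space_of A ==> (\<And>f. f \<in> \<Gamma> ==> f a = f b) ==> a = b"
begin

abbreviation (input) "W \<equiv> space_of A"

definition "\<pi> x = P0 x + P1 x"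
definition "prd x y = mul A (\<pi> x) (\<pi> y)"
definition "bra x y = brk A (\<pi> x) (\<pi> y)"
definition "Dual = fs.span ((\<lambda>f x. f (\<pi> x)) ` \<Gamma>)"

lemma ca: "comm_assoc_superalgebra A" and lie: "lie_super_bracket A (brk A)" and der: "even_derivation A D"
 using gp by (auto simp: generalized_poisson_def)

lemma sA: "is_superspace A" and gm: "graded_bilinear A (mul A)" and gb: "graded_bilinear A (brk A)"
 using ca lie by (auto simp: comm_assoc_superalgebra_def is_superalgebra_def lie_super_bracket_def)

sublocale vector_space "scl A" using sA by (simp add: is_superspace_def)

lemma sub: "subspace (evens A)" "subspace (odds A)" and ev_od: "evens A \<inter> odds A = {0}"
 using sA by (auto simp: is_superspace_def)

lemma W_sub: "subspace W"
 using subspace_sums[OF sub] by (simp add: space_of_def)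

lemma \<pi>_W [simp]: "\<pi> x \<in> W" using P_in by (auto simp: \<pi>_def space_of_def)

lemma \<pi>_id [simp]: "x \<in> W ==> \<pi> x = x"
 by (auto simp: space_of_def \<pi>_def P0_lin P1_lin P_id P_0)

lemma ev_W: "x \<in> evens A ==> x \<in> W" and od_W: "x \<in> odds A ==> x \<in> W"
 using \<pi>_W[of x] P_id[of x] P_0[of x] by (auto simp: \<pi>_def)

lemma PW [simp]: "P0 x \<in> W" "P1 x \<in> W" using ev_W od_W P_in by blast+

lemma \<pi>_lin: "\<pi> (x + y) = \<pi> x + \<pi> y" "\<pi> (scl A c x) = scl A c (\<pi> x)"
 by (simp_all add: \<pi>_def P0_lin P1_lin scale_right_distrib)

lemma hom01: "P0 x \<in> homog A 0" "P1 x \<in> homog A (Suc 0)" "P1 x \<in> homog A 1"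
 using P_in by (simp_all add: homog_def)

lemma bilin:
 assumes "graded_bilinear A f"
 shows "a \<in> W ==> b \<in> W ==> c \<in> W ==> f (a + b) c = f a c + f b c"
  "a \<in> W ==> b \<in> W ==> c \<in> W ==> f a (b + c) = f a b + f a c"
  "a \<in> W ==> b \<in> W ==> f (scl A s a) b = scl A s (f a b)"
  "a \<in> W ==> b \<in> W ==> f a (scl A s b) = scl A s (f a b)"
  "a \<in> homog A p ==> b \<in> homog A q ==> f a b \<in> homog A (p + q)"
 using assms unfolding graded_bilinear_def linear_on_space_def by blast+

lemma bilin_W:
 assumes f: "graded_bilinear A f" and a: "a \<in> W" and b: "b \<in> W" shows "f a b \<in> W"
proof -
 have h: "f x y \<in> W" if "x \<in> homog A p" "y \<in> homog A q" for x y p q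
  using bilin(5)[OF f that] ev_W od_W by (auto simp: homog_def split: if_splits)
 have "f a b = f (P0 a) (P0 b) + f (P0 a) (P1 b) + (f (P1 a) (P0 b) + f (P1 a) (P1 b))"
  using bilin(1)[OF f, of "P0 a" "P1 a" b] bilin(2)[OF f, of "P0 a" "P0 b" "P1 b"] bilin(2)[OF f, of "P1 a" "P0 b" "P1 b"]
   \<pi>_id[OF a] \<pi>_id[OF b] b by (simp add: \<pi>_def)
 thus ?thesis using h[OF hom01(1) hom01(1)] h[OF hom01(1) hom01(2)] h[OF hom01(2) hom01(1)] h[OF hom01(2) hom01(2)]
  subspace_add[OF W_sub] by simp
qed

lemma total_bilin:
 assumes f: "graded_bilinear A f" and g: "\<And>x y. g x y = f (\<pi> x) (\<pi> y)"
 shows "g (x + y) z = g x z + g y z" "g x (y + z) = g x y + g x z"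
  "g (scl A c x) y = scl A c (g x y)" "g x (scl A c y) = scl A c (g x y)"
  "g (\<pi> x) y = g x y" "g x (\<pi> y) = g x y" "g x y \<in> W"
 using bilin[OF f] bilin_W[OF f] by (simp_all add: g \<pi>_lin)

lemmas prd_bilin = total_bilin[OF gm prd_def] and bra_bilin = total_bilin[OF gb bra_def]

lemma top: "topspace (topo A) = W" using lc by (simp add: linearly_compact_gp_def topological_superspace_def)

lemma \<Gamma>_Dual: "f \<in> \<Gamma> ==> (\<lambda>x. f (\<pi> x)) \<in> Dual"
 unfolding Dual_def by (rule fs.span_base) blast

lemma Dual_facts:
 assumes "h \<in> Dual"
 shows "h (x + y) = h x + h y" "h (scl A c x) = c * h x" "h (\<pi> x) = h x"
  "\<exists>\<Phi>. finite \<Phi> \<and> \<Phi> \<subseteq> \<Gamma> \<and> (\<forall>x\<in>W. (\<forall>f\<in>\<Phi>. f x = 0) \<longrightarrow> h x = 0)"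
proof -
 have "(\<forall>x y. h (x + y) = h x + h y) \<and> (\<forall>c x. h (scl A c x) = c * h x) \<and> (\<forall>x. h (\<pi> x) = h x) \<and>
  (\<exists>\<Phi>. finite \<Phi> \<and> \<Phi> \<subseteq> \<Gamma> \<and> (\<forall>x\<in>W. (\<forall>f\<in>\<Phi>. f x = 0) \<longrightarrow> h x = 0))"
  using assms unfolding Dual_def
 proof (induction rule: fs.span_induct_alt)
  case base
  show ?case by (intro conjI exI[of _ "{}"]) auto
 next
  case (step c g h)
  then obtain f where f: "f \<in> \<Gamma>" "g = (\<lambda>x. f (\<pi> x))" by blast
  from step obtain \<Phi> where P: "finite \<Phi>" "\<Phi> \<subseteq> \<Gamma>" "\<forall>x\<in>W. (\<forall>f\<in>\<Phi>. f x = 0) \<longrightarrow> h x = 0" by blast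
  have "\<exists>\<Phi>. finite \<Phi> \<and> \<Phi> \<subseteq> \<Gamma> \<and> (\<forall>x\<in>W. (\<forall>f\<in>\<Phi>. f x = 0) \<longrightarrow> ((\<lambda>x. c * g x) + h) x = 0)"
   using P f(1) by (intro exI[of _ "insert f \<Phi>"]) (auto simp: f(2))
  moreover have "\<pi> (\<pi> x) = \<pi> x" for x by simp
  ultimately show ?case using step.IH \<Gamma>_add[OF f(1)] \<Gamma>_scale[OF f(1)]
   by (simp add: f(2) \<pi>_lin algebra_simps)
 qed
 thus "h (x + y) = h x + h y" "h (scl A c x) = c * h x" "h (\<pi> x) = h x"
  "\<exists>\<Phi>. finite \<Phi> \<and> \<Phi> \<subseteq> \<Gamma> \<and> (\<forall>x\<in>W. (\<forall>f\<in>\<Phi>. f x = 0) \<longrightarrow> h x = 0)" by simp_all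
qed

lemma Dual_combination:
 assumes add: "\<And>x y. h (x + y) = h x + h y" and sc: "\<And>c x. h (scl A c x) = c * h x" and p: "\<And>x. h (\<pi> x) = h x"
  and \<Phi>: "finite \<Phi>" "\<Phi> \<subseteq> \<Gamma>" and z: "\<And>x. x \<in> W ==> (\<And>f. f \<in> \<Phi> ==> f x = 0) ==> h x = 0"
 shows "\<exists>\<Psi> c. finite \<Psi> \<and> \<Psi> \<subseteq> (\<lambda>f x. f (\<pi> x)) ` \<Gamma> \<and> h = (\<lambda>x. \<Sum>g\<in>\<Psi>. c g * g x)"
proof -
 let ?\<Psi> = "(\<lambda>f x. f (\<pi> x)) ` \<Phi>"
 have "\<exists>c. \<forall>x. h x = (\<Sum>g\<in>?\<Psi>. c g * g x)"
 proof (rule functional_in_span)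
  show "finite ?\<Psi>" using \<Phi> by simp
  show "(\<forall>x y. g (x + y) = g x + g y) \<and> (\<forall>c x. g (scl A c x) = c * g x)" if "g \<in> ?\<Psi>" for g
  proof -
   have "g \<in> Dual" using that \<Phi>(2) \<Gamma>_Dual by auto
   thus ?thesis using Dual_facts by blast
  qed
  show "h x = 0" if g: "\<And>g. g \<in> ?\<Psi> ==> g x = 0" for x
  proof -
   have "h (\<pi> x) = 0" by (rule z) (use g in \<open>simp_all add: image_def\<close>, blast)
   thus ?thesis by (simp add: p)
  qed
 qed (rule add, rule sc)
 then obtain c where "\<forall>x. h x = (\<Sum>g\<in>?\<Psi>. c g * g x)" ..
 hence "h = (\<lambda>x. \<Sum>g\<in>?\<Psi>. c g * g x)" by blast
 thus ?thesis using \<Phi> by (intro exI[of _ ?\<Psi>] exI[of _ c]) auto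
qed

lemma Dual_I:
 assumes "\<And>x y. h (x + y) = h x + h y" "\<And>c x. h (scl A c x) = c * h x" "\<And>x. h (\<pi> x) = h x"
  and U: "openin (topo A) U" "0 \<in> U" "\<And>x. x \<in> U ==> h x = 0"
 shows "h \<in> Dual"
proof -
 obtain \<Phi> where P: "finite \<Phi>" "\<Phi> \<subseteq> \<Gamma>" "{b\<in>W. \<forall>f\<in>\<Phi>. f b = f 0} \<subseteq> U" using \<Gamma>_open[OF U(1,2)] by blast
 have f0: "f 0 = 0" if "f \<in> \<Gamma>" for f using \<Gamma>_scale[OF that, of 0 0] subspace_0[OF W_sub] by simp
 have "h x = 0" if "x \<in> W" "\<And>f. f \<in> \<Phi> ==> f x = 0" for x
  by (rule U(3)) (use that P f0 in fastforce)
 from Dual_combination[OF assms(1,2,3) P(1,2) this] obtain \<Psi> c where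
  c: "finite \<Psi>" "\<Psi> \<subseteq> (\<lambda>f x. f (\<pi> x)) ` \<Gamma>" "h = (\<lambda>x. \<Sum>g\<in>\<Psi>. c g * g x)" by blast
 have "(\<lambda>x. \<Sum>g\<in>\<Psi>. c g * g x) \<in> Dual"
  using c(1,2)
 proof (induction rule: finite_induct)
  case empty
  show ?case unfolding Dual_def using fs.span_zero by (simp add: zero_fun_def)
 next
  case (insert g \<Psi>)
  have "(\<lambda>x. c g * g x) + (\<lambda>x. \<Sum>g\<in>\<Psi>. c g * g x) \<in> Dual"
   using insert.IH insert.prems unfolding Dual_def
   by (intro fs.span_add[OF fs.span_scale[OF fs.span_base]]) auto
  thus ?case using insert(1,2) by (simp add: plus_fun_def)
 qed
 thus ?thesis by (simp add: c(3))
qed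

lemma Dual_level_open: "h \<in> Dual ==> openin (topo A) {x\<in>W. h x = c}"
proof -
 assume h: "h \<in> Dual"
 obtain \<Phi> where P: "finite \<Phi>" "\<Phi> \<subseteq> \<Gamma>" "\<forall>x\<in>W. (\<forall>f\<in>\<Phi>. f x = 0) \<longrightarrow> h x = 0" using Dual_facts(4)[OF h] by blast
 show ?thesis
 proof (subst openin_subopen, intro ballI)
  fix a assume a: "a \<in> {x\<in>W. h x = c}"
  let ?U = "W \<inter> (\<Inter>f\<in>\<Phi>. {b\<in>W. f b = f a})"
  have "openin (topo A) ?U"
  proof (cases "\<Phi> = {}")
   case True thus ?thesis using openin_topspace[of "topo A"] by (simp add: top)
  next
   case False
   have "openin (topo A) (\<Inter>f\<in>\<Phi>. {b\<in>W. f b = f a})" by (rule openin_INT2) (use P False open_\<Gamma> in auto)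
   moreover have "?U = (\<Inter>f\<in>\<Phi>. {b\<in>W. f b = f a})" using False by auto
   ultimately show ?thesis by simp
  qed
  moreover have "?U \<subseteq> {x\<in>W. h x = c}"
  proof
   fix b assume b: "b \<in> ?U"
   have na: "scl A (-1) a \<in> W" using a subspace_scale[OF W_sub] by blast
   have f0: "f (b + scl A (-1) a) = 0" if "f \<in> \<Phi>" for f
   proof -
    have "f \<in> \<Gamma>" "b \<in> W" "f b = f a" "a \<in> W" using P(2) that a b by auto
    thus ?thesis using \<Gamma>_add[of f b "scl A (-1) a"] \<Gamma>_scale[of f a "-1"] na by simp
   qed
   have "b + scl A (-1) a \<in> W" using subspace_add[OF W_sub _ na] b by blast
   hence "h (b + scl A (-1) a) = 0" using P(3)[rule_format] f0 by blast
   thus "b \<in> {x\<in>W. h x = c}" using Dual_facts(1)[OF h, of "b - a" a] a b by simp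
  qed
  ultimately show "\<exists>T. openin (topo A) T \<and> a \<in> T \<and> T \<subseteq> {x\<in>W. h x = c}" using a by (intro exI[of _ ?U]) auto
 qed
qed

lemma finite_codimension:
 assumes "finite \<Phi>" "\<Phi> \<subseteq> Dual"
 shows "\<exists>B. finite B \<and> B \<subseteq> W \<and> (\<forall>y\<in>W. \<exists>b\<in>span B. \<forall>f\<in>\<Phi>. f (y - b) = 0)"
 using assms
proof (induction rule: finite_induct)
 case empty
 show ?case by (intro exI[of _ "{}"]) auto
next
 case (insert f \<Phi>)
 then obtain B where B: "finite B" "B \<subseteq> W" "\<forall>y\<in>W. \<exists>b\<in>span B. \<forall>f\<in>\<Phi>. f (y - b) = 0" by auto
 have f: "f \<in> Dual" "\<Phi> \<subseteq> Dual" using insert.prems by auto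
 have BW: "span B \<subseteq> W" by (rule span_minimal[OF B(2) W_sub])
 have dl: "g (x - y) = g x - g y" if "g \<in> Dual" for g x y
  using Dual_facts(1)[OF that, of "x - y" y] by simp
 show ?case
 proof (cases "\<exists>z\<in>W. (\<forall>g\<in>\<Phi>. g z = 0) \<and> f z \<noteq> 0")
  case False
  have "\<exists>b\<in>span B. \<forall>g\<in>insert f \<Phi>. g (y - b) = 0" if y: "y \<in> W" for y
  proof -
   obtain b where b: "b \<in> span B" "\<forall>g\<in>\<Phi>. g (y - b) = 0" using B(3) y by blast
   have "y - b \<in> W" using y b(1) BW subspace_diff[OF W_sub] by blast
   thus ?thesis using False b by blast
  qed
  thus ?thesis using B by blast
 next
  case True
  then obtain z where z: "z \<in> W" "\<forall>g\<in>\<Phi>. g z = 0" "f z \<noteq> 0" by blast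
  have "\<exists>b\<in>span (insert z B). \<forall>g\<in>insert f \<Phi>. g (y - b) = 0" if y: "y \<in> W" for y
  proof -
   obtain b where b: "b \<in> span B" "\<forall>g\<in>\<Phi>. g (y - b) = 0" using B(3) y by blast
   let ?b = "b + scl A (f (y - b) / f z) z"
   have "?b \<in> span (insert z B)"
    by (rule span_add[OF subsetD[OF span_mono b(1)] span_scale[OF span_base]]) auto
   moreover have "g (y - ?b) = 0" if "g \<in> insert f \<Phi>" for g
   proof -
    have g: "g \<in> Dual" using that f by auto
    have "g (y - ?b) = g (y - b) - f (y - b) / f z * g z"
     by (simp add: dl[OF g] Dual_facts(1,2)[OF g])
    thus ?thesis using that b(2) z by auto
   qed
   ultimately show ?thesis by blast
  qed
  thus ?thesis using B z by (intro exI[of _ "insert z B"]) auto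
 qed
qed

text \<open>Joint continuity at the origin bounds \<open>h {x, y}\<close> on a product of two subspaces of finite codimension. Finitely
many representatives of the second factor are then handled by continuity in \<open>x\<close> alone, which gives a
neighbourhood that works for all \<open>y\<close>.\<close>

lemma joint_continuity:
 assumes f: "graded_bilinear A f" and g: "\<And>x y. g x y = f (\<pi> x) (\<pi> y)"
  and c: "continuous_map (prod_topology (topo A) (topo A)) (topo A) (\<lambda>(a, b). f a b)"
  and h: "h \<in> Dual"
 shows "(\<lambda>x. h (g a x)) \<in> Dual" "(\<lambda>x. h (g x a)) \<in> Dual"
  "\<exists>\<Phi>. finite \<Phi> \<and> \<Phi> \<subseteq> Dual \<and> (\<forall>x y. (\<forall>k\<in>\<Phi>. k x = 0) \<longrightarrow> h (g x y) = 0)"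
  "\<exists>\<Phi>. finite \<Phi> \<and> \<Phi> \<subseteq> Dual \<and> (\<forall>x y. (\<forall>k\<in>\<Phi>. k x = 0) \<longrightarrow> h (g y x) = 0)"
proof -
 note gl = total_bilin[OF f g] and hl = Dual_facts[OF h]
 have z: "0 \<in> W" by (rule subspace_0[OF W_sub])
 have g0: "g 0 x = 0" "g x 0 = 0" for x using gl(3)[of 0 0 x] gl(4)[of x 0 0] by simp_all
 have h0: "h 0 = 0" using hl(2)[of 0 0] by simp
 have f0: "f x y = g x y" if "x \<in> W" "y \<in> W" for x y using that g by simp
 have op: "openin (prod_topology (topo A) (topo A)) {p \<in> W \<times> W. (\<lambda>(a, b). f a b) p \<in> {x\<in>W. h x = 0}}"
  using openin_continuous_map_preimage[OF c Dual_level_open[OF h, of 0]] by (simp add: top)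
 have N: "\<exists>U U'. openin (topo A) U \<and> openin (topo A) U' \<and> a \<in> U \<and> b \<in> U' \<and> (\<forall>x\<in>U. \<forall>y\<in>U'. h (g x y) = 0)"
  if "a \<in> W" "b \<in> W" "g a b = 0" for a b
 proof -
  have ab: "(a, b) \<in> {p \<in> W \<times> W. (\<lambda>(a, b). f a b) p \<in> {x\<in>W. h x = 0}}"
   using that h0 z by (simp add: f0)
  from iffD1[OF openin_prod_topology_alt op, rule_format, OF ab] obtain U U' where U: "openin (topo A) U" "openin (topo A) U'" "a \<in> U" "b \<in> U'"
   "U \<times> U' \<subseteq> {p \<in> W \<times> W. (\<lambda>(a, b). f a b) p \<in> {x\<in>W. h x = 0}}"
   by (elim exE conjE)
  have "h (g x y) = 0" if "x \<in> U" "y \<in> U'" for x y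
  proof -
   have "(x, y) \<in> {p \<in> W \<times> W. (\<lambda>(a, b). f a b) p \<in> {x\<in>W. h x = 0}}" using U(5) that by blast
   thus ?thesis using f0[of x y] by auto
  qed
  thus ?thesis using U by blast
 qed
 show 1: "(\<lambda>x. h (g a x)) \<in> Dual" for a
 proof -
  obtain U U' where U: "openin (topo A) U'" "\<pi> a \<in> U" "0 \<in> U'" "\<forall>x\<in>U. \<forall>y\<in>U'. h (g x y) = 0"
   using N[of "\<pi> a" 0] z g0 by auto
  show ?thesis
  proof (rule Dual_I[OF _ _ _ U(1,3)])
   show "h (g a x) = 0" if "x \<in> U'" for x using U(4)[rule_format, OF U(2) that] gl(5) by simp
  qed (simp_all add: gl hl)
 qed
 show 2: "(\<lambda>x. h (g x a)) \<in> Dual" for a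
 proof -
  obtain U U' where U: "openin (topo A) U" "\<pi> a \<in> U'" "0 \<in> U" "\<forall>x\<in>U. \<forall>y\<in>U'. h (g x y) = 0"
   using N[of 0 "\<pi> a"] z g0 by auto
  show ?thesis
  proof (rule Dual_I[OF _ _ _ U(1,3)])
   show "h (g x a) = 0" if "x \<in> U" for x using U(4)[rule_format, OF that U(2)] gl(6) by simp
  qed (simp_all add: gl hl)
 qed
 obtain U U' where U: "openin (topo A) U" "openin (topo A) U'" "0 \<in> U" "0 \<in> U'" "\<forall>x\<in>U. \<forall>y\<in>U'. h (g x y) = 0"
  using N[OF z z g0(1)] by blast
 have f00: "k 0 = 0" if "k \<in> \<Gamma>" for k using \<Gamma>_scale[OF that, of 0 0] z by simp
 have nb: "\<exists>\<Phi>. finite \<Phi> \<and> \<Phi> \<subseteq> Dual \<and> (\<forall>x. (\<forall>k\<in>\<Phi>. k x = 0) \<longrightarrow> \<pi> x \<in> U)" if U: "openin (topo A) U" "0 \<in> U" for U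
 proof -
  obtain \<Phi> where P: "finite \<Phi>" "\<Phi> \<subseteq> \<Gamma>" "{b\<in>W. \<forall>f\<in>\<Phi>. f b = f 0} \<subseteq> U" using \<Gamma>_open[OF U] by blast
  show ?thesis
  proof (intro exI[of _ "(\<lambda>f x. f (\<pi> x)) ` \<Phi>"] conjI allI impI)
   show "finite ((\<lambda>f x. f (\<pi> x)) ` \<Phi>)" using P by simp
   show "(\<lambda>f x. f (\<pi> x)) ` \<Phi> \<subseteq> Dual" using P \<Gamma>_Dual by auto
   fix x assume "\<forall>k\<in>(\<lambda>f x. f (\<pi> x)) ` \<Phi>. k x = 0"
   hence 0: "f (\<pi> x) = 0" if "f \<in> \<Phi>" for f using that by simp
   have "\<forall>f\<in>\<Phi>. f (\<pi> x) = f 0"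
   proof
    fix f assume f: "f \<in> \<Phi>"
    show "f (\<pi> x) = f 0" using 0[OF f] f00[OF subsetD[OF P(2) f]] by (metis)
   qed
   thus "\<pi> x \<in> U" using P(3) \<pi>_W[of x] by blast
  qed
 qed
 obtain \<Phi> where P: "finite \<Phi>" "\<Phi> \<subseteq> Dual" "\<forall>x. (\<forall>k\<in>\<Phi>. k x = 0) \<longrightarrow> \<pi> x \<in> U" using nb[OF U(1,3)] by blast
 obtain \<Phi>' where P': "finite \<Phi>'" "\<Phi>' \<subseteq> Dual" "\<forall>x. (\<forall>k\<in>\<Phi>'. k x = 0) \<longrightarrow> \<pi> x \<in> U'" using nb[OF U(2,4)] by blast
 have hg: "h (g x y) = 0" if "\<forall>k\<in>\<Phi>. k x = 0" "\<forall>k\<in>\<Phi>'. k y = 0" for x y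
  using U(5) P(3) P'(3) that gl(5,6) by metis
 obtain B where B: "finite B" "B \<subseteq> W" "\<forall>y\<in>W. \<exists>b\<in>span B. \<forall>k\<in>\<Phi>. k (y - b) = 0" using finite_codimension[OF P(1,2)] by blast
 obtain B' where B': "finite B'" "B' \<subseteq> W" "\<forall>y\<in>W. \<exists>b\<in>span B'. \<forall>k\<in>\<Phi>'. k (y - b) = 0" using finite_codimension[OF P'(1,2)] by blast
 have span0: "k b = 0" if "b \<in> span B" "\<And>x y. k (x + y) = k x + k y" "\<And>c x. k (scl A c x) = c * k x" "\<And>b. b \<in> B ==> k b = 0"
  for k :: "'v => 'k" and b B
  using that(1)
 proof (induction rule: span_induct_alt)
  case base show ?case using that(3)[of 0 0] by simp
 qed (use that in auto)
 have gd: "g x (y - z) = g x y - g x z" "g (y - z) x = g y x - g z x" for x y z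
  using gl(2)[of x "y - z" z] gl(1)[of "y - z" z x] by simp_all
 have hd: "h (x - y) = h x - h y" for x y using hl(1)[of "x - y" y] by simp
 show "\<exists>\<Phi>. finite \<Phi> \<and> \<Phi> \<subseteq> Dual \<and> (\<forall>x y. (\<forall>k\<in>\<Phi>. k x = 0) \<longrightarrow> h (g x y) = 0)"
 proof (intro exI[of _ "\<Phi> \<union> (\<lambda>b x. h (g x b)) ` B'"] conjI allI impI)
  show "finite (\<Phi> \<union> (\<lambda>b x. h (g x b)) ` B')" using P B' by simp
  show "\<Phi> \<union> (\<lambda>b x. h (g x b)) ` B' \<subseteq> Dual" using P 2 by auto
  fix x y assume x: "\<forall>k\<in>\<Phi> \<union> (\<lambda>b x. h (g x b)) ` B'. k x = 0"
  obtain b where b: "b \<in> span B'" "\<forall>k\<in>\<Phi>'. k (\<pi> y - b) = 0" using B'(3) \<pi>_W by blast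
  have "h (g x b) = 0" by (rule span0[OF b(1)]) (use x in \<open>auto simp: gl hl\<close>)
  moreover have "h (g x (\<pi> y - b)) = 0" by (rule hg) (use x b in auto)
  ultimately show "h (g x y) = 0" by (simp add: gd hd gl)
 qed
 show "\<exists>\<Phi>. finite \<Phi> \<and> \<Phi> \<subseteq> Dual \<and> (\<forall>x y. (\<forall>k\<in>\<Phi>. k x = 0) \<longrightarrow> h (g y x) = 0)"
 proof (intro exI[of _ "\<Phi>' \<union> (\<lambda>b x. h (g b x)) ` B"] conjI allI impI)
  show "finite (\<Phi>' \<union> (\<lambda>b x. h (g b x)) ` B)" using P' B by simp
  show "\<Phi>' \<union> (\<lambda>b x. h (g b x)) ` B \<subseteq> Dual" using P' 1 by auto
  fix x y assume x: "\<forall>k\<in>\<Phi>' \<union> (\<lambda>b x. h (g b x)) ` B. k x = 0"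
  obtain b where b: "b \<in> span B" "\<forall>k\<in>\<Phi>. k (\<pi> y - b) = 0" using B(3) \<pi>_W by blast
  have "h (g b x) = 0" by (rule span0[OF b(1), of "\<lambda>b. h (g b x)"]) (use x in \<open>auto simp: gl hl\<close>)
  moreover have "h (g (\<pi> y - b) x) = 0" by (rule hg) (use x b in auto)
  ultimately show "h (g y x) = 0" by (simp add: gd hd gl)
 qed
qed

end

context lc_gp
begin

lemma mul_comm: "a \<in> homog A p ==> b \<in> homog A q ==> mul A a b = scl A ((-1) ^ (p * q)) (mul A b a)"
 using ca unfolding comm_assoc_superalgebra_def by blast

lemma mul_assoc: "a \<in> W ==> b \<in> W ==> c \<in> W ==> mul A (mul A a b) c = mul A a (mul A b c)"
 using ca unfolding comm_assoc_superalgebra_def by blast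

lemma unit_facts: "e \<in> W" "a \<in> W ==> mul A e a = a" "a \<in> W ==> mul A a e = a"
 using unit by (auto simp: is_unit_element_def)

lemma PP: "P0 (P0 x) = P0 x" "P1 (P1 x) = P1 x" "P0 (P1 x) = 0" "P1 (P0 x) = 0"
 "P0 (\<pi> x) = P0 x" "P1 (\<pi> x) = P1 x" "\<pi> (P0 x) = P0 x" "\<pi> (P1 x) = P1 x"
 using P_in P_id P_0 by (simp_all add: \<pi>_def P0_lin P1_lin)

lemma homog_split: "x \<in> W ==> x = P0 x + P1 x" using \<pi>_id[of x] by (simp add: \<pi>_def)

lemma homog_iff: "x \<in> homog A p \<longleftrightarrow> (if even p then P0 x = x else P1 x = x)"
 using P_in P_id by (auto simp: homog_def) (metis P_in(1), metis P_in(2))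

lemma homog_W: "x \<in> homog A p ==> x \<in> W"
 using ev_W od_W by (auto simp: homog_def split: if_splits)

text \<open>The square of the odd part of \<open>e\<close> vanishes by anticommutativity, and comparing parities in \<open>e x = x\<close> for the two parts of \<open>e\<close> gives
that the odd part is \<open>0\<close>.\<close>

lemma unit_even: "P0 e = e"
proof -
 have e: "e = P0 e + P1 e" by (rule homog_split[OF unit_facts(1)])
 note g = bilin(5)[OF gm]
 have "mul A (P1 e) (P1 e) = - mul A (P1 e) (P1 e)"
  using mul_comm[OF hom01(2) hom01(2), of e e] by simp
 moreover have "x = 0" if "x = - x" for x :: 'v
 proof -
  have "scl A 2 x = x + x" by (metis one_add_one scale_left_distrib scale_one)
  also have "\<dots> = 0" using that by (metis add.right_inverse)
  finally show ?thesis by simp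
 qed
 ultimately have z: "mul A (P1 e) (P1 e) = 0" by blast
 have "P1 e = mul A (P0 e + P1 e) (P1 e)" using unit_facts(2)[of "P1 e"] e by simp
 hence a: "mul A (P0 e) (P1 e) = P1 e" using z by (simp add: bilin(1)[OF gm])
 have b: "mul A (P1 e) (P0 e) = P1 e" using mul_comm[OF hom01(2) hom01(1), of e e] a by simp
 have "P0 e = mul A (P0 e + P1 e) (P0 e)" using unit_facts(2)[of "P0 e"] e by simp
 hence "P0 e = mul A (P0 e) (P0 e) + P1 e" using b by (simp add: bilin(1)[OF gm])
 hence "P1 e = P0 e - mul A (P0 e) (P0 e)" by (simp add: algebra_simps)
 moreover have "mul A (P0 e) (P0 e) \<in> evens A" using g[OF hom01(1) hom01(1)] by (simp add: homog_def)
 ultimately have "P1 e \<in> evens A" using P_in(1) subspace_diff[OF sub(1)] by simp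
 hence "P1 e = 0" using P_in(2)[of e] ev_od by blast
 thus ?thesis using e by simp
qed

lemma e_nonzero: "e \<noteq> 0"
proof
 assume e: "e = 0"
 have "a = 0" if "a \<in> W" for a
  using unit_facts(2)[OF that] bilin(3)[OF gm, of 0 a 0] e that subspace_0[OF W_sub] by simp
 hence "brk A a b = 0" if "a \<in> W" "b \<in> W" for a b using bilin_W[OF gb that] by blast
 thus False using gp_simple unfolding gp_simple_def by blast
qed

lemma brk_skew: "a \<in> homog A p ==> b \<in> homog A q ==> brk A a b = - scl A ((-1) ^ (p * q)) (brk A b a)"
 using lie unfolding lie_super_bracket_def by blast

lemma brk_jacobi: "a \<in> homog A p ==> b \<in> homog A q ==> c \<in> W ==>
  brk A a (brk A b c) = brk A (brk A a b) c + scl A ((-1) ^ (p * q)) (brk A b (brk A a c))"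
 using lie unfolding lie_super_bracket_def by blast

lemma leibniz: "a \<in> homog A p ==> b \<in> homog A q ==> c \<in> W ==>
  brk A a (mul A b c) = mul A (brk A a b) c + scl A ((-1) ^ (p * q)) (mul A b (brk A a c)) + mul A (mul A (D a) b) c"
 using gp unfolding generalized_poisson_def by blast

lemma D_lin: "a \<in> W ==> b \<in> W ==> D (a + b) = D a + D b" "a \<in> homog A p ==> D a \<in> homog A p"
 using der unfolding even_derivation_def linear_on_space_def by blast+

text \<open>The Leibniz rule for \<open>{a, e e}\<close> gives \<open>{a, e} = -D a\<close>; in particular a derivation as in the definition
is unique on the carrier.\<close>

lemma D_brk: assumes a: "a \<in> W" shows "D a = brk A e a"
proof -
 have eh: "e \<in> homog A 0" using unit_even by (simp add: homog_iff)
 have h: "D x = brk A e x" if x: "x \<in> homog A p" for x p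
 proof -
  have xW: "x \<in> W" and DW: "D x \<in> W" using homog_W x D_lin(2)[OF x] by blast+
  have bW: "brk A x e \<in> W" by (rule bilin_W[OF gb xW unit_facts(1)])
  have "brk A x (mul A e e) = mul A (brk A x e) e + mul A e (brk A x e) + mul A (mul A (D x) e) e"
   using leibniz[OF x eh unit_facts(1)] by simp
  hence "brk A x e = brk A x e + brk A x e + D x" using bW DW unit_facts by simp
  hence "D x = - brk A x e" by (simp add: add.assoc eq_neg_iff_add_eq_0 add.commute)
  thus ?thesis using brk_skew[OF eh x] by simp
 qed
 have "D a = D (P0 a + P1 a)" using homog_split[OF a] by simp
 also have "\<dots> = brk A e (P0 a + P1 a)"
  using h[OF hom01(1)] h[OF hom01(2)] by (simp add: D_lin bilin(2)[OF gb] unit_facts)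
 finally show ?thesis using homog_split[OF a] by simp
qed

lemma mul_cont: "continuous_map (prod_topology (topo A) (topo A)) (topo A) (\<lambda>(a, b). mul A a b)"
 and brk_cont: "continuous_map (prod_topology (topo A) (topo A)) (topo A) (\<lambda>(a, b). brk A a b)"
 using lc by (simp_all add: linearly_compact_gp_def)

lemmas prd_cont = joint_continuity[OF gm prd_def mul_cont] and bra_cont = joint_continuity[OF gb bra_def brk_cont]

lemma prd_homog: "x \<in> homog A p ==> y \<in> homog A q ==> prd x y \<in> homog A (p + q)"
 and bra_homog: "x \<in> homog A p ==> y \<in> homog A q ==> bra x y \<in> homog A (p + q)"
 using bilin(5)[OF gm, of x p y q] bilin(5)[OF gb, of x p y q] homog_W[of x p] homog_W[of y q]
 by (simp_all add: prd_def bra_def)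

lemma prd_comm: "x \<in> homog A p ==> y \<in> homog A q ==> prd x y = (if even (p * q) then prd y x else - prd y x)"
 using mul_comm[of x p y q] homog_W[of x p] homog_W[of y q] by (simp add: prd_def)

lemma prd_split: "prd x y = prd x (P0 y) + prd x (P1 y)"
 using prd_bilin(2)[of x "P0 y" "P1 y"] prd_bilin(6)[of x y] by (simp add: \<pi>_def)

lemma Dual_reflexive:
 assumes F: "\<And>h g. h \<in> Dual ==> g \<in> Dual ==> F (\<lambda>x. h x + g x) = F h + F g"
  "\<And>c h. h \<in> Dual ==> F (\<lambda>x. c * h x) = c * F h"
 shows "\<exists>a\<in>W. \<forall>h\<in>Dual. F h = h a"
proof -
 obtain a where a: "a \<in> W" "\<forall>f\<in>\<Gamma>. f a = F (\<lambda>x. f (\<pi> x))"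
  using \<Gamma>_surj[of "\<lambda>f. F (\<lambda>x. f (\<pi> x))"] by blast
 have z0: "0 \<in> Dual" unfolding Dual_def by (rule fs.span_zero)
 hence z: "(\<lambda>_. 0) \<in> Dual" by (simp only: zero_fun_def)
 have "F h = h a" if "h \<in> Dual" for h
 proof -
  have "h \<in> Dual \<and> F h = h a" using that unfolding Dual_def
  proof (induction rule: fs.span_induct_alt)
   case base
   have "F (\<lambda>_. 0) = 0" using F(2)[OF z, of 0] by (simp only: mult_zero_left)
   thus ?case using z0 unfolding Dual_def by (simp only: zero_fun_def simp_thms)
  next
   case (step c g h)
   then obtain f where f: "f \<in> \<Gamma>" "g = (\<lambda>x. f (\<pi> x))" by blast
   have gD: "g \<in> Dual" using \<Gamma>_Dual[OF f(1)] f(2) by simp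
   hence cg: "(\<lambda>x. c * g x) \<in> Dual" unfolding Dual_def by (rule fs.span_scale)
   have hD: "h \<in> Dual" "F h = h a" using step.IH unfolding Dual_def by auto
   have "(\<lambda>x. c * g x) + h \<in> Dual" using cg hD(1) unfolding Dual_def by (rule fs.span_add)
   moreover have "F (\<lambda>x. c * g x + h x) = c * g a + h a" using F(1)[OF cg hD(1)] F(2)[OF gD] hD(2) a f by simp
   ultimately show ?case unfolding Dual_def by (simp only: plus_fun_def simp_thms)
  qed
  thus ?thesis ..
 qed
 thus ?thesis using a(1) by blast
qed

sublocale calg "scl A" P0 P1 prd e Dual
proof (unfold_locales, goal_cases)
 case 13 show ?case using prd_bilin(5) by (simp add: \<pi>_def)
next case 14 show ?case using prd_bilin(6) by (simp add: \<pi>_def)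
next case (15 x y) thus ?case using prd_homog[OF hom01(1) hom01(1), of x y] by (simp add: homog_iff)
next case (16 x y) thus ?case using prd_homog[OF hom01(1) hom01(2), of x y] by (simp add: homog_iff)
next case (17 x y) thus ?case using prd_homog[OF hom01(2) hom01(2), of x y] by (simp add: homog_iff)
next case (18 x y)
 show ?case unfolding prd_split[of _ y] using prd_bilin(1)[of "P0 y" "P1 y" "P0 x"] prd_bilin(5)[of y "P0 x"]
   prd_comm[OF hom01(1) hom01(1), of x y] prd_comm[OF hom01(1) hom01(2), of x y] by (simp add: \<pi>_def)
next case (19 x y) thus ?case using prd_comm[OF hom01(2) hom01(2), of x y] by simp
next case 20 show ?case using bilin_W[OF gm] by (simp add: prd_def mul_assoc)
next case 22 show ?case using unit_facts by (simp add: prd_def \<pi>_def[symmetric])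
next case (26 h x) thus ?case using Dual_facts(3) by (simp add: \<pi>_def)
next case (27 h g) thus ?case unfolding Dual_def using fs.span_add[of h _ g] by (simp add: plus_fun_def)
next case (28 h c) thus ?case unfolding Dual_def by (rule fs.span_scale)
next case (29 h a) thus ?case by (rule prd_cont(1))
next case (30 h a) thus ?case by (rule prd_cont(2))
next case (31 x)
 have x: "x \<in> W" "\<pi> x = x" using 31(1) \<pi>_W[of x] by (simp_all add: \<pi>_def)
 show ?case
 proof (rule \<Gamma>_inj[OF x(1) subspace_0[OF W_sub]])
  fix f assume f: "f \<in> \<Gamma>"
  thus "f x = f 0" using 31(2)[OF \<Gamma>_Dual[OF f]] x(2) \<Gamma>_scale[OF f, of 0 0] subspace_0[OF W_sub] by simp
 qed
next case (32 F)
 from Dual_reflexive[of F, OF 32(1) 32(2)] show ?case using \<pi>_id unfolding \<pi>_def by blast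
next case (33 h)
 obtain \<Phi> \<Phi>' where "finite \<Phi>" "\<Phi> \<subseteq> Dual" "\<forall>x y. (\<forall>k\<in>\<Phi>. k x = 0) \<longrightarrow> h (prd x y) = 0"
  "finite \<Phi>'" "\<Phi>' \<subseteq> Dual" "\<forall>x y. (\<forall>k\<in>\<Phi>'. k x = 0) \<longrightarrow> h (prd y x) = 0"
  using prd_cont(3)[OF 33] prd_cont(4)[OF 33] by blast
 thus ?case by (intro exI[of _ "\<Phi> \<union> \<Phi>'"]) auto
qed (simp_all add: P0_lin P1_lin PP prd_bilin unit_even e_nonzero Dual_facts)

lemma V_W: "V = W" using \<pi>_id \<pi>_W by (auto simp: V_def local.pi_def simp flip: \<pi>_def) (metis \<pi>_W)

lemma pi_\<pi>: "local.pi = \<pi>" by (simp add: fun_eq_iff local.pi_def \<pi>_def)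

lemma H_homog: "H p = homog A p" by (auto simp: H_def homog_iff)

lemma bra_split: "bra x y = bra (P0 x) y + bra (P1 x) y" "bra x y = bra x (P0 y) + bra x (P1 y)"
 using bra_bilin(1)[of "P0 x" "P1 x" y] bra_bilin(5)[of x y] bra_bilin(2)[of x "P0 y" "P1 y"] bra_bilin(6)[of x y]
 by (simp_all add: \<pi>_def)

lemma bra_uminus: "bra (- x) y = - bra x y" "bra x (- y) = - bra x y"
 using bra_bilin(3)[of "-1" x y] bra_bilin(4)[of x "-1" y] by simp_all

lemma bra_skew: assumes x: "x \<in> H p" shows "bra x y = - bra (tw p y) x"
proof -
 have h: "bra x z = - (if even (p * q) then bra z x else - bra z x)" if "z \<in> homog A q" for z q
  using brk_skew[OF x[unfolded H_homog] that] homog_W[OF that] homog_W[OF x[unfolded H_homog]] by (simp add: bra_def)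
 have "bra x y = - bra (P0 y) x + (if even p then - bra (P1 y) x else bra (P1 y) x)"
  using h[OF hom01(1)] h[OF hom01(2)] bra_split(2)[of x y] by simp
 also have "\<dots> = - bra (tw p y) x"
  using bra_bilin(1)[of "P0 y" "- P1 y" x] bra_split(1)[of y x] by (simp add: tw_def sg_def bra_uminus)
 finally show ?thesis .
qed

lemma bra_jacobi: assumes x: "x \<in> H p" shows "bra x (bra y z) = bra (bra x y) z + bra (tw p y) (bra x z)"
proof -
 have xh: "x \<in> homog A p" using x H_homog by simp
 have h: "bra x (bra y z) = bra (bra x y) z + (if even (p * q) then bra y (bra x z) else - bra y (bra x z))"
  if "y \<in> homog A q" for y q
  using brk_jacobi[OF xh that, of "\<pi> z"] homog_W[OF that] homog_W[OF xh] bilin_W[OF gb] by (simp add: bra_def)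
 have "bra x (bra y z) = bra x (bra (P0 y) z) + bra x (bra (P1 y) z)"
  using bra_split(1)[of y z] bra_bilin(2) by simp
 also have "\<dots> = (bra (bra x (P0 y)) z + bra (bra x (P1 y)) z) + (bra (P0 y) (bra x z) + (if even p then bra (P1 y) (bra x z) else - bra (P1 y) (bra x z)))"
  using h[OF hom01(1)] h[OF hom01(2)] by simp
 also have "bra (bra x (P0 y)) z + bra (bra x (P1 y)) z = bra (bra x y) z"
  using bra_split(2)[of x y] bra_bilin(1)[of "bra x (P0 y)" "bra x (P1 y)" z] by simp
 also have "bra (P0 y) (bra x z) + (if even p then bra (P1 y) (bra x z) else - bra (P1 y) (bra x z)) = bra (tw p y) (bra x z)"
  using bra_bilin(1)[of "P0 y" "- P1 y" "bra x z"] bra_split(1)[of y "bra x z"] by (simp add: tw_def sg_def bra_uminus)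
 finally show ?thesis .
qed

lemma bra_leibniz: assumes x: "x \<in> H p" shows "bra x (prd y z) = prd (bra x y) z + prd (tw p y) (bra x z) + prd (bra e x) (prd y z)"
proof -
 have xh: "x \<in> homog A p" using x H_homog by simp
 have xW: "x \<in> W" by (rule homog_W[OF xh])
 have De: "bra e x = D x" "D x \<in> W" using D_brk[OF xW] unit_facts(1) bilin_W[OF gb _ xW] xW by (simp_all add: bra_def)
 have h: "bra x (prd y z) = prd (bra x y) z + (if even (p * q) then prd y (bra x z) else - prd y (bra x z)) + prd (bra e x) (prd y z)"
  if "y \<in> homog A q" for y q
  using leibniz[OF xh that, of "\<pi> z"] homog_W[OF that] xW bilin_W[OF gb] bilin_W[OF gm] De
  by (simp add: bra_def prd_def mul_assoc)
 have "bra x (prd y z) = bra x (prd (P0 y) z) + bra x (prd (P1 y) z)"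
  using bra_bilin(2)[of x "prd (P0 y) z" "prd (P1 y) z"] prd_addl[of "P0 y" "P1 y" z] prd_pil[of y z] by simp
 also have "\<dots> = (prd (bra x (P0 y)) z + prd (bra x (P1 y)) z) + (prd (P0 y) (bra x z) + (if even p then prd (P1 y) (bra x z) else - prd (P1 y) (bra x z)))
   + (prd (bra e x) (prd (P0 y) z) + prd (bra e x) (prd (P1 y) z))"
  using h[OF hom01(1)] h[OF hom01(2)] by simp
 also have "prd (bra x (P0 y)) z + prd (bra x (P1 y)) z = prd (bra x y) z"
  using bra_split(2)[of x y] prd_addl[of "bra x (P0 y)" "bra x (P1 y)" z] by simp
 also have "prd (P0 y) (bra x z) + (if even p then prd (P1 y) (bra x z) else - prd (P1 y) (bra x z)) = prd (tw p y) (bra x z)"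
  using prd_addl[of "P0 y" "P1 y" "bra x z"] prd_pil[of y "bra x z"] by (simp add: tw_def sg_def prd_diff)
 also have "prd (bra e x) (prd (P0 y) z) + prd (bra e x) (prd (P1 y) z) = prd (bra e x) (prd y z)"
  using prd_addr[of "bra e x" "prd (P0 y) z" "prd (P1 y) z"] prd_addl[of "P0 y" "P1 y" z] prd_pil[of y z] by simp
 finally show ?thesis .
qed

sublocale cgp "scl A" P0 P1 prd e Dual bra
proof (unfold_locales, goal_cases)
 case (7 x p y q) thus ?case using bra_homog by (simp add: H_homog)
next case 8 thus ?case by (rule bra_skew)
next case 9 thus ?case by (rule bra_jacobi)
next case 10 thus ?case by (rule bra_leibniz)
next case 11 thus ?case by (rule bra_cont(1))
next case 12 thus ?case by (rule bra_cont(3))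
next case (13 I)
 have P1I: "P1 x \<in> I" if "x \<in> I" for x
 proof -
  have "P1 x = x - P0 x" using V_decomp[of x] 13(2) that by (metis add_diff_cancel_left' subsetD)
  thus ?thesis using subspace_diff[OF 13(1) that 13(3)[OF that]] by simp
 qed
 have "gp_ideal A I" unfolding gp_ideal_def
 proof (intro conjI ballI)
  show "subspace I" by (rule 13(1))
  show "I = {x + y |x y. x \<in> I \<inter> evens A \<and> y \<in> I \<inter> odds A}"
  proof (intro set_eqI iffI)
   fix x assume x: "x \<in> I"
   have "x = P0 x + P1 x" using x 13(2) V_decomp by blast
   thus "x \<in> {x + y |x y. x \<in> I \<inter> evens A \<and> y \<in> I \<inter> odds A}" using 13(3)[OF x] P1I[OF x] P_in by blast
  next
   fix x assume "x \<in> {x + y |x y. x \<in> I \<inter> evens A \<and> y \<in> I \<inter> odds A}"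
   thus "x \<in> I" using subspace_add[OF 13(1)] by blast
  qed
  fix a x assume a: "a \<in> W" and x: "x \<in> I"
  have xW: "x \<in> W" using 13(2) x V_W by blast
  have m: "prd u x \<in> I" "bra u x \<in> I" if "x \<in> I" for u x using 13(4,5) that by blast+
  show "mul A a x \<in> I" "brk A a x \<in> I" using m[OF x, of a] a xW by (simp_all add: prd_def bra_def)
  have "prd x a = prd a (P0 x) + prd (sg a) (P1 x)"
   using comm_tw[of "P0 x" 0 a] comm_tw[of "P1 x" 1 a] prd_pil[of x a] prd_addl[of "P0 x" "P1 x" a] by (simp add: tw_def)
  also have "\<dots> \<in> I" using m(1) 13(3)[OF x] P1I[OF x] subspace_add[OF 13(1)] by blast
  finally show "mul A x a \<in> I" using a xW by (simp add: prd_def)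
  have "bra x a = - bra a (P0 x) - bra (sg a) (P1 x)"
   using bra_skew[of "P0 x" 0 a] bra_skew[of "P1 x" 1 a] bra_split(1)[of x a] by (simp add: tw_def)
  also have "\<dots> \<in> I" using m(2) 13(3)[OF x] P1I[OF x] subspace_diff[OF 13(1)] subspace_neg[OF 13(1)] by blast
  finally show "brk A x a \<in> I" using a xW by (simp add: bra_def)
 qed
 hence "I = {0} \<or> I = W" using gp_simple unfolding gp_simple_def by blast
 thus ?case using V_W by blast
qed (simp_all add: bra_bilin pi_\<pi>)

end

context lgp
begin

subsection \<open>The double under gauge transformations\<close>

lemma br_even_left:
 assumes f: "f \<in> H 0" and x: "x \<in> H p"
 shows "br (f \<odot> x) y = x \<odot> br f y + f \<odot> br x y - f \<odot> (x \<odot> br e y)"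
proof -
 have fx: "f \<odot> x \<in> H p" using prd_H[OF f x] by simp
 have twf: "tw p f = f" using tw_HH[OF f, of p] by simp
 have h: "br (f \<odot> x) y = x \<odot> br f y + f \<odot> br x y - f \<odot> (x \<odot> br e y)" if y: "y \<in> H q" for y q
 proof -
  have y': "tw p y \<in> H q" by (rule tw_H[OF y])
  have "br (tw p y) (f \<odot> x) = br (tw p y) f \<odot> x + f \<odot> br (tw p y) x + br e (tw p y) \<odot> (f \<odot> x)"
   using br_leibniz[OF y', of f x] tw_HH[OF f, of q] by simp
  also have "br (tw p y) f \<odot> x = - (x \<odot> br f y)"
   using even_skew[OF f y'] comm_tw[OF x, of "br f y"] twf by (simp add: tw_br prd_lin)
  also have "br (tw p y) x = - br x y" using br_skew[OF x, of y] by simp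
  also have "br e (tw p y) \<odot> (f \<odot> x) = f \<odot> (x \<odot> br e y)"
   using comm_tw[OF x, of "br e y"] by (simp add: tw_br even_left_commute[OF f])
  finally have "br (tw p y) (f \<odot> x) = - (x \<odot> br f y) - f \<odot> br x y + f \<odot> (x \<odot> br e y)" by (simp add: prd_lin)
  thus ?thesis using br_skew[OF fx, of y] by simp
 qed
 have "br z (P0 y) + br z (P1 y) = br z y" for z using br_addr[of z "P0 y" "P1 y"] br_pir[of z y] by (simp add: pi_def)
 from this[symmetric] h[OF P_in_H(1), of y] h[OF P_in_H(2), of y] show ?thesis by (simp add: prd_lin algebra_simps)
qed

text \<open>The expansion of \<open>{f x, f y}\<close> for even \<open>f\<close> by the Leibniz rule in both arguments; the terms in which \<open>D f\<close> occurs cancel.\<close>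

lemma br_even_both:
 assumes f: "f \<in> H 0"
 shows "br (f \<odot> x) (f \<odot> y) = (f \<odot> f) \<odot> (br x y - x \<odot> br e y + br e x \<odot> y) + f \<odot> (x \<odot> br f y - br f x \<odot> y)"
proof -
 have h: "br (f \<odot> x) (f \<odot> y) = (f \<odot> f) \<odot> (br x y - x \<odot> br e y + br e x \<odot> y) + f \<odot> (x \<odot> br f y - br f x \<odot> y)"
  if x: "x \<in> H p" for x p
 proof -
  have fx: "f \<odot> x \<in> H p" using prd_H[OF f x] by simp
  have "br f (f \<odot> x) = f \<odot> br f x + br e f \<odot> (f \<odot> x)"
   using br_leibniz[OF f, of f x] even_self[OF f] by (simp add: tw_def)
  hence 1: "br (f \<odot> x) f = - (f \<odot> br f x) - br e f \<odot> (f \<odot> x)" using even_skew[OF f fx] by simp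
  have 2: "br e (f \<odot> x) = br e f \<odot> x + f \<odot> br e x" using D_deriv[of f x] by (simp add: D_def)
  have "br (f \<odot> x) (f \<odot> y) = br (f \<odot> x) f \<odot> y + f \<odot> br (f \<odot> x) y + br e (f \<odot> x) \<odot> (f \<odot> y)"
   using br_leibniz[OF fx, of f y] tw_HH[OF f, of p] by simp
  thus ?thesis unfolding 1 2 br_even_left[OF f x, of y]
   using even_left_commute[OF f, of x y] even_left_commute[OF f, of "br e x" y] even_left_commute[OF f, of "br e f"]
   by (simp add: prd_lin assoc algebra_simps)
 qed
 have s: "f \<odot> x = f \<odot> P0 x + f \<odot> P1 x" "br x y = br (P0 x) y + br (P1 x) y" "x \<odot> z = P0 x \<odot> z + P1 x \<odot> z"
  "br u x = br u (P0 x) + br u (P1 x)" for u z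
  using prd_pi(2)[of f x] br_pil[of x y] prd_pi(1)[of x z] br_pir[of u x] by (simp_all add: pi_def prd_lin br_lin)
 show ?thesis unfolding s(1) br_addl h[OF P_in_H(1)] h[OF P_in_H(2)] s(2,3) s(4)[of e] s(4)[of f]
  by (simp add: prd_lin algebra_simps)
qed

text \<open>The bracket \<open>{\<cdot>,\<cdot>}\<^sub>D\<close> on the algebra gauged by \<open>f\<^sup>2\<close> is \<open>{f x, f y}\<^sub>D\<close>: expand both sides by \<open>br_even_both\<close>, applied to \<open>f\<^sup>2\<close>
and to \<open>f\<close>, and use \<open>{f\<^sup>2, y} = 2 f {f, y} - f\<^sup>2 D y\<close>.\<close>

theorem jordan_gauge:
 assumes f: "f \<in> H 0" and g: "g \<in> H 0" and gf: "g \<odot> (f \<odot> f) = e"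
 shows "gauge (f \<odot> f) g x y - (1/2) \<cdot> (x \<odot> gauge (f \<odot> f) g e y - gauge (f \<odot> f) g e x \<odot> y)
  = br (f \<odot> x) (f \<odot> y) - (1/2) \<cdot> ((f \<odot> x) \<odot> br e (f \<odot> y) - br e (f \<odot> x) \<odot> (f \<odot> y))"
proof -
 define \<phi> where "\<phi> = f \<odot> f"
 have p: "\<phi> \<in> H 0" "g \<odot> \<phi> = e" using prd_H[OF f f] gf by (simp_all add: \<phi>_def)
 define u where "u = f \<odot> (x \<odot> br f y - br f x \<odot> y)"
 define z where "z = \<phi> \<odot> (x \<odot> br e y - br e x \<odot> y)"
 define b where "b = \<phi> \<odot> br x y"
 have Dp: "br e \<phi> \<in> H 0" using D_H[OF p(1)] by (simp add: D_def)
 have two: "2 \<cdot> a = a + a" for a by (metis one_add_one scale_left_distrib scale_one)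
 have ff: "br \<phi> a = f \<odot> br f a + f \<odot> br f a - \<phi> \<odot> br e a" for a
  using br_even_left[OF f f, of a] by (simp add: \<phi>_def assoc)
 have c1: "x \<odot> br \<phi> y - br \<phi> x \<odot> y = u + u - z"
  unfolding ff u_def z_def using even_left_commute[OF f] even_left_commute[OF p(1)]
  by (simp add: prd_lin assoc algebra_simps)
 have "gauge \<phi> g x y = g \<odot> (\<phi> \<odot> (\<phi> \<odot> (br x y - x \<odot> br e y + br e x \<odot> y)) + \<phi> \<odot> (x \<odot> br \<phi> y - br \<phi> x \<odot> y))"
  unfolding gauge_def br_even_both[OF p(1)] by (simp add: assoc)
 also have "\<dots> = (g \<odot> \<phi>) \<odot> (\<phi> \<odot> (br x y - x \<odot> br e y + br e x \<odot> y)) + (g \<odot> \<phi>) \<odot> (x \<odot> br \<phi> y - br \<phi> x \<odot> y)"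
  by (simp only: prd_addr assoc)
 also have "\<dots> = b - z + (u + u - z)"
  unfolding p(2) c1[symmetric] unfolding b_def z_def by (simp add: pi_V V_in(3) prd_lin algebra_simps)
 finally have l1: "gauge \<phi> g x y = b - z + (u + u - z)" .
 have "x \<odot> gauge \<phi> g e y - gauge \<phi> g e x \<odot> y = u + u - z"
  unfolding gauge_D[OF p(1) g p(2)] c1[symmetric] using even_left_commute[OF Dp, of x y]
  by (simp add: prd_lin assoc)
 hence l2: "(1/2) \<cdot> (x \<odot> gauge \<phi> g e y - gauge \<phi> g e x \<odot> y) = u - (1/2) \<cdot> z"
  by (simp add: scale_right_diff_distrib flip: two[of u])
 have De: "br e (f \<odot> a) = br e f \<odot> a + f \<odot> br e a" for a using D_deriv[of f a] by (simp add: D_def)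
 have Df: "br e f \<in> H 0" using D_H[OF f] by (simp add: D_def)
 have r2: "(f \<odot> x) \<odot> br e (f \<odot> y) - br e (f \<odot> x) \<odot> (f \<odot> y) = z"
  unfolding De z_def \<phi>_def
  using even_left_commute[OF f, of x] even_left_commute[OF f, of "br e x" y] even_left_commute[OF Df, of x y] even_left_commute[OF f, of "br e f"]
  by (simp add: prd_lin assoc algebra_simps)
 have r1: "br (f \<odot> x) (f \<odot> y) = b - z + u"
  unfolding br_even_both[OF f] b_def z_def u_def \<phi>_def by (simp add: prd_lin algebra_simps)
 have "(1/2 + 1/2 :: 'k) = 1" by simp
 hence "z = (1/2) \<cdot> z + (1/2) \<cdot> z" by (simp only: scale_left_distrib[symmetric] scale_one)
 hence h: "z - (1/2) \<cdot> z = (1/2) \<cdot> z" by (metis add_diff_cancel_right')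
 have "b - z + (u + u - z) - (u - (1/2) \<cdot> z) = b - z + u - (z - (1/2) \<cdot> z)" by simp
 thus ?thesis unfolding \<phi>_def[symmetric] l1 l2 r2 r1 h .
qed

end

section \<open>The algebras \<open>P(m,n)\<close> and their topology\<close>

lemma P_alg_simps: "scl (P_alg r n) = ser_scale" "mul (P_alg r n) = ser_mult" "brk (P_alg r n) = P_brk r n"
 "f \<in> evens (P_alg r n) \<longleftrightarrow> f \<in> Ser r n \<and> (\<forall>\<alpha> S. f \<alpha> S \<noteq> 0 \<longrightarrow> even (card S))"
 "f \<in> odds (P_alg r n) \<longleftrightarrow> f \<in> Ser r n \<and> (\<forall>\<alpha> S. f \<alpha> S \<noteq> 0 \<longrightarrow> odd (card S))"
 "topo (P_alg r n) = subtopology (product_topology (\<lambda>_. discrete_topology UNIV) UNIV) (Ser r n)"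
 by (simp_all add: P_alg_def P_brk_def)

lemma space_of_P: "space_of (P_alg r n :: ('k::field, 'k series) gp_superalg) = Ser r n"
proof (intro set_eqI iffI)
 fix f :: "'k series" assume "f \<in> space_of (P_alg r n)"
 then obtain x y where f: "f = x + y" "x \<in> Ser r n" "y \<in> Ser r n" by (auto simp: space_of_def P_alg_simps)
 show "f \<in> Ser r n"
 proof (rule Ser_I)
  fix \<alpha> S assume "f \<alpha> S \<noteq> 0"
  hence "x \<alpha> S \<noteq> 0 \<or> y \<alpha> S \<noteq> 0" using f(1) by auto
  thus "Poly_Mapping.keys \<alpha> \<subseteq> {..<r} \<and> S \<subseteq> {..<n}" using Ser_outside[OF f(2)] Ser_outside[OF f(3)] by blast
 qed
next
 fix f :: "'k series" assume f: "f \<in> Ser r n"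
 define x where "x = (\<lambda>\<alpha> S. if even (card S) then f \<alpha> S else 0)"
 define y where "y = (\<lambda>\<alpha> S. if even (card S) then 0 else f \<alpha> S)"
 have "x \<in> Ser r n" "y \<in> Ser r n"
  by (rule Ser_I; use Ser_outside[OF f] in \<open>auto simp: x_def y_def split: if_splits\<close>)+
 hence "x \<in> evens (P_alg r n)" "y \<in> odds (P_alg r n)" by (auto simp: P_alg_simps x_def y_def split: if_splits)
 moreover have "f = x + y" by (simp add: fun_eq_iff x_def y_def)
 ultimately show "f \<in> space_of (P_alg r n)" unfolding space_of_def by blast
qed

lemma parity_aut_P:
 fixes f :: "'k::field series"
 assumes "f \<in> Ser r n" shows "parity_aut (P_alg r n) f = ser_sign f"
proof -
 have u: "x - y = ser_sign (x + y)" if "x \<in> evens (P_alg r n)" "y \<in> odds (P_alg r n)" for x y :: "'k series"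
 proof -
  have "(x - y) \<alpha> S = ser_sign (x + y) \<alpha> S" for \<alpha> S
   using that by (cases "even (card S)") (auto simp: P_alg_simps ser_sign_def)
  thus ?thesis by blast
 qed
 have "f \<in> space_of (P_alg r n)" using assms by (simp add: space_of_P)
 then obtain x y where xy: "x \<in> evens (P_alg r n)" "y \<in> odds (P_alg r n)" "f = x + y"
  unfolding space_of_def by blast
 show ?thesis unfolding parity_aut_def
 proof (rule the_equality)
  show "\<exists>x\<in>evens (P_alg r n). \<exists>y\<in>odds (P_alg r n). f = x + y \<and> ser_sign f = x - y" using xy u by metis
  show "b = ser_sign f" if "\<exists>x\<in>evens (P_alg r n). \<exists>y\<in>odds (P_alg r n). f = x + y \<and> b = x - y" for b
   using that u by metis
 qed
qed

lemma space_of_double: "space_of (jordan_double B d) = space_of B \<times> space_of B"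
proof (intro set_eqI iffI)
 fix z assume "z \<in> space_of (jordan_double B d)"
 then obtain a b c d' where "z = (a, b) + (c, d')" "a \<in> evens B" "b \<in> odds B" "c \<in> odds B" "d' \<in> evens B"
  by (auto simp: space_of_def jordan_double_def)
 moreover have "b + d' = d' + b" by (rule add.commute)
 ultimately show "z \<in> space_of B \<times> space_of B" by (auto simp: space_of_def)
next
 fix z assume "z \<in> space_of B \<times> space_of B"
 then obtain a b c d' where z: "z = (a + c, d' + b)" "a \<in> evens B" "b \<in> odds B" "c \<in> odds B" "d' \<in> evens B"
  by (auto simp: space_of_def)
 have "z = (a, b) + (c, d')" by (simp add: z(1) add.commute)
 thus "z \<in> space_of (jordan_double B d)" using z(2-5) by (fastforce simp: space_of_def jordan_double_def)
qed

lemma locally_constant_continuous: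
 assumes "\<And>a. a \<in> topspace X ==> \<exists>U. openin X U \<and> a \<in> U \<and> (\<forall>b\<in>U. f b = f a)"
 shows "continuous_map X (discrete_topology UNIV) f"
 unfolding continuous_map_def
proof (intro conjI allI impI)
 fix C
 show "openin X {x \<in> topspace X. f x \<in> C}"
 proof (subst openin_subopen, intro ballI)
  fix a assume a: "a \<in> {x \<in> topspace X. f x \<in> C}"
  then obtain U where U: "openin X U" "a \<in> U" "\<forall>b\<in>U. f b = f a" using assms by blast
  have "b \<in> {x \<in> topspace X. f x \<in> C}" if b: "b \<in> U" for b
  proof -
   have "f b = f a" "b \<in> topspace X" using U(3) openin_subset[OF U(1)] b by blast+
   thus ?thesis using a by simp
  qed
  thus "\<exists>T. openin X T \<and> a \<in> T \<and> T \<subseteq> {x \<in> topspace X. f x \<in> C}" using U(1,2) by blast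
 qed
qed simp

lemma finite_Inter_open: "finite F ==> (\<And>x. x \<in> F ==> openin X (G x)) ==> openin X (topspace X \<inter> (\<Inter>x\<in>F. G x))"
proof (induction rule: finite_induct)
 case (insert x F)
 have "openin X (G x \<inter> (topspace X \<inter> (\<Inter>x\<in>F. G x)))"
  by (rule openin_Int[OF insert.prems insert.IH]) (use insert.prems in auto)
 moreover have "G x \<inter> (topspace X \<inter> (\<Inter>x\<in>F. G x)) = topspace X \<inter> (\<Inter>x\<in>insert x F. G x)" by auto
 ultimately show ?case by (simp only:)
qed simp

lemma coefficient_open: "openin (topo (P_alg r n)) {s \<in> Ser r n. s \<alpha> S = c}"
proof -
 have "openin (product_topology (\<lambda>_. discrete_topology UNIV) UNIV)
  {s \<in> topspace (product_topology (\<lambda>_. discrete_topology UNIV) UNIV). s \<alpha> \<in> {u. u S = c}}"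
  by (rule openin_continuous_map_preimage[OF continuous_map_product_projection]) auto
 from openin_subtopology_Int2[OF this, of "Ser r n"] show ?thesis
  unfolding P_alg_simps by (rule back_subst[of "openin _"]) auto
qed

lemma topspace_P: "topspace (topo (P_alg r n)) = Ser r n"
 by (simp add: P_alg_simps)

context lc_gp
begin

text \<open>For linear maps, a finite set of functionals determines a neighbourhood, so openness and continuity become the
comparison of finite sets of coefficients with finite sets of functionals.\<close>

lemma homeomorphism:
 assumes diff: "\<And>a b. K (a - b) = K a - K b" and Ser: "\<And>a. K a \<in> Ser r n" and inj: "\<And>a. a \<in> W ==> K a = 0 ==> a = 0"
  and surj: "\<And>f. f \<in> Ser r n ==> \<exists>a\<in>W. K a = f" and KD: "\<And>\<alpha> S. (\<lambda>a. K a \<alpha> S) \<in> Dual"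
  and fin: "\<And>h. h \<in> Dual ==> \<exists>Y. finite Y \<and> (\<forall>a\<in>W. (\<forall>(\<alpha>, S)\<in>Y. K a \<alpha> S = 0) \<longrightarrow> h a = 0)"
 shows "bij_betw K W (Ser r n)" "homeomorphic_map (topo A) (topo (P_alg r n)) K"
proof -
 have io: "inj_on K W"
 proof (rule inj_onI)
  fix a b assume ab: "a \<in> W" "b \<in> W" "K a = K b"
  hence "a - b = 0" using inj[of "a - b"] subspace_diff[OF W_sub] diff by simp
  thus "a = b" by simp
 qed
 have im: "K ` W = Ser r n" using Ser surj by blast
 show "bij_betw K W (Ser r n)" using io im by (simp add: bij_betw_def)
 show "homeomorphic_map (topo A) (topo (P_alg r n)) K"
 proof (rule bijective_open_imp_homeomorphic_map)
  show "K ` topspace (topo A) = topspace (topo (P_alg r n))" "inj_on K (topspace (topo A))"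
   using im io by (simp_all add: top topspace_P)
  show "continuous_map (topo A) (topo (P_alg r n)) K"
   unfolding P_alg_simps
  proof (rule continuous_map_into_subtopology)
   show "continuous_map (topo A) (product_topology (\<lambda>_. discrete_topology UNIV) UNIV) K"
    unfolding continuous_map_componentwise_UNIV
   proof (intro allI locally_constant_continuous)
    fix \<alpha> a assume a: "a \<in> topspace (topo A)"
    let ?U = "topspace (topo A) \<inter> (\<Inter>S\<in>Pow {..<n}. {b\<in>W. K b \<alpha> S = K a \<alpha> S})"
    have "openin (topo A) ?U"
    proof (rule finite_Inter_open)
     show "finite (Pow {..<n})" by simp
     show "openin (topo A) {b\<in>W. K b \<alpha> S = K a \<alpha> S}" for S by (rule Dual_level_open[OF KD])
    qed
    moreover have "a \<in> ?U" using a by (auto simp: top)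
    moreover have "K b \<alpha> = K a \<alpha>" if "b \<in> ?U" for b
    proof
     fix S show "K b \<alpha> S = K a \<alpha> S"
     proof (cases "S \<subseteq> {..<n}")
      case True thus ?thesis using that by blast
     next
      case False
      thus ?thesis using Ser_outside[OF Ser] by metis
     qed
    qed
    ultimately show "\<exists>U. openin (topo A) U \<and> a \<in> U \<and> (\<forall>b\<in>U. K b \<alpha> = K a \<alpha>)" by (intro exI[of _ ?U]) blast
   qed
  qed (use Ser in auto)
  show "open_map (topo A) (topo (P_alg r n)) K"
   unfolding open_map_def
  proof (intro allI impI)
   fix U assume U: "openin (topo A) U"
   have UW: "U \<subseteq> W" using openin_subset[OF U] top by simp
   show "openin (topo (P_alg r n)) (K ` U)"
   proof (subst openin_subopen, intro ballI)
    fix s assume "s \<in> K ` U"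
    then obtain a where a: "a \<in> U" "s = K a" by blast
    obtain \<Phi> where P: "finite \<Phi>" "\<Phi> \<subseteq> \<Gamma>" "{b\<in>W. \<forall>f\<in>\<Phi>. f b = f a} \<subseteq> U" using \<Gamma>_open[OF U a(1)] by blast
    have "\<forall>f\<in>\<Phi>. \<exists>Y. finite Y \<and> (\<forall>a\<in>W. (\<forall>(\<alpha>, S)\<in>Y. K a \<alpha> S = 0) \<longrightarrow> f (\<pi> a) = 0)"
    proof
     fix f assume "f \<in> \<Phi>"
     hence "f \<in> \<Gamma>" using P(2) by blast
     from fin[OF \<Gamma>_Dual[OF this]] show "\<exists>Y. finite Y \<and> (\<forall>a\<in>W. (\<forall>(\<alpha>, S)\<in>Y. K a \<alpha> S = 0) \<longrightarrow> f (\<pi> a) = 0)" .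
    qed
    from bchoice[OF this] obtain Y where Y: "\<forall>f\<in>\<Phi>. finite (Y f) \<and> (\<forall>a\<in>W. (\<forall>(\<alpha>, S)\<in>Y f. K a \<alpha> S = 0) \<longrightarrow> f (\<pi> a) = 0)" ..
    let ?N = "topspace (topo (P_alg r n)) \<inter> (\<Inter>x\<in>(\<Union>f\<in>\<Phi>. Y f). {s \<in> Ser r n. s (fst x) (snd x) = K a (fst x) (snd x)})"
    have oN: "openin (topo (P_alg r n)) ?N"
    proof (rule finite_Inter_open)
     show "finite (\<Union>f\<in>\<Phi>. Y f)" by (rule finite_UN_I[OF P(1)]) (use Y in blast)
    qed (rule coefficient_open)
    have sN: "s \<in> ?N" using a(2) Ser by (auto simp: topspace_P)
    have "t \<in> K ` U" if t: "t \<in> ?N" for t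
    proof -
     have "t \<in> Ser r n" using t topspace_P by blast
     then obtain b where b: "b \<in> W" "K b = t" using surj by blast
     have aW: "a \<in> W" using a(1) UW by blast
     have d: "b - a \<in> W" by (rule subspace_diff[OF W_sub b(1) aW])
     have "f b = f a" if f: "f \<in> \<Phi>" for f
     proof -
      have "K (b - a) \<alpha> S = 0" if "(\<alpha>, S) \<in> Y f" for \<alpha> S
      proof -
       have "t \<in> {s \<in> Ser r n. s (fst (\<alpha>, S)) (snd (\<alpha>, S)) = K a (fst (\<alpha>, S)) (snd (\<alpha>, S))}"
        using t that f by blast
       thus ?thesis using b(2) diff[of b a] by simp
      qed
      hence 0: "f (\<pi> (b - a)) = 0" using Y[rule_format, OF f] d by blast
      have fG: "f \<in> \<Gamma>" using P(2) f by blast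
      have "f (b - a + a) = f (b - a) + f a" by (rule \<Gamma>_add[OF fG d aW])
      thus ?thesis using 0 \<pi>_id[OF d] by simp
     qed
     hence "b \<in> U" using P(3) b(1) by blast
     thus ?thesis using b(2) by blast
    qed
    hence NU: "?N \<subseteq> K ` U" by (rule subsetI)
    show "\<exists>T. openin (topo (P_alg r n)) T \<and> s \<in> T \<and> T \<subseteq> K ` U"
     by (intro exI[of _ ?N] conjI; fact oN sN NU)
   qed
  qed
 qed
qed

text \<open>If the bracket also satisfies the Leibniz rule with derivation \<open>0\<close>, then uniqueness of the derivation, \<open>D_brk\<close>, gives
\<open>{e, \<cdot>} = 0\<close>.\<close>

lemma poisson_bra: assumes "poisson_superalgebra A" shows "bra e x = 0"
proof -
 have "generalized_poisson A (\<lambda>_. 0)" using assms by (simp add: poisson_superalgebra_def)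
 hence "lc_gp A (\<lambda>_. 0) P0 P1 \<Gamma> e" using lc_gp_axioms unfolding lc_gp_def
  by (elim conjE) (intro conjI; assumption)
 from lc_gp.D_brk[OF this, of "\<pi> x"] show ?thesis using unit_facts(1) by (simp add: bra_def)
qed

lemma lc_structure:
 "\<exists>r n T \<phi> g \<psi>. (\<phi> \<in> H 0 \<and> g \<in> H 0 \<and> prd g \<phi> = e) \<and> (\<psi> \<in> H 0 \<and> prd \<psi> \<psi> = \<phi>) \<and> coords r n T \<and>
   (\<forall>a b. T (prd g (bra (prd \<phi> a) (prd \<phi> b))) = P_brk r n (T a) (T b)) \<and>
   (\<forall>b. T (prd g (bra (prd \<phi> e) (prd \<phi> b))) = P_deriv r (T b)) \<and>
   (\<forall>x y. prd g (bra (prd \<phi> x) (prd \<phi> y)) - scl A (1/2) (prd x (prd g (bra (prd \<phi> e) (prd \<phi> y))) - prd (prd g (bra (prd \<phi> e) (prd \<phi> x))) y)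
    = bra (prd \<psi> x) (prd \<psi> y) - scl A (1/2) (prd (prd \<psi> x) (bra e (prd \<psi> y)) - prd (bra e (prd \<psi> x)) (prd \<psi> y))) \<and>
   ((\<forall>x. bra e x = 0) \<longrightarrow> even r \<and> \<phi> = e \<and> g = e)"
proof -
 obtain \<epsilon> where eps: "\<epsilon> \<in> Dual" "\<epsilon> e = 1" "\<And>a b. \<epsilon> (prd a b) = \<epsilon> a * \<epsilon> b" "\<And>a. \<epsilon> (P1 a) = 0"
  using ex_character by blast
 interpret L: lgp "scl A" P0 P1 prd e Dual bra \<epsilon>
  by unfold_locales (fact eps)+
 obtain r n T \<phi> g where s: "\<phi> \<in> H 0" "g \<in> H 0" "prd g \<phi> = e" "coords r n T"
  "\<forall>a b. T (L.gauge \<phi> g a b) = P_brk r n (T a) (T b)" "\<forall>b. T (L.gauge \<phi> g e b) = P_deriv r (T b)"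
  "(\<forall>x. bra e x = 0) \<longrightarrow> even r \<and> \<phi> = e \<and> g = e" using L.structure_theorem by blast
 have "\<epsilon> g * \<epsilon> \<phi> = 1" using eps(3)[of g \<phi>] s(3) eps(2) by simp
 hence "\<epsilon> \<phi> \<noteq> 0" by auto
 from L.ex_sqrt[OF s(1) this] obtain \<psi> where psi: "\<psi> \<in> H 0" "prd \<psi> \<psi> = \<phi>" by blast
 have "prd g (prd \<psi> \<psi>) = e" using s(3) psi(2) by simp
 from L.jordan_gauge[OF psi(1) s(2) this, unfolded psi(2)]
 show ?thesis using s psi unfolding L.gauge_def
  by - (rule exI[of _ r], rule exI[of _ n], rule exI[of _ T], rule exI[of _ \<phi>], rule exI[of _ g], rule exI[of _ \<psi>], intro conjI allI; simp)
qed

end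

section \<open>The isomorphisms\<close>

lemma space_of_gauge: "space_of (gauge_transform B \<phi>) = space_of B"
 by (simp add: space_of_def gauge_transform_def)

lemma superalgebra_iso_gauge: "superalgebra_iso B (gauge_transform C \<phi>) h = superalgebra_iso B C h"
 unfolding superalgebra_iso_def space_of_gauge by (simp add: gauge_transform_def)

context lc_gp
begin

text \<open>The bracket \<open>{\<cdot>,\<cdot>}\<^sub>D\<close> of the given algebra in terms of total operations.\<close>

definition J where "J x y = bra x y - scl A (1/2) (prd x (bra e y) - prd (bra e x) y)"

lemma parity_aut_A: assumes "a \<in> W" shows "parity_aut A a = sg a"
proof -
 have u: "x - y = sg (x + y)" if "x \<in> evens A" "y \<in> odds A" for x y
  using that by (simp add: sg_def P0_add P1_add P_id P_0)
 show ?thesis unfolding parity_aut_def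
 proof (rule the_equality)
  show "\<exists>x\<in>evens A. \<exists>y\<in>odds A. a = x + y \<and> sg a = x - y"
   using homog_split[OF assms] P_in by (intro bexI[of _ "P0 a"] bexI[of _ "P1 a"]) (simp_all add: sg_def)
  show "b = sg a" if "\<exists>x\<in>evens A. \<exists>y\<in>odds A. a = x + y \<and> b = x - y" for b
   using that u by metis
 qed
qed

lemma bracket_D_A: assumes "x \<in> W" "y \<in> W" shows "bracket_D A D x y = J x y"
 using D_brk[OF assms(1)] D_brk[OF assms(2)] assms unit_facts(1) bilin_W[OF gb unit_facts(1)]
 by (simp add: bracket_D_def J_def bra_def prd_def)

context
 fixes r n T \<phi> g \<psi>
 assumes H: "\<phi> \<in> H 0 \<and> g \<in> H 0 \<and> prd g \<phi> = e" and psi: "\<psi> \<in> H 0 \<and> prd \<psi> \<psi> = \<phi>" and co: "coords r n T"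
  and TB: "\<forall>a b. T (prd g (bra (prd \<phi> a) (prd \<phi> b))) = P_brk r n (T a) (T b)"
  and TD: "\<forall>b. T (prd g (bra (prd \<phi> e) (prd \<phi> b))) = P_deriv r (T b)"
  and TJ: "\<forall>x y. prd g (bra (prd \<phi> x) (prd \<phi> y)) - scl A (1/2) (prd x (prd g (bra (prd \<phi> e) (prd \<phi> y))) - prd (prd g (bra (prd \<phi> e) (prd \<phi> x))) y)
    = bra (prd \<psi> x) (prd \<psi> y) - scl A (1/2) (prd (prd \<psi> x) (bra e (prd \<psi> y)) - prd (bra e (prd \<psi> x)) (prd \<psi> y))"
begin

lemma T_facts: "T (a + b) = T a + T b" "T (scl A c a) = ser_scale c (T a)" "T (prd a b) = ser_mult (T a) (T b)"
 "T (sg a) = ser_sign (T a)" "T a \<in> Ser r n" "a \<in> W ==> T a = 0 ==> a = 0" "f \<in> Ser r n ==> \<exists>a\<in>W. T a = f"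
 "(\<lambda>a. T a \<alpha> S) \<in> Dual"
 "h \<in> Dual ==> \<exists>Y. finite Y \<and> (\<forall>a. (\<forall>(\<alpha>, S)\<in>Y. T a \<alpha> S = 0) \<longrightarrow> h a = 0)"
 using co unfolding coords_def V_W by metis+

lemma T_diff: "T (a - b) = T a - T b" and T_pi: "T (local.pi a) = T a"
proof -
 have "T (a - b) \<alpha> S = (T a - T b) \<alpha> S" for \<alpha> S using Dual_diff[OF T_facts(8)] by simp
 thus "T (a - b) = T a - T b" by blast
 have "T (local.pi a) \<alpha> S = T a \<alpha> S" for \<alpha> S using Dual_pi'[OF T_facts(8)] by simp
 thus "T (local.pi a) = T a" by blast
qed

lemma two_c: "c = 0" if "c = - c" for c :: 'k
proof -
 have "2 * c = 0" using that by (metis mult_2 add.right_inverse)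
 thus ?thesis by simp
qed

lemma T_evens: "x \<in> evens A ==> T x \<in> evens (P_alg r n)"
proof -
 assume "x \<in> evens A"
 hence "sg x = x" by (simp add: sg_def P_id P_0)
 hence e: "ser_sign (T x) = T x" using T_facts(4)[of x] by simp
 have "T x \<alpha> S = 0" if "odd (card S)" for \<alpha> S
  using fun_cong[OF fun_cong[OF e], of \<alpha> S] that two_c[of "T x \<alpha> S"] by (simp add: ser_sign_def)
 thus ?thesis using T_facts(5) by (auto simp: P_alg_simps)
qed

lemma T_odds: "x \<in> odds A ==> T x \<in> odds (P_alg r n)"
proof -
 assume "x \<in> odds A"
 hence "sg x = - x" by (simp add: sg_def P_id P_0)
 hence e: "ser_sign (T x) = - T x" using T_facts(4)[of x] T_diff[of 0 x] T_diff[of 0 0] by simp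
 have "T x \<alpha> S = 0" if "even (card S)" for \<alpha> S
  using fun_cong[OF fun_cong[OF e], of \<alpha> S] that two_c[of "T x \<alpha> S"] by (simp add: ser_sign_def)
 thus ?thesis using T_facts(5) by (auto simp: P_alg_simps)
qed

text \<open>Expansion after multiplication by an invertible element, as needed for the odd component of the double. For \<open>w = e\<close> it
is \<open>T\<close> itself.\<close>

lemma twisted_homeomorphism:
 assumes w: "prd w v = e" "prd v w = e"
 shows "bij_betw (\<lambda>b. T (prd w b)) W (Ser r n)" "homeomorphic_map (topo A) (topo (P_alg r n)) (\<lambda>b. T (prd w b))"
proof -
 have inv: "prd v (prd w a) = a" "prd w (prd v a) = a" if "a \<in> W" for a
  using w that by (simp_all add: pi_\<pi> flip: assoc)
 have PW: "prd a b \<in> W" for a b using prd_V V_W by blast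
 have d: "T (prd w (a - b)) = T (prd w a) - T (prd w b)" for a b by (simp add: prd_diff T_diff)
 have i: "a = 0" if "a \<in> W" "T (prd w a) = 0" for a
  using T_facts(6)[OF PW that(2)] inv(1)[OF that(1)] by simp
 have s: "\<exists>a\<in>W. T (prd w a) = f" if f: "f \<in> Ser r n" for f
 proof -
  obtain c where "c \<in> W" "T c = f" using T_facts(7)[OF f] by blast
  thus ?thesis using inv(2) PW by (intro bexI[of _ "prd v c"]) simp_all
 qed
 have D: "(\<lambda>a. T (prd w a) \<alpha> S) \<in> Dual" for \<alpha> S by (rule Dual_prdl[OF T_facts(8)])
 have f: "\<exists>Y. finite Y \<and> (\<forall>a\<in>W. (\<forall>(\<alpha>, S)\<in>Y. T (prd w a) \<alpha> S = 0) \<longrightarrow> h a = 0)" if h: "h \<in> Dual" for h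
 proof -
  obtain Y where Y: "finite Y" "\<forall>a. (\<forall>(\<alpha>, S)\<in>Y. T a \<alpha> S = 0) \<longrightarrow> h (prd v a) = 0"
   using T_facts(9)[OF Dual_prdl[OF h]] by blast
  have "h a = 0" if "a \<in> W" "\<forall>(\<alpha>, S)\<in>Y. T (prd w a) \<alpha> S = 0" for a
   using Y(2)[rule_format, OF that(2)[rule_format]] inv(1)[OF that(1)] by auto
  thus ?thesis using Y(1) by blast
 qed
 show "bij_betw (\<lambda>b. T (prd w b)) W (Ser r n)" by (rule homeomorphism(1)[OF d T_facts(5) i s D f])
 show "homeomorphic_map (topo A) (topo (P_alg r n)) (\<lambda>b. T (prd w b))" by (rule homeomorphism(2)[OF d T_facts(5) i s D f])
qed

lemma T_homeomorphism: "bij_betw T W (Ser r n)" "homeomorphic_map (topo A) (topo (P_alg r n)) T"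
proof -
 have "(\<lambda>b. T (prd e b)) = T" by (simp add: T_pi)
 thus "bij_betw T W (Ser r n)" "homeomorphic_map (topo A) (topo (P_alg r n)) T"
  using twisted_homeomorphism[of e e] pi_V[OF e_H(2)] by simp_all
qed

lemma T_iso: "superalgebra_iso A (P_alg r n) T"
 unfolding superalgebra_iso_def space_of_P linear_on_space_def P_alg_simps(1,2)
proof (intro conjI ballI allI)
 show "T ` evens A \<subseteq> evens (P_alg r n)" "T ` odds A \<subseteq> odds (P_alg r n)" using T_evens T_odds by blast+
 show "T (mul A a b) = ser_mult (T a) (T b)" if "a \<in> W" "b \<in> W" for a b
  using T_facts(3)[of a b] that by (simp add: prd_def)
qed (rule T_homeomorphism T_facts)+

lemma unit_P: "is_unit_element (P_alg r n) u \<longleftrightarrow> u = T e"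
proof
 assume u: "is_unit_element (P_alg r n) u"
 hence "u \<in> Ser r n" by (simp add: is_unit_element_def space_of_P)
 then obtain c where c: "T c = u" using T_facts(7) by blast
 have "ser_mult u (T e) = T e" using u T_facts(5) by (simp add: is_unit_element_def space_of_P P_alg_simps)
 moreover have "ser_mult u (T e) = u" using T_facts(3)[of c e] c T_pi[of c] by simp
 ultimately show "u = T e" by simp
next
 assume u: "u = T e"
 have "ser_mult (T e) f = f \<and> ser_mult f (T e) = f" if f: "f \<in> Ser r n" for f
 proof -
  obtain c where c: "T c = f" using T_facts(7)[OF f] by blast
  show ?thesis using T_facts(3)[of c e] T_facts(3)[of e c] c T_pi[of c] by simp
 qed
 thus "is_unit_element (P_alg r n) u" using T_facts(5) by (simp add: u is_unit_element_def space_of_P P_alg_simps)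
qed

lemma inverse_P: "is_inverse (P_alg r n) (T g) b \<longleftrightarrow> b = T \<phi>"
proof
 have pg: "prd \<phi> g = e" using H comm_e[of \<phi> g] by simp
 assume "is_inverse (P_alg r n) (T g) b"
 hence b: "b \<in> Ser r n" "ser_mult (T g) b = T e" by (simp_all add: is_inverse_def space_of_P unit_P P_alg_simps)
 then obtain c where c: "c \<in> W" "T c = b" using T_facts(7) by blast
 have "prd \<phi> (prd g c) = c" using c(1) pg by (simp add: pi_\<pi> flip: assoc)
 hence "b = ser_mult (T \<phi>) (ser_mult (T g) b)" using T_facts(3)[of \<phi> "prd g c"] T_facts(3)[of g c] c(2) by simp
 also have "\<dots> = T \<phi>" using b(2) T_facts(3)[of \<phi> e] T_pi[of \<phi>] by simp
 finally show "b = T \<phi>" .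
next
 assume b: "b = T \<phi>"
 have "prd \<phi> g = e" using H comm_e[of \<phi> g] by simp
 thus "is_inverse (P_alg r n) (T g) b"
  using H T_facts(3)[of \<phi> g] T_facts(3)[of g \<phi>] T_facts(5) by (simp add: b is_inverse_def space_of_P unit_P P_alg_simps)
qed

text \<open>The bracket of \<open>P(r,n)\<close> corresponds to the bracket gauged by \<open>\<phi>\<close>, so the given bracket is recovered with the
inverse gauge factor \<open>g\<close>.\<close>

lemma gauge_isomorphic:
 "T g \<in> evens (P_alg r n)" "invertible_element (P_alg r n) (T g)" "gp_isomorphic A (gauge_transform (P_alg r n) (T g))"
proof -
 have "g \<in> evens A" using H by (simp add: H_homog homog_def)
 thus "T g \<in> evens (P_alg r n)" by (rule T_evens)
 show "invertible_element (P_alg r n) (T g)"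
  using inverse_P[of "T \<phi>"] T_facts(5) by (auto simp: invertible_element_def space_of_P)
 have inv: "inverse_of (P_alg r n) (T g) = T \<phi>" unfolding inverse_of_def inverse_P by simp
 have pg: "prd \<phi> g = e" using H comm_e[of \<phi> g] by simp
 have pgx: "prd \<phi> (prd g x) = local.pi x" for x using pg by (simp flip: assoc)
 show "gp_isomorphic A (gauge_transform (P_alg r n) (T g))"
  unfolding gp_isomorphic_def superalgebra_iso_gauge
 proof (intro exI[of _ T] conjI ballI)
  fix a b assume ab: "a \<in> W" "b \<in> W"
  have "brk (gauge_transform (P_alg r n) (T g)) (T a) (T b)
   = ser_mult (T \<phi>) (P_brk r n (ser_mult (T g) (T a)) (ser_mult (T g) (T b)))"
   by (simp add: gauge_transform_def P_alg_simps inv)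
  also have "\<dots> = T (prd \<phi> (prd g (bra (prd \<phi> (prd g a)) (prd \<phi> (prd g b)))))"
   using TB by (simp add: T_facts(3))
  also have "\<dots> = T (bra a b)" unfolding pgx by (simp add: T_pi br_pil br_pir)
  finally show "T (brk A a b) = brk (gauge_transform (P_alg r n) (T g)) (T a) (T b)" using ab by (simp add: bra_def)
 qed (rule T_iso)
qed

lemma poisson_isomorphic:
 assumes "\<phi> = e" "g = e" shows "gp_isomorphic A (P_alg r n)"
 unfolding gp_isomorphic_def
proof (intro exI[of _ T] conjI ballI)
 fix a b assume "a \<in> W" "b \<in> W"
 thus "T (brk A a b) = brk (P_alg r n) (T a) (T b)"
  using TB[rule_format, of a b] assms by (simp add: P_alg_simps bra_def pi_\<pi> bilin_W[OF gb])
qed (rule T_iso)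

text \<open>On the odd component \<open>\<eta>A\<close> the isomorphism is twisted by \<open>w = \<psi>\<inverse>\<close>, which absorbs the factor \<open>\<psi>\<close> in \<open>jordan_gauge\<close>.\<close>

lemma double_isomorphic: "superalgebra_isomorphic (jordan_double A D) (jordan_double (P_alg r n) (P_deriv r))"
proof -
 define w where "w = prd g \<psi>"
 have wH: "w \<in> H 0" using prd_H[of g 0 \<psi> 0] H psi by (simp add: w_def)
 have ww: "prd w \<psi> = e" using H psi by (simp add: w_def assoc)
 have ww': "prd \<psi> w = e" using comm_e[OF wH, of \<psi>] ww by simp
 have inv: "prd \<psi> (prd w x) = local.pi x" for x using ww' by (simp flip: assoc)
 note homw = twisted_homeomorphism[OF ww ww']
 define K where "K = (\<lambda>(a, b). (T a, T (prd w b)))"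
 have K: "K (a, b) = (T a, T (prd w b))" for a b by (simp add: K_def)
 have Kh: "homeomorphic_map (topo (jordan_double A D)) (topo (jordan_double (P_alg r n) (P_deriv r))) K"
 proof -
  obtain f' where f: "homeomorphic_maps (topo A) (topo (P_alg r n)) T f'"
   using T_homeomorphism(2) unfolding homeomorphic_map_maps by blast
  obtain k' where k: "homeomorphic_maps (topo A) (topo (P_alg r n)) (\<lambda>b. T (prd w b)) k'"
   using homw(2) unfolding homeomorphic_map_maps by blast
  have "homeomorphic_maps (prod_topology (topo A) (topo A)) (prod_topology (topo (P_alg r n)) (topo (P_alg r n)))
   (\<lambda>(a, b). (T a, T (prd w b))) (\<lambda>(x, y). (f' x, k' y))"
   unfolding homeomorphic_maps_prod using f k by blast
  thus ?thesis unfolding homeomorphic_map_maps K_def by (auto simp: jordan_double_def)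
 qed
 have bP: "bracket_D (P_alg r n) (P_deriv r) (T x) (T y) = T (J (prd \<psi> x) (prd \<psi> y))" for x y
 proof -
  have "bracket_D (P_alg r n) (P_deriv r) (T x) (T y)
   = T (prd g (bra (prd \<phi> x) (prd \<phi> y)) - scl A (1/2) (prd x (prd g (bra (prd \<phi> e) (prd \<phi> y))) - prd (prd g (bra (prd \<phi> e) (prd \<phi> x))) y))"
   using TB TD by (simp add: bracket_D_def P_alg_simps T_facts(2,3) T_diff)
  thus ?thesis using TJ unfolding J_def by simp
 qed
 have sw: "sg (prd w x) = prd w (sg x)" for x using sg_H[OF wH] by (simp add: sg_prd)
 have Kmul: "K (mul (jordan_double A D) x y) = mul (jordan_double (P_alg r n) (P_deriv r)) (K x) (K y)"
  if xy: "x \<in> W \<times> W" "y \<in> W \<times> W" for x y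
 proof -
  obtain a b c d where x: "x = (a, b)" "y = (c, d)" "a \<in> W" "b \<in> W" "c \<in> W" "d \<in> W" using xy by blast
  have sW: "sg z \<in> W" if "z \<in> W" for z using V_in(9)[of z] V_W by simp
  have "mul (jordan_double A D) x y = (prd a c + J (sg b) d, prd b c + prd (sg a) d)"
   using x sW by (simp add: jordan_double_def parity_aut_A bracket_D_A prd_def)
  hence l: "K (mul (jordan_double A D) x y) = (T (prd a c) + T (J (sg b) d), T (prd w (prd b c)) + T (prd w (prd (sg a) d)))"
   by (simp add: K T_facts(1) prd_addr)
  have p: "parity_aut (P_alg r n) (T z) = T (sg z)" for z using parity_aut_P[OF T_facts(5)] T_facts(4) by simp
  have "mul (jordan_double (P_alg r n) (P_deriv r)) (K x) (K y)
   = (ser_mult (T a) (T c) + bracket_D (P_alg r n) (P_deriv r) (T (sg (prd w b))) (T (prd w d)),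
     ser_mult (T (prd w b)) (T c) + ser_mult (T (sg a)) (T (prd w d)))"
   by (simp add: x K jordan_double_def p P_alg_simps)
  also have "bracket_D (P_alg r n) (P_deriv r) (T (sg (prd w b))) (T (prd w d)) = T (J (sg b) d)"
   unfolding bP sw inv using x(6) V_W pi_V[of d] by simp
  also have "ser_mult (T (prd w b)) (T c) = T (prd w (prd b c))" using T_facts(3)[of "prd w b" c] by (simp add: assoc)
  also have "ser_mult (T (sg a)) (T (prd w d)) = T (prd w (prd (sg a) d))"
   using T_facts(3)[of "sg a" "prd w d"] comm_e[OF wH, of "sg a"] by (metis assoc)
  finally show ?thesis unfolding l T_facts(3)[of a c] by (rule sym)
 qed
 have sub1: "K ` evens (jordan_double A D) \<subseteq> evens (jordan_double (P_alg r n) (P_deriv r))"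
  and sub2: "K ` odds (jordan_double A D) \<subseteq> odds (jordan_double (P_alg r n) (P_deriv r))"
 proof -
  have "prd w b \<in> evens A" if "b \<in> evens A" for b using prd_H[OF wH, of b 0] that by (simp add: H_homog homog_def)
  moreover have "prd w b \<in> odds A" if "b \<in> odds A" for b using prd_H[OF wH, of b 1] that by (simp add: H_homog homog_def)
  ultimately show "K ` evens (jordan_double A D) \<subseteq> evens (jordan_double (P_alg r n) (P_deriv r))"
   "K ` odds (jordan_double A D) \<subseteq> odds (jordan_double (P_alg r n) (P_deriv r))"
   using T_evens T_odds by (auto simp: jordan_double_def K)
 qed
 have bij: "bij_betw K (W \<times> W) (Ser r n \<times> Ser r n)"
  using homeomorphic_imp_surjective_map[OF Kh] homeomorphic_imp_injective_map[OF Kh]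
  by (simp add: bij_betw_def jordan_double_def top topspace_P)
 have "superalgebra_iso (jordan_double A D) (jordan_double (P_alg r n) (P_deriv r)) K"
  unfolding superalgebra_iso_def space_of_double space_of_P linear_on_space_def
 proof (intro conjI ballI allI)
  show "K (a + b) = K a + K b" if "a \<in> W \<times> W" "b \<in> W \<times> W" for a b
   using that by (auto simp: K T_facts(1) prd_addr)
  show "K (scl (jordan_double A D) c a) = scl (jordan_double (P_alg r n) (P_deriv r)) c (K a)" for c a
   by (cases a) (simp add: K jordan_double_def P_alg_simps T_facts(2) prd_scaler)
 qed (fact bij sub1 sub2 Kh | (rule Kmul; assumption))+
 thus ?thesis unfolding superalgebra_isomorphic_def by blast
qed

end

lemma classification:
 "(\<exists>m n. superalgebra_isomorphic (jordan_double A D)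
       (jordan_double (P_alg m n :: ('k, 'k series) gp_superalg) (P_deriv m))) \<and>
  (\<exists>m n. \<exists>\<phi> \<in> evens (P_alg m n :: ('k, 'k series) gp_superalg).
       invertible_element (P_alg m n) \<phi> \<and> gp_isomorphic A (gauge_transform (P_alg m n) \<phi>)) \<and>
  (poisson_superalgebra A \<longrightarrow>
      (\<exists>m n. even m \<and> gp_isomorphic A (P_alg m n :: ('k, 'k series) gp_superalg)))"
proof -
 obtain r n T \<phi> g \<psi> where s: "\<phi> \<in> H 0 \<and> g \<in> H 0 \<and> prd g \<phi> = e" "\<psi> \<in> H 0 \<and> prd \<psi> \<psi> = \<phi>" "coords r n T"
   "\<forall>a b. T (prd g (bra (prd \<phi> a) (prd \<phi> b))) = P_brk r n (T a) (T b)"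
   "\<forall>b. T (prd g (bra (prd \<phi> e) (prd \<phi> b))) = P_deriv r (T b)"
   "\<forall>x y. prd g (bra (prd \<phi> x) (prd \<phi> y)) - scl A (1/2) (prd x (prd g (bra (prd \<phi> e) (prd \<phi> y))) - prd (prd g (bra (prd \<phi> e) (prd \<phi> x))) y)
    = bra (prd \<psi> x) (prd \<psi> y) - scl A (1/2) (prd (prd \<psi> x) (bra e (prd \<psi> y)) - prd (bra e (prd \<psi> x)) (prd \<psi> y))"
   and p: "(\<forall>x. bra e x = 0) \<longrightarrow> even r \<and> \<phi> = e \<and> g = e"
  using lc_structure by (elim exE conjE) (rule that; (intro conjI)?; assumption)
 have "\<exists>m n. even m \<and> gp_isomorphic A (P_alg m n :: ('k, 'k series) gp_superalg)" if "poisson_superalgebra A"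
 proof -
  have "even r" "\<phi> = e" "g = e" using p poisson_bra[OF that] by blast+
  thus ?thesis using poisson_isomorphic[OF s] by blast
 qed
 thus ?thesis using double_isomorphic[OF s] gauge_isomorphic[OF s] by blast
qed

end

theorem corollary7p1:
 fixes A :: "('k::{alg_closed_field, field_char_0}, 'v::ab_group_add) gp_superalg"
  and D :: "'v => 'v"
 assumes "generalized_poisson A D"
  and "unital A"
  and "gp_simple A"
  and "linearly_compact_gp A"
 shows "(\<exists>m n. superalgebra_isomorphic (jordan_double A D)
       (jordan_double (P_alg m n :: ('k, 'k series) gp_superalg) (P_deriv m))) \<and>
     (\<exists>m n. \<exists>\<phi> \<in> evens (P_alg m n :: ('k, 'k series) gp_superalg).
       invertible_element (P_alg m n) \<phi> \<and> gp_isomorphic A (gauge_transform (P_alg m n) \<phi>)) \<and>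
     (poisson_superalgebra A \<longrightarrow>
      (\<exists>m n. even m \<and> gp_isomorphic A (P_alg m n :: ('k, 'k series) gp_superalg)))"
proof -
 have ss: "is_superspace A"
  using assms(1) by (simp add: generalized_poisson_def comm_assoc_superalgebra_def is_superalgebra_def)
 have vs: "vector_space (scl A)" using ss by (simp add: is_superspace_def)
 have lc: "linearly_compact_space A" "topspace (topo A) = space_of A"
  using assms(4) by (simp_all add: linearly_compact_gp_def topological_superspace_def)
 obtain e where e: "is_unit_element A e" using assms(2) by (auto simp: unital_def)
 show ?thesis
 proof (rule superspace_projections[OF ss])
  fix P0 P1 :: "'v => 'v"
  assume P: "\<And>x y. P0 (x + y) = P0 x + P0 y" "\<And>c x. P0 (scl A c x) = scl A c (P0 x)"
  "\<And>x y. P1 (x + y) = P1 x + P1 y" "\<And>c x. P1 (scl A c x) = scl A c (P1 x)"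
  "\<And>x. P0 x \<in> evens A" "\<And>x. P1 x \<in> odds A"
  "\<And>x. x \<in> evens A ==> P0 x = x" "\<And>x. x \<in> odds A ==> P1 x = x"
  "\<And>x. x \<in> evens A ==> P1 x = 0" "\<And>x. x \<in> odds A ==> P0 x = 0"
  show ?thesis
  proof (rule linearly_compact_coordinates[OF vs lc])
   fix \<Gamma> :: "('v => 'k) set"
   assume G:
  "\<And>f a b. f \<in> \<Gamma> ==> a \<in> space_of A ==> b \<in> space_of A ==> f (a + b) = f a + f b"
  "\<And>f c a. f \<in> \<Gamma> ==> a \<in> space_of A ==> f (scl A c a) = c * f a"
  "\<And>U a. openin (topo A) U ==> a \<in> U ==> \<exists>\<Phi>. finite \<Phi> \<and> \<Phi> \<subseteq> \<Gamma> \<and> {b\<in>space_of A. \<forall>f\<in>\<Phi>. f b = f a} \<subseteq> U"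
  "\<And>f c. f \<in> \<Gamma> ==> openin (topo A) {b\<in>space_of A. f b = c}"
  "\<And>F. \<exists>a\<in>space_of A. \<forall>f\<in>\<Gamma>. f a = F f"
  "\<And>a b. a \<in> space_of A ==> b \<in> space_of A ==> (\<And>f. f \<in> \<Gamma> ==> f a = f b) ==> a = b"
   have "lc_gp A D P0 P1 \<Gamma> e"
    by (rule lc_gp.intro) (fact assms e P G)+
   from lc_gp.classification[OF this] show ?thesis .
  qed
 qed
qed

end
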